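(* Let $m,n,d$ be positive integers with $m\geqslant n$, and set $l=d(m-n)+n$. Let $(R,\mathfrak{m})$ be a Noetherian local ring of Krull dimension $n$, and let $N_1,\ldots,N_l\in R[X_1,\ldots,X_m]$ be linear forms whose images $\bar N_1,\ldots,\bar N_l\in \frac{R}{\mathfrak{m}}[X_1,\ldots,X_m]$ form an independent sequence of linear forms. Then for any $\mathfrak{m}$-primary ideal $\mathfrak{q}=(u_1,\ldots,u_m)R$ such that $$\operatorname{deg.rad}\mathcal{F}_{\mathfrak{q}}(R)\leqslant d,$$ there exist $1\leqslant i_1<\cdots<i_n\leqslant l$ such that $\mathfrak{b}=(N_{i_1}(u),\ldots,N_{i_n}(u))R$ is a reduction of $\mathfrak{q}$ and $N_{i_1}(u),\ldots,N_{i_n}(u)$ is a system of parameters of $R$, where $u=(u_1,\ldots,u_m)$.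
   Context: Rings are commutative with unity. An ideal $\mathfrak{b}\subset\mathfrak{a}$ is a reduction of the ideal $\mathfrak{a}$ if there is a positive integer $k$ with $\mathfrak{a}^{k+1}=\mathfrak{b}\mathfrak{a}^k$. For an ideal $\mathfrak{a}$ of a Noetherian local ring $(R,\mathfrak{m})$, the fiber cone is the graded ring $\mathcal{F}_{\mathfrak{a}}(R)=\bigoplus_{j\geqslant 0}\mathfrak{a}^j/\mathfrak{m}\mathfrak{a}^j$ (with $\mathfrak{a}^0=R$); it is a graded algebra finitely generated over $R/\mathfrak{m}$ by elements of degree one. For a Noetherian graded $k$-algebra $A$ ($k$ a field) finitely generated over $k$ by elements of degree one, $\operatorname{deg.rad}A:=\sum_{\mathfrak{p}}\deg (A/\mathfrak{p})$, the sum running over all minimal prime ideals $\mathfrak{p}$ of $A$. Here $\deg$ of such a graded algebra $B$ of Krull dimension $D$ is its usual degree (multiplicity): $(D-1)!$ times the leading coefficient of the Hilbert polynomial if $D\geqslant 1$, and $\dim_k B$ if $D=0$. A sequence of linear forms $N_1,\ldots,N_s\in k[X_1,\ldots,X_m]$ over a field $k$, with $s\geqslant m$, is called independent if for any $1\leqslant i_1<\cdots<i_m\leqslant s$ the forms $N_{i_1},\ldots,N_{i_m}$ are linearly independent over $k$. For a polynomial $P\in R[X_1,\ldots,X_m]$, $\bar P$ denotes its image in $\frac{R}{\mathfrak{m}}[X_1,\ldots,X_m]$. *)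

theory Defs
  imports
    "HOL-Algebra.Ideal_Product"
    "HOL-Algebra.Ring_Divisibility"
    "HOL-Algebra.Embedded_Algebras"
    "HOL-Algebra.Indexed_Polynomials"
    "HOL-Computational_Algebra.Polynomial"
    "HOL-Library.Extended_Nat"
begin

section \<open>Commutative algebra\<close>

locale noetherian_local_ring = cring R + noetherian_ring R
  for R (structure) +
  fixes \<mm> :: "'a set"
  assumes maximal: "maximalideal \<mm> R"
    and unique_maximal: "maximalideal J R \<Longrightarrow> J = \<mm>"

definition prime_chain :: "('a, 'b) ring_scheme \<Rightarrow> nat \<Rightarrow> (nat \<Rightarrow> 'a set) \<Rightarrow> bool" where
  "prime_chain R n P \<longleftrightarrow> (\<forall>i\<le>n. primeideal (P i) R) \<and> (\<forall>i<n. P i \<subset> P (Suc i))"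

text \<open>The zero ring, which has no prime ideals, gets dimension 0 here.\<close>

definition krull_dim :: "('a, 'b) ring_scheme \<Rightarrow> enat" where
  "krull_dim R = (SUP n \<in> {n. \<exists>P. prime_chain R n P}. enat n)"

definition minimal_primes :: "('a, 'b) ring_scheme \<Rightarrow> 'a set set" where
  "minimal_primes R = {P. primeideal P R \<and> (\<forall>Q. primeideal Q R \<longrightarrow> Q \<subseteq> P \<longrightarrow> Q = P)}"

definition radical :: "('a, 'b) ring_scheme \<Rightarrow> 'a set \<Rightarrow> 'a set" where
  "radical R I = {x \<in> carrier R. \<exists>k::nat. x [^]\<^bsub>R\<^esub> k \<in> I}"

definition primary_ideal :: "('a, 'b) ring_scheme \<Rightarrow> 'a set \<Rightarrow> bool" where
  "primary_ideal R Q \<longleftrightarrow> ideal Q R \<and> Q \<noteq> carrier R \<and>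
     (\<forall>a\<in>carrier R. \<forall>b\<in>carrier R. a \<otimes>\<^bsub>R\<^esub> b \<in> Q \<longrightarrow> a \<in> Q \<or> b \<in> radical R Q)"

definition primary_to :: "('a, 'b) ring_scheme \<Rightarrow> 'a set \<Rightarrow> 'a set \<Rightarrow> bool" where
  "primary_to R \<pp> Q \<longleftrightarrow> primary_ideal R Q \<and> radical R Q = \<pp>"

definition system_of_parameters ::
  "('a, 'b) ring_scheme \<Rightarrow> 'a set \<Rightarrow> nat \<Rightarrow> (nat \<Rightarrow> 'a) \<Rightarrow> bool" where
  "system_of_parameters R \<mm> n x \<longleftrightarrow>
     krull_dim R = enat n \<and> (\<forall>i\<in>{1..n}. x i \<in> \<mm>) \<and>
     primary_to R \<mm> (Idl\<^bsub>R\<^esub> (x ` {1..n}))"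

text \<open>Powers of ideals are taken in the semiring \<^const>\<open>ideals_set\<close> of ideals, whose
  unit is the whole ring.\<close>

abbreviation ideal_pow :: "('a, 'b) ring_scheme \<Rightarrow> 'a set \<Rightarrow> nat \<Rightarrow> 'a set" where
  "ideal_pow R I k \<equiv> I [^]\<^bsub>ideals_set R\<^esub> k"

definition reduction_of :: "('a, 'b) ring_scheme \<Rightarrow> 'a set \<Rightarrow> 'a set \<Rightarrow> bool" where
  "reduction_of R \<bb> \<aa> \<longleftrightarrow> ideal \<bb> R \<and> ideal \<aa> R \<and> \<bb> \<subseteq> \<aa> \<and>
     (\<exists>k>0. ideal_pow R \<aa> (k + 1) = \<bb> \<cdot>\<^bsub>R\<^esub> ideal_pow R \<aa> k)"


section \<open>Linear forms\<close>

text \<open>A polynomial in $X_1,\ldots,X_m$ is a function from monomials (multisets over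
  \<open>{1..m}\<close>) to coefficients. As usual, the zero polynomial counts as a linear form.\<close>

definition linear_form :: "('a, 'b) ring_scheme \<Rightarrow> nat \<Rightarrow> (nat multiset \<Rightarrow> 'a) \<Rightarrow> bool" where
  "linear_form R m P \<longleftrightarrow> P \<in> ring.indexed_pset R {1..m} (carrier R) \<and>
     (\<forall>M. P M \<noteq> \<zero>\<^bsub>R\<^esub> \<longrightarrow> size M = 1)"

definition poly_value :: "('a, 'b) ring_scheme \<Rightarrow> (nat multiset \<Rightarrow> 'a) \<Rightarrow> (nat \<Rightarrow> 'a) \<Rightarrow> 'a" where
  "poly_value R P u = (\<Oplus>\<^bsub>R\<^esub>M\<in>{M. P M \<noteq> \<zero>\<^bsub>R\<^esub>}.
     P M \<otimes>\<^bsub>R\<^esub> (\<Otimes>\<^bsub>R\<^esub>i\<in>set_mset M. u i [^]\<^bsub>R\<^esub> count M i))"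

definition poly_reduce ::
  "('a, 'b) ring_scheme \<Rightarrow> 'a set \<Rightarrow> (nat multiset \<Rightarrow> 'a) \<Rightarrow> (nat multiset \<Rightarrow> 'a set)" where
  "poly_reduce R \<mm> P = (\<lambda>M. \<mm> +>\<^bsub>R\<^esub> P M)"

text \<open>Linear independence over \<open>K\<close> of the family \<open>P i\<close>, \<open>i \<in> I\<close>, of polynomials;
  the vanishing of a linear combination is read off coefficientwise.\<close>

definition lin_indep_polys ::
  "('a, 'b) ring_scheme \<Rightarrow> nat set \<Rightarrow> (nat \<Rightarrow> nat multiset \<Rightarrow> 'a) \<Rightarrow> bool" where
  "lin_indep_polys K I P \<longleftrightarrow>
     (\<forall>c \<in> I \<rightarrow> carrier K.
        (\<forall>M. (\<Oplus>\<^bsub>K\<^esub>i\<in>I. c i \<otimes>\<^bsub>K\<^esub> P i M) = \<zero>\<^bsub>K\<^esub>) \<longrightarrow> (\<forall>i\<in>I. c i = \<zero>\<^bsub>K\<^esub>))"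

text \<open>\<open>1 \<le> \<iota> 1 < \<dots> < \<iota> n \<le> s\<close>\<close>

definition increasing_indices :: "nat \<Rightarrow> nat \<Rightarrow> (nat \<Rightarrow> nat) \<Rightarrow> bool" where
  "increasing_indices n s \<iota> \<longleftrightarrow> strict_mono_on {1..n} \<iota> \<and> \<iota> ` {1..n} \<subseteq> {1..s}"

definition independent_linear_forms ::
  "('a, 'b) ring_scheme \<Rightarrow> nat \<Rightarrow> nat \<Rightarrow> (nat \<Rightarrow> nat multiset \<Rightarrow> 'a) \<Rightarrow> bool" where
  "independent_linear_forms K m s N \<longleftrightarrow>
     m \<le> s \<and> (\<forall>i\<in>{1..s}. linear_form K m (N i)) \<and>
     (\<forall>\<iota>. increasing_indices m s \<iota> \<longrightarrow> lin_indep_polys K {1..m} (\<lambda>j. N (\<iota> j)))"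


section \<open>Degrees of graded algebras\<close>

text \<open>A graded algebra is a ring \<open>B\<close> with its family \<open>G\<close> of homogeneous components. For an
  algebra generated in degree one over a field, the base field is the component \<open>G 0\<close>, so
  vector space dimensions are taken over \<open>G 0\<close>.\<close>

definition hilbert_function :: "('a, 'b) ring_scheme \<Rightarrow> (nat \<Rightarrow> 'a set) \<Rightarrow> nat \<Rightarrow> nat" where
  "hilbert_function B G j = ring.dim B (G 0) (G j)"

definition hilbert_polynomial :: "('a, 'b) ring_scheme \<Rightarrow> (nat \<Rightarrow> 'a set) \<Rightarrow> rat poly" where
  "hilbert_polynomial B G =
     (THE P. \<forall>\<^sub>F j in sequentially. poly P (of_nat j) = of_nat (hilbert_function B G j))"

definition graded_degree :: "('a, 'b) ring_scheme \<Rightarrow> (nat \<Rightarrow> 'a set) \<Rightarrow> rat" where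
  "graded_degree B G =
     (if krull_dim B = 0 then of_nat (ring.dim B (G 0) (carrier B))
      else fact (the_enat (krull_dim B) - 1) *
           Polynomial.coeff (hilbert_polynomial B G) (Polynomial.degree (hilbert_polynomial B G)))"

text \<open>The sum is over a finite set, as \<open>A\<close> is meant to be Noetherian. Minimal primes of a
  graded ring are homogeneous, so \<open>A Quot P\<close> is graded by the images of the \<open>G j\<close>.\<close>

definition deg_rad :: "('a, 'b) ring_scheme \<Rightarrow> (nat \<Rightarrow> 'a set) \<Rightarrow> rat" where
  "deg_rad A G =
     (\<Sum>P\<in>minimal_primes A. graded_degree (A Quot P) (\<lambda>j. (\<lambda>x. P +>\<^bsub>A\<^esub> x) ` G j))"


section \<open>The fiber cone\<close>

text \<open>Elements are families \<open>f\<close> of cosets \<open>f j \<in> \<aa>\<^sup>j / \<mm>\<aa>\<^sup>j\<close>, almost all zero. Since \<open>\<mm>\<aa>\<^sup>j\<close>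
  is an ideal of \<open>R\<close>, the group \<open>\<aa>\<^sup>j / \<mm>\<aa>\<^sup>j\<close> lies in the ring \<open>R Quot \<mm>\<aa>\<^sup>j\<close>, where the sums are
  formed.\<close>

definition fiber_cone_modulus ::
  "('a, 'b) ring_scheme \<Rightarrow> 'a set \<Rightarrow> 'a set \<Rightarrow> nat \<Rightarrow> 'a set" where
  "fiber_cone_modulus R \<mm> \<aa> j = \<mm> \<cdot>\<^bsub>R\<^esub> ideal_pow R \<aa> j"

definition fiber_cone ::
  "('a, 'b) ring_scheme \<Rightarrow> 'a set \<Rightarrow> 'a set \<Rightarrow> (nat \<Rightarrow> 'a set) ring" where
  "fiber_cone R \<mm> \<aa> =
     (let J = fiber_cone_modulus R \<mm> \<aa> in
      \<lparr>carrier = {f. (\<forall>j. f j \<in> (\<lambda>x. J j +>\<^bsub>R\<^esub> x) ` ideal_pow R \<aa> j) \<and> finite {j. f j \<noteq> J j}},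
       monoid.mult = (\<lambda>f g j. \<Oplus>\<^bsub>R Quot J j\<^esub>i\<in>{..j}. rcoset_mult R (J j) (f i) (g (j - i))),
       one = (\<lambda>j. if j = 0 then J 0 +>\<^bsub>R\<^esub> \<one>\<^bsub>R\<^esub> else J j),
       zero = J,
       add = (\<lambda>f g j. f j <+>\<^bsub>R\<^esub> g j)\<rparr>)"

definition fiber_cone_component ::
  "('a, 'b) ring_scheme \<Rightarrow> 'a set \<Rightarrow> 'a set \<Rightarrow> nat \<Rightarrow> (nat \<Rightarrow> 'a set) set" where
  "fiber_cone_component R \<mm> \<aa> j =
     {f \<in> carrier (fiber_cone R \<mm> \<aa>). \<forall>i. i \<noteq> j \<longrightarrow> f i = fiber_cone_modulus R \<mm> \<aa> i}"

end

theory Submission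
  imports Defs "HOL-Algebra.UnivPoly"
begin

text \<open>
  \<^bold>\<open>Reduction to a statement about graded algebras.\<close> Let \<open>A\<close> be the fiber cone of \<open>\<qq>\<close>. The elements
  \<open>N\<^sub>i(u) \<in> \<qq>\<close> define forms \<open>x\<^sub>i\<close> of degree one in \<open>A\<close>. If the ideal generated by some of the \<open>x\<^sub>i\<close>
  contains all components of \<open>A\<close> of large degree, then Nakayama's lemma turns this into
  \<open>\<qq>\<^sup>k\<^sup>+\<^sup>1 = \<bb>\<qq>\<^sup>k\<close> (\<open>reduction_of_generated\<close>), and then \<open>\<bb>\<close> has radical \<open>\<mm>\<close>. So \<open>n\<close> of the \<open>l\<close> forms have to
  be found that have no common zero in \<open>Proj A\<close> (\<open>few_forms_suffice\<close>). The independence of the \<open>N\<^sub>i\<close>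
  says that any \<open>m\<close> of the forms generate the irrelevant ideal (\<open>independent_values_generate\<close>).

  \<^bold>\<open>The choice of the forms\<close> (\<open>selection\<close>). The forms are chosen one after the other, such that the
  components of the common zero locus of the first \<open>j\<close> of them have dimension at most \<open>n - j\<close> (as cones)
  and degrees with sum at most \<open>d\<close>. A component \<open>P\<close> of dimension exactly \<open>n - j\<close> contains at most
  \<open>m - (n - j)\<close> of all the forms: together with fewer than \<open>n - j\<close> further ones, which cannot cut \<open>P\<close> down to
  dimension zero, they would otherwise be \<open>m\<close> in number and generate the irrelevant ideal
  (\<open>forms_in_prime\<close>). As \<open>j\<close> of these are the chosen ones, at most \<open>m - n\<close> of the others vanish on \<open>P\<close>. There are at most \<open>d\<close>
  such components, so at most \<open>d(m - n) < l - j\<close> of the remaining \<open>l - j\<close> forms are excluded, and any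
  other one lowers the dimension of all of them. By Bezout's theorem (\<open>hyperplane_cut\<close>) the sum of the degrees
  does not grow.

  \<^bold>\<open>Dimension and degree\<close> of a homogeneous ideal are read off its Hilbert polynomial (\<open>gdim\<close>, \<open>gdeg\<close>), which
  makes them additive in exact sequences; this yields Bezout's theorem, once all components of a
  hyperplane section of an irreducible variety are known to have codimension one
  (\<open>principal_ideal_theorem\<close>). For the latter,
  parameters modulo the hyperplane section are shown to stay algebraically independent modulo each of its components, so that
  the growth rates of both quotients agree. The degrees in the theorem are defined by means of the Krull dimension; they are at least
  the \<open>gdeg\<close> of the minimal primes (\<open>graded_degree_ge\<close>), because there are chains of homogeneous primes of length \<open>gdim\<close>.

  \<^bold>\<open>The dimension of the fiber cone\<close> is at most \<open>n\<close> (\<open>gdim_le_krull_dim\<close>): the sums of its Hilbert function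
  are bounded by the length of \<open>R/\<qq>\<^sup>N\<close>, hence by the length of \<open>R\<close> modulo the \<open>N\<close>-th powers of \<open>n\<close> parameters,
  and this grows at most like \<open>N\<^sup>n\<close>.
\<close>

section \<open>Ideals of Noetherian rings\<close>

definition (in ring) adjoin :: "'a set \<Rightarrow> 'a \<Rightarrow> 'a set" where
  "adjoin I a = I <+> PIdl a"

definition (in ring) colon :: "'a set \<Rightarrow> 'a \<Rightarrow> 'a set" where
  "colon I a = {x \<in> carrier R. a \<otimes> x \<in> I}"

context cring
begin

lemma idealD:
  assumes "ideal I R"
  shows "I \<subseteq> carrier R" "\<zero> \<in> I" "\<And>a b. a \<in> I \<Longrightarrow> b \<in> I \<Longrightarrow> a \<oplus> b \<in> I"
    "\<And>a. a \<in> I \<Longrightarrow> \<ominus> a \<in> I" "\<And>a b. a \<in> I \<Longrightarrow> b \<in> I \<Longrightarrow> a \<ominus> b \<in> I"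
    "\<And>a r. a \<in> I \<Longrightarrow> r \<in> carrier R \<Longrightarrow> r \<otimes> a \<in> I"
    "\<And>a r. a \<in> I \<Longrightarrow> r \<in> carrier R \<Longrightarrow> a \<otimes> r \<in> I"
proof -
  interpret ideal I R by fact
  show "I \<subseteq> carrier R" "\<zero> \<in> I" "\<And>a b. a \<in> I \<Longrightarrow> b \<in> I \<Longrightarrow> a \<oplus> b \<in> I"
    "\<And>a. a \<in> I \<Longrightarrow> \<ominus> a \<in> I" "\<And>a b. a \<in> I \<Longrightarrow> b \<in> I \<Longrightarrow> a \<ominus> b \<in> I"
    "\<And>a r. a \<in> I \<Longrightarrow> r \<in> carrier R \<Longrightarrow> r \<otimes> a \<in> I"
    "\<And>a r. a \<in> I \<Longrightarrow> r \<in> carrier R \<Longrightarrow> a \<otimes> r \<in> I"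
    using I_l_closed I_r_closed by (auto simp: a_subset a_minus_def)
qed

lemma ideal_cancel_r:
  assumes "ideal I R" "a \<oplus> b \<in> I" "b \<in> I" "a \<in> carrier R" shows "a \<in> I"
proof -
  have b: "b \<in> carrier R" using idealD(1)[OF assms(1)] assms(3) by auto
  have "(a \<oplus> b) \<ominus> b \<in> I" using idealD(5)[OF assms(1-3)] .
  moreover have "(a \<oplus> b) \<ominus> b = a" using b assms(4) by algebra
  ultimately show ?thesis by simp
qed

lemma adjoin_ideal: "ideal I R \<Longrightarrow> a \<in> carrier R \<Longrightarrow> ideal (adjoin I a) R"
  unfolding adjoin_def by (intro add_ideals cgenideal_ideal)

lemma adjoin_iff: "x \<in> adjoin I a \<longleftrightarrow> (\<exists>i\<in>I. \<exists>r\<in>carrier R. x = i \<oplus> r \<otimes> a)"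
  unfolding adjoin_def set_add_def' cgenideal_def by auto

lemma adjoin_incl: "ideal I R \<Longrightarrow> a \<in> carrier R \<Longrightarrow> I \<subseteq> adjoin I a"
proof
  fix x assume *: "ideal I R" "a \<in> carrier R" "x \<in> I"
  hence "x = x \<oplus> \<zero> \<otimes> a" using idealD(1)[of I] by auto
  thus "x \<in> adjoin I a" using * unfolding adjoin_iff by blast
qed

lemma adjoin_mem: "ideal I R \<Longrightarrow> a \<in> carrier R \<Longrightarrow> a \<in> adjoin I a"
proof -
  assume *: "ideal I R" "a \<in> carrier R"
  hence "a = \<zero> \<oplus> \<one> \<otimes> a" by auto
  thus "a \<in> adjoin I a" using * idealD(2)[of I] unfolding adjoin_iff by blast
qed

lemma adjoin_least: "ideal J R \<Longrightarrow> I \<subseteq> J \<Longrightarrow> a \<in> J \<Longrightarrow> adjoin I a \<subseteq> J"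
  using idealD by (auto simp: adjoin_iff subset_iff)

definition adjoin_list :: "'a set \<Rightarrow> 'a list \<Rightarrow> 'a set" where "adjoin_list I ys = foldr (\<lambda>y J. adjoin J y) ys I"

lemma adjoin_list_contains:
  assumes "ideal I R" "set ys \<subseteq> carrier R"
  shows "ideal (adjoin_list I ys) R \<and> I \<subseteq> adjoin_list I ys \<and> set ys \<subseteq> adjoin_list I ys"
  using assms(2)
proof (induction ys)
  case Nil
  thus ?case using assms(1) unfolding adjoin_list_def by simp
next
  case (Cons y ys)
  hence ih: "ideal (adjoin_list I ys) R" "I \<subseteq> adjoin_list I ys" "set ys \<subseteq> adjoin_list I ys" "y \<in> carrier R" by auto
  have "adjoin_list I (y # ys) = adjoin (adjoin_list I ys) y" unfolding adjoin_list_def by simp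
  thus ?case using adjoin_ideal[OF ih(1,4)] adjoin_incl[OF ih(1,4)] adjoin_mem[OF ih(1,4)] ih by auto
qed

lemma adjoin_list_least: "ideal J R \<Longrightarrow> I \<subseteq> J \<Longrightarrow> set ys \<subseteq> J \<Longrightarrow> adjoin_list I ys \<subseteq> J"
proof (induction ys)
  case (Cons y ys)
  have "adjoin (adjoin_list I ys) y \<subseteq> J" using adjoin_least[of J "adjoin_list I ys" y] Cons by simp
  thus ?case unfolding adjoin_list_def by simp
qed (simp add: adjoin_list_def)

lemma colon_ideal:
  assumes "ideal I R" "a \<in> carrier R" shows "ideal (colon I a) R"
  unfolding colon_def by (rule ideal.helper_max_prime[OF assms(1) is_cring assms(2)])

lemma colon_incl: "ideal I R \<Longrightarrow> a \<in> carrier R \<Longrightarrow> I \<subseteq> colon I a"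
  using idealD by (auto simp: colon_def)

lemma adjoin_prod:
  assumes "ideal I R" "a \<in> carrier R" "b \<in> carrier R" "a \<otimes> b \<in> I" "x \<in> adjoin I a" "y \<in> adjoin I b"
  shows "x \<otimes> y \<in> I"
proof -
  obtain i r j s where *: "i \<in> I" "r \<in> carrier R" "x = i \<oplus> r \<otimes> a" "j \<in> I" "s \<in> carrier R" "y = j \<oplus> s \<otimes> b"
    using assms(5,6) by (auto simp: adjoin_iff)
  have c: "i \<in> carrier R" "j \<in> carrier R" using * idealD(1)[OF assms(1)] by auto
  have "x \<otimes> y = (i \<otimes> (j \<oplus> s \<otimes> b) \<oplus> (r \<otimes> a) \<otimes> j) \<oplus> (r \<otimes> s) \<otimes> (a \<otimes> b)"
    using * c assms(2,3) by (simp only: ) algebra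
  also have "\<dots> \<in> I" using * c assms idealD[OF assms(1)] by auto
  finally show ?thesis .
qed

end

context noetherian_ring
begin

lemma ideal_acc:
  assumes "\<And>i::nat. ideal (I i) R" "\<And>i. I i \<subseteq> I (Suc i)"
  shows "\<exists>n. \<forall>k\<ge>n. I k = I n"
proof -
  have mono: "i \<le> j \<Longrightarrow> I i \<subseteq> I j" for i j using assms(2) by (rule lift_Suc_mono_le)
  have "subset.chain {I. ideal I R} (range I)"
    unfolding pred_on.chain_def
  proof (intro conjI ballI)
    fix A B assume "A \<in> range I" "B \<in> range I"
    then obtain i j where "A = I i" "B = I j" by auto
    thus "(\<subset>)\<^sup>=\<^sup>= A B \<or> (\<subset>)\<^sup>=\<^sup>= B A" using mono[of i j] mono[of j i] by (cases "i \<le> j") auto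
  qed (use assms(1) in auto)
  hence "\<Union>(range I) \<in> range I" by (intro ideal_chain_is_trivial) auto
  then obtain n where n: "\<Union>(range I) = I n" by auto
  have "I k = I n" if "k \<ge> n" for k using mono[OF that] n by auto
  thus ?thesis by auto
qed

lemma noetherian_induct [consumes 1, case_names step]:
  assumes "ideal I R"
    and "\<And>I. ideal I R \<Longrightarrow> (\<And>J. ideal J R \<Longrightarrow> I \<subset> J \<Longrightarrow> P J) \<Longrightarrow> P I"
  shows "P I"
proof -
  have "wf {(J, I). ideal I R \<and> ideal J R \<and> I \<subset> J}"
    unfolding wf_iff_no_infinite_down_chain
  proof
    assume "\<exists>f. \<forall>i. (f (Suc i), f i) \<in> {(J, I). ideal I R \<and> ideal J R \<and> I \<subset> J}"
    then obtain f where f: "\<And>i. ideal (f i) R \<and> f i \<subset> f (Suc i)" by (elim exE) (simp, blast)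
    hence "\<exists>n. \<forall>k\<ge>n. f k = f n" by (intro ideal_acc) auto
    thus False using f by (metis le_Suc_eq order_less_irrefl order_refl)
  qed
  thus ?thesis using assms(1)
  proof (induction I rule: wf_induct_rule)
    case (less I)
    show ?case
    proof (rule assms(2)[OF less.prems])
      fix J assume "ideal J R" "I \<subset> J"
      thus "P J" using less.IH[of J] less.prems by blast
    qed
  qed
qed

end

context cring
begin

lemma foldr_mult_append:
  assumes "set xs \<subseteq> carrier R" "set ys \<subseteq> carrier R"
  shows "foldr (\<otimes>) (xs @ ys) \<one> = foldr (\<otimes>) xs \<one> \<otimes> foldr (\<otimes>) ys \<one> \<and>
    foldr (\<otimes>) xs \<one> \<in> carrier R \<and> foldr (\<otimes>) ys \<one> \<in> carrier R"
proof -
  have c: "foldr (\<otimes>) zs \<one> \<in> carrier R" if "set zs \<subseteq> carrier R" for zs using that by (induction zs) auto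
  show ?thesis using assms c by (induction xs) (auto simp: m_assoc)
qed

text \<open>Every ideal of a Noetherian ring contains a product of primes lying over it, by Noetherian induction. The ideals range over a family
  closed under adjoining elements of the multiplicative set \<open>Hs\<close>, and primality is tested on \<open>Hs\<close> only: with all ideals and
  all elements this is the classical statement, with homogeneous ideals and elements the graded one.\<close>

lemma prime_decomposition:
  assumes noeth: "noetherian_ring R"
    and H: "Hs \<subseteq> carrier R" "\<And>a b. a \<in> Hs \<Longrightarrow> b \<in> Hs \<Longrightarrow> a \<otimes> b \<in> Hs"
    and C: "\<And>I. I \<in> \<I> \<Longrightarrow> ideal I R" "\<And>I a. I \<in> \<I> \<Longrightarrow> a \<in> Hs \<Longrightarrow> adjoin I a \<in> \<I>"
    and I: "I \<in> \<I>"
  shows "\<exists>Ps. (\<forall>P\<in>set Ps. P \<in> \<I> \<and> I \<subseteq> P \<and> \<one> \<notin> P \<and> (\<forall>a\<in>Hs. \<forall>b\<in>Hs. a \<otimes> b \<in> P \<longrightarrow> a \<in> P \<or> b \<in> P)) \<and>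
    (\<forall>as. list_all2 (\<in>) as Ps \<longrightarrow> foldr (\<otimes>) as \<one> \<in> I)"
proof -
  interpret noetherian_ring R by fact
  have "ideal I R" using C(1) I .
  thus ?thesis using I
  proof (induction I rule: noetherian_induct)
    case (step I)
    have idI: "ideal I R" by fact
    show ?case
    proof (cases "\<one> \<in> I")
      case True
      thus ?thesis by (intro exI[of _ "[]"]) auto
    next
      case one: False
      show ?thesis
      proof (cases "\<forall>a\<in>Hs. \<forall>b\<in>Hs. a \<otimes> b \<in> I \<longrightarrow> a \<in> I \<or> b \<in> I")
        case True
        have "foldr (\<otimes>) as \<one> \<in> I" if "list_all2 (\<in>) as [I]" for as
          using that idealD(1)[OF idI] by (auto simp: list_all2_Cons2 subset_iff)
        thus ?thesis using True one step.prems by (intro exI[of _ "[I]"]) auto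
      next
        case False
        \<comment> \<open>the product of \<open>I + (a)\<close> and \<open>I + (b)\<close> lies in \<open>I\<close>, so the two lists can be concatenated\<close>
        then obtain a b where ab: "a \<in> Hs" "b \<in> Hs" "a \<otimes> b \<in> I" "a \<notin> I" "b \<notin> I" by auto
        have abc: "a \<in> carrier R" "b \<in> carrier R" using ab H(1) by auto
        have lt: "I \<subset> adjoin I a" "I \<subset> adjoin I b"
          using adjoin_incl[OF idI] adjoin_mem[OF idI] abc ab by blast+
        obtain Ps where Ps: "\<forall>P\<in>set Ps. P \<in> \<I> \<and> adjoin I a \<subseteq> P \<and> \<one> \<notin> P \<and> (\<forall>a\<in>Hs. \<forall>b\<in>Hs. a \<otimes> b \<in> P \<longrightarrow> a \<in> P \<or> b \<in> P)"
          "\<forall>as. list_all2 (\<in>) as Ps \<longrightarrow> foldr (\<otimes>) as \<one> \<in> adjoin I a"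
          using step.IH[OF adjoin_ideal[OF idI abc(1)] lt(1) C(2)[OF step.prems ab(1)]] by blast
        obtain Qs where Qs: "\<forall>P\<in>set Qs. P \<in> \<I> \<and> adjoin I b \<subseteq> P \<and> \<one> \<notin> P \<and> (\<forall>a\<in>Hs. \<forall>b\<in>Hs. a \<otimes> b \<in> P \<longrightarrow> a \<in> P \<or> b \<in> P)"
          "\<forall>as. list_all2 (\<in>) as Qs \<longrightarrow> foldr (\<otimes>) as \<one> \<in> adjoin I b"
          using step.IH[OF adjoin_ideal[OF idI abc(2)] lt(2) C(2)[OF step.prems ab(2)]] by blast
        have sub: "set as \<subseteq> carrier R" if "list_all2 (\<in>) as Xs" "\<forall>P\<in>set Xs. P \<in> \<I>" for as Xs
        proof
          fix x assume "x \<in> set as"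
          then obtain i where "i < length as" "x = as ! i" by (auto simp: in_set_conv_nth)
          hence "x \<in> Xs ! i" "Xs ! i \<in> set Xs" using that(1) by (auto simp: list_all2_conv_all_nth)
          thus "x \<in> carrier R" using that(2) C(1) idealD(1) by blast
        qed
        have "foldr (\<otimes>) as \<one> \<in> I" if as: "list_all2 (\<in>) as (Ps @ Qs)" for as
        proof -
          obtain us vs where uv: "as = us @ vs" "list_all2 (\<in>) us Ps" "list_all2 (\<in>) vs Qs"
            using as unfolding list_all2_append2 by auto
          have "set us \<subseteq> carrier R" "set vs \<subseteq> carrier R" using sub[OF uv(2)] sub[OF uv(3)] Ps(1) Qs(1) by blast+
          hence "foldr (\<otimes>) as \<one> = foldr (\<otimes>) us \<one> \<otimes> foldr (\<otimes>) vs \<one>"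
            unfolding uv(1) using foldr_mult_append[of us vs] by simp
          moreover have "foldr (\<otimes>) us \<one> \<in> adjoin I a" "foldr (\<otimes>) vs \<one> \<in> adjoin I b"
            using uv Ps(2) Qs(2) by blast+
          ultimately show ?thesis using adjoin_prod[OF idI abc ab(3)] by simp
        qed
        moreover have "\<forall>P\<in>set (Ps @ Qs). P \<in> \<I> \<and> I \<subseteq> P \<and> \<one> \<notin> P \<and> (\<forall>a\<in>Hs. \<forall>b\<in>Hs. a \<otimes> b \<in> P \<longrightarrow> a \<in> P \<or> b \<in> P)"
        proof
          fix P assume "P \<in> set (Ps @ Qs)"
          then consider "P \<in> set Ps" | "P \<in> set Qs" by auto
          thus "P \<in> \<I> \<and> I \<subseteq> P \<and> \<one> \<notin> P \<and> (\<forall>a\<in>Hs. \<forall>b\<in>Hs. a \<otimes> b \<in> P \<longrightarrow> a \<in> P \<or> b \<in> P)"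
          proof cases
            case 1
            show ?thesis using bspec[OF Ps(1) 1] subset_trans[OF psubset_imp_subset[OF lt(1)], of P] by simp
          next
            case 2
            show ?thesis using bspec[OF Qs(1) 2] subset_trans[OF psubset_imp_subset[OF lt(2)], of P] by simp
          qed
        qed
        ultimately show ?thesis by blast
      qed
    qed
  qed
qed

text \<open>The product of witnesses of the non-inclusions \<open>Q \<subseteq> P\<close>.\<close>

lemma separating_element:
  assumes fin: "finite \<Q>" and H: "\<one> \<in> Hs" "\<And>a b. a \<in> Hs \<Longrightarrow> b \<in> Hs \<Longrightarrow> a \<otimes> b \<in> Hs" "Hs \<subseteq> carrier R"
    and id: "\<And>Q. Q \<in> \<Q> \<Longrightarrow> ideal Q R"
    and P: "\<one> \<notin> P" "\<And>a b. a \<in> Hs \<Longrightarrow> b \<in> Hs \<Longrightarrow> a \<otimes> b \<in> P \<Longrightarrow> a \<in> P \<or> b \<in> P"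
    and inc: "\<And>Q. Q \<in> \<Q> \<Longrightarrow> \<exists>a\<in>Hs. a \<in> Q \<and> a \<notin> P"
  shows "\<exists>f\<in>Hs. f \<notin> P \<and> (\<forall>Q\<in>\<Q>. f \<in> Q)"
  using fin id inc
proof (induction \<Q> rule: finite_induct)
  case empty
  thus ?case using P(1) H(1) by auto
next
  case (insert Q \<Q>)
  obtain f where f: "f \<in> Hs" "f \<notin> P" "\<forall>Q\<in>\<Q>. f \<in> Q" using insert by auto
  obtain a where a: "a \<in> Hs" "a \<in> Q" "a \<notin> P" using insert.prems(2) by auto
  have c: "f \<in> carrier R" "a \<in> carrier R" using f a H(3) by auto
  have "a \<otimes> f \<notin> P" using P(2)[of a f] a f by auto
  moreover have "\<forall>Q'\<in>insert Q \<Q>. a \<otimes> f \<in> Q'"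
    using f a c idealD(6,7)[OF insert.prems(1)] by auto
  ultimately show ?case using H(2)[OF a(1) f(1)] by auto
qed

text \<open>Modulo each of the ideals all summands but one vanish. Together with \<open>separating_element\<close> this replaces prime
  avoidance for finitely many incomparable primes.\<close>

lemma avoid_by_sum:
  assumes "finite \<Q>" "\<And>Q. Q \<in> \<Q> \<Longrightarrow> ideal Q R"
    and "\<And>Q. Q \<in> \<Q> \<Longrightarrow> f Q \<in> carrier R" "\<And>Q. Q \<in> \<Q> \<Longrightarrow> f Q \<notin> Q"
    and "\<And>Q Q'. Q \<in> \<Q> \<Longrightarrow> Q' \<in> \<Q> \<Longrightarrow> Q \<noteq> Q' \<Longrightarrow> f Q \<in> Q'"
    and "P \<in> \<Q>"
  shows "(\<Oplus>Q\<in>\<Q>. f Q) \<notin> P"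
proof
  assume *: "(\<Oplus>Q\<in>\<Q>. f Q) \<in> P"
  have idP: "ideal P R" using assms by auto
  have sum_in: "finite S \<Longrightarrow> (\<And>Q. Q \<in> S \<Longrightarrow> f Q \<in> P) \<Longrightarrow> (\<Oplus>Q\<in>S. f Q) \<in> P" for S
  proof (induction S rule: finite_induct)
    case empty
    thus ?case using idealD(2)[OF idP] by simp
  next
    case (insert Q S)
    have "f \<in> insert Q S \<rightarrow> carrier R" using insert.prems idealD(1)[OF idP] by blast
    thus ?case using insert idealD(3)[OF idP] by (simp add: Pi_iff)
  qed
  have "(\<Oplus>Q\<in>\<Q>. f Q) = f P \<oplus> (\<Oplus>Q\<in>\<Q> - {P}. f Q)"
    using assms by (subst finsum_insert[symmetric]) (auto simp: insert_absorb)
  moreover have "(\<Oplus>Q\<in>\<Q> - {P}. f Q) \<in> P" using assms by (intro sum_in) auto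
  ultimately have "f P \<in> P" using ideal_cancel_r[OF idP] * assms by auto
  thus False using assms by auto
qed

end

section \<open>Finitely generated algebras are Noetherian\<close>

context cring
begin

text \<open>Ideals of a subring \<open>S\<close>, and the ascending chain condition for them, are formulated inside the ambient ring, so that
  the adjunction of one element after the other stays within one type.\<close>

definition sideal :: "'a set \<Rightarrow> 'a set \<Rightarrow> bool" where
  "sideal S L \<longleftrightarrow> L \<subseteq> S \<and> \<zero> \<in> L \<and> (\<forall>a\<in>L. \<forall>b\<in>L. a \<oplus> b \<in> L) \<and> (\<forall>s\<in>S. \<forall>a\<in>L. s \<otimes> a \<in> L)"

definition acc :: "'a set \<Rightarrow> bool" where
  "acc S \<longleftrightarrow> (\<forall>L. (\<forall>i::nat. sideal S (L i) \<and> L i \<subseteq> L (Suc i)) \<longrightarrow> (\<exists>n. \<forall>k\<ge>n. L k = L n))"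

text \<open>The values at \<open>x\<close> of the polynomials of degree less than \<open>n\<close> over \<open>S\<close>.\<close>

fun poly_span :: "'a set \<Rightarrow> 'a \<Rightarrow> nat \<Rightarrow> 'a set" where
  "poly_span S x 0 = {\<zero>}"
| "poly_span S x (Suc n) = {s \<otimes> (x [^] n) \<oplus> d |s d. s \<in> S \<and> d \<in> poly_span S x n}"

lemma poly_span_props:
  assumes S: "subring S R" and x: "x \<in> carrier R"
  shows "poly_span S x n \<subseteq> carrier R" "\<zero> \<in> poly_span S x n"
    "a \<in> poly_span S x n \<Longrightarrow> b \<in> poly_span S x n \<Longrightarrow> a \<oplus> b \<in> poly_span S x n"
    "s \<in> S \<Longrightarrow> a \<in> poly_span S x n \<Longrightarrow> s \<otimes> a \<in> poly_span S x n"
    "a \<in> poly_span S x n \<Longrightarrow> x \<otimes> a \<in> poly_span S x (Suc n)"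
    "poly_span S x n \<subseteq> poly_span S x (Suc n)"
proof -
  note S' = subringE[OF S]
  have Sc: "s \<in> carrier R" if "s \<in> S" for s using that S'(1) by auto
  show c: "poly_span S x n \<subseteq> carrier R" for n
    by (induction n) (auto simp: Sc x)
  show z: "\<zero> \<in> poly_span S x n" for n
    by (induction n) (auto simp: x S'(2) intro!: exI[of _ \<zero>])
  show "a \<in> poly_span S x n \<Longrightarrow> b \<in> poly_span S x n \<Longrightarrow> a \<oplus> b \<in> poly_span S x n"
  proof (induction n arbitrary: a b)
    case (Suc n)
    then obtain s d s' d' where *: "s \<in> S" "d \<in> poly_span S x n" "a = s \<otimes> (x [^] n) \<oplus> d"
       "s' \<in> S" "d' \<in> poly_span S x n" "b = s' \<otimes> (x [^] n) \<oplus> d'" by auto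
    have cc: "d \<in> carrier R" "d' \<in> carrier R" "x [^] n \<in> carrier R" using * c x by auto
    have "a \<oplus> b = (s \<oplus> s') \<otimes> (x [^] n) \<oplus> (d \<oplus> d')"
      using * cc Sc[OF *(1)] Sc[OF *(4)] by (simp only:) algebra
    thus ?case using Suc.IH[OF *(2,5)] S'(7)[OF *(1,4)] by auto
  qed auto
  show "s \<in> S \<Longrightarrow> a \<in> poly_span S x n \<Longrightarrow> s \<otimes> a \<in> poly_span S x n"
  proof (induction n arbitrary: a)
    case (Suc n)
    then obtain t d where *: "t \<in> S" "d \<in> poly_span S x n" "a = t \<otimes> (x [^] n) \<oplus> d" by auto
    have cc: "d \<in> carrier R" "x [^] n \<in> carrier R" using * c x by auto
    have "s \<otimes> a = (s \<otimes> t) \<otimes> (x [^] n) \<oplus> (s \<otimes> d)"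
      using * cc Sc[OF *(1)] Sc[OF Suc.prems(1)] by (simp only:) algebra
    thus ?case using Suc.IH[OF Suc.prems(1) *(2)] S'(6)[OF Suc.prems(1) *(1)] by auto
  qed (auto simp: Sc)
  show "a \<in> poly_span S x n \<Longrightarrow> x \<otimes> a \<in> poly_span S x (Suc n)"
  proof (induction n arbitrary: a)
    case 0
    thus ?case using S'(2) x by (auto intro!: exI[of _ \<zero>])
  next
    case (Suc n)
    then obtain t d where *: "t \<in> S" "d \<in> poly_span S x n" "a = t \<otimes> (x [^] n) \<oplus> d" by auto
    have cc: "d \<in> carrier R" "x [^] n \<in> carrier R" using * c x by auto
    have "x \<otimes> a = t \<otimes> (x [^] Suc n) \<oplus> (x \<otimes> d)"
      using * cc Sc[OF *(1)] x unfolding nat_pow_Suc by (simp only:) algebra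
    thus ?case using Suc.IH[OF *(2)] *(1) by (subst poly_span.simps) blast
  qed
  show "poly_span S x n \<subseteq> poly_span S x (Suc n)"
  proof
    fix a assume a: "a \<in> poly_span S x n"
    have "a \<in> carrier R" using a c by blast
    hence "a = \<zero> \<otimes> (x [^] n) \<oplus> a" using x by simp
    thus "a \<in> poly_span S x (Suc n)" using a S'(2) by auto
  qed
qed

text \<open>Hilbert's basis theorem for \<open>T = S[x]\<close>. For a chain of ideals \<open>I k\<close> the leading coefficients of degree \<open>n\<close> form
  ideals \<open>L n k\<close> of \<open>S\<close> that increase in both arguments, hence they are stationary simultaneously, and ideals with the same
  leading coefficients in all degrees coincide. Since \<open>x\<close> may be algebraic over \<open>S\<close>, \<open>n\<close> refers to a chosen
  representation of an element and not to its degree.\<close>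

lemma hilbert_basis:
  assumes S: "subring S R" and T: "subring T R" and x: "x \<in> T"
    and ST: "S \<subseteq> T" and gen: "\<And>t. t \<in> T \<Longrightarrow> \<exists>n. t \<in> poly_span S x n"
    and acc: "acc S"
  shows "acc T"
  unfolding acc_def
proof (intro allI impI)
  fix I :: "nat \<Rightarrow> 'a set"
  assume I: "\<forall>i. sideal T (I i) \<and> I i \<subseteq> I (Suc i)"
  note S' = subringE[OF S] and T' = subringE[OF T]
  have xc: "x \<in> carrier R" using x T'(1) by auto
  note ps = poly_span_props[OF S xc]
  have xn: "x [^] (n::nat) \<in> carrier R" for n using xc by auto
  have Sc: "s \<in> carrier R" if "s \<in> S" for s using that S'(1) by auto
  have IT: "I k \<subseteq> T" "\<zero> \<in> I k" "\<And>a b. a \<in> I k \<Longrightarrow> b \<in> I k \<Longrightarrow> a \<oplus> b \<in> I k"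
    "\<And>t a. t \<in> T \<Longrightarrow> a \<in> I k \<Longrightarrow> t \<otimes> a \<in> I k" for k
    using I unfolding sideal_def by auto
  have I2: "I i \<subseteq> I (Suc i)" for i using I by blast
  have Imono: "k \<le> k' \<Longrightarrow> I k \<subseteq> I k'" for k k' by (rule lift_Suc_mono_le[of I, OF I2])
  define L where "L n k = {s \<in> S. \<exists>d\<in>poly_span S x n. s \<otimes> (x [^] n) \<oplus> d \<in> I k}" for n k
  have neg: "\<ominus> a \<in> I k" if "a \<in> I k" for a k
  proof -
    have "\<ominus> \<one> \<otimes> a \<in> I k" using IT(4) T'(5)[OF T'(3)] that by auto
    moreover have "\<ominus> \<one> \<otimes> a = \<ominus> a" using that IT(1)[of k] T'(1) by (auto simp: l_minus subset_iff)
    ultimately show ?thesis by simp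
  qed
  have L_sub: "L n k \<subseteq> S" for n k unfolding L_def by auto
  have L_ideal: "sideal S (L n k)" for n k
    unfolding sideal_def
  proof (intro conjI ballI)
    show "\<zero> \<in> L n k" unfolding L_def using S'(2) ps(2)[of n] IT(2) xn by (auto intro!: bexI[of _ \<zero>])
  next
    fix a b assume "a \<in> L n k" "b \<in> L n k"
    then obtain d e where *: "a \<in> S" "b \<in> S" "d \<in> poly_span S x n" "e \<in> poly_span S x n"
      "a \<otimes> (x [^] n) \<oplus> d \<in> I k" "b \<otimes> (x [^] n) \<oplus> e \<in> I k" unfolding L_def by auto
    have cc: "d \<in> carrier R" "e \<in> carrier R" using * ps(1) by auto
    have "(a \<oplus> b) \<otimes> (x [^] n) \<oplus> (d \<oplus> e) = (a \<otimes> (x [^] n) \<oplus> d) \<oplus> (b \<otimes> (x [^] n) \<oplus> e)"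
      using cc xn[of n] Sc[OF *(1)] Sc[OF *(2)] by algebra
    also have "\<dots> \<in> I k" using IT(3) * by auto
    finally show "a \<oplus> b \<in> L n k" unfolding L_def using S'(7)[OF *(1,2)] ps(3)[OF *(3,4)] by auto
  next
    fix s a assume s: "s \<in> S" and "a \<in> L n k"
    then obtain d where *: "a \<in> S" "d \<in> poly_span S x n" "a \<otimes> (x [^] n) \<oplus> d \<in> I k" unfolding L_def by auto
    have cc: "d \<in> carrier R" using * ps(1) by auto
    have "(s \<otimes> a) \<otimes> (x [^] n) \<oplus> (s \<otimes> d) = s \<otimes> (a \<otimes> (x [^] n) \<oplus> d)"
      using cc xn[of n] Sc[OF *(1)] Sc[OF s] by algebra
    also have "\<dots> \<in> I k" using IT(4) * s ST by auto
    finally show "s \<otimes> a \<in> L n k" unfolding L_def using S'(6)[OF s *(1)] ps(4)[OF s *(2)] by auto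
  qed (use L_sub in auto)
  have L_k: "L n k \<subseteq> L n k'" if "k \<le> k'" for n k k'
    using Imono[OF that] unfolding L_def by auto
  have L_S: "L n k \<subseteq> L (Suc n) k" for n k
  proof
    fix a assume "a \<in> L n k"
    then obtain d where *: "a \<in> S" "d \<in> poly_span S x n" "a \<otimes> (x [^] n) \<oplus> d \<in> I k" unfolding L_def by auto
    have cc: "d \<in> carrier R" using * ps(1) by auto
    have "a \<otimes> (x [^] Suc n) \<oplus> x \<otimes> d = x \<otimes> (a \<otimes> (x [^] n) \<oplus> d)"
      using cc xn[of n] Sc[OF *(1)] xc unfolding nat_pow_Suc by algebra
    also have "\<dots> \<in> I k" using IT(4)[OF x] * by auto
    finally show "a \<in> L (Suc n) k" unfolding L_def using *(1) ps(5)[OF *(2)] by (auto simp del: poly_span.simps)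
  qed
  have L_n: "L n k \<subseteq> L n' k" if "n \<le> n'" for n n' k
    using that by (rule lift_Suc_mono_le[of "\<lambda>n. L n k", OF L_S])
  have "L k k \<subseteq> L (Suc k) (Suc k)" for k using L_k[of k "Suc k" k] L_S[of k "Suc k"] by auto
  hence "\<exists>N. \<forall>k\<ge>N. L k k = L N N"
    using acc[unfolded acc_def, rule_format, of "\<lambda>k. L k k"] L_ideal by blast
  then obtain N where N: "\<And>k. k \<ge> N \<Longrightarrow> L k k = L N N" by auto
  have diag: "L n k = L N N" if "n \<ge> N" "k \<ge> N" for n k
    using N[of "max n k"] L_k[of k "max n k" n] L_n[of n "max n k" "max n k"] that
      L_k[of N k N] L_n[of N n k] by auto
  have "\<exists>M. \<forall>k\<ge>M. L n k = L n M" for n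
    using acc[unfolded acc_def, rule_format, of "\<lambda>k. L n k"] L_ideal L_k[OF le_SucI[OF order_refl]] by blast
  then obtain M where M: "\<And>n k. k \<ge> M n \<Longrightarrow> L n k = L n (M n)" by metis
  define B where "B = Max (insert N (M ` {..<N}))"
  have B1: "N \<le> B" and B2: "\<And>n. n < N \<Longrightarrow> M n \<le> B" unfolding B_def by auto
  have stab: "L n k = L n B" if "k \<ge> B" for n k
  proof (cases "n < N")
    case True
    thus ?thesis using M[of n k] M[of n B] B2[OF True] that by auto
  next
    case False
    thus ?thesis using diag[of n k] diag[of n B] B1 that by auto
  qed
  have "I k \<subseteq> I B" if kB: "k \<ge> B" for k
  proof -
    have "a \<in> I B" if "a \<in> I k" "a \<in> poly_span S x n" for a n
      using that
    proof (induction n arbitrary: a)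
      case 0
      thus ?case using IT(2) by auto
    next
      case (Suc n)
      then obtain s d where *: "s \<in> S" "d \<in> poly_span S x n" "a = s \<otimes> (x [^] n) \<oplus> d" by auto
      hence "s \<in> L n k" unfolding L_def using Suc.prems by auto
      hence "s \<in> L n B" using stab[OF kB] by auto
      then obtain d' where d': "d' \<in> poly_span S x n" "s \<otimes> (x [^] n) \<oplus> d' \<in> I B" unfolding L_def by auto
      have cc: "d \<in> carrier R" "d' \<in> carrier R" using * d' ps(1) by auto
      have m1: "\<ominus> \<one> \<in> S" using S'(3,5) by auto
      have eq: "a \<oplus> \<ominus> (s \<otimes> (x [^] n) \<oplus> d') = d \<oplus> (\<ominus> \<one>) \<otimes> d'"
        using cc xn[of n] Sc[OF *(1)] *(3) by (simp only:) algebra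
      have "d \<oplus> (\<ominus> \<one>) \<otimes> d' \<in> I k"
        unfolding eq[symmetric] using IT(3) Suc.prems(1) neg d'(2) Imono[OF kB] by auto
      moreover have "d \<oplus> (\<ominus> \<one>) \<otimes> d' \<in> poly_span S x n" using ps(3)[OF *(2) ps(4)[OF m1 d'(1)]] .
      ultimately have "d \<oplus> (\<ominus> \<one>) \<otimes> d' \<in> I B" by (rule Suc.IH)
      moreover have "a = (d \<oplus> (\<ominus> \<one>) \<otimes> d') \<oplus> (s \<otimes> (x [^] n) \<oplus> d')"
        using cc xn[of n] Sc[OF *(1)] *(3) by (simp only:) algebra
      ultimately show ?case using IT(3) d'(2) by auto
    qed
    thus ?thesis using gen IT(1) by blast
  qed
  thus "\<exists>n. \<forall>k\<ge>n. I k = I n" using Imono by (intro exI[of _ B]) blast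
qed

lemma acc_carrier_imp_noetherian:
  assumes "acc (carrier R)" shows "noetherian_ring R"
proof (rule trivial_ideal_chain_imp_noetherian)
  fix C assume C: "C \<noteq> {}" "subset.chain {I. ideal I R} C"
  have id: "ideal I R" if "I \<in> C" for I using C that unfolding pred_on.chain_def by auto
  have tot: "I \<subseteq> J \<or> J \<subseteq> I" if "I \<in> C" "J \<in> C" for I J using C that unfolding pred_on.chain_def by auto
  show "\<Union>C \<in> C"
  proof (rule ccontr)
    assume "\<Union>C \<notin> C"
    hence "\<exists>J\<in>C. I \<subset> J" if "I \<in> C" for I
      using tot that by (metis Sup_upper Union_least psubsetI subset_antisym subset_refl)
    then obtain nx where nx: "\<And>I. I \<in> C \<Longrightarrow> nx I \<in> C \<and> I \<subset> nx I" by metis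
    obtain I0 where I0: "I0 \<in> C" using C by auto
    define f where "f i = (nx ^^ i) I0" for i
    have fC: "f i \<in> C" for i unfolding f_def by (induction i) (auto simp: I0 nx)
    have fs: "f i \<subset> f (Suc i)" for i using nx[OF fC[of i]] unfolding f_def by auto
    have "sideal (carrier R) (f i)" for i
      using idealD[OF id[OF fC[of i]]] unfolding sideal_def by auto
    hence "\<exists>n. \<forall>k\<ge>n. f k = f n" using assms fs unfolding acc_def by blast
    thus False using fs by (metis le_Suc_eq order_less_irrefl order_refl)
  qed
qed

lemma acc_subfield:
  assumes K: "subfield K R" shows "acc K"
  unfolding acc_def
proof (intro allI impI)
  fix L :: "nat \<Rightarrow> 'a set" assume L: "\<forall>i. sideal K (L i) \<and> L i \<subseteq> L (Suc i)"
  have L2: "L i \<subseteq> L (Suc i)" for i using L by blast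
  have mono: "i \<le> j \<Longrightarrow> L i \<subseteq> L j" for i j by (rule lift_Suc_mono_le[of L, OF L2])
  note S = subringE[OF subfieldE(1)[OF K]]
  have triv: "L i = K" if "a \<in> L i" "a \<noteq> \<zero>" for a i
  proof
    show "L i \<subseteq> K" using L unfolding sideal_def by auto
    have a: "a \<in> K - {\<zero>}" using that L unfolding sideal_def by auto
    show "K \<subseteq> L i"
    proof
      fix k assume k: "k \<in> K"
      have "(k \<otimes> inv a) \<otimes> a \<in> L i"
        using L that k S(6)[OF k, of "inv a"] subfield_m_inv(1)[OF K a] unfolding sideal_def by auto
      moreover have "(k \<otimes> inv a) \<otimes> a = k"
        using subfield_m_inv[OF K a] k a S(1) by (simp add: m_assoc subset_iff)
      ultimately show "k \<in> L i" by simp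
    qed
  qed
  show "\<exists>n. \<forall>k\<ge>n. L k = L n"
  proof (cases "\<exists>i a. a \<in> L i \<and> a \<noteq> \<zero>")
    case True
    then obtain i a where a: "a \<in> L i" "a \<noteq> \<zero>" by auto
    have "L k = L i" if "k \<ge> i" for k using triv a mono[OF that] by blast
    thus ?thesis by auto
  next
    case False
    hence "L k = {\<zero>}" for k using L unfolding sideal_def by blast
    thus ?thesis by auto
  qed
qed

end

section \<open>Dimensions of subspaces of a commutative algebra\<close>

locale comm_algebra = cring R for R (structure) +
  fixes K :: "'a set"
  assumes subfield: "subfield K R"
begin

abbreviation subsp :: "'a set \<Rightarrow> bool" where "subsp V \<equiv> subalgebra K V R"
abbreviation fd :: "'a set \<Rightarrow> bool" where "fd V \<equiv> finite_dimension K V"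
abbreviation d :: "'a set \<Rightarrow> nat" where "d V \<equiv> dim K V"

lemma K_sub: "K \<subseteq> carrier R" "\<one> \<in> K" "\<zero> \<in> K" "\<And>k. k \<in> K \<Longrightarrow> k \<in> carrier R"
  using subringE[OF subfieldE(1)[OF subfield]] by auto

lemma subspI:
  assumes "V \<subseteq> carrier R" "\<zero> \<in> V" "\<And>a b. a \<in> V \<Longrightarrow> b \<in> V \<Longrightarrow> a \<oplus> b \<in> V"
    "\<And>k a. k \<in> K \<Longrightarrow> a \<in> V \<Longrightarrow> k \<otimes> a \<in> V"
  shows "subsp V"
proof -
  have neg: "\<ominus> a \<in> V" if "a \<in> V" for a
  proof -
    have "\<ominus> \<one> \<in> K" using subringE(3,5)[OF subfieldE(1)[OF subfield]] by auto
    hence "\<ominus> \<one> \<otimes> a \<in> V" using assms(4) that by auto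
    moreover have "\<ominus> \<one> \<otimes> a = \<ominus> a" using that assms(1) by (auto simp: l_minus subset_iff)
    ultimately show ?thesis by simp
  qed
  have "subgroup V (add_monoid R)"
    using assms(1-3) neg by (intro add.subgroupI) (auto simp: a_inv_def)
  thus ?thesis using assms(4) by (simp add: subalgebra_def subalgebra_axioms_def)
qed

lemma subspD:
  assumes "subsp V"
  shows "V \<subseteq> carrier R" "\<zero> \<in> V" "\<And>a b. a \<in> V \<Longrightarrow> b \<in> V \<Longrightarrow> a \<oplus> b \<in> V"
    "\<And>k a. k \<in> K \<Longrightarrow> a \<in> V \<Longrightarrow> k \<otimes> a \<in> V" "\<And>a. a \<in> V \<Longrightarrow> \<ominus> a \<in> V"
proof -
  note s = subalgebra.axioms(1)[OF assms]
  show "V \<subseteq> carrier R" using subalgebra_in_carrier[OF assms] .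
  show "\<zero> \<in> V" using subgroup.one_closed[OF s] by simp
  show "\<And>a b. a \<in> V \<Longrightarrow> b \<in> V \<Longrightarrow> a \<oplus> b \<in> V" using subgroup.m_closed[OF s] by simp
  show "\<And>k a. k \<in> K \<Longrightarrow> a \<in> V \<Longrightarrow> k \<otimes> a \<in> V" using subalgebra.smult_closed[OF assms] .
  show "\<And>a. a \<in> V \<Longrightarrow> \<ominus> a \<in> V" using subgroup.m_inv_closed[OF s] by (simp add: a_inv_def)
qed

lemma ideal_subsp: "ideal I R \<Longrightarrow> subsp I"
  using ideal_is_subalgebra K_sub(1) by blast

lemma subsp_int: "subsp V \<Longrightarrow> subsp W \<Longrightarrow> subsp (V \<inter> W)"
  by (rule subalgebra_inter)

lemma fd_subsp: "fd V \<Longrightarrow> subsp V"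
  by (rule finite_dimension_imp_subalgebra[OF subfield])

lemma fd_dim: "fd V \<Longrightarrow> dimension (d V) K V"
  using finite_dimensionE[OF subfield] by (simp add: over_def)

lemma d_eq: "dimension n K V \<Longrightarrow> d V = n"
  using dimI[OF subfield] by (simp add: over_def)

lemma fd_base:
  assumes "fd V"
  shows "\<exists>Us. set Us \<subseteq> carrier R \<and> independent K Us \<and> length Us = d V \<and> Span K Us = V \<and> set Us \<subseteq> V"
  using exists_base[OF subfield fd_dim[OF assms]] Span_base_incl[OF subfield] by blast

lemma fd_mono: "fd E \<Longrightarrow> subsp V \<Longrightarrow> V \<subseteq> E \<Longrightarrow> fd V"
  using subalbegra_incl_imp_finite_dimension[OF subfield] by blast

lemma fd_int: "fd E \<Longrightarrow> subsp V \<Longrightarrow> fd (E \<inter> V)"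
  using fd_mono[of E "E \<inter> V"] fd_subsp subsp_int by auto

lemma d_mono:
  assumes "fd E" "subsp V" "V \<subseteq> E" shows "d V \<le> d E"
proof -
  obtain Us where "independent K Us" "length Us = d V" "set Us \<subseteq> V" using fd_base[OF fd_mono[OF assms]] by auto
  thus ?thesis using independent_length_le_dimension[OF subfield fd_dim[OF assms(1)]] assms(3) by (metis subset_trans)
qed

lemma d_eq_imp:
  assumes "fd E" "subsp V" "V \<subseteq> E" "d V = d E" shows "V = E"
proof -
  obtain Us where "independent K Us" "length Us = d V" "set Us \<subseteq> V" "Span K Us = V"
    using fd_base[OF fd_mono[OF assms(1-3)]] by auto
  thus ?thesis using independent_length_eq_dimension[OF subfield fd_dim[OF assms(1)]] assms(3,4) by (metis subset_trans)
qed

lemma zero_space: "fd {\<zero>}" "d {\<zero>} = 0"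
  using finite_dimensionI[OF zero_dim] d_eq[OF zero_dim] by auto

lemma sum_fd: "fd E \<Longrightarrow> fd F \<Longrightarrow> fd (E <+> F)"
  using sum_space_dim(1)[OF subfield] by blast

lemma d_sum:
  assumes "fd E" "fd F" shows "d (E <+> F) + d (E \<inter> F) = d E + d F"
proof -
  have "d (E \<inter> F) \<le> d E" using assms fd_subsp by (intro d_mono subsp_int) auto
  moreover have "d (E <+> F) = d E + d F - d (E \<inter> F)"
    using sum_space_dim(2)[OF subfield assms] by (simp add: over_def)
  ultimately show ?thesis by simp
qed

lemma set_add_mem: "x \<in> A <+> B \<longleftrightarrow> (\<exists>a\<in>A. \<exists>b\<in>B. x = a \<oplus> b)"
  unfolding set_add_def' by auto

lemma set_add_least: "subsp V \<Longrightarrow> A \<subseteq> V \<Longrightarrow> B \<subseteq> V \<Longrightarrow> A <+> B \<subseteq> V"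
  using subspD(3)[of V] by (auto simp: set_add_mem subset_iff)

lemma set_add_ge: "subsp A \<Longrightarrow> subsp B \<Longrightarrow> A \<subseteq> A <+> B \<and> B \<subseteq> A <+> B"
proof -
  assume *: "subsp A" "subsp B"
  have "a = a \<oplus> \<zero>" "a = \<zero> \<oplus> a" if "a \<in> A \<or> a \<in> B" for a using that subspD(1)[OF *(1)] subspD(1)[OF *(2)] by auto
  thus ?thesis using subspD(2)[OF *(1)] subspD(2)[OF *(2)] unfolding set_add_mem subset_iff by blast
qed

definition mul :: "'a \<Rightarrow> 'a set \<Rightarrow> 'a set" where "mul a V = (\<lambda>v. a \<otimes> v) ` V"

lemma mul_subsp:
  assumes "a \<in> carrier R" "subsp V" shows "subsp (mul a V)"
proof (rule subspI)
  note D = subspD[OF assms(2)]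
  show "mul a V \<subseteq> carrier R" unfolding mul_def using assms(1) D(1) by auto
  show "\<zero> \<in> mul a V" unfolding mul_def using D(2) assms(1) by (auto intro!: image_eqI[of _ _ \<zero>])
  show "x \<oplus> y \<in> mul a V" if xy: "x \<in> mul a V" "y \<in> mul a V" for x y
  proof -
    obtain v w where *: "v \<in> V" "w \<in> V" "x = a \<otimes> v" "y = a \<otimes> w" using xy unfolding mul_def by blast
    hence "x \<oplus> y = a \<otimes> (v \<oplus> w)" using assms(1) D(1) by (auto simp: r_distr subset_iff)
    thus ?thesis unfolding mul_def using * D(3) by blast
  qed
  show "k \<otimes> x \<in> mul a V" if k: "k \<in> K" and x: "x \<in> mul a V" for k x
  proof -
    obtain v where *: "v \<in> V" "x = a \<otimes> v" using x unfolding mul_def by auto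
    hence "k \<otimes> x = a \<otimes> (k \<otimes> v)" using assms(1) D(1) K_sub(4)[OF k] by (auto simp: m_lcomm subset_iff)
    thus ?thesis unfolding mul_def using * D(4)[OF k] by blast
  qed
qed

text \<open>Rank-nullity for the multiplication by a ring element.\<close>

lemma mul_rank:
  assumes a: "a \<in> carrier R" and V: "fd V"
  shows "fd (mul a V)" "d (mul a V) + d {v \<in> V. a \<otimes> v = \<zero>} = d V"
proof -
  let ?N = "{v \<in> V. a \<otimes> v = \<zero>}"
  note sV = fd_subsp[OF V] note D = subspD[OF sV]
  have Vc: "v \<in> carrier R" if "v \<in> V" for v using that D(1) by auto
  have sN: "subsp ?N"
  proof (rule subspI)
    show "?N \<subseteq> carrier R" using D(1) by auto
    show "\<zero> \<in> ?N" using D(2) a by auto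
    show "x \<oplus> y \<in> ?N" if "x \<in> ?N" "y \<in> ?N" for x y using that D(3) a Vc by (auto simp: r_distr)
    show "k \<otimes> x \<in> ?N" if "k \<in> K" "x \<in> ?N" for k x
      using that D(4) a Vc m_lcomm[OF a K_sub(4)[OF that(1)], of x] K_sub(4) by auto
  qed
  have fN: "fd ?N" by (rule fd_mono[OF V sN]) auto
  obtain Us where Us: "set Us \<subseteq> carrier R" "independent K Us" "length Us = d ?N" "Span K Us = ?N" "set Us \<subseteq> ?N"
    using fd_base[OF fN] by blast
  obtain Vs where Vs: "length (Vs @ Us) = d V" "independent K (Vs @ Us)" "Span K (Vs @ Us) = V"
    using complete_base[OF subfield fd_dim[OF V] Us(2)] Us(5) by blast
  have Vsc: "set Vs \<subseteq> carrier R" using independent_in_carrier[OF Vs(2)] by auto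
  note sp = independent_split[OF subfield Vs(2)]
  let ?h = "\<lambda>v. a \<otimes> v"
  have hc: "combine Ks (map ?h Ws) = a \<otimes> combine Ks Ws" if "set Ks \<subseteq> K" "set Ws \<subseteq> carrier R" for Ks Ws
    using that
  proof (induction Ks Ws rule: combine.induct)
    case (1 k Ks u Us)
    hence "k \<in> carrier R" "u \<in> carrier R" "combine Ks Us \<in> carrier R"
      using K_sub by (auto intro!: combine_in_carrier)
    thus ?case using 1 a by (simp add: r_distr m_lcomm)
  qed (use a in auto)
  have mc: "set (map ?h Vs) \<subseteq> carrier R" using Vsc a by auto
  have "Span K (map ?h Vs) = mul a V"
  proof
    show "Span K (map ?h Vs) \<subseteq> mul a V"
    proof (rule subalgebra_Span_incl[OF subfield mul_subsp[OF a sV]])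
      have "set Vs \<subseteq> V" using Span_base_incl[OF subfield, of "Vs @ Us"] Vs(3) Vsc Us(1) by auto
      thus "set (map ?h Vs) \<subseteq> mul a V" unfolding mul_def by auto
    qed
    show "mul a V \<subseteq> Span K (map ?h Vs)"
    proof
      fix y assume "y \<in> mul a V"
      then obtain v where v: "v \<in> V" "y = a \<otimes> v" unfolding mul_def by auto
      then obtain p q where pq: "p \<in> Span K Vs" "q \<in> Span K Us" "v = p \<oplus> q"
        using Vs(3) Span_append_eq_set_add[OF subfield Vsc Us(1)] by (auto simp: set_add_mem)
      have pc: "p \<in> carrier R" using pq(1) Span_in_carrier[OF K_sub(1) Vsc] by auto
      have q0: "a \<otimes> q = \<zero>" "q \<in> carrier R" using pq(2) Us(4) Vc by auto
      obtain Ks where Ks: "set Ks \<subseteq> K" "length Ks = length Vs" "p = combine Ks Vs"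
        using pq(1) Span_mem_iff_length_version[OF subfield Vsc] by auto
      have "y = a \<otimes> p" using v pq(3) q0 pc a by (simp add: r_distr)
      also have "\<dots> = combine Ks (map ?h Vs)" using hc[OF Ks(1) Vsc] Ks(3) by simp
      finally show "y \<in> Span K (map ?h Vs)"
        using Span_mem_iff_length_version[OF subfield mc] Ks by auto
    qed
  qed
  moreover have "independent K (map ?h Vs)"
  proof (rule trivial_combine_imp_independent[OF subfield mc])
    fix Ks assume Ks: "set Ks \<subseteq> K" "combine Ks (map ?h Vs) = \<zero>"
    let ?p = "combine Ks Vs"
    have "?p \<in> Span K Vs" using Span_eq_combine_set[OF subfield Vsc] Ks(1) by auto
    moreover have "a \<otimes> ?p = \<zero>" using hc[OF Ks(1) Vsc] Ks(2) by simp
    moreover have "?p \<in> V"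
      using mono_Span_append(1)[OF subfield Vsc Us(1)] Vs(3) calculation(1) by auto
    ultimately have "?p = \<zero>" using sp(3) Us(4) by blast
    thus "set (take (length (map ?h Vs)) Ks) \<subseteq> {\<zero>}"
      using independent_imp_trivial_combine[OF subfield sp(2) Ks(1)] by simp
  qed
  ultimately have dd: "dimension (length Vs) K (mul a V)"
    using dimension_independent[of K "map ?h Vs"] by simp
  show "fd (mul a V)" using finite_dimensionI[OF dd] .
  show "d (mul a V) + d ?N = d V" using d_eq[OF dd] Us(3) Vs(1) by simp
qed

lemma mul_fd: "a \<in> carrier R \<Longrightarrow> fd V \<Longrightarrow> fd (mul a V)" by (rule mul_rank)

text \<open>The dimension of the image of \<open>V\<close> modulo \<open>I\<close>.\<close>

definition dim_mod :: "'a set \<Rightarrow> 'a set \<Rightarrow> nat" where "dim_mod V I = d V - d (V \<inter> I)"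

lemma dim_mod_eq: "fd V \<Longrightarrow> subsp I \<Longrightarrow> dim_mod V I + d (V \<inter> I) = d V"
  unfolding dim_mod_def using d_mono[of V "V \<inter> I"] subsp_int[OF fd_subsp] by auto

lemma dim_mod_le: "dim_mod V I \<le> d V" unfolding dim_mod_def by simp

lemma dim_mod_antimono:
  assumes "fd V" "subsp I" "subsp J" "V \<inter> I \<subseteq> J" shows "dim_mod V J \<le> dim_mod V I"
proof -
  have "d (V \<inter> I) \<le> d (V \<inter> J)" using assms fd_subsp[OF assms(1)] by (intro d_mono fd_int subsp_int) auto
  thus ?thesis unfolding dim_mod_def by simp
qed

lemma dim_mod_sum:
  assumes "fd V" "fd W" "subsp I" shows "dim_mod (V <+> W) I \<le> dim_mod V I + dim_mod W I"
proof -
  have sV: "subsp V" "subsp W" using assms fd_subsp by auto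
  have fs: "fd (V <+> W)" using sum_fd assms by auto
  have f: "fd (V \<inter> I)" "fd (W \<inter> I)" "fd (V \<inter> W)" "fd (V \<inter> W \<inter> I)"
    using assms fd_int sV subsp_int by (auto simp: Int_assoc)
  have ii: "V \<inter> I \<inter> (W \<inter> I) = V \<inter> W \<inter> I" by auto
  have "(V \<inter> I) <+> (W \<inter> I) \<subseteq> (V <+> W) \<inter> I"
    using subspD(3)[OF assms(3)] unfolding subset_iff Int_iff set_add_mem by blast
  hence "d ((V \<inter> I) <+> (W \<inter> I)) \<le> d ((V <+> W) \<inter> I)"
    using f fs assms(3) by (intro d_mono fd_int) (auto intro: fd_subsp sum_fd)
  moreover have "d ((V \<inter> I) <+> (W \<inter> I)) + d (V \<inter> W \<inter> I) = d (V \<inter> I) + d (W \<inter> I)"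
    using d_sum[OF f(1,2)] ii by simp
  moreover have "d (V <+> W) + d (V \<inter> W) = d V + d W" using d_sum assms by auto
  moreover have "d (V \<inter> W \<inter> I) \<le> d (V \<inter> W)" using f by (intro d_mono) (auto intro: fd_subsp)
  ultimately show ?thesis using dim_mod_eq[OF fs assms(3)] dim_mod_eq[OF assms(1,3)] dim_mod_eq[OF assms(2,3)] by linarith
qed

lemma dim_mod_mono:
  assumes "fd W" "subsp V" "V \<subseteq> W" "subsp I" shows "dim_mod V I \<le> dim_mod W I"
proof -
  have fV: "fd V" using fd_mono assms by auto
  have fW: "fd (W \<inter> I)" using fd_int assms by auto
  have "d (V <+> (W \<inter> I)) + d (V \<inter> (W \<inter> I)) = d V + d (W \<inter> I)" using d_sum[OF fV fW] .
  moreover have "V \<inter> (W \<inter> I) = V \<inter> I" using assms by auto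
  moreover have "d (V <+> (W \<inter> I)) \<le> d W"
    using assms fV fW by (intro d_mono fd_subsp[OF sum_fd] set_add_least fd_subsp) auto
  ultimately show ?thesis using dim_mod_eq[OF fV assms(4)] dim_mod_eq[OF assms(1,4)] by simp
qed

lemma dim_mod_mul:
  assumes a: "a \<in> carrier R" and V: "fd V" and I: "ideal I R"
  shows "dim_mod (mul a V) I = dim_mod V (colon I a)"
proof -
  have sI: "subsp I" "subsp (colon I a)" using ideal_subsp I colon_ideal a by auto
  have Vc: "V \<subseteq> carrier R" using subspD(1)[OF fd_subsp[OF V]] .
  have e: "mul a V \<inter> I = mul a (V \<inter> colon I a)" unfolding mul_def colon_def using Vc by auto
  have n: "{v \<in> V. a \<otimes> v = \<zero>} = {v \<in> V \<inter> colon I a. a \<otimes> v = \<zero>}"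
    unfolding colon_def using Vc idealD(2)[OF I] by auto
  have f: "fd (V \<inter> colon I a)" using fd_int V sI by auto
  have "d (mul a V) + d {v \<in> V. a \<otimes> v = \<zero>} = d V" using mul_rank[OF a V] by auto
  moreover have "d (mul a V \<inter> I) + d {v \<in> V. a \<otimes> v = \<zero>} = d (V \<inter> colon I a)"
    using mul_rank(2)[OF a f] e n by simp
  ultimately show ?thesis using dim_mod_eq[OF V sI(2)] dim_mod_eq[OF mul_fd[OF a V] sI(1)] by linarith
qed

lemma dim_mod_mul_le:
  assumes a: "a \<in> carrier R" and V: "fd V" and I: "ideal I R"
  shows "dim_mod (mul a V) I \<le> dim_mod V I"
  unfolding dim_mod_mul[OF assms] using colon_incl[OF I a] V ideal_subsp I colon_ideal[OF I a]
  by (intro dim_mod_antimono) auto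

lemma dim_mod_quot:
  assumes V: "fd V" and I: "ideal I R" "\<one> \<notin> I"
  shows "ring.dim (R Quot I) ((+>) I ` K) ((+>) I ` V) = dim_mod V I"
proof -
  have z: "\<zero>\<^bsub>R Quot I\<^esub> = I" and o: "\<one>\<^bsub>R Quot I\<^esub> = I +> \<one>" by (simp_all add: FactRing_def)
  have e: "I +> v = I \<longleftrightarrow> v \<in> I" if "v \<in> V" for v
    using that subspD(1)[OF fd_subsp[OF V]] ideal.rcos_const_imp_mem[OF I(1)] a_rcos_zero[OF I(1)] by blast
  have ker: "a_kernel (R \<lparr> carrier := V \<rparr>) (R Quot I) ((+>) I) = V \<inter> I"
    unfolding a_kernel_def' z using e by auto
  have one: "\<one>\<^bsub>R Quot I\<^esub> \<noteq> \<zero>\<^bsub>R Quot I\<^esub>"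
    unfolding z o using ideal.rcos_const_imp_mem[OF I(1) one_closed] I(2) by blast
  interpret h: ring_hom_ring R "R Quot I" "(+>) I" using ideal.rcos_ring_hom_ring[OF I(1)] .
  have f: "fd (V \<inter> I)" using fd_int V ideal_subsp[OF I(1)] by auto
  have "h.S.dimension (d V - d (V \<inter> I)) ((+>) I ` K) ((+>) I ` V)"
    using h.rank_nullity_theorem[OF subfield one fd_dim[OF V], of "d (V \<inter> I)"] fd_dim[OF f] ker by simp
  moreover have "Subrings.subfield ((+>) I ` K) (R Quot I)"
    using h.img_is_subfield(2)[OF subfield one] .
  ultimately show ?thesis using h.S.dimI unfolding dim_mod_def over_def by blast
qed

end

section \<open>Finite differences of polynomials\<close>

text \<open>The backward difference with step \<open>t\<close>.\<close>

definition bdiff :: "nat \<Rightarrow> rat poly \<Rightarrow> rat poly" where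
  "bdiff t p = p - pcompose p [:- of_nat t, 1:]"

lemma poly_bdiff: "poly (bdiff t p) x = poly p x - poly p (x - of_nat t)"
  by (simp add: bdiff_def poly_pcompose)

lemma coeff_pcompose_shift:
  assumes "Polynomial.degree p \<le> n"
  shows "Polynomial.coeff (pcompose p [:c, 1::rat:]) n = Polynomial.coeff p n" "i > n \<Longrightarrow> Polynomial.coeff (pcompose p [:c, 1:]) i = 0"
proof -
  have d: "Polynomial.degree (pcompose p [:c, 1:]) = Polynomial.degree p" by (simp add: degree_pcompose)
  show "i > n \<Longrightarrow> Polynomial.coeff (pcompose p [:c, 1:]) i = 0" using d assms by (intro coeff_eq_0) simp
  show "Polynomial.coeff (pcompose p [:c, 1::rat:]) n = Polynomial.coeff p n"
  proof (cases "Polynomial.degree p = n")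
    case True
    have "lead_coeff (pcompose p [:c, 1:]) = lead_coeff p" by (subst lead_coeff_comp) auto
    thus ?thesis using True d by simp
  next
    case False
    thus ?thesis using assms d by (simp add: coeff_eq_0)
  qed
qed

lemma coeff_bdiff:
  "Polynomial.degree p \<le> n \<Longrightarrow> (\<forall>i\<ge>n. Polynomial.coeff (bdiff t p) i = 0) \<and> (n > 0 \<longrightarrow> Polynomial.coeff (bdiff t p) (n - 1) = of_nat (n * t) * Polynomial.coeff p n)"
proof (induction p arbitrary: n rule: pCons_induct)
  case 0
  thus ?case by (simp add: bdiff_def)
next
  case (pCons a p)
  let ?c = "pcompose p [:- of_nat t, 1:]"
  have e: "bdiff t (pCons a p) = pCons 0 (bdiff t p) + smult (of_nat t) ?c"
    by (simp add: bdiff_def pcompose_pCons algebra_simps)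
  show ?case
  proof (cases "p = 0")
    case True
    thus ?thesis by (simp add: bdiff_def pcompose_pCons coeff_pCons split: nat.splits)
  next
    case False
    hence n: "Polynomial.degree p \<le> n - 1" "n > 0" using pCons.prems by auto
    have ih: "\<forall>i\<ge>n - 1. Polynomial.coeff (bdiff t p) i = 0" "n - 1 > 0 \<Longrightarrow> Polynomial.coeff (bdiff t p) (n - 1 - 1) = of_nat ((n - 1) * t) * Polynomial.coeff p (n - 1)"
      using pCons.IH[OF n(1)] by auto
    have c: "Polynomial.coeff ?c (n - 1) = Polynomial.coeff p (n - 1)" "\<And>i. i \<ge> n \<Longrightarrow> Polynomial.coeff ?c i = 0"
      using coeff_pcompose_shift[OF n(1)] n(2) by auto
    have "Polynomial.coeff (bdiff t (pCons a p)) i = 0" if "i \<ge> n" for i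
      using that n(2) ih(1) c(2)[OF that] unfolding e by (cases i) auto
    moreover have "Polynomial.coeff (bdiff t (pCons a p)) (n - 1) = of_nat (n * t) * Polynomial.coeff (pCons a p) n"
    proof (cases "n - 1")
      case 0
      hence "n = 1" using n(2) by simp
      thus ?thesis using c(1) unfolding e by simp
    next
      case (Suc k)
      hence "n = Suc (Suc k)" by simp
      thus ?thesis using ih(2) c(1) unfolding e by (simp add: algebra_simps)
    qed
    ultimately show ?thesis by simp
  qed
qed

text \<open>Every polynomial has an indefinite sum: by induction on the degree, as the difference lowers the degree by exactly one.\<close>

lemma bdiff_surj: "\<exists>p. bdiff 1 p = q"
proof (induction "if q = 0 then 0 else Suc (Polynomial.degree q)" arbitrary: q rule: less_induct)
  case less
  show ?case
  proof (cases "q = 0")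
    case True
    thus ?thesis by (intro exI[of _ 0]) (simp add: bdiff_def)
  next
    case False
    define D where "D = Polynomial.degree q"
    define r where "r = Polynomial.monom (lead_coeff q / of_nat (Suc D)) (Suc D)"
    have dr: "Polynomial.degree r \<le> Suc D" unfolding r_def by (rule degree_monom_le)
    have c: "Polynomial.coeff (q - bdiff 1 r) i = 0" if "i \<ge> D" for i
    proof (cases "i = D")
      case True
      have "Polynomial.coeff (bdiff 1 r) D = lead_coeff q"
        using coeff_bdiff[OF dr, of 1] by (simp add: r_def del: of_nat_Suc)
      thus ?thesis using True by (simp add: D_def)
    next
      case False
      hence "i > D" using that by simp
      thus ?thesis using coeff_bdiff[OF dr, of 1] coeff_eq_0[of q i] by (simp add: D_def)
    qed
    have "\<exists>p. bdiff 1 p = q - bdiff 1 r"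
    proof (cases "q - bdiff 1 r = 0")
      case True
      thus ?thesis by (intro exI[of _ 0]) (simp add: bdiff_def)
    next
      case F: False
      have "Polynomial.degree (q - bdiff 1 r) < D" using c F by (metis leading_coeff_neq_0 not_le)
      thus ?thesis using less[of "q - bdiff 1 r"] False F by (simp add: D_def)
    qed
    then obtain p where "bdiff 1 p = q - bdiff 1 r" by auto
    moreover have "bdiff 1 (p + r) = bdiff 1 p + bdiff 1 r" by (simp add: bdiff_def pcompose_add)
    ultimately have "bdiff 1 (p + r) = q" by simp
    thus ?thesis by auto
  qed
qed

lemma poly_eventually_pos:
  fixes p :: "rat poly"
  assumes "lead_coeff p > 0"
  shows "\<exists>c>0. \<forall>\<^sub>F j in sequentially. poly p (of_nat j) \<ge> c"
  using assms
proof (induction p rule: pCons_induct)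
  case (pCons a q)
  show ?case
  proof (cases "q = 0")
    case True
    thus ?thesis using pCons.prems by (intro exI[of _ a]) auto
  next
    case False
    then obtain c where c: "c > 0" "\<forall>\<^sub>F j in sequentially. poly q (of_nat j) \<ge> c" using pCons by auto
    obtain M where "(1 - a) / c < of_nat M" using reals_Archimedean2 by blast
    hence M: "of_nat M \<ge> (1 - a) / c" by simp
    have "\<forall>\<^sub>F j in sequentially. poly (pCons a q) (of_nat j) \<ge> 1"
      using c(2) eventually_ge_at_top[of M]
    proof eventually_elim
      case (elim j)
      have "(1 - a) / c \<le> of_nat j" using M elim(2) by (meson of_nat_le_iff order_trans)
      hence "1 - a \<le> of_nat j * c" using c(1) by (simp add: divide_le_eq)
      also have "\<dots> \<le> of_nat j * poly q (of_nat j)" using elim(1) by (intro mult_left_mono) auto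
      finally show ?case by simp
    qed
    thus ?thesis by (intro exI[of _ 1]) auto
  qed
qed simp

lemma poly_eventually_le:
  fixes p q :: "rat poly"
  assumes "\<forall>\<^sub>F j in sequentially. poly p (of_nat j) \<le> poly q (of_nat j)" "\<And>i. i > D \<Longrightarrow> Polynomial.coeff p i = Polynomial.coeff q i"
  shows "Polynomial.coeff p D \<le> Polynomial.coeff q D"
proof (rule ccontr)
  assume "\<not> ?thesis"
  hence *: "Polynomial.coeff (p - q) D > 0" by simp
  have "Polynomial.degree (p - q) \<le> D" using assms(2) by (intro degree_le) auto
  hence "Polynomial.degree (p - q) = D" using * le_degree[of "p - q" D] by simp
  then obtain c where c: "c > 0" "\<forall>\<^sub>F j in sequentially. poly (p - q) (of_nat j) \<ge> c"
    using poly_eventually_pos[of "p - q"] * by auto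
  have "\<forall>\<^sub>F j::nat in sequentially. False"
    using c(2) assms(1) by eventually_elim (use c(1) in auto)
  thus False by simp
qed

lemma poly_eventually_eq:
  fixes p q :: "rat poly"
  assumes "\<forall>\<^sub>F j in sequentially. poly p (of_nat j) = poly q (of_nat j)"
  shows "p = q"
proof (rule ccontr)
  assume "p \<noteq> q"
  hence fin: "finite {x. poly (p - q) x = 0}" by (intro poly_roots_finite) simp
  obtain N where "\<And>j. j \<ge> N \<Longrightarrow> poly p (of_nat j) = poly q (of_nat j)"
    using assms by (auto simp: eventually_sequentially)
  hence "of_nat ` {N..} \<subseteq> {x. poly (p - q) x = 0}" by auto
  hence "finite (of_nat ` {N..} :: rat set)" using fin finite_subset by blast
  hence "finite {N..}" by (rule finite_imageD) (auto simp: inj_on_def)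
  thus False by (simp add: infinite_Ici)
qed

section \<open>Standard graded algebras\<close>

context comm_algebra
begin

text \<open>The subalgebra generated by \<open>Y\<close>, presented so that induction multiplies by one generator at a time.\<close>

inductive_set alg :: "'a set \<Rightarrow> 'a set" for Y :: "'a set" where
  const: "k \<in> K \<Longrightarrow> k \<in> alg Y"
| gen: "y \<in> Y \<Longrightarrow> s \<in> alg Y \<Longrightarrow> y \<otimes> s \<in> alg Y"
| add: "s \<in> alg Y \<Longrightarrow> t \<in> alg Y \<Longrightarrow> s \<oplus> t \<in> alg Y"

lemma alg_carrier: "Y \<subseteq> carrier R \<Longrightarrow> alg Y \<subseteq> carrier R"
proof
  fix x assume "Y \<subseteq> carrier R" "x \<in> alg Y"
  thus "x \<in> carrier R" by (induction rule: alg.induct[OF \<open>x \<in> alg Y\<close>]) (use K_sub in auto)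
qed

lemma alg_smult:
  assumes Y: "Y \<subseteq> carrier R" and k: "k \<in> K" and t: "t \<in> alg Y" shows "k \<otimes> t \<in> alg Y"
  using t
proof (induction rule: alg.induct)
  case (const k')
  thus ?case using k subringE(6)[OF subfieldE(1)[OF subfield]] alg.const by auto
next
  case (gen y s)
  have "k \<otimes> (y \<otimes> s) = y \<otimes> (k \<otimes> s)"
    using gen K_sub(4)[OF k] Y alg_carrier[OF Y] by (intro m_lcomm) auto
  thus ?case using alg.gen gen by auto
next
  case (add s t)
  have "k \<otimes> (s \<oplus> t) = k \<otimes> s \<oplus> k \<otimes> t"
    using add K_sub(4)[OF k] alg_carrier[OF Y] by (intro r_distr) auto
  thus ?case using alg.add add by auto
qed

lemma alg_mult:
  assumes Y: "Y \<subseteq> carrier R" and s: "s \<in> alg Y" and t: "t \<in> alg Y" shows "s \<otimes> t \<in> alg Y"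
  using s
proof (induction rule: alg.induct)
  case (const k)
  thus ?case using alg_smult[OF Y _ t] by auto
next
  case (gen y s)
  have "(y \<otimes> s) \<otimes> t = y \<otimes> (s \<otimes> t)" using gen Y t alg_carrier[OF Y] by (intro m_assoc) auto
  thus ?case using alg.gen gen by auto
next
  case (add s s')
  have "(s \<oplus> s') \<otimes> t = s \<otimes> t \<oplus> s' \<otimes> t" using add t alg_carrier[OF Y] by (intro l_distr) auto
  thus ?case using alg.add add by auto
qed

lemma alg_subsp: "Y \<subseteq> carrier R \<Longrightarrow> subsp (alg Y)"
  by (intro subspI) (auto simp: alg_smult alg.add alg.const K_sub intro: subsetD[OF alg_carrier])

lemma alg_subring: "Y \<subseteq> carrier R \<Longrightarrow> subring (alg Y) R"
proof (rule subringI)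
  assume Y: "Y \<subseteq> carrier R"
  show "alg Y \<subseteq> carrier R" using alg_carrier[OF Y] .
  show "\<one> \<in> alg Y" using alg.const K_sub by auto
  show "\<ominus> h \<in> alg Y" if "h \<in> alg Y" for h using subspD(5)[OF alg_subsp[OF Y]] that .
  show "a \<otimes> b \<in> alg Y" if "a \<in> alg Y" "b \<in> alg Y" for a b using alg_mult[OF Y] that .
  show "a \<oplus> b \<in> alg Y" if "a \<in> alg Y" "b \<in> alg Y" for a b using alg.add that .
qed

lemma alg_mono: "Y \<subseteq> Z \<Longrightarrow> alg Y \<subseteq> alg Z"
proof
  fix x assume "Y \<subseteq> Z" "x \<in> alg Y"
  thus "x \<in> alg Z" by (induction rule: alg.induct[OF \<open>x \<in> alg Y\<close>]) (auto intro: alg.intros)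
qed

lemma alg_self: "Y \<subseteq> carrier R \<Longrightarrow> Y \<subseteq> alg Y"
proof
  fix y assume "Y \<subseteq> carrier R" "y \<in> Y"
  thus "y \<in> alg Y" using alg.gen[OF _ alg.const[OF K_sub(2)], of y Y] by auto
qed

lemma alg_acc: "finite Y \<Longrightarrow> Y \<subseteq> carrier R \<Longrightarrow> acc (alg Y)"
proof (induction Y rule: finite_induct)
  case empty
  have "x \<in> K" if "x \<in> alg {}" for x
    using that by (induction rule: alg.induct) (auto intro: subringE(7)[OF subfieldE(1)[OF subfield]])
  hence "alg {} = K" using alg.const by blast
  thus ?case using acc_subfield[OF subfield] by simp
next
  case (insert y Y)
  have Y: "Y \<subseteq> carrier R" "y \<in> carrier R" "insert y Y \<subseteq> carrier R" using insert.prems by auto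
  note ps = poly_span_props[OF alg_subring[OF Y(1)] Y(2)]
  have ps_mono: "poly_span (alg Y) y n \<subseteq> poly_span (alg Y) y m" if "n \<le> m" for n m
    using that ps(6) by (rule lift_Suc_mono_le[rotated])
  have one: "s \<in> poly_span (alg Y) y (Suc 0)" if "s \<in> alg Y" for s
    using that alg_carrier[OF Y(1)] by (auto intro!: exI[of _ s])
  have gen: "\<exists>n. t \<in> poly_span (alg Y) y n" if "t \<in> alg (insert y Y)" for t
    using that
  proof (induction rule: alg.induct)
    case (const k)
    thus ?case using one alg.const by blast
  next
    case (gen y' s)
    then obtain n where n: "s \<in> poly_span (alg Y) y n" by auto
    show ?case
    proof (cases "y' = y")
      case True
      thus ?thesis using ps(5)[OF n] by blast
    next
      case False
      hence "y' \<in> alg Y" using gen alg_self[OF Y(1)] by auto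
      thus ?thesis using ps(4)[OF _ n] by blast
    qed
  next
    case (add s t)
    then obtain n m where "s \<in> poly_span (alg Y) y n" "t \<in> poly_span (alg Y) y m" by auto
    hence "s \<in> poly_span (alg Y) y (max n m)" "t \<in> poly_span (alg Y) y (max n m)" using ps_mono by (meson max.cobounded1 max.cobounded2 subsetD)+
    thus ?case using ps(3) by blast
  qed
  show ?case
    using hilbert_basis[OF alg_subring[OF Y(1)] alg_subring[OF Y(3)] _ alg_mono gen insert.IH[OF Y(1)]]
      alg_self[OF Y(3)] by auto
qed

end

text \<open>An algebra over the field \<open>G 0\<close>, graded by the \<open>G j\<close> with projections \<open>pr j\<close>, and generated by finitely many
  elements \<open>Xs\<close> of degree one.\<close>

locale std_graded = comm_algebra R "G 0" for R (structure) and G :: "nat \<Rightarrow> 'a set" +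
  fixes pr :: "nat \<Rightarrow> 'a \<Rightarrow> 'a" and Xs :: "'a list"
  assumes G_sub: "G j \<subseteq> carrier R"
    and pr_in: "a \<in> carrier R \<Longrightarrow> pr j a \<in> G j"
    and pr_add: "a \<in> carrier R \<Longrightarrow> b \<in> carrier R \<Longrightarrow> pr j (a \<oplus> b) = pr j a \<oplus> pr j b"
    and pr_same: "a \<in> G j \<Longrightarrow> pr j a = a"
    and pr_other: "a \<in> G i \<Longrightarrow> i \<noteq> j \<Longrightarrow> pr j a = \<zero>"
    and pr_sum: "a \<in> carrier R \<Longrightarrow> \<exists>N. a = (\<Oplus>j\<in>{..<N::nat}. pr j a)"
    and G_mult: "a \<in> G i \<Longrightarrow> b \<in> G j \<Longrightarrow> a \<otimes> b \<in> G (i + j)"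
    and X_deg: "set Xs \<subseteq> G 1"
    and gen: "a \<in> G (Suc j) \<Longrightarrow> \<exists>gs. set gs \<subseteq> G j \<and> a = combine gs Xs"
begin

lemma G_carr: "a \<in> G j \<Longrightarrow> a \<in> carrier R" using G_sub by auto

lemma pr_carr: "a \<in> carrier R \<Longrightarrow> pr j a \<in> carrier R" using pr_in G_sub by blast

lemma G_zero: "\<zero> \<in> G j" and pr_zero: "pr j \<zero> = \<zero>"
proof -
  have "pr j \<zero> \<oplus> pr j \<zero> = pr j \<zero> \<oplus> \<zero>" using pr_add[of \<zero> \<zero> j] pr_carr[of \<zero> j] by simp
  thus "pr j \<zero> = \<zero>" using pr_carr[of \<zero> j] by (metis add.l_cancel zero_closed)
  thus "\<zero> \<in> G j" using pr_in[of \<zero> j] by simp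
qed

lemma G_add: "a \<in> G j \<Longrightarrow> b \<in> G j \<Longrightarrow> a \<oplus> b \<in> G j"
  using pr_in[of "a \<oplus> b" j] pr_add[of a b j] pr_same[of a j] pr_same[of b j] G_carr by simp

lemma G_subsp: "subsp (G j)"
proof (rule subspI)
  show "k \<otimes> a \<in> G j" if "k \<in> G 0" "a \<in> G j" for k a using G_mult[OF that] by simp
qed (use G_sub G_zero G_add in auto)

lemma one_G: "\<one> \<in> G 0" using K_sub by simp

lemma pr_minus: "a \<in> carrier R \<Longrightarrow> pr j (\<ominus> a) = \<ominus> pr j a"
proof -
  assume a: "a \<in> carrier R"
  have "pr j (\<ominus> a) \<oplus> pr j a = \<zero>" using pr_add[of "\<ominus> a" a j] a pr_zero by (simp add: l_neg)
  thus ?thesis using minus_equality[of "pr j (\<ominus> a)" "pr j a"] a pr_carr by simp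
qed

lemma pr_finsum:
  assumes "finite S" "f \<in> S \<rightarrow> carrier R"
  shows "pr j (\<Oplus>i\<in>S. f i) = (\<Oplus>i\<in>S. pr j (f i))"
  using assms
proof (induction S rule: finite_induct)
  case empty
  thus ?case using pr_zero by simp
next
  case (insert i S)
  have "(\<lambda>i. pr j (f i)) \<in> S \<rightarrow> carrier R" using insert.prems pr_carr by auto
  thus ?case using insert pr_add pr_carr finsum_closed[of f S] by (simp add: Pi_iff)
qed

lemma pr_bound: "a \<in> carrier R \<Longrightarrow> \<exists>N. \<forall>j>N. pr j a = \<zero>"
proof -
  assume a: "a \<in> carrier R"
  then obtain N where N: "a = (\<Oplus>j\<in>{..<N::nat}. pr j a)" using pr_sum by blast
  have "pr j a = \<zero>" if "j > N" for j
  proof -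
    have "pr j a = (\<Oplus>i\<in>{..<N}. pr j (pr i a))" by (subst N, rule pr_finsum) (use pr_carr a in auto)
    also have "\<dots> = (\<Oplus>i\<in>{..<N}. \<zero>)" using that pr_other[OF pr_in[OF a]] by (intro finsum_cong') auto
    finally show ?thesis by simp
  qed
  thus ?thesis by blast
qed

text \<open>The elements of degree at most \<open>N\<close>.\<close>

definition Fil :: "nat \<Rightarrow> 'a set" where "Fil N = {a \<in> carrier R. \<forall>j>N. pr j a = \<zero>}"

lemma Fil_ex: "a \<in> carrier R \<Longrightarrow> \<exists>N. a \<in> Fil N" unfolding Fil_def using pr_bound by auto

lemma Fil_carr: "a \<in> Fil N \<Longrightarrow> a \<in> carrier R" unfolding Fil_def by auto

lemma Fil_mono: "N \<le> M \<Longrightarrow> Fil N \<subseteq> Fil M" unfolding Fil_def by auto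

lemma Fil_add: "a \<in> Fil N \<Longrightarrow> b \<in> Fil N \<Longrightarrow> a \<oplus> b \<in> Fil N"
  unfolding Fil_def using pr_add by auto

lemma Fil_sum: assumes "a \<in> Fil N" shows "a = (\<Oplus>j\<in>{..N}. pr j a)"
proof -
  have a: "a \<in> carrier R" using assms Fil_carr by auto
  then obtain M where M: "a = (\<Oplus>j\<in>{..<M::nat}. pr j a)" using pr_sum by blast
  let ?f = "\<lambda>j. pr j a"
  have c: "?f \<in> S \<rightarrow> carrier R" for S using pr_carr a by auto
  have zN: "pr j a = \<zero>" if "j > N" for j using assms that unfolding Fil_def by auto
  have zM: "pr j a = \<zero>" if "j \<ge> M" for j
  proof -
    have "pr j a = (\<Oplus>i\<in>{..<M}. pr j (pr i a))" by (subst M, rule pr_finsum) (use pr_carr a in auto)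
    also have "\<dots> = (\<Oplus>i\<in>{..<M}. \<zero>)" using that pr_other[OF pr_in[OF a]] by (intro finsum_cong') auto
    finally show ?thesis by simp
  qed
  have "(\<Oplus>j\<in>{..<M}. ?f j) = (\<Oplus>j\<in>{..<M} \<union> {..N}. ?f j)"
    by (rule add.finprod_mono_neutral_cong_left) (use zM c in auto)
  moreover have "(\<Oplus>j\<in>{..N}. ?f j) = (\<Oplus>j\<in>{..<M} \<union> {..N}. ?f j)"
    by (rule add.finprod_mono_neutral_cong_left) (use zN c in auto)
  ultimately show ?thesis using M by simp
qed

lemma G_Fil: "G j \<subseteq> Fil j" unfolding Fil_def using pr_other G_carr by auto

lemma pr_mult_homogeneous:
  assumes a: "a \<in> carrier R" and b: "b \<in> G t"
  shows "pr j (a \<otimes> b) = (if t \<le> j then pr (j - t) a \<otimes> b else \<zero>)"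
proof -
  obtain N where N: "a \<in> Fil N" using Fil_ex[OF a] by auto
  hence N': "a \<in> Fil (max N j)" using Fil_mono[of N "max N j"] by auto
  have bc: "b \<in> carrier R" using b G_carr by auto
  let ?S = "{..max N j}"
  have c: "(\<lambda>i. pr i a \<otimes> b) \<in> ?S \<rightarrow> carrier R" using pr_carr a bc by auto
  have "a \<otimes> b = (\<Oplus>i\<in>?S. pr i a) \<otimes> b" using Fil_sum[OF N'] by simp
  also have "\<dots> = (\<Oplus>i\<in>?S. pr i a \<otimes> b)" using pr_carr a bc by (intro finsum_ldistr) auto
  finally have "pr j (a \<otimes> b) = (\<Oplus>i\<in>?S. pr j (pr i a \<otimes> b))" using pr_finsum[OF _ c] by simp
  also have "\<dots> = (\<Oplus>i\<in>?S. if t \<le> j \<and> i = j - t then pr i a \<otimes> b else \<zero>)"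
  proof (rule finsum_cong')
    fix i assume "i \<in> ?S"
    have m: "pr i a \<otimes> b \<in> G (i + t)" using G_mult[OF pr_in[OF a] b] .
    show "pr j (pr i a \<otimes> b) = (if t \<le> j \<and> i = j - t then pr i a \<otimes> b else \<zero>)"
    proof (cases "i + t = j")
      case True
      thus ?thesis using pr_same[OF m] by auto
    next
      case False
      thus ?thesis using pr_other[OF m] by auto
    qed
  qed (use pr_carr a bc in auto)
  also have "\<dots> = (if t \<le> j then pr (j - t) a \<otimes> b else \<zero>)"
  proof (cases "t \<le> j")
    case True
    have "(\<Oplus>i\<in>?S. if t \<le> j \<and> i = j - t then pr i a \<otimes> b else \<zero>)
      = (\<Oplus>i\<in>?S. if j - t = i then pr i a \<otimes> b else \<zero>)"
      using True pr_carr a bc by (intro finsum_cong') auto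
    also have "\<dots> = pr (j - t) a \<otimes> b" using pr_carr a bc by (intro finsum_singleton) auto
    finally show ?thesis using True by simp
  next
    case False
    thus ?thesis by simp
  qed
  finally show ?thesis .
qed

lemma Fil_mult:
  assumes "a \<in> Fil N" "b \<in> Fil M"
  shows "a \<otimes> b \<in> Fil (N + M)" "pr (N + M) (a \<otimes> b) = pr N a \<otimes> pr M b"
proof -
  have c: "a \<in> carrier R" "b \<in> carrier R" using assms Fil_carr by auto
  have pc: "(\<lambda>i. a \<otimes> pr i b) \<in> S \<rightarrow> carrier R" for S using c pr_carr by auto
  have "a \<otimes> b = a \<otimes> (\<Oplus>i\<in>{..M}. pr i b)" using Fil_sum[OF assms(2)] by simp
  also have "\<dots> = (\<Oplus>i\<in>{..M}. a \<otimes> pr i b)" using c pr_carr by (intro finsum_rdistr) auto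
  finally have e: "pr j (a \<otimes> b) = (\<Oplus>i\<in>{..M}. pr j (a \<otimes> pr i b))" for j using pr_finsum[OF _ pc] by simp
  have z: "pr j (a \<otimes> pr i b) = \<zero>" if "i \<le> M" "j > N + M \<or> (j = N + M \<and> i \<noteq> M)" for i j
  proof -
    have "pr (j - i) a = \<zero>" using that assms(1) unfolding Fil_def by auto
    thus ?thesis using pr_mult_homogeneous[OF c(1) pr_in[OF c(2), of i], of j] pr_carr[OF c(2)] by auto
  qed
  have "pr j (a \<otimes> b) = \<zero>" if "j > N + M" for j
  proof -
    have "pr j (a \<otimes> b) = (\<Oplus>i\<in>{..M}. \<zero>)" unfolding e using z that by (intro finsum_cong') auto
    thus ?thesis by simp
  qed
  thus "a \<otimes> b \<in> Fil (N + M)" using c unfolding Fil_def by auto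
  have "pr (N + M) (a \<otimes> b) = (\<Oplus>i\<in>{..M}. if M = i then pr (N + M - i) a \<otimes> pr i b else \<zero>)"
    unfolding e
  proof (rule finsum_cong')
    fix i assume i: "i \<in> {..M}"
    show "pr (N + M) (a \<otimes> pr i b) = (if M = i then pr (N + M - i) a \<otimes> pr i b else \<zero>)"
      using i z[of i "N + M"] pr_mult_homogeneous[OF c(1) pr_in[OF c(2), of i], of "N + M"] by auto
  qed (use c pr_carr in auto)
  also have "\<dots> = pr (N + M - M) a \<otimes> pr M b" using c pr_carr by (intro finsum_singleton) auto
  finally show "pr (N + M) (a \<otimes> b) = pr N a \<otimes> pr M b" by simp
qed

subsection \<open>Homogeneous ideals\<close>

definition Homogs :: "'a set" where "Homogs = (\<Union>j. G j)"

definition homogeneous :: "'a set \<Rightarrow> bool" where "homogeneous I \<longleftrightarrow> ideal I R \<and> (\<forall>a\<in>I. \<forall>j. pr j a \<in> I)"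

definition gprime :: "'a set \<Rightarrow> bool" where
  "gprime P \<longleftrightarrow> homogeneous P \<and> \<one> \<notin> P \<and> (\<forall>a\<in>Homogs. \<forall>b\<in>Homogs. a \<otimes> b \<in> P \<longrightarrow> a \<in> P \<or> b \<in> P)"

lemma Homogs_props: "Homogs \<subseteq> carrier R" "\<one> \<in> Homogs" "\<And>a b. a \<in> Homogs \<Longrightarrow> b \<in> Homogs \<Longrightarrow> a \<otimes> b \<in> Homogs" "\<And>a j. a \<in> G j \<Longrightarrow> a \<in> Homogs"
proof -
  show "Homogs \<subseteq> carrier R" using G_sub unfolding Homogs_def by (rule UN_least)
  show "\<one> \<in> Homogs" using one_G unfolding Homogs_def by (rule UN_I[OF UNIV_I])
  show "a \<otimes> b \<in> Homogs" if ab: "a \<in> Homogs" "b \<in> Homogs" for a b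
  proof -
    obtain i j where "a \<in> G i" "b \<in> G j" using ab unfolding Homogs_def by auto
    thus ?thesis using G_mult unfolding Homogs_def by (intro UN_I[OF UNIV_I])
  qed
  show "a \<in> Homogs" if "a \<in> G j" for a j using that unfolding Homogs_def by (rule UN_I[OF UNIV_I])
qed

lemma homD: "homogeneous I \<Longrightarrow> ideal I R" "homogeneous I \<Longrightarrow> a \<in> I \<Longrightarrow> pr j a \<in> I"
  unfolding homogeneous_def by auto

lemma gprimeD: "gprime P \<Longrightarrow> homogeneous P" "gprime P \<Longrightarrow> ideal P R" "gprime P \<Longrightarrow> \<one> \<notin> P"
  "gprime P \<Longrightarrow> a \<in> Homogs \<Longrightarrow> b \<in> Homogs \<Longrightarrow> a \<otimes> b \<in> P \<Longrightarrow> a \<in> P \<or> b \<in> P"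
  unfolding gprime_def homogeneous_def by blast+

lemma mem_by_pr:
  assumes "ideal J R" "a \<in> carrier R" "\<And>j. pr j a \<in> J" shows "a \<in> J"
proof -
  have sum_in: "finite S \<Longrightarrow> (\<Oplus>j\<in>S. pr j a) \<in> J" for S
  proof (induction S rule: finite_induct)
    case empty
    thus ?case using idealD(2)[OF assms(1)] by simp
  next
    case (insert j S)
    thus ?case using idealD(3)[OF assms(1)] assms(2,3) pr_carr by (simp add: Pi_iff)
  qed
  obtain N where "a = (\<Oplus>j\<in>{..<N::nat}. pr j a)" using pr_sum[OF assms(2)] by blast
  thus ?thesis using sum_in[of "{..<N}"] by simp
qed

lemma homogeneous_subsetI:
  assumes "homogeneous I" "ideal J R" "\<And>j a. a \<in> I \<Longrightarrow> a \<in> G j \<Longrightarrow> a \<in> J" shows "I \<subseteq> J"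
proof
  fix a assume a: "a \<in> I"
  have ac: "a \<in> carrier R" using a idealD(1)[OF homD(1)[OF assms(1)]] by auto
  show "a \<in> J" using mem_by_pr[OF assms(2) ac] assms(3)[OF homD(2)[OF assms(1) a] pr_in[OF ac]] .
qed

lemma homogeneous_witness:
  assumes "homogeneous I" "ideal J R" "\<not> I \<subseteq> J" shows "\<exists>a\<in>Homogs. a \<in> I \<and> a \<notin> J"
  using homogeneous_subsetI[OF assms(1,2)] assms(3) Homogs_props(4) by blast

lemma homogeneous_adjoin: assumes "homogeneous I" "a \<in> G t" shows "homogeneous (adjoin I a)"
  unfolding homogeneous_def
proof (intro conjI ballI allI)
  have ac: "a \<in> carrier R" using assms G_carr by auto
  show "ideal (adjoin I a) R" using adjoin_ideal homD assms ac by auto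
  fix x j assume "x \<in> adjoin I a"
  then obtain i r where *: "i \<in> I" "r \<in> carrier R" "x = i \<oplus> r \<otimes> a" unfolding adjoin_iff by auto
  have ic: "i \<in> carrier R" using * idealD(1)[OF homD(1)[OF assms(1)]] by auto
  have "pr j x = pr j i \<oplus> (if t \<le> j then pr (j - t) r else \<zero>) \<otimes> a"
    using * ic ac pr_mult_homogeneous[OF *(2) assms(2)] by (simp add: pr_add)
  thus "pr j x \<in> adjoin I a" unfolding adjoin_iff
    using homD(2)[OF assms(1) *(1)] pr_carr[OF *(2)] by (metis zero_closed)
qed

lemma homogeneous_colon: assumes "homogeneous I" "a \<in> G t" shows "homogeneous (colon I a)"
  unfolding homogeneous_def
proof (intro conjI ballI allI)
  have ac: "a \<in> carrier R" using assms G_carr by auto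
  show "ideal (colon I a) R" using colon_ideal homD assms ac by auto
  fix x j assume "x \<in> colon I a"
  hence x: "x \<in> carrier R" "a \<otimes> x \<in> I" unfolding colon_def by auto
  have "pr (j + t) (x \<otimes> a) = pr j x \<otimes> a" using pr_mult_homogeneous[OF x(1) assms(2)] by simp
  hence "pr j x \<otimes> a \<in> I" using homD(2)[OF assms(1) x(2), of "j + t"] m_comm[OF ac x(1)] by simp
  thus "pr j x \<in> colon I a" unfolding colon_def using pr_carr x ac m_comm by simp
qed

lemma homogeneous_Inter: assumes "\<Q> \<noteq> {}" "\<And>Q. Q \<in> \<Q> \<Longrightarrow> homogeneous Q" shows "homogeneous (\<Inter>\<Q>)"
  unfolding homogeneous_def using assms homD by (auto intro!: i_Intersect)

lemma homogeneous_Int: "homogeneous I \<Longrightarrow> homogeneous J \<Longrightarrow> homogeneous (I \<inter> J)"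
  using homogeneous_Inter[of "{I, J}"] by auto

lemma gprime_colon: assumes "gprime P" "a \<in> G t" "a \<notin> P" shows "colon P a = P"
proof
  have ac: "a \<in> carrier R" using assms G_carr by auto
  show "P \<subseteq> colon P a" using colon_incl gprimeD ac assms by auto
  show "colon P a \<subseteq> P"
  proof (rule homogeneous_subsetI[OF homogeneous_colon[OF gprimeD(1)[OF assms(1)] assms(2)] gprimeD(2)[OF assms(1)]])
    fix j b assume "b \<in> colon P a" "b \<in> G j"
    thus "b \<in> P" using gprimeD(4)[OF assms(1), of a b] Homogs_props(4) assms unfolding colon_def by auto
  qed
qed

text \<open>If the top component of one factor lies in \<open>P\<close>, it can be subtracted; otherwise the product of the top
  components is the top component of the product and lies outside \<open>P\<close>.\<close>

lemma homogeneous_prime: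
  assumes "homogeneous P" "\<one> \<notin> P" "\<And>a b. a \<in> Homogs \<Longrightarrow> b \<in> Homogs \<Longrightarrow> a \<otimes> b \<in> P \<Longrightarrow> a \<in> P \<or> b \<in> P"
  shows "primeideal P R"
proof (rule primeidealI[OF homD(1)[OF assms(1)] is_cring])
  show "carrier R \<noteq> P" using assms(2) by auto
  note D = idealD[OF homD(1)[OF assms(1)]]
  have main: "a \<in> P \<or> b \<in> P" if "a \<in> Fil N" "b \<in> Fil M" "a \<otimes> b \<in> P" for a b N M
    using that
  proof (induction "N + M" arbitrary: N M a b rule: less_induct)
    case less
    have step: "a \<in> P \<or> b \<in> P" if IH: "\<And>N' a. N' < N \<Longrightarrow> a \<in> Fil N' \<Longrightarrow> a \<otimes> b \<in> P \<Longrightarrow> a \<in> P \<or> b \<in> P"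
      and *: "a \<in> Fil N" "b \<in> carrier R" "a \<otimes> b \<in> P" "pr N a \<in> P" for N a b
    proof -
      have ac: "a \<in> carrier R" using Fil_carr * by auto
      let ?a = "a \<oplus> \<ominus> pr N a"
      have pc: "pr N a \<in> carrier R" using pr_carr ac by auto
      show ?thesis
      proof (cases N)
        case 0
        have "a = pr 0 a" using Fil_sum[of a 0] *(1) 0 pc by simp
        thus ?thesis using * 0 by simp
      next
        case (Suc N')
        have "pr j ?a = \<zero>" if "j > N'" for j
        proof (cases "j = N")
          case True
          thus ?thesis using pr_add ac pc pr_minus[OF pc] pr_same[OF pr_in[OF ac]] by (simp add: r_neg)
        next
          case False
          hence "pr j a = \<zero>" "pr j (pr N a) = \<zero>" using *(1) that Suc pr_other[OF pr_in[OF ac]] unfolding Fil_def by auto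
          thus ?thesis using pr_add ac pc pr_minus[OF pc] by simp
        qed
        hence f: "?a \<in> Fil N'" unfolding Fil_def using ac pc by simp
        have "?a \<otimes> b = a \<otimes> b \<oplus> \<ominus> (pr N a \<otimes> b)" using ac pc *(2) by algebra
        also have "\<dots> \<in> P" using D(3,4,7) * by auto
        finally have "?a \<in> P \<or> b \<in> P" using IH[OF _ f] Suc by simp
        moreover have "a = ?a \<oplus> pr N a" using ac pc by algebra
        ultimately show ?thesis using D(3) *(4) by metis
      qed
    qed
    have c: "a \<in> carrier R" "b \<in> carrier R" using less.prems Fil_carr by auto
    have "pr N a \<otimes> pr M b \<in> P" using Fil_mult(2)[OF less.prems(1,2)] homD(2)[OF assms(1) less.prems(3)] by metis
    hence "pr N a \<in> P \<or> pr M b \<in> P" using assms(3) pr_in c Homogs_props(4) by blast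
    thus ?case
    proof
      assume "pr N a \<in> P"
      show ?thesis
      proof (rule step[OF _ less.prems(1) c(2) less.prems(3) \<open>pr N a \<in> P\<close>])
        fix N' a assume "N' < N" "a \<in> Fil N'" "a \<otimes> b \<in> P"
        thus "a \<in> P \<or> b \<in> P" using less.hyps[of N' M a b] less.prems(2) by simp
      qed
    next
      assume "pr M b \<in> P"
      have "b \<in> P \<or> a \<in> P"
      proof (rule step[OF _ less.prems(2) c(1) _ \<open>pr M b \<in> P\<close>])
        show "b \<otimes> a \<in> P" using less.prems(3) m_comm c by simp
        fix M' b assume "M' < M" "b \<in> Fil M'" "b \<otimes> a \<in> P"
        thus "b \<in> P \<or> a \<in> P" using less.hyps[of N M' a b] less.prems(1) m_comm[of a b] c Fil_carr by auto
      qed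
      thus ?thesis by auto
    qed
  qed
  show "a \<in> P \<or> b \<in> P" if "a \<in> carrier R" "b \<in> carrier R" "a \<otimes> b \<in> P" for a b
    using main that Fil_ex by metis
qed

lemma gprime_primeideal: "gprime P \<Longrightarrow> primeideal P R"
  using homogeneous_prime gprimeD by metis

text \<open>The homogeneous elements of a prime ideal generate a homogeneous prime ideal, which minimality identifies with it.\<close>

lemma minimal_prime_gprime:
  assumes "P \<in> minimal_primes R" shows "gprime P"
proof -
  have pP: "primeideal P R" and min: "\<And>Q. primeideal Q R \<Longrightarrow> Q \<subseteq> P \<Longrightarrow> Q = P"
    using assms unfolding minimal_primes_def by auto
  have idP: "ideal P R" using primeideal.axioms(1)[OF pP] .
  note D = idealD[OF idP]
  let ?Q = "{a \<in> carrier R. \<forall>j. pr j a \<in> P}"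
  have idQ: "ideal ?Q R"
  proof (rule idealI[OF ring_axioms])
    show "subgroup ?Q (add_monoid R)"
      using D pr_zero pr_add pr_minus by (intro add.subgroupI) (auto simp: a_inv_def[symmetric])
    have *: "a \<otimes> x \<in> ?Q" if a: "a \<in> ?Q" and x: "x \<in> carrier R" for a x
    proof -
      have "pr j (a \<otimes> x) \<in> P" for j
      proof -
        obtain M where M: "x \<in> Fil M" using Fil_ex x by auto
        have "a \<otimes> x = a \<otimes> (\<Oplus>i\<in>{..M}. pr i x)" using Fil_sum[OF M] by simp
        also have "\<dots> = (\<Oplus>i\<in>{..M}. a \<otimes> pr i x)" using a x pr_carr by (intro finsum_rdistr) auto
        finally have e: "pr j (a \<otimes> x) = (\<Oplus>i\<in>{..M}. pr j (a \<otimes> pr i x))"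
          using pr_finsum[of "{..M}" "\<lambda>i. a \<otimes> pr i x" j] a x pr_carr by simp
        have t: "pr j (a \<otimes> pr i x) \<in> P" for i
          using pr_mult_homogeneous[of a "pr i x" i j] a pr_in[OF x] pr_carr[OF x] D(2,7) by auto
        have "finite S \<Longrightarrow> (\<Oplus>i\<in>S. pr j (a \<otimes> pr i x)) \<in> P" for S
        proof (induction S rule: finite_induct)
          case (insert i S)
          thus ?case using t D(1,3) by (subst finsum_insert) (auto simp: subset_iff)
        qed (use D(2) in auto)
        thus ?thesis unfolding e by simp
      qed
      thus ?thesis using a x by simp
    qed
    show "a \<otimes> x \<in> ?Q" if "a \<in> ?Q" "x \<in> carrier R" for a x using *[OF that] .
    show "x \<otimes> a \<in> ?Q" if "a \<in> ?Q" "x \<in> carrier R" for a x using *[OF that] m_comm that by auto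
  qed
  have mem: "a \<in> ?Q \<longleftrightarrow> a \<in> P" if "a \<in> G j" for a j
  proof -
    have "pr i a = (if i = j then a else \<zero>)" for i using pr_same[OF that] pr_other[OF that] by auto
    thus ?thesis using D(2) G_carr[OF that] by auto
  qed
  have homQ: "homogeneous ?Q" unfolding homogeneous_def using idQ mem[OF pr_in] pr_carr by auto
  have "\<one> \<notin> ?Q" using mem[OF one_G] ideal.one_imp_carrier[OF idP] primeideal.I_notcarr[OF pP] by auto
  moreover have "a \<in> ?Q \<or> b \<in> ?Q" if ab: "a \<in> Homogs" "b \<in> Homogs" "a \<otimes> b \<in> ?Q" for a b
  proof -
    obtain i j where ij: "a \<in> G i" "b \<in> G j" using ab unfolding Homogs_def by auto
    thus ?thesis using mem[OF G_mult[OF ij]] ab(3) mem[OF ij(1)] mem[OF ij(2)]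
        primeideal.I_prime[OF pP] G_carr by blast
  qed
  ultimately have g: "gprime ?Q" unfolding gprime_def using homQ by blast
  have "?Q \<subseteq> P" using mem_by_pr[OF idP] by auto
  hence "?Q = P" using min gprime_primeideal[OF g] by blast
  thus ?thesis using g by simp
qed

lemma combine_mem:
  assumes "ideal I R" "set gs \<subseteq> carrier R" "set us \<subseteq> I"
  shows "combine gs us \<in> I"
  using assms(2,3)
proof (induction gs us rule: combine.induct)
  case (1 k Ks u Us)
  thus ?case using idealD(3,6)[OF assms(1)] by auto
qed (use idealD(2)[OF assms(1)] in auto)

lemma G_carrier_alg: "carrier R = alg (set Xs)"
proof
  have Xs: "set Xs \<subseteq> carrier R" using X_deg G_sub by auto
  show "alg (set Xs) \<subseteq> carrier R" using alg_carrier[OF Xs] .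
  note A = subspD[OF alg_subsp[OF Xs]]
  have G: "G j \<subseteq> alg (set Xs)" for j
  proof (induction j)
    case 0
    thus ?case using alg.const by auto
  next
    case (Suc j)
    show ?case
    proof
      fix a assume "a \<in> G (Suc j)"
      then obtain gs where gs: "set gs \<subseteq> G j" "a = combine gs Xs" using gen by blast
      have "combine hs us \<in> alg (set Xs)" if "set hs \<subseteq> G j" "set us \<subseteq> set Xs" for hs us
        using that
      proof (induction hs us rule: combine.induct)
        case (1 k Ks u Us)
        hence "k \<in> alg (set Xs)" "u \<in> alg (set Xs)" using Suc alg_self[OF Xs] by auto
        thus ?case using 1 alg_mult[OF Xs] A(3) by auto
      qed (use A in auto)
      thus "a \<in> alg (set Xs)" using gs by auto
    qed
  qed
  show "carrier R \<subseteq> alg (set Xs)"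
  proof
    fix a assume a: "a \<in> carrier R"
    obtain N where N: "a = (\<Oplus>j\<in>{..<N::nat}. pr j a)" using pr_sum[OF a] by blast
    have "finite S \<Longrightarrow> (\<Oplus>j\<in>S. pr j a) \<in> alg (set Xs)" for S
    proof (induction S rule: finite_induct)
      case (insert j S)
      have "pr j a \<in> alg (set Xs)" using G pr_in[OF a] by blast
      thus ?case using insert A(3) pr_carr[OF a] by (subst finsum_insert) auto
    qed (use A in auto)
    thus "a \<in> alg (set Xs)" using N by (metis finite_lessThan)
  qed
qed

lemma noetherian: "noetherian_ring R"
  using acc_carrier_imp_noetherian alg_acc[of "set Xs"] X_deg G_sub unfolding G_carrier_alg[symmetric] by auto

lemma G_fd: "fd (G j)"
proof (induction j)
  case 0
  show ?case using finite_dimensionI[OF dimension_one[OF subfield]] .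
next
  case (Suc j)
  let ?S = "\<lambda>xs. foldr (\<lambda>x W. mul x (G j) <+> W) xs {\<zero>}"
  have f: "fd (?S xs)" if "set xs \<subseteq> carrier R" for xs
    using that by (induction xs) (auto intro!: sum_fd mul_fd Suc zero_space)
  have c: "combine gs xs \<in> ?S xs" if "set gs \<subseteq> G j" "set xs \<subseteq> carrier R" for gs xs
    using that
  proof (induction gs xs rule: combine.induct)
    case (1 k Ks u Us)
    have "k \<otimes> u \<in> mul u (G j)" unfolding mul_def using 1 m_comm[of k u] G_carr by auto
    thus ?case using 1 by (auto simp: set_add_mem)
  next
    case ("2_1" Us)
    thus ?case using subspD(2)[OF fd_subsp[OF f]] by simp
  next
    case ("2_2" Ks)
    thus ?case by simp
  qed
  have Xs: "set Xs \<subseteq> carrier R" using X_deg G_sub by auto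
  have "G (Suc j) \<subseteq> ?S Xs" using gen c[OF _ Xs] by blast
  thus ?case using fd_mono[OF f[OF Xs] G_subsp] by blast
qed

lemma gprime_decomposition:
  assumes "homogeneous I"
  shows "\<exists>Ps. (\<forall>P\<in>set Ps. gprime P \<and> I \<subseteq> P) \<and> (\<forall>as. list_all2 (\<in>) as Ps \<longrightarrow> foldr (\<otimes>) as \<one> \<in> I)"
proof -
  have "\<exists>Ps. (\<forall>P\<in>set Ps. P \<in> Collect homogeneous \<and> I \<subseteq> P \<and> \<one> \<notin> P \<and> (\<forall>a\<in>Homogs. \<forall>b\<in>Homogs. a \<otimes> b \<in> P \<longrightarrow> a \<in> P \<or> b \<in> P)) \<and>
    (\<forall>as. list_all2 (\<in>) as Ps \<longrightarrow> foldr (\<otimes>) as \<one> \<in> I)"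
  proof (rule prime_decomposition[OF noetherian Homogs_props(1,3)])
    show "adjoin I a \<in> Collect homogeneous" if "I \<in> Collect homogeneous" "a \<in> Homogs" for I a
      using that homogeneous_adjoin unfolding Homogs_def by auto
  qed (use homD assms in auto)
  then obtain Ps where Ps: "\<forall>P\<in>set Ps. P \<in> Collect homogeneous \<and> I \<subseteq> P \<and> \<one> \<notin> P \<and> (\<forall>a\<in>Homogs. \<forall>b\<in>Homogs. a \<otimes> b \<in> P \<longrightarrow> a \<in> P \<or> b \<in> P)"
    "\<forall>as. list_all2 (\<in>) as Ps \<longrightarrow> foldr (\<otimes>) as \<one> \<in> I" by (elim exE conjE)
  have "gprime P \<and> I \<subseteq> P" if "P \<in> set Ps" for P
    using bspec[OF Ps(1) that] unfolding gprime_def by simp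
  thus ?thesis using Ps(2) by blast
qed

end

section \<open>Hilbert polynomials and dimension\<close>

context std_graded
begin

definition H :: "'a set \<Rightarrow> nat \<Rightarrow> nat" where "H I j = dim_mod (G j) I"

lemma homogeneous_subsp: "homogeneous I \<Longrightarrow> subsp I" using ideal_subsp homD by auto

lemma H_mono: "ideal I R \<Longrightarrow> ideal J R \<Longrightarrow> I \<subseteq> J \<Longrightarrow> H J j \<le> H I j"
  unfolding H_def using ideal_subsp G_fd by (intro dim_mod_antimono) auto

lemma H_zero_iff: "ideal I R \<Longrightarrow> H I j = 0 \<longleftrightarrow> G j \<subseteq> I"
proof -
  assume I: "ideal I R"
  have "dim_mod (G j) I + d (G j \<inter> I) = d (G j)" using dim_mod_eq[OF G_fd ideal_subsp[OF I]] .
  moreover have "d (G j \<inter> I) = d (G j) \<Longrightarrow> G j \<inter> I = G j"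
    using d_eq_imp[OF G_fd subsp_int[OF G_subsp ideal_subsp[OF I]]] by auto
  moreover have "G j \<subseteq> I \<Longrightarrow> G j \<inter> I = G j" by auto
  ultimately show ?thesis unfolding H_def by (metis Int_lower2 add_is_0 add_cancel_left_left)
qed

lemma adjoin_component:
  assumes I: "homogeneous I" and a: "a \<in> G t"
  shows "G (j + t) \<inter> adjoin I a = (G (j + t) \<inter> I) <+> mul a (G j)"
proof
  have ac: "a \<in> carrier R" using a G_carr by auto
  note iI = homD(1)[OF I]
  show "G (j + t) \<inter> adjoin I a \<subseteq> (G (j + t) \<inter> I) <+> mul a (G j)"
  proof
    fix x assume x: "x \<in> G (j + t) \<inter> adjoin I a"
    hence "x \<in> adjoin I a" by auto
    then obtain i r where *: "i \<in> I" "r \<in> carrier R" "x = i \<oplus> r \<otimes> a" unfolding adjoin_iff by auto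
    have ic: "i \<in> carrier R" using * idealD(1)[OF iI] by auto
    have "x = pr (j + t) x" using pr_same x by auto
    also have "\<dots> = pr (j + t) i \<oplus> pr j r \<otimes> a"
      using * ic ac pr_mult_homogeneous[OF *(2) a] by (simp add: pr_add)
    also have "\<dots> = pr (j + t) i \<oplus> a \<otimes> pr j r" using m_comm ac pr_carr *(2) by simp
    finally show "x \<in> (G (j + t) \<inter> I) <+> mul a (G j)"
      unfolding set_add_mem mul_def using homD(2)[OF I *(1)] pr_in[OF ic] pr_in[OF *(2)] by blast
  qed
  have "subsp (G (j + t) \<inter> adjoin I a)" using subsp_int[OF G_subsp homogeneous_subsp[OF homogeneous_adjoin[OF I a]]] .
  moreover have "mul a (G j) \<subseteq> G (j + t)"
    unfolding mul_def using G_mult[OF a, of _ j] by (auto simp: add.commute)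
  moreover have "mul a (G j) \<subseteq> adjoin I a"
    unfolding mul_def using idealD(7)[OF adjoin_ideal[OF iI ac] adjoin_mem[OF iI ac]] G_carr by auto
  ultimately show "(G (j + t) \<inter> I) <+> mul a (G j) \<subseteq> G (j + t) \<inter> adjoin I a"
    using adjoin_incl[OF iI ac] by (intro set_add_least) auto
qed

text \<open>The exact sequence \<open>0 \<rightarrow> R/(I : a)(-t) \<rightarrow> R/I \<rightarrow> R/(I + (a)) \<rightarrow> 0\<close>. All properties of Hilbert polynomials below are
  derived from it.\<close>

lemma H_exact:
  assumes I: "homogeneous I" and a: "a \<in> G t"
  shows "H I (j + t) = H (colon I a) j + H (adjoin I a) (j + t)"
proof -
  have ac: "a \<in> carrier R" using a G_carr by auto
  note iI = homD(1)[OF I] and sI = homogeneous_subsp[OF I]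
  let ?E = "G (j + t) \<inter> I" and ?F = "mul a (G j)"
  have fE: "fd ?E" using fd_int G_fd sI by auto
  have fF: "fd ?F" using mul_fd ac G_fd by auto
  have mG: "?F \<subseteq> G (j + t)" unfolding mul_def using G_mult[OF a, of _ j] by (auto simp: add.commute)
  have "?E \<inter> ?F = ?F \<inter> I" using mG by auto
  hence "d (?E <+> ?F) + d (?F \<inter> I) = d ?E + d ?F" using d_sum[OF fE fF] by simp
  moreover have "dim_mod ?F I + d (?F \<inter> I) = d ?F" using dim_mod_eq[OF fF sI] .
  moreover have "dim_mod ?F I = dim_mod (G j) (colon I a)" using dim_mod_mul[OF ac G_fd iI] .
  moreover have "dim_mod (G (j + t)) I + d ?E = d (G (j + t))" using dim_mod_eq[OF G_fd sI] .
  moreover have "dim_mod (G (j + t)) (adjoin I a) + d (?E <+> ?F) = d (G (j + t))"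
    using dim_mod_eq[OF G_fd homogeneous_subsp[OF homogeneous_adjoin[OF I a]], of "j + t"] adjoin_component[OF I a] by simp
  ultimately show ?thesis unfolding H_def by linarith
qed

definition hpoly :: "'a set \<Rightarrow> rat poly \<Rightarrow> bool" where
  "hpoly I p \<longleftrightarrow> (\<forall>\<^sub>F j in sequentially. poly p (of_nat j) = of_nat (H I j))"

lemma irrelevant:
  assumes "ideal I R" "G 1 \<subseteq> I" "j \<ge> 1" shows "G j \<subseteq> I"
proof
  fix a assume "a \<in> G j"
  moreover obtain k where "j = Suc k" using assms(3) by (cases j) auto
  ultimately obtain gs where "set gs \<subseteq> G k" "a = combine gs Xs" using gen by blast
  thus "a \<in> I" using combine_mem[OF assms(1)] X_deg assms(2) G_sub by (metis subset_trans)
qed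

text \<open>Noetherian induction: multiplication by a form \<open>x\<close> of degree one relates \<open>I\<close> to \<open>I : x\<close>
  and \<open>I + (x)\<close>, and \<open>I : x = I\<close> only leaves a difference equation to be solved.\<close>

lemma hpoly_exists: "homogeneous I \<Longrightarrow> \<exists>p. hpoly I p"
proof -
  interpret noetherian_ring R by (rule noetherian)
  assume "homogeneous I"
  hence "ideal I R" "homogeneous I" using homD by auto
  thus ?thesis
  proof (induction I rule: noetherian_induct)
    case (step I)
    note iI = homD(1)[OF step.prems]
    show ?case
    proof (cases "G 1 \<subseteq> I")
      case True
      have "\<forall>\<^sub>F j in sequentially. H I j = 0"
        using eventually_ge_at_top[of 1] by eventually_elim (use irrelevant[OF iI True] H_zero_iff[OF iI] in auto)
      thus ?thesis unfolding hpoly_def by (intro exI[of _ 0]) (auto elim: eventually_mono)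
    next
      case False
      then obtain x where x: "x \<in> G 1" "x \<notin> I" by auto
      have xc: "x \<in> carrier R" using x G_carr by auto
      have "I \<subset> adjoin I x" using adjoin_incl[OF iI xc] adjoin_mem[OF iI xc] x by auto
      then obtain q where "hpoly (adjoin I x) q" using step.IH[OF homD(1)] homogeneous_adjoin[OF step.prems x(1)] by blast
      then obtain N where q: "\<And>j. j \<ge> N \<Longrightarrow> poly q (of_nat j) = of_nat (H (adjoin I x) j)"
        unfolding hpoly_def eventually_sequentially by blast
      have ex: "H I (Suc j) = H (colon I x) j + H (adjoin I x) (Suc j)" for j
        using H_exact[OF step.prems x(1), of j] by simp
      show ?thesis
      proof (cases "colon I x = I")
        case False
        hence "I \<subset> colon I x" using colon_incl[OF iI xc] by auto
        then obtain p where "hpoly (colon I x) p" using step.IH[OF homD(1)] homogeneous_colon[OF step.prems x(1)] by blast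
        then obtain M where p: "\<And>j. j \<ge> M \<Longrightarrow> poly p (of_nat j) = of_nat (H (colon I x) j)"
          unfolding hpoly_def eventually_sequentially by blast
        have "poly (pcompose p [:-1, 1:] + q) (of_nat j) = of_nat (H I j)" if "j \<ge> Suc (max N M)" for j
        proof -
          obtain k where k: "j = Suc k" "k \<ge> M" "Suc k \<ge> N" using \<open>j \<ge> Suc (max N M)\<close> by (cases j) auto
          show ?thesis using p[OF k(2)] q[OF k(3)] ex[of k] k(1) by (simp add: poly_pcompose)
        qed
        thus ?thesis unfolding hpoly_def eventually_sequentially by blast
      next
        case True
        obtain p where p: "bdiff 1 p = q" using bdiff_surj by blast
        define c where "c = of_nat (H I N) - poly p (of_nat N)"
        have "poly (p + [:c:]) (of_nat j) = of_nat (H I j)" if "j \<ge> N" for j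
          using that
        proof (induction j rule: dec_induct)
          case base
          thus ?case by (simp add: c_def)
        next
          case (step j)
          have "poly q (of_nat (Suc j)) = poly p (of_nat (Suc j)) - poly p (of_nat j)"
            unfolding p[symmetric] poly_bdiff by simp
          thus ?case using step q[of "Suc j"] ex[of j] True by simp
        qed
        thus ?thesis unfolding hpoly_def eventually_sequentially by blast
      qed
    qed
  qed
qed

definition hp :: "'a set \<Rightarrow> rat poly" where "hp I = (THE p. hpoly I p)"

lemma hpoly_unique: "hpoly I p \<Longrightarrow> hpoly I q \<Longrightarrow> p = q"
proof -
  assume "hpoly I p" "hpoly I q"
  hence "\<forall>\<^sub>F j in sequentially. poly p (of_nat j) = poly q (of_nat j)"
    unfolding hpoly_def by eventually_elim simp
  thus ?thesis by (rule poly_eventually_eq)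
qed

lemma hp_eqI: "hpoly I p \<Longrightarrow> hp I = p"
  unfolding hp_def using hpoly_unique by blast

lemma hp: "homogeneous I \<Longrightarrow> hpoly I (hp I)"
  using hpoly_exists hp_eqI by metis

definition hpcoeff :: "'a set \<Rightarrow> nat \<Rightarrow> rat" where "hpcoeff I D = Polynomial.coeff (hp I) D"

text \<open>The Krull dimension of \<open>R/I\<close> as measured by the Hilbert polynomial: one more than its degree, and \<open>0\<close> for the
  zero polynomial.\<close>

definition gdim :: "'a set \<Rightarrow> nat" where "gdim I = (if hp I = 0 then 0 else Suc (Polynomial.degree (hp I)))"

text \<open>The degree of \<open>R/I\<close> if \<open>gdim I > 0\<close>; if \<open>gdim I = 0\<close>, the value is \<open>0\<close>, in accordance
  with \<open>Proj (R/I)\<close> being empty.\<close>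

definition gdeg :: "'a set \<Rightarrow> rat" where "gdeg I = fact (gdim I - 1) * hpcoeff I (gdim I - 1)"

lemma hpcoeff_zero: "D \<ge> gdim I \<Longrightarrow> hpcoeff I D = 0"
  unfolding hpcoeff_def gdim_def by (auto simp: coeff_eq_0 split: if_splits)

lemma gdim_leI: "(\<And>D. D \<ge> s \<Longrightarrow> hpcoeff I D = 0) \<Longrightarrow> gdim I \<le> s"
  unfolding gdim_def hpcoeff_def by (metis leading_coeff_neq_0 not_less_eq_eq zero_le)

lemma H_le_hpcoeff:
  assumes "homogeneous I" "homogeneous J" "I \<subseteq> J" "gdim I \<le> Suc D" "gdim J \<le> Suc D"
  shows "hpcoeff J D \<le> hpcoeff I D"
  unfolding hpcoeff_def
proof (rule poly_eventually_le)
  show "\<forall>\<^sub>F j in sequentially. poly (hp J) (of_nat j) \<le> poly (hp I) (of_nat j)"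
    using hp[OF assms(1)] hp[OF assms(2)] unfolding hpoly_def
    by eventually_elim (use H_mono[OF homD(1)[OF assms(1)] homD(1)[OF assms(2)] assms(3)] in simp)
  show "Polynomial.coeff (hp J) i = Polynomial.coeff (hp I) i" if "i > D" for i
    using that assms(4,5) hpcoeff_zero[of I i] hpcoeff_zero[of J i] unfolding hpcoeff_def by simp
qed

lemma homogeneous_carrier: "homogeneous (carrier R)" unfolding homogeneous_def using oneideal pr_carr by auto

lemma hp_carrier: "hp (carrier R) = 0" "gdim (carrier R) = 0"
proof -
  have "H (carrier R) j = 0" for j using H_zero_iff[OF oneideal] G_sub by auto
  hence "hpoly (carrier R) 0" unfolding hpoly_def by simp
  thus "hp (carrier R) = 0" by (rule hp_eqI)
  thus "gdim (carrier R) = 0" unfolding gdim_def by simp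
qed

lemma hpcoeff_nonneg: "homogeneous I \<Longrightarrow> gdim I \<le> Suc D \<Longrightarrow> hpcoeff I D \<ge> 0"
  using H_le_hpcoeff[of I "carrier R" D] homogeneous_carrier hp_carrier idealD(1)[OF homD(1)] hpcoeff_zero[of "carrier R" D] by auto

lemma hpcoeff_pos: "homogeneous I \<Longrightarrow> gdim I = Suc D \<Longrightarrow> hpcoeff I D > 0"
proof -
  assume *: "homogeneous I" "gdim I = Suc D"
  hence "hpcoeff I D \<noteq> 0" unfolding hpcoeff_def gdim_def by (auto split: if_splits)
  thus ?thesis using hpcoeff_nonneg[of I D] * by simp
qed

lemma gdim_mono: "homogeneous I \<Longrightarrow> homogeneous J \<Longrightarrow> I \<subseteq> J \<Longrightarrow> gdim J \<le> gdim I"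
proof (rule ccontr)
  assume *: "homogeneous I" "homogeneous J" "I \<subseteq> J" "\<not> gdim J \<le> gdim I"
  then obtain D where D: "gdim J = Suc D" by (cases "gdim J") auto
  hence "hpcoeff J D > 0" "hpcoeff I D = 0" using * hpcoeff_pos hpcoeff_zero[of I D] by auto
  moreover have "hpcoeff J D \<le> hpcoeff I D" using H_le_hpcoeff[of I J D] * D by simp
  ultimately show False by simp
qed

lemma hpcoeff_mono:
  assumes "homogeneous I" "homogeneous J" "I \<subseteq> J" "gdim I \<le> Suc D" shows "hpcoeff J D \<le> hpcoeff I D"
  using H_le_hpcoeff[OF assms] gdim_mono[OF assms(1-3)] assms(4) by simp

lemma gdeg_nonneg: "homogeneous I \<Longrightarrow> gdeg I \<ge> 0"
  unfolding gdeg_def using hpcoeff_nonneg[of I "gdim I - 1"] by simp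

lemma hp_exact:
  assumes "homogeneous I" "a \<in> G t"
  shows "hp I = pcompose (hp (colon I a)) [:- of_nat t, 1:] + hp (adjoin I a)"
proof (rule hp_eqI)
  obtain N where p: "\<And>j. j \<ge> N \<Longrightarrow> poly (hp (colon I a)) (of_nat j) = of_nat (H (colon I a) j)"
    using hp[OF homogeneous_colon[OF assms]] unfolding hpoly_def eventually_sequentially by blast
  obtain M where q: "\<And>j. j \<ge> M \<Longrightarrow> poly (hp (adjoin I a)) (of_nat j) = of_nat (H (adjoin I a) j)"
    using hp[OF homogeneous_adjoin[OF assms]] unfolding hpoly_def eventually_sequentially by blast
  have "poly (pcompose (hp (colon I a)) [:- of_nat t, 1:] + hp (adjoin I a)) (of_nat j) = of_nat (H I j)"
    if j: "j \<ge> N + M + t" for j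
  proof -
    define k where "k = j - t"
    have k: "j = k + t" "k \<ge> N" "k + t \<ge> M" using j unfolding k_def by auto
    show ?thesis using p[OF k(2)] q[OF k(3)] H_exact[OF assms, of k] k(1) by (simp add: poly_pcompose)
  qed
  thus "hpoly I (pcompose (hp (colon I a)) [:- of_nat t, 1:] + hp (adjoin I a))"
    unfolding hpoly_def eventually_sequentially by blast
qed

lemma hpcoeff_exact:
  assumes "homogeneous I" "a \<in> G t" "gdim (colon I a) \<le> Suc D"
  shows "hpcoeff I D = hpcoeff (colon I a) D + hpcoeff (adjoin I a) D"
proof -
  have "Polynomial.degree (hp (colon I a)) \<le> D" using assms(3) unfolding gdim_def by (auto split: if_splits)
  thus ?thesis unfolding hpcoeff_def by (subst hp_exact[OF assms(1,2)]) (simp add: coeff_pcompose_shift)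
qed

lemma gdim_zero_iff: assumes "homogeneous I" shows "gdim I = 0 \<longleftrightarrow> (\<exists>N. \<forall>j\<ge>N. G j \<subseteq> I)"
proof -
  have "gdim I = 0 \<longleftrightarrow> hp I = 0" unfolding gdim_def by simp
  also have "\<dots> \<longleftrightarrow> (\<forall>\<^sub>F j in sequentially. H I j = 0)"
  proof
    assume "hp I = 0"
    thus "\<forall>\<^sub>F j in sequentially. H I j = 0" using hp[OF assms] unfolding hpoly_def by simp
  next
    assume "\<forall>\<^sub>F j in sequentially. H I j = 0"
    hence "hpoly I 0" unfolding hpoly_def by eventually_elim simp
    thus "hp I = 0" by (rule hp_eqI)
  qed
  finally show ?thesis unfolding eventually_sequentially using H_zero_iff[OF homD(1)[OF assms]] by simp
qed

lemma G_pow: "x \<in> G 1 \<Longrightarrow> x [^] (n::nat) \<in> G n"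
  using one_G G_mult[of _ _ x 1] by (induction n) auto

lemma gprime_pow: "gprime P \<Longrightarrow> x \<in> G 1 \<Longrightarrow> x \<notin> P \<Longrightarrow> x [^] (n::nat) \<notin> P"
proof (induction n)
  case 0
  thus ?case using gprimeD(3) by simp
next
  case (Suc n)
  thus ?case using gprimeD(4)[OF Suc.prems(1) Homogs_props(4)[OF G_pow[OF Suc.prems(2), of n]] Homogs_props(4)[OF Suc.prems(2)]] by auto
qed

lemma gprime_gdim_zero: assumes "gprime P" "gdim P = 0" shows "G 1 \<subseteq> P"
proof
  fix x assume x: "x \<in> G 1"
  obtain N where "\<forall>j\<ge>N. G j \<subseteq> P" using gdim_zero_iff gprimeD(1) assms by blast
  hence "x [^] N \<in> P" using G_pow[OF x, of N] by auto
  thus "x \<in> P" using gprime_pow[OF assms(1) x] by auto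
qed

lemma field_unit: assumes "ideal I R" "k \<in> G 0" "k \<noteq> \<zero>" "k \<in> I" shows "\<one> \<in> I"
proof -
  have k: "k \<in> G 0 - {\<zero>}" using assms by auto
  have "inv k \<otimes> k \<in> I" using idealD(6)[OF assms(1,4)] subfield_m_inv(1)[OF subfield k] G_carr by auto
  thus ?thesis using subfield_m_inv(3)[OF subfield k] by simp
qed

text \<open>As \<open>P : a = P\<close>, the Hilbert polynomial of \<open>P + (a)\<close> is the difference with step \<open>t\<close> of that of \<open>P\<close>.\<close>

lemma gprime_adjoin:
  assumes P: "gprime P" and a: "a \<in> G t" "a \<notin> P" and t: "t > 0"
  shows "gdim P > 0" "gdim (adjoin P a) = gdim P - 1"
    "gdim P = Suc (Suc D) \<Longrightarrow> hpcoeff (adjoin P a) D = of_nat (Suc D * t) * hpcoeff P (Suc D)"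
proof -
  note hP = gprimeD(1)[OF P]
  show pos: "gdim P > 0"
  proof (rule ccontr)
    assume "\<not> gdim P > 0"
    hence "G t \<subseteq> P" using irrelevant[OF gprimeD(2)[OF P] gprime_gdim_zero[OF P], of t] t by auto
    thus False using a by auto
  qed
  have hd: "hp (adjoin P a) = bdiff t (hp P)"
    using hp_exact[OF hP a(1)] unfolding gprime_colon[OF P a] bdiff_def by (simp add: algebra_simps)
  have dg: "Polynomial.degree (hp P) \<le> gdim P - 1" using pos unfolding gdim_def by (auto split: if_splits)
  have z: "hpcoeff (adjoin P a) i = 0" if "i \<ge> gdim P - 1" for i
    using coeff_bdiff[OF dg, of t] that unfolding hpcoeff_def hd by simp
  show c: "hpcoeff (adjoin P a) D = of_nat (Suc D * t) * hpcoeff P (Suc D)" if "gdim P = Suc (Suc D)" for D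
    using coeff_bdiff[OF dg, of t] that unfolding hpcoeff_def hd by simp
  show "gdim (adjoin P a) = gdim P - 1"
  proof (rule antisym)
    show "gdim (adjoin P a) \<le> gdim P - 1" using z by (rule gdim_leI)
    show "gdim P - 1 \<le> gdim (adjoin P a)"
    proof (cases "gdim P - 1")
      case (Suc D)
      hence D: "gdim P = Suc (Suc D)" using pos by simp
      have "hpcoeff (adjoin P a) D > 0" unfolding c[OF D] using hpcoeff_pos[OF hP D] t by (intro mult_pos_pos) (auto simp del: of_nat_Suc of_nat_mult)
      thus ?thesis using hpcoeff_zero[of "adjoin P a" D] Suc by (metis less_irrefl not_less_eq_eq)
    qed simp
  qed
qed

lemma gprime_adjoin_gdeg:
  assumes P: "gprime P" and x: "x \<in> G 1" "x \<notin> P" and g: "gdim P \<ge> 2"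
  shows "gdeg (adjoin P x) = gdeg P"
proof -
  obtain D where D: "gdim P = Suc (Suc D)" using g by (metis add_2_eq_Suc le_Suc_ex)
  show ?thesis unfolding gdeg_def gprime_adjoin(2)[OF P x zero_less_one] using gprime_adjoin(3)[OF P x zero_less_one D] D
    by (simp add: fact_Suc algebra_simps)
qed

lemma gprime_strict: assumes "gprime P" "gprime Q" "P \<subset> Q" shows "gdim Q < gdim P"
proof -
  obtain a where a: "a \<in> Homogs" "a \<in> Q" "a \<notin> P"
    using homogeneous_witness[OF gprimeD(1)[OF assms(2)] gprimeD(2)[OF assms(1)]] assms(3) by auto
  then obtain t where t: "a \<in> G t" unfolding Homogs_def by auto
  have "t > 0"
  proof (rule ccontr)
    assume "\<not> t > 0"
    hence "\<one> \<in> Q" using field_unit[OF gprimeD(2)[OF assms(2)], of a] t a idealD(2)[OF gprimeD(2)[OF assms(1)]] by auto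
    thus False using gprimeD(3)[OF assms(2)] by simp
  qed
  note g = gprime_adjoin(1,2)[OF assms(1) t a(3) this]
  have "adjoin P a \<subseteq> Q" using adjoin_least[OF gprimeD(2)[OF assms(2)]] assms(3) a by auto
  hence "gdim Q \<le> gdim (adjoin P a)" using gdim_mono homogeneous_adjoin[OF gprimeD(1)[OF assms(1)] t] gprimeD(1)[OF assms(2)] by auto
  thus ?thesis using g by simp
qed

text \<open>From \<open>I \<subseteq> I : x\<close> the first difference of the Hilbert polynomial of \<open>I\<close> is at most that of \<open>I + (x)\<close>.\<close>

lemma gdim_adjoin_ge:
  assumes I: "homogeneous I" and x: "x \<in> G 1" shows "gdim I \<le> Suc (gdim (adjoin I x))"
proof (rule ccontr)
  assume c: "\<not> ?thesis"
  then obtain D where D: "gdim I = Suc (Suc D)" by (cases "gdim I"; cases "gdim I - 1") auto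
  have xc: "x \<in> carrier R" using x G_carr by auto
  have dg: "Polynomial.degree (hp I) \<le> Suc D" using D unfolding gdim_def by (auto split: if_splits)
  have cz: "hpcoeff (adjoin I x) i = 0" if "i \<ge> D" for i using hpcoeff_zero[of "adjoin I x" i] c D that by simp
  have "Polynomial.coeff (bdiff 1 (hp I)) D \<le> Polynomial.coeff (hp (adjoin I x)) D"
  proof (rule poly_eventually_le)
    show "Polynomial.coeff (bdiff 1 (hp I)) i = Polynomial.coeff (hp (adjoin I x)) i" if "i > D" for i
      using coeff_bdiff[OF dg, of 1] cz[of i] that unfolding hpcoeff_def by simp
    obtain N where p: "\<And>j. j \<ge> N \<Longrightarrow> poly (hp I) (of_nat j) = of_nat (H I j)"
      using hp[OF I] unfolding hpoly_def eventually_sequentially by blast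
    obtain M where q: "\<And>j. j \<ge> M \<Longrightarrow> poly (hp (adjoin I x)) (of_nat j) = of_nat (H (adjoin I x) j)"
      using hp[OF homogeneous_adjoin[OF I x]] unfolding hpoly_def eventually_sequentially by blast
    have "poly (bdiff 1 (hp I)) (of_nat j) \<le> poly (hp (adjoin I x)) (of_nat j)" if j: "j \<ge> Suc (N + M)" for j
    proof -
      obtain k where k: "j = Suc k" "k \<ge> N" "Suc k \<ge> N" "Suc k \<ge> M" using j by (cases j) auto
      have "H (colon I x) k \<le> H I k"
        using H_mono[OF homD(1)[OF I] colon_ideal[OF homD(1)[OF I] xc] colon_incl[OF homD(1)[OF I] xc]] .
      hence "H I (Suc k) \<le> H I k + H (adjoin I x) (Suc k)" using H_exact[OF I x, of k] by simp
      hence "(of_nat (H I (Suc k)) :: rat) \<le> of_nat (H I k) + of_nat (H (adjoin I x) (Suc k))"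
        by (metis of_nat_add of_nat_mono)
      thus ?thesis using p[OF k(2)] p[OF k(3)] q[OF k(4)] k(1) by (simp add: poly_bdiff)
    qed
    thus "\<forall>\<^sub>F j in sequentially. poly (bdiff 1 (hp I)) (of_nat j) \<le> poly (hp (adjoin I x)) (of_nat j)"
      unfolding eventually_sequentially by blast
  qed
  moreover have "Polynomial.coeff (bdiff 1 (hp I)) D = of_nat (Suc D) * hpcoeff I (Suc D)"
    using coeff_bdiff[OF dg, of 1] unfolding hpcoeff_def by simp
  moreover have "of_nat (Suc D) * hpcoeff I (Suc D) > 0" using hpcoeff_pos[OF I D] by simp
  ultimately show False using cz[of D] unfolding hpcoeff_def by simp
qed

text \<open>Noetherian induction: if \<open>a \<otimes> b \<in> J\<close>, then the exact sequence reduces \<open>J\<close> to the larger ideals \<open>J : a\<close> and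
  \<open>J + (a)\<close>.\<close>

lemma gdim_le_primes:
  assumes "homogeneous J" "\<And>Q. gprime Q \<Longrightarrow> J \<subseteq> Q \<Longrightarrow> gdim Q \<le> s" shows "gdim J \<le> s"
proof -
  interpret noetherian_ring R by (rule noetherian)
  have "ideal J R" using homD assms by auto
  thus ?thesis using assms
  proof (induction J rule: noetherian_induct)
    case (step J)
    note iJ = homD(1)[OF step.prems(1)]
    show ?case
    proof (cases "gprime J")
      case True
      thus ?thesis using step.prems(2) by auto
    next
      case F: False
      show ?thesis
      proof (cases "\<one> \<in> J")
        case True
        hence "J = carrier R" using ideal.one_imp_carrier[OF iJ] by simp
        thus ?thesis using hp_carrier by simp
      next
        case False
        then obtain a b where ab: "a \<in> Homogs" "b \<in> Homogs" "a \<otimes> b \<in> J" "a \<notin> J" "b \<notin> J"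
          using F step.prems(1) unfolding gprime_def by auto
        then obtain t where t: "a \<in> G t" unfolding Homogs_def by auto
        have c: "a \<in> carrier R" "b \<in> carrier R" using ab Homogs_props(1) by auto
        have l: "J \<subset> colon J a" "J \<subset> adjoin J a"
          using colon_incl[OF iJ c(1)] adjoin_incl[OF iJ c(1)] adjoin_mem[OF iJ c(1)] ab c unfolding colon_def by auto
        have g1: "gdim (colon J a) \<le> s"
          using step.IH[OF homD(1) l(1)] step.prems(2) l(1) homogeneous_colon[OF step.prems(1) t] by blast
        have g2: "gdim (adjoin J a) \<le> s"
          using step.IH[OF homD(1) l(2)] step.prems(2) l(2) homogeneous_adjoin[OF step.prems(1) t] by blast
        show ?thesis
          by (rule gdim_leI) (use hpcoeff_exact[OF step.prems(1) t] hpcoeff_zero g1 g2 in force)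
      qed
    qed
  qed
qed

lemma prime_attaining_gdim:
  assumes "homogeneous J" "gdim J = Suc s" shows "\<exists>Q. gprime Q \<and> J \<subseteq> Q \<and> gdim Q = Suc s"
proof (rule ccontr)
  assume c: "\<not> ?thesis"
  have "gdim J \<le> s"
  proof (rule gdim_le_primes[OF assms(1)])
    fix Q assume Q: "gprime Q" "J \<subseteq> Q"
    hence "gdim Q \<le> Suc s" using gdim_mono[OF assms(1) gprimeD(1)] assms(2) by auto
    thus "gdim Q \<le> s" using c Q by (metis le_SucE)
  qed
  thus False using assms by simp
qed

text \<open>Primes of the same dimension are incomparable.\<close>

lemma incomparable_separation:
  assumes "finite \<Q>" "\<And>Q. Q \<in> \<Q> \<Longrightarrow> gprime Q \<and> gdim Q = s" "gprime P" "gdim P = s" "P \<notin> \<Q>"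
  shows "\<exists>f\<in>Homogs. f \<notin> P \<and> (\<forall>Q\<in>\<Q>. f \<in> Q)"
proof (rule separating_element[OF assms(1) Homogs_props(2,3,1)])
  show "\<one> \<notin> P" using gprimeD assms by auto
  show "ideal Q R" if "Q \<in> \<Q>" for Q using gprimeD assms that by auto
  show "a \<in> P \<or> b \<in> P" if "a \<in> Homogs" "b \<in> Homogs" "a \<otimes> b \<in> P" for a b using gprimeD(4)[OF assms(3)] that by auto
  fix Q assume Q: "Q \<in> \<Q>"
  have "\<not> Q \<subseteq> P"
  proof
    assume "Q \<subseteq> P"
    hence "Q \<subset> P" using Q assms by auto
    thus False using gprime_strict[of Q P] assms Q by auto
  qed
  thus "\<exists>a\<in>Homogs. a \<in> Q \<and> a \<notin> P"
    using homogeneous_witness[OF gprimeD(1) gprimeD(2)[OF assms(3)]] assms Q by auto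
qed

text \<open>The primes are intersected one after the other: if \<open>f\<close> lies in all previous primes but not in the new one \<open>P\<close>, then \<open>K : f = P\<close> for the
  new intersection \<open>K\<close>, and \<open>K + (f)\<close> lies in the old one.\<close>

lemma sum_hpcoeff_le:
  assumes fin: "finite \<Q>" and Q: "\<And>Q. Q \<in> \<Q> \<Longrightarrow> gprime Q \<and> J \<subseteq> Q \<and> gdim Q = Suc D"
    and J: "homogeneous J" "gdim J \<le> Suc D"
  shows "(\<Sum>Q\<in>\<Q>. hpcoeff Q D) \<le> hpcoeff J D"
proof -
  let ?I = "\<lambda>\<Q>. carrier R \<inter> \<Inter>\<Q>"
  have hI: "homogeneous (?I S)" if "S \<subseteq> \<Q>" for S
  proof (cases "S = {}")
    case False
    hence "homogeneous (\<Inter>S)" using homogeneous_Inter[of S] Q gprimeD(1) that by blast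
    thus ?thesis using homogeneous_Int[OF homogeneous_carrier] by blast
  qed (use homogeneous_carrier in simp)
  have JI: "J \<subseteq> ?I S" if "S \<subseteq> \<Q>" for S using Q that idealD(1)[OF homD(1)[OF J(1)]] by blast
  have gI: "gdim (?I S) \<le> Suc D" if "S \<subseteq> \<Q>" for S using gdim_mono[OF J(1) hI[OF that] JI[OF that]] J(2) by (rule order_trans)
  have "S \<subseteq> \<Q> \<Longrightarrow> (\<Sum>Q\<in>S. hpcoeff Q D) \<le> hpcoeff (?I S) D" if "finite S" for S
    using that
  proof (induction S rule: finite_induct)
    case empty
    show ?case using hp_carrier unfolding hpcoeff_def by simp
  next
    case (insert P S)
    have S: "S \<subseteq> \<Q>" "P \<in> \<Q>" using insert by auto
    have gP: "gprime P" "gdim P = Suc D" using Q S by auto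
    have "\<exists>f\<in>Homogs. f \<notin> P \<and> (\<forall>Q\<in>S. f \<in> Q)"
      by (rule incomparable_separation[OF insert(1) _ gP insert(2)]) (use Q S in auto)
    then obtain f where f: "f \<in> Homogs" "f \<notin> P" "\<forall>Q\<in>S. f \<in> Q" by auto
    then obtain t where t: "f \<in> G t" unfolding Homogs_def by auto
    have fc: "f \<in> carrier R" using t G_carr by auto
    let ?K = "?I (insert P S)"
    note hK = hI[OF insert.prems]
    have colon: "colon ?K f = P"
    proof
      show "P \<subseteq> colon ?K f"
      proof
        fix a assume a: "a \<in> P"
        have ac: "a \<in> carrier R" using a idealD(1)[OF gprimeD(2)[OF gP(1)]] by auto
        have "f \<otimes> a \<in> Q" if "Q \<in> insert P S" for Q
        proof (cases "Q = P")
          case True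
          thus ?thesis using idealD(6)[OF gprimeD(2)[OF gP(1)] a fc] by simp
        next
          case False
          thus ?thesis using that f(3) idealD(7)[OF gprimeD(2) _ ac] Q S by blast
        qed
        thus "a \<in> colon ?K f" unfolding colon_def using ac fc by auto
      qed
      have "colon ?K f \<subseteq> colon P f" unfolding colon_def by auto
      thus "colon ?K f \<subseteq> P" using gprime_colon[OF gP(1) t f(2)] by simp
    qed
    have "adjoin ?K f \<subseteq> ?I S"
      by (rule adjoin_least[OF homD(1)[OF hI[OF S(1)]]]) (use f fc in auto)
    hence "hpcoeff (?I S) D \<le> hpcoeff (adjoin ?K f) D"
    proof (intro hpcoeff_mono homogeneous_adjoin[OF hK t] hI[OF S(1)])
      show "gdim (adjoin ?K f) \<le> Suc D"
        using gdim_mono[OF hK homogeneous_adjoin[OF hK t] adjoin_incl[OF homD(1)[OF hK] fc]] gI[OF insert.prems] by simp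
    qed
    moreover have "hpcoeff ?K D = hpcoeff P D + hpcoeff (adjoin ?K f) D"
      using hpcoeff_exact[OF hK t, of D] colon gP(2) by simp
    ultimately show ?case using insert.IH[OF S(1)] insert(1,2) by simp
  qed
  from this[OF fin order_refl] show ?thesis
    using hpcoeff_mono[OF J(1) hI[OF order_refl] JI[OF order_refl] J(2)] by simp
qed

text \<open>By induction on the dimension: a hyperplane section has the same degree, and this is at least the degree of one of its
  components of the same dimension.\<close>

lemma gdeg_ge_1: "gprime P \<Longrightarrow> gdim P = Suc D \<Longrightarrow> gdeg P \<ge> 1"
proof (induction D arbitrary: P)
  case 0
  have hP: "homogeneous P" using gprimeD 0 by auto
  have "Polynomial.degree (hp P) = 0" "hp P \<noteq> 0" using 0(2) unfolding gdim_def by (auto split: if_splits)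
  then obtain c where c: "hp P = [:c:]" by (metis degree_0_id)
  hence cc: "hpcoeff P 0 = c" unfolding hpcoeff_def by simp
  obtain N where "poly (hp P) (of_nat N) = of_nat (H P N)"
    using hp[OF hP] unfolding hpoly_def eventually_sequentially by blast
  hence "c = of_nat (H P N)" using c by simp
  moreover have "c > 0" using hpcoeff_pos[OF hP 0(2)] cc by simp
  ultimately have "c \<ge> 1" by simp
  thus ?case unfolding gdeg_def 0(2) using cc by simp
next
  case (Suc D)
  have "\<not> G 1 \<subseteq> P"
  proof
    assume "G 1 \<subseteq> P"
    hence "gdim P = 0" using gdim_zero_iff[OF gprimeD(1)[OF Suc.prems(1)]] irrelevant[OF gprimeD(2)[OF Suc.prems(1)]] by blast
    thus False using Suc.prems by simp
  qed
  then obtain x where x: "x \<in> G 1" "x \<notin> P" by auto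
  note hA = homogeneous_adjoin[OF gprimeD(1)[OF Suc.prems(1)] x(1)]
  have g: "gdim (adjoin P x) = Suc D" using gprime_adjoin(2)[OF Suc.prems(1) x] Suc.prems(2) by simp
  obtain Q where Q: "gprime Q" "adjoin P x \<subseteq> Q" "gdim Q = Suc D" using prime_attaining_gdim[OF hA g] by auto
  have "1 \<le> gdeg Q" using Suc.IH[OF Q(1,3)] .
  also have "\<dots> \<le> gdeg (adjoin P x)"
    unfolding gdeg_def g Q(3) using hpcoeff_mono[OF hA gprimeD(1)[OF Q(1)] Q(2), of D] g by (simp add: mult_left_mono)
  also have "\<dots> = gdeg P" using gprime_adjoin_gdeg[OF Suc.prems(1) x] Suc.prems(2) by simp
  finally show ?case .
qed

lemma gprime_prod:
  assumes "gprime Q" "\<And>a. a \<in> set as \<Longrightarrow> a \<in> Homogs \<and> a \<notin> Q"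
  shows "foldr (\<otimes>) as \<one> \<in> Homogs \<and> foldr (\<otimes>) as \<one> \<notin> Q"
  using assms(2)
proof (induction as)
  case Nil
  thus ?case using gprimeD(3)[OF assms(1)] Homogs_props(2) by simp
next
  case (Cons a as)
  have A: "a \<in> Homogs" "a \<notin> Q" using Cons.prems[of a] by auto
  have B: "foldr (\<otimes>) as \<one> \<in> Homogs" "foldr (\<otimes>) as \<one> \<notin> Q" using Cons by auto
  show ?case using gprimeD(4)[OF assms(1) A(1) B(1)] A B Homogs_props(3)[OF A(1) B(1)] by auto
qed

lemma gprime_over_decomposition:
  assumes Ps: "\<And>P. P \<in> set Ps \<Longrightarrow> gprime P" "\<forall>as. list_all2 (\<in>) as Ps \<longrightarrow> foldr (\<otimes>) as \<one> \<in> I"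
    and Q: "gprime Q" "I \<subseteq> Q"
  shows "\<exists>P\<in>set Ps. P \<subseteq> Q"
proof (rule ccontr)
  assume c: "\<not> ?thesis"
  have "\<exists>a\<in>Homogs. a \<in> P \<and> a \<notin> Q" if "P \<in> set Ps" for P
    using homogeneous_witness[OF gprimeD(1)[OF Ps(1)[OF that]] gprimeD(2)[OF Q(1)]] c that by blast
  then obtain a where a: "\<And>P. P \<in> set Ps \<Longrightarrow> a P \<in> Homogs \<and> a P \<in> P \<and> a P \<notin> Q" by metis
  have "list_all2 (\<in>) (map a Ps) Ps" using a by (auto simp: list_all2_conv_all_nth)
  hence "foldr (\<otimes>) (map a Ps) \<one> \<in> Q" using Ps(2) Q(2) by blast
  moreover have "foldr (\<otimes>) (map a Ps) \<one> \<notin> Q" using gprime_prod[OF Q(1), of "map a Ps"] a by auto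
  ultimately show False by simp
qed

text \<open>Homogeneous prime avoidance, applied to the primes of top dimension. The separating elements have different degrees, which are
  equalised by multiplication with powers of forms of degree one that lie outside the respective prime.\<close>

lemma parameter_exists:
  assumes I: "homogeneous I" and g: "gdim I = Suc s"
  shows "\<exists>t>0. \<exists>y\<in>G t. gdim (adjoin I y) \<le> s"
proof -
  obtain Ps where Ps: "\<forall>P\<in>set Ps. gprime P \<and> I \<subseteq> P" "\<forall>as. list_all2 (\<in>) as Ps \<longrightarrow> foldr (\<otimes>) as \<one> \<in> I"
    using gprime_decomposition[OF I] by auto
  define \<Q> where "\<Q> = {Q \<in> set Ps. gdim Q = Suc s}"
  have fin: "finite \<Q>" and Q: "\<And>Q. Q \<in> \<Q> \<Longrightarrow> gprime Q \<and> gdim Q = Suc s" unfolding \<Q>_def using Ps by auto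
  have "\<exists>f t. f \<in> G t \<and> f \<notin> P \<and> (\<forall>Q\<in>\<Q> - {P}. f \<in> Q)" if "P \<in> \<Q>" for P
    using incomparable_separation[of "\<Q> - {P}" "Suc s" P] fin Q that unfolding Homogs_def by blast
  then obtain f t where f: "\<And>P. P \<in> \<Q> \<Longrightarrow> f P \<in> G (t P) \<and> f P \<notin> P \<and> (\<forall>Q\<in>\<Q> - {P}. f P \<in> Q)" by metis
  have "\<exists>x. x \<in> G 1 \<and> x \<notin> P" if "P \<in> \<Q>" for P
  proof (rule ccontr)
    assume "\<nexists>x. x \<in> G 1 \<and> x \<notin> P"
    hence "\<forall>j\<ge>1. G j \<subseteq> P" using irrelevant gprimeD(2) Q[OF that] by blast
    hence "gdim P = 0" using gdim_zero_iff gprimeD(1) Q[OF that] by blast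
    thus False using Q[OF that] by simp
  qed
  then obtain x where x: "\<And>P. P \<in> \<Q> \<Longrightarrow> x P \<in> G 1 \<and> x P \<notin> P" by metis
  define T where "T = Suc (Max (insert 0 (t ` \<Q>)))"
  have tT: "t P \<le> T" if "P \<in> \<Q>" for P unfolding T_def using fin that by (simp add: le_SucI)
  define h where "h P = f P \<otimes> x P [^] (T - t P)" for P
  have hG: "h P \<in> G T" if "P \<in> \<Q>" for P
    unfolding h_def using G_mult[of "f P" "t P" "x P [^] (T - t P)" "T - t P"] f[OF that] G_pow x[OF that] tT[OF that] by auto
  have hn: "h P \<notin> P" if "P \<in> \<Q>" for P
  proof
    assume a: "h P \<in> P"
    have gP: "gprime P" using Q that by auto
    have "f P \<in> P \<or> x P [^] (T - t P) \<in> P"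
      using gprimeD(4)[OF gP, of "f P" "x P [^] (T - t P)"] Homogs_props(4) f[OF that] G_pow x[OF that] a unfolding h_def by blast
    thus False using gprime_pow[OF gP] f[OF that] x[OF that] by blast
  qed
  have hm: "h P \<in> Q" if "P \<in> \<Q>" "Q \<in> \<Q>" "P \<noteq> Q" for P Q
    unfolding h_def using f[OF that(1)] that idealD(7)[OF gprimeD(2)] Q G_carr[OF G_pow] x[OF that(1)] by auto
  define y where "y = (\<Oplus>P\<in>\<Q>. h P)"
  have "finite S \<Longrightarrow> S \<subseteq> \<Q> \<Longrightarrow> (\<Oplus>P\<in>S. h P) \<in> G T" for S
  proof (induction S rule: finite_induct)
    case (insert P S)
    hence "P \<in> \<Q>" "h \<in> S \<rightarrow> carrier R" using hG G_carr by blast+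
    thus ?case using insert hG G_add G_carr[OF hG] by (subst finsum_insert) auto
  qed (use G_zero in auto)
  hence yG: "y \<in> G T" unfolding y_def using fin by simp
  have yn: "y \<notin> P" if "P \<in> \<Q>" for P
    unfolding y_def by (rule avoid_by_sum[OF fin _ _ hn hm that]) (use Q gprimeD(2) G_carr[OF hG] in auto)
  have "gdim (adjoin I y) \<le> s"
  proof (rule gdim_le_primes[OF homogeneous_adjoin[OF I yG]])
    fix Q' assume Q': "gprime Q'" "adjoin I y \<subseteq> Q'"
    have yc: "y \<in> carrier R" using yG G_carr by auto
    have IQ: "I \<subseteq> Q'" "y \<in> Q'" using Q'(2) adjoin_incl[OF homD(1)[OF I] yc] adjoin_mem[OF homD(1)[OF I] yc] by auto
    have "\<exists>P\<in>set Ps. P \<subseteq> Q'" using gprime_over_decomposition[OF _ Ps(2) Q'(1) IQ(1)] Ps(1) by blast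
    then obtain P where P: "P \<in> set Ps" "P \<subseteq> Q'" by auto
    have gP: "gprime P" "I \<subseteq> P" using Ps(1) P(1) by auto
    have le: "gdim P \<le> Suc s" using gdim_mono[OF I gprimeD(1)[OF gP(1)] gP(2)] g by simp
    show "gdim Q' \<le> s"
    proof (cases "gdim P = Suc s")
      case True
      hence "P \<in> \<Q>" unfolding \<Q>_def using P by auto
      hence "P \<subset> Q'" using yn IQ(2) P(2) by auto
      thus ?thesis using gprime_strict[OF gP(1) Q'(1)] True by simp
    next
      case False
      thus ?thesis using gdim_mono[OF gprimeD(1)[OF gP(1)] gprimeD(1)[OF Q'(1)] P(2)] le by simp
    qed
  qed
  thus ?thesis using yG unfolding T_def by blast
qed

end

section \<open>Finiteness over a subalgebra of parameters\<close>

context std_graded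
begin

definition pos_homs :: "'a list \<Rightarrow> bool" where "pos_homs ys \<longleftrightarrow> (\<forall>y\<in>set ys. \<exists>t>0. y \<in> G t)"

lemma pos_homs_carrier: "pos_homs ys \<Longrightarrow> set ys \<subseteq> carrier R"
  unfolding pos_homs_def using G_carr by blast

lemma pos_homs_Homogs: "pos_homs ys \<Longrightarrow> set ys \<subseteq> Homogs"
  unfolding pos_homs_def using Homogs_props(4) by blast

lemma adjoin_list_homogeneous: "homogeneous I \<Longrightarrow> pos_homs ys \<Longrightarrow> homogeneous (adjoin_list I ys)"
proof (induction ys)
  case (Cons y ys)
  hence "homogeneous (adjoin_list I ys)" unfolding pos_homs_def by simp
  thus ?case using Cons.prems homogeneous_adjoin unfolding adjoin_list_def pos_homs_def by auto
qed (simp add: adjoin_list_def)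

lemma parameters_exist:
  assumes "homogeneous I" "gdim I \<le> s"
  shows "\<exists>ys. length ys \<le> s \<and> pos_homs ys \<and> gdim (adjoin_list I ys) = 0"
  using assms
proof (induction s arbitrary: I)
  case 0
  thus ?case by (intro exI[of _ "[]"]) (simp add: adjoin_list_def pos_homs_def)
next
  case (Suc s)
  show ?case
  proof (cases "gdim I = Suc s")
    case True
    then obtain t y where y: "t > 0" "y \<in> G t" "gdim (adjoin I y) \<le> s" using parameter_exists[OF Suc.prems(1)] by blast
    then obtain ys where ys: "length ys \<le> s" "pos_homs ys" "gdim (adjoin_list (adjoin I y) ys) = 0"
      using Suc.IH[OF homogeneous_adjoin[OF Suc.prems(1) y(2)] y(3)] by blast
    have "adjoin_list I (ys @ [y]) = adjoin_list (adjoin I y) ys" unfolding adjoin_list_def by simp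
    thus ?thesis using ys y by (intro exI[of _ "ys @ [y]"]) (auto simp: pos_homs_def)
  next
    case False
    hence "gdim I \<le> s" using Suc.prems by simp
    thus ?thesis using Suc.IH[OF Suc.prems(1)] le_SucI by blast
  qed
qed

lemma alg_pr:
  assumes Y: "Y \<subseteq> Homogs" and a: "a \<in> alg Y" shows "pr j a \<in> alg Y"
  using a
proof (induction arbitrary: j rule: alg.induct)
  case (const k)
  thus ?case using pr_same[of k 0] pr_other[of k 0 j] alg.const[of k Y] alg.const[OF K_sub(3)] by (cases "j = 0") auto
next
  case (gen y s)
  have Yc: "Y \<subseteq> carrier R" using Y Homogs_props(1) by auto
  obtain t where t: "y \<in> G t" using gen Y unfolding Homogs_def by auto
  have c: "s \<in> carrier R" "y \<in> carrier R" using gen(2) alg_carrier[OF Yc] t G_carr by auto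
  have "pr j (y \<otimes> s) = (if t \<le> j then y \<otimes> pr (j - t) s else \<zero>)"
    using pr_mult_homogeneous[OF c(1) t, of j] m_comm c pr_carr by auto
  thus ?case using alg.gen[OF gen(1) gen.IH] alg.const[OF K_sub(3)] by auto
next
  case (add s t)
  have Yc: "Y \<subseteq> carrier R" using Y Homogs_props(1) by auto
  have "pr j (s \<oplus> t) = pr j s \<oplus> pr j t" using add(1,2) alg_carrier[OF Yc] by (intro pr_add) auto
  thus ?case using alg.add add.IH by auto
qed

lemma alg_insert_split:
  assumes Y: "insert y Y \<subseteq> carrier R" and a: "a \<in> alg (insert y Y)"
  shows "\<exists>s\<in>alg Y. \<exists>s'\<in>alg (insert y Y). a = s \<oplus> y \<otimes> s'"
  using a
proof (induction rule: alg.induct)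
  case (const k)
  have "k = k \<oplus> y \<otimes> \<zero>" using const K_sub Y by auto
  thus ?case using alg.const[OF const] alg.const[OF K_sub(3)] by blast
next
  case (gen z s)
  note A = subsetD[OF alg_carrier[OF Y]] and B = subsetD[OF alg_carrier[of Y]]
  show ?case
  proof (cases "z = y")
    case True
    have "z \<otimes> s = \<zero> \<oplus> y \<otimes> s" using True A[OF gen(2)] Y by auto
    thus ?thesis using gen(2) alg.const[OF K_sub(3)] by blast
  next
    case False
    hence z: "z \<in> Y" using gen by auto
    obtain p q where pq: "p \<in> alg Y" "q \<in> alg (insert y Y)" "s = p \<oplus> y \<otimes> q" using gen.IH by auto
    have c: "p \<in> carrier R" "q \<in> carrier R" "z \<in> carrier R" "y \<in> carrier R" using A[OF pq(2)] B[OF _ pq(1)] z Y by auto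
    have "z \<otimes> s = z \<otimes> p \<oplus> y \<otimes> (z \<otimes> q)" using c pq(3) by (simp add: r_distr m_lcomm)
    moreover have "z \<otimes> p \<in> alg Y" "z \<otimes> q \<in> alg (insert y Y)" using alg.gen pq z by auto
    ultimately show ?thesis by blast
  qed
next
  case (add s t)
  obtain p q where pq: "p \<in> alg Y" "q \<in> alg (insert y Y)" "s = p \<oplus> y \<otimes> q" using add.IH by auto
  obtain p' q' where pq': "p' \<in> alg Y" "q' \<in> alg (insert y Y)" "t = p' \<oplus> y \<otimes> q'" using add.IH by auto
  have c: "p \<in> carrier R" "q \<in> carrier R" "p' \<in> carrier R" "q' \<in> carrier R" "y \<in> carrier R"
    using pq pq' alg_carrier[OF Y] alg_carrier[of Y] Y by auto
  have "s \<oplus> t = (p \<oplus> p') \<oplus> y \<otimes> (q \<oplus> q')" using c pq(3) pq'(3) by (simp only:) algebra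
  thus ?case using alg.add pq pq' by blast
qed

lemma algG_subsp: "Y \<subseteq> carrier R \<Longrightarrow> subsp (alg Y \<inter> G j)"
  by (intro subsp_int alg_subsp G_subsp)

lemma algG_fd: "Y \<subseteq> carrier R \<Longrightarrow> fd (alg Y \<inter> G j)"
  using fd_mono[OF G_fd algG_subsp] by auto

lemma algG_split:
  assumes Y: "insert y Y \<subseteq> Homogs" and y: "y \<in> G t" and a: "a \<in> alg (insert y Y) \<inter> G j"
  shows "if t \<le> j then a \<in> (alg Y \<inter> G j) <+> mul y (alg (insert y Y) \<inter> G (j - t)) else a \<in> alg Y \<inter> G j"
proof -
  have Yc: "insert y Y \<subseteq> carrier R" "Y \<subseteq> Homogs" "Y \<subseteq> carrier R" using Y Homogs_props(1) by auto
  obtain s s' where s: "s \<in> alg Y" "s' \<in> alg (insert y Y)" "a = s \<oplus> y \<otimes> s'"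
    using alg_insert_split[OF Yc(1), of a] a by blast
  have c: "s \<in> carrier R" "s' \<in> carrier R" "y \<in> carrier R" using s alg_carrier[OF Yc(1)] alg_carrier[OF Yc(3)] Yc by auto
  have "a = pr j a" using pr_same a by auto
  also have "\<dots> = pr j s \<oplus> pr j (s' \<otimes> y)" using s(3) c pr_add m_comm by simp
  also have "pr j (s' \<otimes> y) = (if t \<le> j then y \<otimes> pr (j - t) s' else \<zero>)"
    using pr_mult_homogeneous[OF c(2) y, of j] m_comm c pr_carr by auto
  finally have e: "a = pr j s \<oplus> (if t \<le> j then y \<otimes> pr (j - t) s' else \<zero>)" .
  have m: "pr j s \<in> alg Y \<inter> G j" "pr (j - t) s' \<in> alg (insert y Y) \<inter> G (j - t)"
    using alg_pr[OF Yc(2) s(1)] alg_pr[OF Y s(2)] pr_in c by auto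
  show ?thesis
  proof (cases "t \<le> j")
    case True
    thus ?thesis using e m unfolding set_add_mem mul_def by auto
  next
    case False
    thus ?thesis using e m pr_carr[OF c(1)] by auto
  qed
qed

lemma alg_empty: "alg {} = G 0"
proof
  show "G 0 \<subseteq> alg {}" using alg.const by auto
  show "alg {} \<subseteq> G 0"
  proof
    fix x assume "x \<in> alg {}"
    thus "x \<in> G 0" by (induction rule: alg.induct) (auto intro: G_add)
  qed
qed

lemma G_int_zero: "i \<noteq> j \<Longrightarrow> G i \<inter> G j = {\<zero>}"
  using pr_same pr_other G_zero by fastforce

text \<open>The number of monomials of degree \<open>i\<close> in \<open>k + 1\<close> variables of positive weights is at most \<open>(i + 1)\<^sup>k\<close>. A family of
  at most \<open>k + 1\<close> generators thus yields growth of order \<open>k\<close>.\<close>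

lemma algG_dim:
  assumes "pos_homs ys" "length ys \<le> Suc k" shows "d (alg (set ys) \<inter> G i) \<le> (i + 1) ^ k"
  using assms
proof (induction ys arbitrary: k i)
  case Nil
  have "d (alg {} \<inter> G i) \<le> 1"
  proof (cases "i = 0")
    case True
    thus ?thesis using alg_empty d_eq[OF dimension_one[OF subfield]] by simp
  next
    case False
    thus ?thesis using alg_empty G_int_zero[of 0 i] zero_space(2) by simp
  qed
  thus ?case by (metis add.commute le_add1 list.set(1) one_le_power order_trans)
next
  case (Cons y ys)
  obtain t where t: "t > 0" "y \<in> G t" using Cons.prems(1) unfolding pos_homs_def by auto
  have ph: "pos_homs ys" using Cons.prems(1) unfolding pos_homs_def by auto
  let ?A = "\<lambda>i. alg (set ys) \<inter> G i" and ?B = "\<lambda>i. alg (set (y # ys)) \<inter> G i"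
  have Yc: "set ys \<subseteq> carrier R" "set (y # ys) \<subseteq> carrier R" "set (y # ys) \<subseteq> Homogs" "insert y (set ys) \<subseteq> Homogs" "y \<in> carrier R"
    using pos_homs_carrier[OF Cons.prems(1)] pos_homs_Homogs[OF Cons.prems(1)] by auto
  have step: "d (?B i) \<le> d (?A i) + (if t \<le> i then d (?B (i - t)) else 0)" for i
  proof (cases "t \<le> i")
    case True
    have fm: "fd (mul y (?B (i - t)))" using mul_fd Yc algG_fd by blast
    have "?B i \<subseteq> ?A i <+> mul y (?B (i - t))" using algG_split[OF Yc(4) t(2), of _ i] True by auto
    hence "d (?B i) \<le> d (?A i <+> mul y (?B (i - t)))"
      using d_mono[OF sum_fd[OF algG_fd[OF Yc(1)] fm] algG_subsp[OF Yc(2)]] by blast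
    also have "\<dots> \<le> d (?A i) + d (mul y (?B (i - t)))" using d_sum[OF algG_fd[OF Yc(1)] fm, of i] by linarith
    also have "d (mul y (?B (i - t))) \<le> d (?B (i - t))" using mul_rank(2)[OF Yc(5) algG_fd[OF Yc(2)], of "i - t"] by linarith
    finally show ?thesis using True by simp
  next
    case False
    have "?B i \<subseteq> ?A i" using algG_split[OF Yc(4) t(2), of _ i] False by auto
    thus ?thesis using d_mono[OF algG_fd[OF Yc(1)] algG_subsp[OF Yc(2)]] False by auto
  qed
  show ?case
  proof (cases k)
    case 0
    hence ys: "ys = []" using Cons.prems by simp
    have A: "d (?A i) = (if i = 0 then 1 else 0)" for i
      using alg_empty d_eq[OF dimension_one[OF subfield]] zero_space(2) G_int_zero[of 0 i] ys by auto
    have "d (?B i) \<le> 1"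
    proof (induction i rule: less_induct)
      case (less i)
      show ?case using step[of i] A[of i] less[of "i - t"] t(1) by (cases "i = 0"; cases "t \<le> i") auto
    qed
    thus ?thesis using 0 by simp
  next
    case (Suc k')
    have A: "d (?A i) \<le> (i + 1) ^ k'" for i using Cons.IH[OF ph, of k' i] Cons.prems(2) Suc by simp
    have "d (?B i) \<le> (i + 1) ^ k"
    proof (induction i rule: less_induct)
      case (less i)
      show ?case
      proof (cases "t \<le> i")
        case True
        have "d (?B (i - t)) \<le> (i - t + 1) ^ k" using less[of "i - t"] t(1) True by simp
        also have "\<dots> \<le> i ^ k" using t(1) True by (intro power_mono) auto
        also have "\<dots> \<le> i * (i + 1) ^ k'" unfolding Suc power_Suc by (intro mult_left_mono power_mono) auto
        finally have "d (?B i) \<le> (i + 1) ^ k' + i * (i + 1) ^ k'" using step[of i] A[of i] True by simp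
        thus ?thesis using Suc by simp
      next
        case False
        have "(i + 1) ^ k' \<le> (i + 1) ^ k" using Suc by (intro power_increasing) auto
        thus ?thesis using step[of i] A[of i] False by simp
      qed
    qed
    thus ?thesis by simp
  qed
qed

definition weighted_term :: "'a set \<Rightarrow> 'a \<Rightarrow> nat \<Rightarrow> nat \<Rightarrow> 'a set" where
  "weighted_term Y w c j = (if c \<le> j then mul w (alg Y \<inter> G (j - c)) else {\<zero>})"

text \<open>The span in degree \<open>j\<close> of the module generated over the subalgebra of \<open>Y\<close> by the elements \<open>w\<close> of degree \<open>c\<close>, for the pairs
  \<open>(w, c)\<close> in \<open>W\<close>; \<open>weighted_term\<close> is the contribution of one pair.\<close>

definition weighted_span :: "'a set \<Rightarrow> ('a \<times> nat) list \<Rightarrow> nat \<Rightarrow> 'a set" where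
  "weighted_span Y W j = foldr (\<lambda>(w, c) V. weighted_term Y w c j <+> V) W {\<zero>}"

definition weighted_list :: "('a \<times> nat) list \<Rightarrow> bool" where "weighted_list W \<longleftrightarrow> (\<forall>(w, c)\<in>set W. w \<in> G c)"

lemma weighted_term_props:
  assumes "Y \<subseteq> carrier R" "w \<in> G c"
  shows "fd (weighted_term Y w c j)" "weighted_term Y w c j \<subseteq> G j"
proof -
  have wc: "w \<in> carrier R" using assms G_carr by auto
  show "fd (weighted_term Y w c j)" unfolding weighted_term_def using mul_fd[OF wc algG_fd[OF assms(1)]] zero_space by auto
  show "weighted_term Y w c j \<subseteq> G j" unfolding weighted_term_def mul_def using G_mult[OF assms(2), of _ "j - c"] G_zero by auto
qed

lemma weighted_span_props:
  assumes "Y \<subseteq> carrier R" "weighted_list W"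
  shows "fd (weighted_span Y W j)" "weighted_span Y W j \<subseteq> G j"
proof -
  have "fd (weighted_span Y W j) \<and> weighted_span Y W j \<subseteq> G j"
    using assms(2)
  proof (induction W)
    case Nil
    thus ?case unfolding weighted_span_def using zero_space G_zero by simp
  next
    case (Cons a W)
    obtain w c where a: "a = (w, c)" by (cases a)
    have w: "w \<in> G c" "weighted_list W" using Cons.prems a unfolding weighted_list_def by auto
    have ih: "fd (weighted_span Y W j)" "weighted_span Y W j \<subseteq> G j" using Cons.IH[OF w(2)] by auto
    have "weighted_span Y (a # W) j = weighted_term Y w c j <+> weighted_span Y W j" unfolding weighted_span_def a by simp
    thus ?case using sum_fd weighted_term_props[OF assms(1) w(1)] ih set_add_least[OF G_subsp] by simp
  qed
  thus "fd (weighted_span Y W j)" "weighted_span Y W j \<subseteq> G j" by auto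
qed

lemma weighted_span_Cons: "weighted_span Y ((w, c) # W) j = weighted_term Y w c j <+> weighted_span Y W j" unfolding weighted_span_def by simp

lemma weighted_span_mem:
  assumes "Y \<subseteq> carrier R" "weighted_list W" "(w, c) \<in> set W" "c \<le> j" "s \<in> alg Y \<inter> G (j - c)"
  shows "w \<otimes> s \<in> weighted_span Y W j"
  using assms(2,3)
proof (induction W)
  case (Cons a W)
  obtain w' c' where a: "a = (w', c')" by (cases a)
  have w: "w' \<in> G c'" "weighted_list W" using Cons.prems a unfolding weighted_list_def by auto
  note ge = set_add_ge[OF fd_subsp[OF weighted_term_props(1)[OF assms(1) w(1)]] fd_subsp[OF weighted_span_props(1)[OF assms(1) w(2)]]]
  show ?case
  proof (cases "(w, c) = a")
    case True
    hence "w \<otimes> s \<in> weighted_term Y w' c' j" unfolding weighted_term_def mul_def a using assms(4,5) by auto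
    thus ?thesis unfolding a weighted_span_Cons using ge by blast
  next
    case False
    hence "w \<otimes> s \<in> weighted_span Y W j" using Cons.IH[OF w(2)] Cons.prems(2) by auto
    thus ?thesis unfolding a weighted_span_Cons using ge by blast
  qed
qed simp

lemma weighted_span_mul:
  assumes Y: "Y \<subseteq> carrier R" and y: "y \<in> Y" "y \<in> G t" and W: "weighted_list W" and v: "v \<in> weighted_span Y W k"
  shows "y \<otimes> v \<in> weighted_span Y W (k + t)"
  using W v
proof (induction W arbitrary: v)
  case Nil
  thus ?case unfolding weighted_span_def using G_carr[OF y(2)] by simp
next
  case (Cons a W)
  obtain w c where a: "a = (w, c)" by (cases a)
  have w: "w \<in> G c" "weighted_list W" using Cons.prems a unfolding weighted_list_def by auto
  obtain p q where pq: "p \<in> weighted_term Y w c k" "q \<in> weighted_span Y W k" "v = p \<oplus> q"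
    using Cons.prems(2) unfolding a weighted_span_Cons set_add_mem by auto
  have c: "p \<in> carrier R" "q \<in> carrier R" "y \<in> carrier R" "w \<in> carrier R"
    using weighted_term_props(2)[OF Y w(1)] weighted_span_props(2)[OF Y w(2)] pq G_sub G_carr[OF y(2)] G_carr[OF w(1)] by blast+
  have "y \<otimes> p \<in> weighted_term Y w c (k + t)"
  proof (cases "c \<le> k")
    case True
    then obtain s where s: "s \<in> alg Y \<inter> G (k - c)" "p = w \<otimes> s" using pq(1) unfolding weighted_term_def mul_def by auto
    have sc: "s \<in> carrier R" using s G_carr by auto
    have "y \<otimes> p = w \<otimes> (y \<otimes> s)" using s(2) c sc m_lcomm by simp
    moreover have "y \<otimes> s \<in> alg Y" using alg.gen y(1) s by auto
    moreover have "y \<otimes> s \<in> G (k + t - c)" using G_mult[OF y(2), of s "k - c"] s True by (simp add: add.commute)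
    ultimately show ?thesis unfolding weighted_term_def mul_def using True by auto
  next
    case False
    hence "p = \<zero>" using pq(1) unfolding weighted_term_def by auto
    thus ?thesis using c subspD(2)[OF fd_subsp[OF weighted_term_props(1)[OF Y w(1)]]] by simp
  qed
  moreover have "y \<otimes> v = y \<otimes> p \<oplus> y \<otimes> q" using pq(3) c by (simp add: r_distr)
  ultimately show ?case using Cons.IH[OF w(2) pq(2)] unfolding a weighted_span_Cons set_add_mem by blast
qed

text \<open>Graded Nakayama: if the quotient by \<open>ys\<close> is finite-dimensional, then the algebra is finite
  over the subalgebra generated by \<open>ys\<close>, modulo \<open>I\<close>.\<close>

lemma finite_over_parameters:
  assumes I: "homogeneous I" and ys: "pos_homs ys" and g: "gdim (adjoin_list I ys) = 0"
  shows "\<exists>W. weighted_list W \<and> (\<forall>j. G j \<subseteq> weighted_span (set ys) W j <+> (I \<inter> G j))"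
proof -
  let ?Y = "set ys"
  have Y: "?Y \<subseteq> carrier R" using pos_homs_carrier ys by auto
  obtain N0 where N0: "\<forall>j\<ge>N0. G j \<subseteq> adjoin_list I ys" using gdim_zero_iff[OF adjoin_list_homogeneous[OF I ys]] g by auto
  obtain t where t: "\<And>y. y \<in> ?Y \<Longrightarrow> t y > 0 \<and> y \<in> G (t y)" using ys unfolding pos_homs_def by metis
  define N where "N = Max (insert N0 (t ` ?Y))"
  have N: "N0 \<le> N" "\<And>y. y \<in> ?Y \<Longrightarrow> t y \<le> N" unfolding N_def by auto
  obtain B where B: "\<And>i. set (B i) \<subseteq> G i \<and> Span (G 0) (B i) = G i" using fd_base[OF G_fd] by metis
  \<comment> \<open>bases of all components of degree less than \<open>N\<close> generate the module\<close>
  define W where "W = concat (map (\<lambda>i. map (\<lambda>w. (w, i)) (B i)) [0..<N])"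
  have W: "weighted_list W" unfolding weighted_list_def W_def using B by auto
  have sS: "subsp (weighted_span ?Y W j)" for j using fd_subsp weighted_span_props(1)[OF Y W] by auto
  have sI: "subsp (I \<inter> G j)" for j using subsp_int homogeneous_subsp[OF I] G_subsp by auto
  have sV: "subsp (weighted_span ?Y W j <+> (I \<inter> G j))" for j
    using fd_subsp[OF sum_fd[OF weighted_span_props(1)[OF Y W]]] fd_mono[OF G_fd sI] by blast
  have "G j \<subseteq> weighted_span ?Y W j <+> (I \<inter> G j)" for j
  proof (induction j rule: less_induct)
    case (less j)
    note ge = set_add_ge[OF sS sI, of j]
    show ?case
    proof (cases "j < N")
      case True
      have "set (B j) \<subseteq> weighted_span ?Y W j"
      proof
        fix w assume w: "w \<in> set (B j)"
        hence "(w, j) \<in> set W" unfolding W_def using True by auto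
        moreover have "\<one> \<in> alg ?Y \<inter> G (j - j)" using alg.const[OF K_sub(2)] one_G by auto
        ultimately have "w \<otimes> \<one> \<in> weighted_span ?Y W j" using weighted_span_mem[OF Y W] by blast
        moreover have "w \<in> carrier R" using B w G_carr by blast
        ultimately show "w \<in> weighted_span ?Y W j" by simp
      qed
      hence "Span (G 0) (B j) \<subseteq> weighted_span ?Y W j" using subalgebra_Span_incl[OF subfield sS] by blast
      thus ?thesis using B[of j] ge by blast
    next
      case False
      have "G j \<inter> adjoin_list I zs \<subseteq> weighted_span ?Y W j <+> (I \<inter> G j)" if "set zs \<subseteq> ?Y" for zs
        using that
      proof (induction zs)
        case Nil
        thus ?case unfolding adjoin_list_def using ge by auto
      next
        case (Cons y zs)
        have yY: "y \<in> ?Y" using Cons.prems by simp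
        have y: "y \<in> ?Y" "y \<in> G (t y)" "0 < t y" "t y \<le> j" using yY t[OF yY] N(2)[OF yY] False by auto
        have phz: "pos_homs zs" using ys Cons.prems unfolding pos_homs_def by auto
        define k where "k = j - t y"
        have k: "j = k + t y" "k < j" using y unfolding k_def by auto
        have "adjoin_list I (y # zs) = adjoin (adjoin_list I zs) y" unfolding adjoin_list_def by simp
        hence e: "G j \<inter> adjoin_list I (y # zs) = (G j \<inter> adjoin_list I zs) <+> mul y (G k)"
          using adjoin_component[OF adjoin_list_homogeneous[OF I phz] y(2), of k] k(1) by simp
        have "mul y (G k) \<subseteq> weighted_span ?Y W j <+> (I \<inter> G j)"
        proof
          fix b assume "b \<in> mul y (G k)"
          then obtain g where g: "g \<in> G k" "b = y \<otimes> g" unfolding mul_def by auto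
          have "g \<in> weighted_span ?Y W k <+> (I \<inter> G k)" using less.IH[OF k(2)] g(1) by blast
          then obtain p q where pq: "p \<in> weighted_span ?Y W k" "q \<in> I \<inter> G k" "g = p \<oplus> q"
            unfolding set_add_mem by blast
          have c: "p \<in> carrier R" "q \<in> carrier R" "y \<in> carrier R"
            using weighted_span_props(2)[OF Y W] pq G_sub y(2) by blast+
          have "y \<otimes> p \<in> weighted_span ?Y W j" using weighted_span_mul[OF Y y(1,2) W pq(1)] k(1) by simp
          moreover have "y \<otimes> q \<in> I \<inter> G j"
            using idealD(6)[OF homD(1)[OF I], of q y] pq(2) c(3) G_mult[OF y(2), of q k] k(1) by (simp add: add.commute)
          moreover have "b = y \<otimes> p \<oplus> y \<otimes> q" using g(2) pq(3) c by (simp add: r_distr)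
          ultimately show "b \<in> weighted_span ?Y W j <+> (I \<inter> G j)" unfolding set_add_mem by blast
        qed
        moreover have "G j \<inter> adjoin_list I zs \<subseteq> weighted_span ?Y W j <+> (I \<inter> G j)" using Cons by auto
        ultimately show ?case unfolding e by (intro set_add_least[OF sV])
      qed
      from this[OF order_refl] show ?thesis using N0 N(1) False by (meson Int_greatest le_trans not_le_imp_less order_refl subset_trans)
    qed
  qed
  thus ?thesis using W by blast
qed

lemma H_le_weighted_span:
  assumes J: "homogeneous J" and Y: "Y \<subseteq> carrier R" and W: "weighted_list W" and le: "G j \<subseteq> weighted_span Y W j <+> (J \<inter> G j)"
  shows "H J j \<le> (\<Sum>(w, c)\<leftarrow>W. if c \<le> j then dim_mod (alg Y \<inter> G (j - c)) J else 0)"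
proof -
  note sJ = homogeneous_subsp[OF J]
  have fJ: "fd (J \<inter> G j)" using fd_mono[OF G_fd subsp_int[OF sJ G_subsp]] by auto
  have "dim_mod (weighted_span Y W j) J \<le> (\<Sum>(w, c)\<leftarrow>W. if c \<le> j then dim_mod (alg Y \<inter> G (j - c)) J else 0)"
    using W
  proof (induction W)
    case Nil
    have "dim_mod {\<zero>} J = 0" using dim_mod_le[of "{\<zero>}" J] zero_space(2) by simp
    thus ?case by (simp add: weighted_span_def)
  next
    case (Cons a W)
    obtain w c where a: "a = (w, c)" by (cases a)
    have w: "w \<in> G c" "weighted_list W" using Cons.prems a unfolding weighted_list_def by auto
    have "dim_mod (weighted_term Y w c j) J \<le> (if c \<le> j then dim_mod (alg Y \<inter> G (j - c)) J else 0)"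
      unfolding weighted_term_def using dim_mod_mul_le[OF G_carr[OF w(1)] algG_fd[OF Y] homD(1)[OF J]] dim_mod_le[of "{\<zero>}" J] zero_space(2) by simp
    moreover have "dim_mod (weighted_span Y (a # W) j) J \<le> dim_mod (weighted_term Y w c j) J + dim_mod (weighted_span Y W j) J"
      unfolding a weighted_span_Cons using dim_mod_sum[OF weighted_term_props(1)[OF Y w(1)] weighted_span_props(1)[OF Y w(2)] sJ] .
    ultimately show ?case using Cons.IH[OF w(2)] a by simp
  qed
  moreover have "dim_mod (J \<inter> G j) J = 0"
  proof -
    have "J \<inter> G j \<inter> J = J \<inter> G j" by auto
    thus ?thesis unfolding dim_mod_def by simp
  qed
  moreover have "dim_mod (G j) J \<le> dim_mod (weighted_span Y W j <+> (J \<inter> G j)) J"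
    using dim_mod_mono[OF sum_fd[OF weighted_span_props(1)[OF Y W] fJ] G_subsp le sJ] .
  moreover have "\<dots> \<le> dim_mod (weighted_span Y W j) J + dim_mod (J \<inter> G j) J" using dim_mod_sum[OF weighted_span_props(1)[OF Y W] fJ sJ] .
  ultimately show ?thesis unfolding H_def by linarith
qed

end

section \<open>The principal ideal theorem for graded algebras\<close>

context cring
begin

lemma cross_difference:
  assumes "s \<in> carrier R" "p \<in> carrier R" "f \<in> carrier R" "x \<in> carrier R" "g \<in> carrier R"
    "A \<in> carrier R" "B \<in> carrier R" "q \<in> carrier R" "r \<in> carrier R"
    and e: "s \<otimes> f = A \<oplus> q" "s \<otimes> g = B \<oplus> r"
  shows "p \<otimes> A \<oplus> (\<ominus> x) \<otimes> B = s \<otimes> (p \<otimes> f \<ominus> x \<otimes> g) \<ominus> p \<otimes> q \<oplus> x \<otimes> r"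
proof -
  have "s \<otimes> (p \<otimes> f \<ominus> x \<otimes> g) = p \<otimes> (s \<otimes> f) \<ominus> x \<otimes> (s \<otimes> g)"
    using assms(1-5) by algebra
  also have "\<dots> = p \<otimes> (A \<oplus> q) \<ominus> x \<otimes> (B \<oplus> r)" by (simp only: e)
  finally have *: "s \<otimes> (p \<otimes> f \<ominus> x \<otimes> g) = p \<otimes> (A \<oplus> q) \<ominus> x \<otimes> (B \<oplus> r)" .
  show ?thesis unfolding * using assms(1-9) by algebra
qed

text \<open>The \<open>S\<close>-module spanned by \<open>F\<close>, modulo \<open>P\<close>.\<close>

definition span_mod :: "'a set \<Rightarrow> 'a set \<Rightarrow> 'a list \<Rightarrow> 'a set" where
  "span_mod S P F = {a. \<exists>Ks q. set Ks \<subseteq> S \<and> length Ks = length F \<and> q \<in> P \<and> a = combine Ks F \<oplus> q}"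

text \<open>In the application \<open>S'\<close> is generated by parameters modulo \<open>P + (x)\<close>, and \<open>S\<close> by \<open>S'\<close> and \<open>x\<close>, so that \<open>R/P\<close> is
  a finite module over \<open>S/P\<close>. Modulo \<open>P\<close> the ring \<open>S\<close> behaves like the polynomial ring \<open>S'[x]\<close>: elements have a constant term, and \<open>triv\<close>
  says that no nonzero constant is divisible by \<open>x\<close>.\<close>

context
  fixes P S S' :: "'a set" and x :: 'a
  assumes P: "primeideal P R" and S: "subring S R" and S': "S' \<subseteq> S" and x: "x \<in> S" "x \<notin> P"
    and split: "\<And>a. a \<in> S \<Longrightarrow> \<exists>s\<in>S'. \<exists>t\<in>S. a = s \<oplus> x \<otimes> t"
    and S'mult: "\<And>a b. a \<in> S' \<Longrightarrow> b \<in> S' \<Longrightarrow> a \<otimes> b \<in> S'"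
    and triv: "S' \<inter> adjoin P x \<subseteq> P"
begin

lemma idP: "ideal P R" using primeideal.axioms(1)[OF P] .

lemmas PD = idealD[OF idP]

lemma P_prime: "a \<in> carrier R \<Longrightarrow> b \<in> carrier R \<Longrightarrow> a \<otimes> b \<in> P \<Longrightarrow> a \<in> P \<or> b \<in> P"
  using primeideal.I_prime[OF P] .

lemma one_P: "\<one> \<notin> P" using ideal.one_imp_carrier[OF idP] primeideal.I_notcarr[OF P] by auto

lemma Sc: "a \<in> S \<Longrightarrow> a \<in> carrier R" using subringE(1)[OF S] by auto

lemma SL: "set Ks \<subseteq> S \<Longrightarrow> set Ks \<subseteq> carrier R" using Sc by auto

lemma map2_S:
  assumes "set Ks \<subseteq> S" "set Ls \<subseteq> S" shows "set (map2 (\<oplus>) Ks Ls) \<subseteq> S"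
proof
  fix z assume "z \<in> set (map2 (\<oplus>) Ks Ls)"
  then obtain a b where "(a, b) \<in> set (zip Ks Ls)" "z = a \<oplus> b" by auto
  thus "z \<in> S" using set_zip_leftD set_zip_rightD subringE(7)[OF S] assms by (metis subsetD)
qed

lemma span_mod_add:
  assumes "set F \<subseteq> carrier R" "a \<in> span_mod S P F" "b \<in> span_mod S P F" shows "a \<oplus> b \<in> span_mod S P F"
proof -
  obtain Ks q where 1: "set Ks \<subseteq> S" "length Ks = length F" "q \<in> P" "a = combine Ks F \<oplus> q"
    using assms(2) unfolding span_mod_def by blast
  obtain Ls r where 2: "set Ls \<subseteq> S" "length Ls = length F" "r \<in> P" "b = combine Ls F \<oplus> r"
    using assms(3) unfolding span_mod_def by blast
  have c: "combine Ks F \<in> carrier R" "combine Ls F \<in> carrier R" "q \<in> carrier R" "r \<in> carrier R"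
    using 1 2 SL assms(1) PD(1) by auto
  have "a \<oplus> b = (combine Ks F \<oplus> combine Ls F) \<oplus> (q \<oplus> r)" using c 1 2 by (simp only:) algebra
  also have "combine Ks F \<oplus> combine Ls F = combine (map2 (\<oplus>) Ks Ls) F"
    using combine_add[of Ks F Ls] 1 2 SL assms(1) by auto
  finally show ?thesis unfolding span_mod_def
    using map2_S[OF 1(1) 2(1)] 1 2 PD(3)[OF 1(3) 2(3)] by (intro CollectI exI[of _ "map2 (\<oplus>) Ks Ls"] exI[of _ "q \<oplus> r"]) auto
qed

lemma span_mod_smult:
  assumes "set F \<subseteq> carrier R" "a \<in> span_mod S P F" "s \<in> S" shows "s \<otimes> a \<in> span_mod S P F"
proof -
  obtain Ks q where 1: "set Ks \<subseteq> S" "length Ks = length F" "q \<in> P" "a = combine Ks F \<oplus> q"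
    using assms(2) unfolding span_mod_def by blast
  have c: "combine Ks F \<in> carrier R" "q \<in> carrier R" "s \<in> carrier R" using 1 SL assms Sc PD(1) by auto
  have "s \<otimes> a = combine (map ((\<otimes>) s) Ks) F \<oplus> s \<otimes> q"
    using 1 c combine_r_distr[OF SL[OF 1(1)] assms(1) c(3)] by (simp add: r_distr)
  moreover have "set (map ((\<otimes>) s) Ks) \<subseteq> S" using 1(1) subringE(6)[OF S assms(3)] by auto
  ultimately show ?thesis unfolding span_mod_def using 1 PD(6)[OF 1(3) c(3)]
    by (intro CollectI exI[of _ "map ((\<otimes>) s) Ks"] exI[of _ "s \<otimes> q"]) auto
qed

lemma span_mod_Cons: "set F \<subseteq> carrier R \<Longrightarrow> w \<in> carrier R \<Longrightarrow> span_mod S P F \<subseteq> span_mod S P (w # F)"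
proof
  fix a assume F: "set F \<subseteq> carrier R" "w \<in> carrier R" and "a \<in> span_mod S P F"
  then obtain Ks q where 1: "set Ks \<subseteq> S" "length Ks = length F" "q \<in> P" "a = combine Ks F \<oplus> q"
    unfolding span_mod_def by blast
  have "combine Ks F \<in> carrier R" using 1 SL F by auto
  hence "combine (\<zero> # Ks) (w # F) = combine Ks F" using F by simp
  thus "a \<in> span_mod S P (w # F)" unfolding span_mod_def using 1 subringE(2)[OF S]
    by (intro CollectI exI[of _ "\<zero> # Ks"] exI[of _ q]) auto
qed

definition indep_mod :: "'a list \<Rightarrow> bool" where
  "indep_mod F \<longleftrightarrow> (\<forall>Ks. set Ks \<subseteq> S \<and> length Ks = length F \<and> combine Ks F \<in> P \<longrightarrow> set Ks \<subseteq> P)"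

text \<open>A maximal independent subfamily of a finite generating family spans a free submodule that
  contains a nonzero multiple of everything.\<close>

lemma free_submodule:
  assumes "set W \<subseteq> carrier R"
  shows "\<exists>F s. set F \<subseteq> carrier R \<and> indep_mod F \<and> s \<in> S \<and> s \<notin> P \<and> (\<forall>w\<in>set W. s \<otimes> w \<in> span_mod S P F)"
  using assms
proof (induction W)
  case Nil
  show ?case using subringE(3)[OF S] one_P by (intro exI[of _ "[]"] exI[of _ \<one>]) (auto simp: indep_mod_def)
next
  case (Cons w W)
  then obtain F s where F: "set F \<subseteq> carrier R" "indep_mod F" and s: "s \<in> S" "s \<notin> P"
    and sW: "\<forall>w\<in>set W. s \<otimes> w \<in> span_mod S P F" by auto
  have wc: "w \<in> carrier R" and Wc: "set W \<subseteq> carrier R" using Cons.prems by auto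
  show ?case
  proof (cases "\<exists>r\<in>S. r \<notin> P \<and> r \<otimes> w \<in> span_mod S P F")
    case True
    then obtain r where r: "r \<in> S" "r \<notin> P" "r \<otimes> w \<in> span_mod S P F" by auto
    have rs: "r \<otimes> s \<in> S" "r \<otimes> s \<notin> P" using r s subringE(6)[OF S] P_prime[of r s] Sc by auto
    have "(r \<otimes> s) \<otimes> v \<in> span_mod S P F" if "v \<in> set (w # W)" for v
    proof (cases "v = w")
      case True
      have "(r \<otimes> s) \<otimes> w = s \<otimes> (r \<otimes> w)" using r s Sc wc by (simp add: m_ac)
      thus ?thesis using span_mod_smult[OF F(1) r(3) s(1)] True by simp
    next
      case False
      have v: "v \<in> set W" "v \<in> carrier R" using that False Wc by auto
      have "(r \<otimes> s) \<otimes> v = r \<otimes> (s \<otimes> v)" using r s Sc v by (simp add: m_ac)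
      thus ?thesis using span_mod_smult[OF F(1) bspec[OF sW v(1)] r(1)] by simp
    qed
    thus ?thesis using F rs by blast
  next
    case False
    have "indep_mod (w # F)"
      unfolding indep_mod_def
    proof (intro allI impI)
      fix Ks assume *: "set Ks \<subseteq> S \<and> length Ks = length (w # F) \<and> combine Ks (w # F) \<in> P"
      then obtain k Ls where k: "Ks = k # Ls" "length Ls = length F" by (cases Ks) auto
      have kS: "k \<in> S" "set Ls \<subseteq> S" using * k by auto
      have kc: "k \<in> carrier R" "combine Ls F \<in> carrier R" using kS Sc SL F by auto
      have m: "k \<otimes> w \<oplus> combine Ls F \<in> P" using * k by simp
      have neg: "set (map ((\<otimes>) (\<ominus> \<one>)) Ls) \<subseteq> S" using kS(2) subringE(3,5,6)[OF S] by auto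
      have "combine (map ((\<otimes>) (\<ominus> \<one>)) Ls) F = \<ominus> \<one> \<otimes> combine Ls F"
        using combine_r_distr[OF SL[OF kS(2)] F(1), of "\<ominus> \<one>"] by simp
      hence "k \<otimes> w = combine (map ((\<otimes>) (\<ominus> \<one>)) Ls) F \<oplus> (k \<otimes> w \<oplus> combine Ls F)"
        using kc wc by (simp only:) algebra
      hence "k \<otimes> w \<in> span_mod S P F" unfolding span_mod_def using neg m k(2)
        by (intro CollectI exI[of _ "map ((\<otimes>) (\<ominus> \<one>)) Ls"] exI[of _ "k \<otimes> w \<oplus> combine Ls F"]) auto
      hence kP: "k \<in> P" using False kS by blast
      have "combine Ls F \<in> P"
        using ideal_cancel_r[OF idP, of "combine Ls F" "k \<otimes> w"] m PD(7)[OF kP wc] kc wc by (simp add: a_comm)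
      hence "set Ls \<subseteq> P" using F(2) kS k unfolding indep_mod_def by blast
      thus "set Ks \<subseteq> P" using kP k by simp
    qed
    moreover have "s \<otimes> v \<in> span_mod S P (w # F)" if "v \<in> set (w # W)" for v
    proof (cases "v = w")
      case True
      have z: "combine (replicate (length F) \<zero>) F = \<zero>" using combine_replicate[OF F(1)] .
      have "s \<otimes> w = combine (s # replicate (length F) \<zero>) (w # F) \<oplus> \<zero>" using s Sc wc z by simp
      thus ?thesis unfolding span_mod_def True using s subringE(2)[OF S] PD(2)
        by (intro CollectI exI[of _ "s # replicate (length F) \<zero>"] exI[of _ \<zero>]) (auto dest: in_set_replicate[THEN iffD1])
    next
      case False
      thus ?thesis using that sW span_mod_Cons[OF F(1) wc] by auto
    qed
    ultimately show ?thesis using F s wc by (intro exI[of _ "w # F"] exI[of _ s]) auto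
  qed
qed

text \<open>In \<open>S'[x]\<close> the element \<open>x\<close> is prime to every constant \<open>q\<close>: if \<open>x\<^sup>i\<close> divides \<open>q \<otimes> \<phi>\<close> and \<open>q\<close> is not zero, then it divides
  \<open>\<phi>\<close>. The constant term of \<open>\<phi>\<close> must vanish, and induction applies to the quotient by \<open>x\<close>.\<close>

lemma x_adic:
  assumes q: "q \<in> S'" "q \<notin> P"
  shows "\<phi> \<in> S \<Longrightarrow> \<gamma> \<in> S \<Longrightarrow> q \<otimes> \<phi> \<ominus> x [^] (i::nat) \<otimes> \<gamma> \<in> P \<Longrightarrow> \<exists>\<psi>\<in>S. \<phi> \<ominus> x [^] i \<otimes> \<psi> \<in> P"
proof (induction i arbitrary: \<phi>)
  case 0
  have "\<phi> \<ominus> x [^] (0::nat) \<otimes> \<phi> = \<zero>" using Sc[OF 0(1)] by (simp add: a_minus_def r_neg)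
  thus ?case using 0(1) PD(2) by metis
next
  case (Suc i)
  obtain s t where st: "s \<in> S'" "t \<in> S" "\<phi> = s \<oplus> x \<otimes> t" using split[OF Suc.prems(1)] by blast
  have c: "s \<in> carrier R" "t \<in> carrier R" "x \<in> carrier R" "\<gamma> \<in> carrier R" "q \<in> carrier R" "x [^] i \<in> carrier R"
    using st S' Sc x Suc.prems q by auto
  let ?u = "q \<otimes> \<phi> \<ominus> x [^] Suc i \<otimes> \<gamma>" and ?v = "q \<otimes> t \<ominus> x [^] i \<otimes> \<gamma>"
  have xs: "x [^] Suc i = x \<otimes> x [^] i" using c m_comm by simp
  have "q \<otimes> s = ?u \<oplus> (\<ominus> ?v) \<otimes> x" unfolding xs st(3) using c by algebra
  hence "q \<otimes> s \<in> adjoin P x" unfolding adjoin_iff using Suc.prems(3) c by blast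
  hence qs: "q \<otimes> s \<in> S \<and> q \<otimes> s \<in> adjoin P x" using subringE(6)[OF S] st q S' by blast
  have sP: "s \<in> P"
    using qs triv P_prime[OF c(5) c(1)] q st S'mult[OF q(1) st(1)] by blast
  have "x \<otimes> ?v = ?u \<ominus> q \<otimes> s" unfolding xs st(3) using c by algebra
  also have "\<dots> \<in> P" using PD(5,6) Suc.prems(3) sP c by simp
  finally have "?v \<in> P" using P_prime[of x ?v] c x by simp
  then obtain \<psi> where p: "\<psi> \<in> S" "t \<ominus> x [^] i \<otimes> \<psi> \<in> P" using Suc.IH[OF st(2) Suc.prems(2)] by blast
  have pc: "\<psi> \<in> carrier R" using p Sc by auto
  have "\<phi> \<ominus> x [^] Suc i \<otimes> \<psi> = s \<oplus> x \<otimes> (t \<ominus> x [^] i \<otimes> \<psi>)" unfolding xs st(3) using c pc by algebra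
  also have "\<dots> \<in> P" using PD(3,6) sP p c by simp
  finally show ?case using p by blast
qed

text \<open>Modulo \<open>P\<close> let \<open>p f = g x\<close>. A fixed \<open>s\<close> carries \<open>R\<close> into a free module over \<open>S\<close> (\<open>free_submodule\<close>). There
  \<open>p\<^sup>i (s f\<^sup>i) = x\<^sup>i (s g\<^sup>i)\<close>, and comparing coordinates, \<open>x\<^sup>i\<close> divides \<open>s f\<^sup>i\<close> for every \<open>i\<close>. So the powers of
  the fraction \<open>f / x\<close> have the common denominator \<open>s\<close>. The quotients \<open>s f\<^sup>i / x\<^sup>i\<close> generate an ideal that is finitely
  generated, and a relation that expresses one of them by the previous ones is an integral equation for \<open>f / x\<close>; multiplied
  by a power of \<open>x\<close> it says that a power of \<open>f\<close> is divisible by \<open>x\<close>.\<close>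

lemma nilpotent_mod_x:
  assumes noeth: "noetherian_ring R"
    and W: "set W \<subseteq> carrier R" "\<And>a. a \<in> carrier R \<Longrightarrow> a \<in> span_mod S P W"
    and p: "p \<in> S'" "p \<notin> P" and one: "\<one> \<in> S'" and f: "f \<in> carrier R" "p \<otimes> f \<in> adjoin P x"
  shows "\<exists>n::nat. f [^] n \<in> adjoin P x"
proof -
  interpret noetherian_ring R by fact
  obtain F s where F: "set F \<subseteq> carrier R" "indep_mod F" and s: "s \<in> S" "s \<notin> P"
    and sW: "\<forall>w\<in>set W. s \<otimes> w \<in> span_mod S P F" using free_submodule[OF W(1)] by blast
  have sa: "s \<otimes> a \<in> span_mod S P F" if a: "a \<in> carrier R" for a
  proof -
    have zF: "\<zero> \<in> span_mod S P F"
      unfolding span_mod_def using combine_replicate[OF F(1)] subringE(2)[OF S] PD(2)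
      by (intro CollectI exI[of _ "replicate (length F) \<zero>"] exI[of _ \<zero>]) (auto dest: in_set_replicate[THEN iffD1])
    have "s \<otimes> combine Ks V \<in> span_mod S P F" if "set Ks \<subseteq> S" "set V \<subseteq> set W" for Ks V
      using that
    proof (induction Ks V rule: combine.induct)
      case (1 k Ks u V)
      have c: "k \<in> carrier R" "u \<in> carrier R" "combine Ks V \<in> carrier R" "s \<in> carrier R"
        using 1 Sc W(1) SL s by (auto intro!: combine_in_carrier)
      have "s \<otimes> combine (k # Ks) (u # V) = k \<otimes> (s \<otimes> u) \<oplus> s \<otimes> combine Ks V"
        using c by (simp add: r_distr m_lcomm)
      thus ?case using span_mod_add[OF F(1) span_mod_smult[OF F(1)]] 1 sW by auto
    qed (use zF s Sc in auto)
    moreover obtain Ks q where K: "set Ks \<subseteq> S" "q \<in> P" "a = combine Ks W \<oplus> q"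
      using W(2)[OF a] unfolding span_mod_def by blast
    ultimately have m: "s \<otimes> combine Ks W \<in> span_mod S P F" by blast
    have c: "combine Ks W \<in> carrier R" "q \<in> carrier R" "s \<in> carrier R" using K SL W(1) PD(1) s Sc by auto
    have "s \<otimes> q \<in> P" using PD(6)[OF K(2) c(3)] .
    moreover have "\<zero> \<oplus> s \<otimes> q = s \<otimes> q" using c by simp
    ultimately have "s \<otimes> q \<in> span_mod S P F"
      unfolding span_mod_def using combine_replicate[OF F(1)] subringE(2)[OF S]
      by (intro CollectI exI[of _ "replicate (length F) \<zero>"] exI[of _ "s \<otimes> q"]) (auto dest: in_set_replicate[THEN iffD1])
    hence "s \<otimes> combine Ks W \<oplus> s \<otimes> q \<in> span_mod S P F" using span_mod_add[OF F(1) m] by blast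
    thus ?thesis using K(3) c by (simp add: r_distr)
  qed
  have xc: "x \<in> carrier R" and pc: "p \<in> carrier R" and sc: "s \<in> carrier R" using x p S' s Sc by auto
  obtain \<pi> g where g: "\<pi> \<in> P" "g \<in> carrier R" "p \<otimes> f = \<pi> \<oplus> g \<otimes> x" using f(2) unfolding adjoin_iff by blast
  have \<pi>c: "\<pi> \<in> carrier R" using g PD(1) by auto
  have pw: "p [^] i \<in> S' \<and> p [^] i \<notin> P" for i :: nat
  proof (induction i)
    case (Suc i)
    thus ?case using S'mult[of "p [^] i" p] P_prime[of "p [^] i" p] p pc by auto
  qed (use one one_P in auto)
  \<comment> \<open>the powers of the relation \<open>p f = g x\<close>\<close>
  have pf: "p [^] i \<otimes> f [^] i \<ominus> x [^] i \<otimes> g [^] i \<in> P" for i :: nat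
  proof (induction i)
    case 0
    show ?case using PD(2) by (simp add: a_minus_def r_neg)
  next
    case (Suc i)
    define a b c e where ab: "a = p [^] i" "b = f [^] i" "c = x [^] i" "e = g [^] i"
    have cc: "a \<in> carrier R" "b \<in> carrier R" "c \<in> carrier R" "e \<in> carrier R" using pc f xc g unfolding ab by auto
    have "p [^] Suc i \<otimes> f [^] Suc i \<ominus> x [^] Suc i \<otimes> g [^] Suc i = (a \<otimes> b) \<otimes> (p \<otimes> f) \<ominus> (c \<otimes> e) \<otimes> (g \<otimes> x)"
      unfolding nat_pow_Suc ab[symmetric] using cc pc f(1) xc g(2) by algebra
    also have "\<dots> = (a \<otimes> b \<ominus> c \<otimes> e) \<otimes> (g \<otimes> x) \<oplus> (a \<otimes> b) \<otimes> \<pi>"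
      unfolding g(3) using cc pc f(1) xc g(2) \<pi>c by algebra
    also have "\<dots> \<in> P" using PD(3,6,7) Suc[folded ab] g(1) cc g(2) xc by simp
    finally show ?case .
  qed
  \<comment> \<open>coordinates of \<open>s f\<^sup>i\<close> and \<open>s g\<^sup>i\<close> in the free module are compared\<close>
  have "\<exists>b\<in>carrier R. s \<otimes> f [^] i \<ominus> x [^] i \<otimes> b \<in> P" for i :: nat
  proof -
    have c: "p [^] i \<in> carrier R" "f [^] i \<in> carrier R" "x [^] i \<in> carrier R" "g [^] i \<in> carrier R" using pc f xc g by auto
    obtain Ks q where K: "set Ks \<subseteq> S" "length Ks = length F" "q \<in> P" "s \<otimes> f [^] i = combine Ks F \<oplus> q"
      using sa[OF c(2)] unfolding span_mod_def by blast
    obtain Ls r where L: "set Ls \<subseteq> S" "length Ls = length F" "r \<in> P" "s \<otimes> g [^] i = combine Ls F \<oplus> r"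
      using sa[OF c(4)] unfolding span_mod_def by blast
    have cc: "combine Ks F \<in> carrier R" "combine Ls F \<in> carrier R" "q \<in> carrier R" "r \<in> carrier R"
      using K L SL F(1) PD(1) by auto
    have xS: "x [^] i \<in> S" using x(1) subringE(3,6)[OF S] by (induction i) auto
    have pS: "p [^] i \<in> S" and mS: "\<ominus> (x [^] i) \<in> S"
      using pw[of i] S' subringE(5)[OF S xS] by blast+
    define Ms where "Ms = map2 (\<oplus>) (map ((\<otimes>) (p [^] i)) Ks) (map ((\<otimes>) (\<ominus> (x [^] i))) Ls)"
    have mm: "set (map ((\<otimes>) (p [^] i)) Ks) \<subseteq> S" "set (map ((\<otimes>) (\<ominus> (x [^] i))) Ls) \<subseteq> S"
      using subringE(6)[OF S pS] subringE(6)[OF S mS] K(1) L(1) by auto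
    have MS: "set Ms \<subseteq> S" "length Ms = length F" unfolding Ms_def using map2_S[OF mm] K(2) L(2) by auto
    have "combine Ms F = p [^] i \<otimes> combine Ks F \<oplus> (\<ominus> (x [^] i)) \<otimes> combine Ls F"
      unfolding Ms_def using combine_add[of "map ((\<otimes>) (p [^] i)) Ks" F "map ((\<otimes>) (\<ominus> (x [^] i))) Ls"]
        combine_r_distr[OF SL[OF K(1)] F(1) c(1)] combine_r_distr[OF SL[OF L(1)] F(1), of "\<ominus> (x [^] i)"]
        SL[OF mm(1)] SL[OF mm(2)] K(2) L(2) F(1) c by simp
    also have "\<dots> = s \<otimes> (p [^] i \<otimes> f [^] i \<ominus> x [^] i \<otimes> g [^] i) \<ominus> p [^] i \<otimes> q \<oplus> x [^] i \<otimes> r"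
      by (rule cross_difference[OF sc c cc K(4) L(4)])
    also have "\<dots> \<in> P" using PD(3,5,6) pf[of i] K(3) L(3) c sc by simp
    finally have "set Ms \<subseteq> P" using F(2) MS unfolding indep_mod_def by blast
    hence each: "p [^] i \<otimes> (Ks ! k) \<ominus> x [^] i \<otimes> (Ls ! k) \<in> P" if k: "k < length F" for k
    proof -
      have kl: "Ks ! k \<in> carrier R" "Ls ! k \<in> carrier R" using k K(1,2) L(1,2) Sc nth_mem by (metis subsetD)+
      have "Ms ! k \<in> P" using \<open>set Ms \<subseteq> P\<close> MS(2) k nth_mem by (metis subsetD)
      moreover have "Ms ! k = p [^] i \<otimes> (Ks ! k) \<oplus> (\<ominus> (x [^] i)) \<otimes> (Ls ! k)"
        unfolding Ms_def using k K(2) L(2) by simp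
      moreover have "\<dots> = p [^] i \<otimes> (Ks ! k) \<ominus> x [^] i \<otimes> (Ls ! k)" using kl c by algebra
      ultimately show ?thesis by simp
    qed
    have "\<exists>\<psi>\<in>S. Ks ! k \<ominus> x [^] i \<otimes> \<psi> \<in> P" if k: "k < length F" for k
    proof (rule x_adic[of "p [^] i" "Ks ! k" "Ls ! k" i])
      show "Ks ! k \<in> S" "Ls ! k \<in> S" using k K(1,2) L(1,2) nth_mem by (metis subsetD)+
    qed (use pw each[OF k] in auto)
    then obtain \<psi> where \<psi>: "\<And>k. k < length F \<Longrightarrow> \<psi> k \<in> S \<and> Ks ! k \<ominus> x [^] i \<otimes> \<psi> k \<in> P" by metis
    have "\<exists>b\<in>carrier R. combine As Bs \<ominus> x [^] i \<otimes> b \<in> P"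
      if "list_all2 (\<lambda>a u. a \<in> carrier R \<and> u \<in> carrier R \<and> (\<exists>z\<in>carrier R. a \<ominus> x [^] i \<otimes> z \<in> P)) As Bs" for As Bs
      using that
    proof (induction As Bs rule: list_all2_induct)
      case Nil
      show ?case using PD(2) c by (intro bexI[of _ \<zero>]) (auto simp: a_minus_def)
    next
      case (Cons a As u Us)
      then obtain z b where z: "z \<in> carrier R" "a \<ominus> x [^] i \<otimes> z \<in> P" and b: "b \<in> carrier R" "combine As Us \<ominus> x [^] i \<otimes> b \<in> P"
        by blast
      have au: "a \<in> carrier R" "u \<in> carrier R" using Cons by auto
      have cA: "combine As Us \<in> carrier R"
        using Cons(2) by (intro combine_in_carrier) (auto simp: list_all2_conv_all_nth set_conv_nth)
      have "combine (a # As) (u # Us) \<ominus> x [^] i \<otimes> (z \<otimes> u \<oplus> b) = (a \<ominus> x [^] i \<otimes> z) \<otimes> u \<oplus> (combine As Us \<ominus> x [^] i \<otimes> b)"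
        unfolding combine.simps using au z b cA c by algebra
      also have "\<dots> \<in> P" using PD(3,7) z b au by simp
      finally show ?case using z b au by blast
    qed
    moreover have "list_all2 (\<lambda>a u. a \<in> carrier R \<and> u \<in> carrier R \<and> (\<exists>z\<in>carrier R. a \<ominus> x [^] i \<otimes> z \<in> P)) Ks F"
      unfolding list_all2_conv_all_nth
    proof (intro conjI allI impI)
      fix k assume k: "k < length Ks"
      show "Ks ! k \<in> carrier R" "F ! k \<in> carrier R" using k K(1,2) Sc F(1) nth_mem by (metis subsetD)+
      show "\<exists>z\<in>carrier R. Ks ! k \<ominus> x [^] i \<otimes> z \<in> P" using \<psi>[of k] k K(2) Sc by auto
    qed (use K in auto)
    ultimately obtain b where b: "b \<in> carrier R" "combine Ks F \<ominus> x [^] i \<otimes> b \<in> P" by blast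
    have "s \<otimes> f [^] i \<ominus> x [^] i \<otimes> b = (combine Ks F \<ominus> x [^] i \<otimes> b) \<oplus> q" unfolding K(4) using b cc c by algebra
    also have "\<dots> \<in> P" using PD(3) b K by simp
    finally show ?thesis using b by blast
  qed
  hence "\<forall>i::nat. \<exists>b. b \<in> carrier R \<and> s \<otimes> f [^] i \<ominus> x [^] i \<otimes> b \<in> P" by blast
  from choice[OF this] obtain b where b: "\<And>i::nat. b i \<in> carrier R \<and> s \<otimes> f [^] i \<ominus> x [^] i \<otimes> b i \<in> P" by blast
  \<comment> \<open>the chain of ideals \<open>P + (b 0, \<dots>, b (i - 1))\<close> with \<open>b i = s f\<^sup>i / x\<^sup>i\<close>\<close>
  define J where "J = rec_nat P (\<lambda>i J. adjoin J (b i))"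
  have J0: "J 0 = P" and JS: "J (Suc i) = adjoin (J i) (b i)" for i unfolding J_def by auto
  have Ji: "ideal (J i) R" for i by (induction i) (auto simp: J0 JS idP adjoin_ideal b)
  have Jl: "J i \<subseteq> J (Suc i)" for i unfolding JS using adjoin_incl[OF Ji] b by auto
  obtain n where n: "J (Suc n) = J n" using ideal_acc[of J, OF Ji Jl] by (metis le_SucI order_refl)
  \<comment> \<open>\<open>x\<^sup>i J i\<close> consists of multiples of \<open>s x\<close>, as \<open>x\<^sup>i b k = x\<^sup>i\<^sup>-\<^sup>k s f\<^sup>k\<close> for \<open>k < i\<close>\<close>
  have cl: "\<exists>c\<in>carrier R. x [^] i \<otimes> a \<ominus> s \<otimes> (x \<otimes> c) \<in> P" if "a \<in> J i" for i a
    using that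
  proof (induction i arbitrary: a)
    case 0
    hence a: "a \<in> P" "a \<in> carrier R" using PD(1) J0 by auto
    hence "x [^] (0::nat) \<otimes> a \<ominus> s \<otimes> (x \<otimes> \<zero>) = a" using xc sc by (simp add: a_minus_def)
    thus ?case using a by (intro bexI[of _ \<zero>]) auto
  next
    case (Suc i)
    then obtain a' r where a: "a' \<in> J i" "r \<in> carrier R" "a = a' \<oplus> r \<otimes> b i" unfolding JS adjoin_iff by blast
    obtain c where c: "c \<in> carrier R" "x [^] i \<otimes> a' \<ominus> s \<otimes> (x \<otimes> c) \<in> P" using Suc.IH[OF a(1)] by blast
    have ac: "a' \<in> carrier R" "b i \<in> carrier R" using a idealD(1)[OF Ji] b by auto
    define y h where "y = x [^] i" and "h = f [^] i"
    have yh: "y \<in> carrier R" "h \<in> carrier R" using xc f unfolding y_def h_def by auto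
    have "x [^] Suc i \<otimes> a \<ominus> s \<otimes> (x \<otimes> (x \<otimes> c \<oplus> r \<otimes> h))
      = x \<otimes> (y \<otimes> a' \<ominus> s \<otimes> (x \<otimes> c)) \<ominus> (r \<otimes> x) \<otimes> (s \<otimes> h \<ominus> y \<otimes> b i)"
      unfolding nat_pow_Suc y_def[symmetric] a(3) using yh ac a(2) c(1) xc sc by algebra
    also have "\<dots> \<in> P" using PD(5,6) c(2) b[of i] xc a(2) unfolding y_def h_def by simp
    finally show ?case using c a(2) xc yh by blast
  qed
  have "b n \<in> J n" using adjoin_mem[OF Ji[of n], of "b n"] b[of n] n JS[of n] by simp
  then obtain c where c: "c \<in> carrier R" "x [^] n \<otimes> b n \<ominus> s \<otimes> (x \<otimes> c) \<in> P" using cl by blast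
  have cc: "x [^] n \<in> carrier R" "f [^] n \<in> carrier R" "b n \<in> carrier R" using xc f b by auto
  have "s \<otimes> (f [^] n \<ominus> x \<otimes> c) = (s \<otimes> f [^] n \<ominus> x [^] n \<otimes> b n) \<oplus> (x [^] n \<otimes> b n \<ominus> s \<otimes> (x \<otimes> c))"
    using cc sc c xc by algebra
  also have "\<dots> \<in> P" using PD(3) b[of n] c by simp
  finally have "f [^] n \<ominus> x \<otimes> c \<in> P" using P_prime[OF sc, of "f [^] n \<ominus> x \<otimes> c"] s cc c xc by simp
  moreover have "f [^] n = (f [^] n \<ominus> x \<otimes> c) \<oplus> c \<otimes> x" using cc c xc by algebra
  ultimately have "f [^] n \<in> adjoin P x" unfolding adjoin_iff using c by blast
  thus ?thesis by blast
qed

end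

end

context std_graded
begin

lemma H_lower_bound:
  assumes J: "homogeneous J" and g: "gdim J = Suc D"
  shows "\<exists>\<epsilon>>0. \<exists>N. \<forall>j\<ge>N. \<epsilon> * of_nat j ^ D \<le> (of_nat (H J j) :: rat)"
proof -
  define \<epsilon> where "\<epsilon> = hpcoeff J D / 2"
  define q where "q = hp J - Polynomial.monom \<epsilon> D"
  have pos: "hpcoeff J D > 0" using hpcoeff_pos[OF J g] .
  have dg: "Polynomial.degree (hp J) = D" using g unfolding gdim_def by (auto split: if_splits)
  have cD: "Polynomial.coeff q D = \<epsilon>" unfolding q_def \<epsilon>_def hpcoeff_def by simp
  have "Polynomial.degree q \<le> D" unfolding q_def using dg degree_monom_le[of \<epsilon> D] by (intro degree_diff_le) auto
  hence "Polynomial.degree q = D" using cD pos le_degree[of q D] unfolding \<epsilon>_def by simp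
  then obtain c where c: "c > 0" "\<forall>\<^sub>F j in sequentially. poly q (of_nat j) \<ge> c"
    using poly_eventually_pos[of q] cD pos unfolding \<epsilon>_def by auto
  have "\<forall>\<^sub>F j in sequentially. \<epsilon> * of_nat j ^ D \<le> (of_nat (H J j) :: rat)"
    using c(2) hp[OF J, unfolded hpoly_def]
  proof eventually_elim
    case (elim j)
    thus ?case using c(1) unfolding q_def by (simp add: poly_monom)
  qed
  thus ?thesis unfolding eventually_sequentially using pos unfolding \<epsilon>_def by (intro exI[of _ "hpcoeff J D / 2"]) auto
qed

text \<open>The sum over \<open>j\<close> of the Hilbert function grows like the power \<open>D + 1\<close>, hence is not bounded by a
  multiple of \<open>T\<^sup>D\<close>.\<close>

lemma cumulative_growth:
  assumes J: "homogeneous J" and D: "gdim J = Suc D" and upper: "\<And>T. (\<Sum>j<T. H J j) \<le> B * T ^ D"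
  shows False
proof -
  obtain \<epsilon> N where \<epsilon>: "\<epsilon> > 0" "\<And>j. j \<ge> N \<Longrightarrow> \<epsilon> * of_nat j ^ D \<le> (of_nat (H J j) :: rat)"
    using H_lower_bound[OF J D] by blast
  define C :: rat where "C = of_nat B * 2 ^ D"
  obtain T0 where T0: "C / \<epsilon> < of_nat T0" using reals_Archimedean2 by blast
  define T where "T = max T0 (max N 1)"
  have T: "T \<ge> N" "T \<ge> 1" "T0 \<le> T" unfolding T_def by auto
  have "of_nat T * (\<epsilon> * of_nat T ^ D) = (\<Sum>j\<in>{T..<2 * T}. \<epsilon> * (of_nat T ^ D :: rat))" by simp
  also have "\<dots> \<le> (\<Sum>j\<in>{T..<2 * T}. of_nat (H J j))"
  proof (rule sum_mono)
    fix j assume j: "j \<in> {T..<2 * T}"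
    have "\<epsilon> * of_nat T ^ D \<le> \<epsilon> * of_nat j ^ D" using j \<epsilon>(1) by (intro mult_left_mono power_mono) auto
    also have "\<dots> \<le> of_nat (H J j)" using \<epsilon>(2)[of j] j T(1) by auto
    finally show "\<epsilon> * of_nat T ^ D \<le> (of_nat (H J j) :: rat)" .
  qed
  also have "\<dots> \<le> (\<Sum>j<2 * T. of_nat (H J j))" by (intro sum_mono2) auto
  also have "\<dots> \<le> of_nat (B * (2 * T) ^ D)"
    using upper[of "2 * T"] by (metis of_nat_le_iff of_nat_sum)
  also have "\<dots> = C * of_nat T ^ D" unfolding C_def by (simp add: power_mult_distrib)
  finally have "(of_nat T * \<epsilon>) * of_nat T ^ D \<le> C * of_nat T ^ D" by (simp add: mult.assoc)
  hence "of_nat T * \<epsilon> \<le> C" using T(2) by simp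
  moreover have "C < of_nat T * \<epsilon>"
  proof -
    have "C / \<epsilon> < of_nat T" using T0 T(3) by (meson less_le_trans of_nat_le_iff)
    thus ?thesis using \<epsilon>(1) by (simp add: divide_less_eq)
  qed
  ultimately show False by simp
qed

text \<open>Parameters modulo \<open>J\<close> whose number does not exceed the dimension of \<open>J\<close> are algebraically independent modulo \<open>J\<close>. A form \<open>p\<close> of degree \<open>c\<close> in the intersection, but
  outside \<open>P\<close>, would give the subalgebra modulo \<open>J\<close> in degree \<open>i + c\<close> at most the dimension \<open>\<tau> (i + c) - \<tau> i\<close>, where
  \<open>\<tau>\<close> counts modulo \<open>P\<close>; these telescope, and the quotient by \<open>J\<close>, which is finite over the subalgebra, would grow too
  slowly.\<close>

lemma alg_inter_trivial:
  assumes P: "gprime P" and J: "homogeneous J" "P \<subseteq> J" "\<one> \<notin> J"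
    and ys: "pos_homs ys" "length ys \<le> gdim J" "gdim (adjoin_list J ys) = 0"
  shows "alg (set ys) \<inter> J \<subseteq> P"
proof (rule ccontr)
  assume "\<not> ?thesis"
  then obtain a where a: "a \<in> alg (set ys)" "a \<in> J" "a \<notin> P" by auto
  let ?A = "\<lambda>i. alg (set ys) \<inter> G i"
  have Y: "set ys \<subseteq> carrier R" "set ys \<subseteq> Homogs" using pos_homs_carrier[OF ys(1)] pos_homs_Homogs[OF ys(1)] by auto
  have ac: "a \<in> carrier R" using a alg_carrier[OF Y(1)] by auto
  note iP = gprimeD(2)[OF P] and iJ = homD(1)[OF J(1)]
  have sP: "subsp P" and sJ: "subsp J" using ideal_subsp iP iJ by auto
  obtain c where nP: "pr c a \<notin> P" using mem_by_pr[OF iP ac] a(3) by blast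
  define p where "p = pr c a"
  have p: "p \<in> alg (set ys)" "p \<in> J" "p \<notin> P" "p \<in> G c" "p \<in> carrier R"
    unfolding p_def using alg_pr[OF Y(2) a(1)] homD(2)[OF J(1) a(2)] nP pr_in[OF ac] pr_carr[OF ac] by auto
  have p0: "p \<noteq> \<zero>" using p(3) idealD(2)[OF iP] by auto
  have c: "c > 0"
  proof (rule ccontr)
    assume "\<not> c > 0"
    thus False using field_unit[OF iJ _ p0 p(2)] p(4) J(3) by simp
  qed
  have "ys \<noteq> []"
  proof
    assume "ys = []"
    hence "p \<in> G 0 \<inter> G c" using p alg_empty by auto
    thus False using G_int_zero[of 0 c] c p0 by auto
  qed
  then obtain D where D: "gdim J = Suc D" using ys(2) by (cases "gdim J") auto
  define \<tau> where "\<tau> i = dim_mod (?A i) P" for i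
  define \<tau>' where "\<tau>' i = dim_mod (?A i) J" for i
  have \<tau>_le: "\<tau> i \<le> (i + 1) ^ D" for i
    unfolding \<tau>_def using dim_mod_le[of "?A i" P] algG_dim[OF ys(1), of D i] ys(2) D by simp
  have \<tau>'_le: "\<tau>' i \<le> \<tau> i" for i
    unfolding \<tau>_def \<tau>'_def using J(2) by (intro dim_mod_antimono algG_fd Y sP sJ) auto
  \<comment> \<open>multiplication by \<open>p\<close> is injective modulo \<open>P\<close> and maps into \<open>J\<close>\<close>
  have key: "\<tau>' (i + c) + \<tau> i \<le> \<tau> (i + c)" for i
  proof -
    let ?V = "?A (i + c)" and ?M = "mul p (?A i)"
    have fV: "fd ?V" and fM: "fd ?M" using algG_fd[OF Y(1)] mul_fd[OF p(5)] by auto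
    have fVP: "fd (?V \<inter> P)" using fd_int[OF fV sP] .
    have MV: "?M \<subseteq> ?V \<inter> J"
      unfolding mul_def using alg_mult[OF Y(1) p(1)] G_mult[OF p(4), of _ i] idealD(7)[OF iJ p(2)] G_carr
      by (auto simp: add.commute)
    have "(?V \<inter> P) <+> ?M \<subseteq> ?V \<inter> J"
      using MV J(2) by (intro set_add_least subsp_int[OF fd_subsp[OF fV] sJ]) auto
    hence "d ((?V \<inter> P) <+> ?M) \<le> d (?V \<inter> J)"
      using d_mono[OF fd_int[OF fV sJ] fd_subsp[OF sum_fd[OF fVP fM]]] by blast
    moreover have "?V \<inter> P \<inter> ?M = ?M \<inter> P" using MV by auto
    hence "d ((?V \<inter> P) <+> ?M) + d (?M \<inter> P) = d (?V \<inter> P) + d ?M" using d_sum[OF fVP fM] by simp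
    moreover have "dim_mod ?M P + d (?M \<inter> P) = d ?M" using dim_mod_eq[OF fM sP] .
    moreover have "dim_mod ?M P = \<tau> i"
      unfolding \<tau>_def using dim_mod_mul[OF p(5) algG_fd[OF Y(1)] iP, of i] gprime_colon[OF P p(4,3)] by simp
    moreover have "\<tau>' (i + c) + d (?V \<inter> J) = d ?V" unfolding \<tau>'_def using dim_mod_eq[OF fV sJ] .
    moreover have "\<tau> (i + c) + d (?V \<inter> P) = d ?V" unfolding \<tau>_def using dim_mod_eq[OF fV sP] .
    ultimately show ?thesis by linarith
  qed
  have sum1: "(\<Sum>i<T. \<tau>' i) + (\<Sum>i<T - c. \<tau> i) \<le> (\<Sum>i<T. \<tau> i)" for T
  proof (induction T)
    case (Suc T)
    show ?case
    proof (cases "c \<le> T")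
      case True
      hence "Suc T - c = Suc (T - c)" by simp
      thus ?thesis using Suc key[of "T - c"] True by simp
    next
      case False
      thus ?thesis using Suc \<tau>'_le[of T] by simp
    qed
  qed simp
  have sum2: "(\<Sum>i<T. \<tau>' i) \<le> c * T ^ D" for T
  proof -
    have "(\<Sum>i<T. \<tau> i) = (\<Sum>i<T - c. \<tau> i) + (\<Sum>i\<in>{T - c..<T}. \<tau> i)"
      by (simp add: lessThan_atLeast0 sum.atLeastLessThan_concat)
    moreover have "(\<Sum>i\<in>{T - c..<T}. \<tau> i) \<le> (\<Sum>i\<in>{T - c..<T}. T ^ D)"
    proof (rule sum_mono)
      fix i assume "i \<in> {T - c..<T}"
      hence "(i + 1) ^ D \<le> T ^ D" by (intro power_mono) auto
      thus "\<tau> i \<le> T ^ D" using \<tau>_le[of i] by simp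
    qed
    moreover have "(\<Sum>i\<in>{T - c..<T}. T ^ D) \<le> c * T ^ D"
    proof -
      have "T - (T - c) \<le> c" by arith
      thus ?thesis by simp
    qed
    ultimately show ?thesis using sum1[of T] by linarith
  qed
  obtain W where W: "weighted_list W" "\<And>j. G j \<subseteq> weighted_span (set ys) W j <+> (J \<inter> G j)"
    using finite_over_parameters[OF J(1) ys(1,3)] by blast
  have shift: "(\<Sum>j<T. if c' \<le> j then \<tau>' (j - c') else 0) \<le> c * T ^ D" for c' T
  proof -
    have "(\<Sum>j<T. if c' \<le> j then \<tau>' (j - c') else 0) = (\<Sum>i<T - c'. \<tau>' i)"
    proof (induction T)
      case (Suc T)
      thus ?case by (cases "c' \<le> T") (auto simp: Suc_diff_le)
    qed simp
    also have "\<dots> \<le> (\<Sum>i<T. \<tau>' i)" by (intro sum_mono2) auto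
    finally show ?thesis using sum2[of T] by linarith
  qed
  have upper: "(\<Sum>j<T. H J j) \<le> length W * (c * T ^ D)" for T
  proof -
    have "(\<Sum>j<T. H J j) \<le> (\<Sum>j<T. \<Sum>(w, c')\<leftarrow>W. if c' \<le> j then \<tau>' (j - c') else 0)"
      unfolding \<tau>'_def by (intro sum_mono H_le_weighted_span[OF J(1) Y(1) W])
    also have "\<dots> \<le> length W * (c * T ^ D)"
    proof (induction W)
      case (Cons a W)
      obtain w c' where a: "a = (w, c')" by (cases a)
      show ?case using Cons shift[of c' T] unfolding a by (simp add: sum.distrib)
    qed simp
    finally show ?thesis .
  qed
  show False
  proof (rule cumulative_growth[OF J(1) D])
    show "(\<Sum>j<T. H J j) \<le> (length W * c) * T ^ D" for T using upper[of T] by (simp add: mult.assoc)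
  qed
qed

text \<open>If the parameters modulo \<open>J\<close> remain independent modulo \<open>Q\<close>, then \<open>R/J\<close>, which is finite over them, cannot grow
  faster than \<open>R/Q\<close>.\<close>

lemma gdim_le_of_alg:
  assumes J: "homogeneous J" and Q: "homogeneous Q" and ys: "pos_homs ys" "gdim (adjoin_list J ys) = 0"
    and sub: "alg (set ys) \<inter> Q \<subseteq> J"
  shows "gdim J \<le> gdim Q"
proof (rule ccontr)
  assume c: "\<not> ?thesis"
  then obtain D where D: "gdim J = Suc D" by (cases "gdim J") auto
  have gQ: "gdim Q \<le> D" using c D by simp
  have Y: "set ys \<subseteq> carrier R" using pos_homs_carrier[OF ys(1)] .
  obtain W where W: "weighted_list W" "\<And>j. G j \<subseteq> weighted_span (set ys) W j <+> (J \<inter> G j)"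
    using finite_over_parameters[OF J ys] by blast
  have r: "dim_mod (alg (set ys) \<inter> G i) J \<le> H Q i" for i
  proof -
    have "dim_mod (alg (set ys) \<inter> G i) J \<le> dim_mod (alg (set ys) \<inter> G i) Q"
      using sub by (intro dim_mod_antimono algG_fd Y homogeneous_subsp J Q) auto
    also have "\<dots> \<le> dim_mod (G i) Q" by (intro dim_mod_mono G_fd algG_subsp Y homogeneous_subsp Q) auto
    finally show ?thesis unfolding H_def .
  qed
  have bound: "H J j \<le> (\<Sum>(w, c)\<leftarrow>W. if c \<le> j then H Q (j - c) else 0)" for j
  proof -
    have "H J j \<le> (\<Sum>(w, c)\<leftarrow>W. if c \<le> j then dim_mod (alg (set ys) \<inter> G (j - c)) J else 0)"
      by (rule H_le_weighted_span[OF J Y W])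
    also have "\<dots> \<le> (\<Sum>(w, c)\<leftarrow>W. if c \<le> j then H Q (j - c) else 0)"
      by (rule sum_list_mono) (use r in auto)
    finally show ?thesis .
  qed
  obtain N where N: "\<And>j. j \<ge> N \<Longrightarrow> poly (hp Q) (of_nat j) = of_nat (H Q j)"
    using hp[OF Q] unfolding hpoly_def eventually_sequentially by blast
  define q where "q = (\<Sum>(w, c)\<leftarrow>W. pcompose (hp Q) [:- of_nat c, 1:])"
  have "\<forall>\<^sub>F j in sequentially. of_nat (\<Sum>(w, c)\<leftarrow>W. if c \<le> j then H Q (j - c) else 0) = poly q (of_nat j)"
    unfolding q_def
  proof (induction W)
    case (Cons a W)
    obtain w c where a: "a = (w, c)" by (cases a)
    show ?case using Cons eventually_ge_at_top[of "N + c"]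
    proof eventually_elim
      case (elim j)
      have "poly (hp Q) (of_nat j - of_nat c) = of_nat (H Q (j - c))"
        using N[of "j - c"] elim(2) by (simp add: of_nat_diff)
      thus ?case using elim unfolding a by (simp add: poly_pcompose)
    qed
  qed simp
  hence "\<forall>\<^sub>F j in sequentially. poly (hp J) (of_nat j) \<le> poly q (of_nat j)"
    using hp[OF J, unfolded hpoly_def]
  proof eventually_elim
    case (elim j)
    have "(of_nat (H J j) :: rat) \<le> of_nat (\<Sum>(w, c)\<leftarrow>W. if c \<le> j then H Q (j - c) else 0)"
      using bound[of j] of_nat_mono by blast
    thus ?case using elim by simp
  qed
  moreover have z: "Polynomial.coeff q i = 0" if "i \<ge> D" for i
    unfolding q_def
  proof (induction W)
    case (Cons a W)
    obtain w c where a: "a = (w, c)" by (cases a)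
    have "Polynomial.coeff (pcompose (hp Q) [:- of_nat c, 1:]) i = 0"
    proof (cases "hp Q = 0")
      case False
      hence "Polynomial.degree (hp Q) < i" using gQ that unfolding gdim_def by auto
      thus ?thesis using coeff_pcompose_shift(2)[OF order_refl] by blast
    qed simp
    thus ?case using Cons unfolding a by simp
  qed simp
  ultimately have "Polynomial.coeff (hp J) D \<le> Polynomial.coeff q D"
    using D hpcoeff_zero[of J] by (intro poly_eventually_le) (auto simp: hpcoeff_def)
  thus False using z[of D] hpcoeff_pos[OF J D] unfolding hpcoeff_def by simp
qed

lemma one_notin_adjoin:
  assumes P: "gprime P" and x: "x \<in> G 1" shows "\<one> \<notin> adjoin P x"
proof
  assume "\<one> \<in> adjoin P x"
  then obtain i r where *: "i \<in> P" "r \<in> carrier R" "\<one> = i \<oplus> r \<otimes> x" unfolding adjoin_iff by blast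
  have c: "i \<in> carrier R" "x \<in> carrier R" using * idealD(1)[OF gprimeD(2)[OF P]] x G_carr by auto
  have "pr 0 \<one> = pr 0 i \<oplus> \<zero>" using *(3) c *(2) pr_add pr_mult_homogeneous[OF *(2) x, of 0] by (metis m_closed not_one_le_zero)
  hence "\<one> = pr 0 i" using pr_same[OF one_G] pr_carr[OF c(1)] by simp
  thus False using homD(2)[OF gprimeD(1)[OF P] *(1), of 0] gprimeD(3)[OF P] by simp
qed

text \<open>Let \<open>ys\<close> be parameters modulo \<open>P + (x)\<close> and \<open>p\<close> an element of their subalgebra that lies in \<open>Q\<close>, but not in \<open>P\<close>.
  A product of primes over \<open>P + (x)\<close> is contained in \<open>P + (x)\<close>; taking \<open>p\<close> in the factors \<open>Q\<close> and elements outside \<open>Q\<close>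
  in the other factors, \<open>p\<^sup>k f \<in> P + (x)\<close> with \<open>f \<notin> Q\<close>. By \<open>nilpotent_mod_x\<close> the factor \<open>p\<^sup>k\<close> can be dropped: a power of \<open>f\<close> lies in \<open>P + (x) \<subseteq> Q\<close>, which is absurd. So the parameters are
  independent modulo \<open>Q\<close> as well, and \<open>gdim_le_of_alg\<close> applies.\<close>

theorem principal_ideal_theorem:
  assumes P: "gprime P" and x: "x \<in> G 1" "x \<notin> P" and Q: "gprime Q" "adjoin P x \<subseteq> Q"
    and min: "\<And>Q'. gprime Q' \<Longrightarrow> adjoin P x \<subseteq> Q' \<Longrightarrow> Q' \<subseteq> Q \<Longrightarrow> Q' = Q"
  shows "gdim Q = gdim P - 1"
proof -
  let ?J = "adjoin P x"
  note hP = gprimeD(1)[OF P] and iP = gprimeD(2)[OF P] and hJ = homogeneous_adjoin[OF gprimeD(1)[OF P] x(1)]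
  have xc: "x \<in> carrier R" using x G_carr by auto
  have gJ: "gdim ?J = gdim P - 1" using gprime_adjoin(2)[OF P x] by simp
  have PJ: "P \<subseteq> ?J" using adjoin_incl[OF iP xc] .
  have J1: "\<one> \<notin> ?J" using one_notin_adjoin[OF P x(1)] .
  obtain ys where ys: "length ys \<le> gdim ?J" "pos_homs ys" "gdim (adjoin_list ?J ys) = 0"
    using parameters_exist[OF hJ order_refl] by blast
  have Y: "set ys \<subseteq> carrier R" "set ys \<subseteq> Homogs" using pos_homs_carrier[OF ys(2)] pos_homs_Homogs[OF ys(2)] by auto
  have Yx: "insert x (set ys) \<subseteq> carrier R" using Y xc by auto
  have triv: "alg (set ys) \<inter> ?J \<subseteq> P" using alg_inter_trivial[OF P hJ PJ J1 ys(2,1,3)] .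
  have QP: "alg (set ys) \<inter> Q \<subseteq> P"
  proof (rule ccontr)
    assume "\<not> ?thesis"
    then obtain p where p: "p \<in> alg (set ys)" "p \<in> Q" "p \<notin> P" by auto
    have pc: "p \<in> carrier R" using p alg_carrier[OF Y(1)] by auto
    obtain Ps where Ps: "\<forall>P\<in>set Ps. gprime P \<and> ?J \<subseteq> P" "\<forall>as. list_all2 (\<in>) as Ps \<longrightarrow> foldr (\<otimes>) as \<one> \<in> ?J"
      using gprime_decomposition[OF hJ] by auto
    have "\<exists>a\<in>Homogs. a \<in> P' \<and> a \<notin> Q" if P': "P' \<in> set Ps" "P' \<noteq> Q" for P'
    proof (rule homogeneous_witness)
      show "\<not> P' \<subseteq> Q" using min Ps(1) P' by blast
    qed (use Ps(1) P' gprimeD Q in auto)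
    then obtain a where a: "\<And>P'. P' \<in> set Ps \<Longrightarrow> P' \<noteq> Q \<Longrightarrow> a P' \<in> Homogs \<and> a P' \<in> P' \<and> a P' \<notin> Q" by metis
    define b where "b P' = (if P' = Q then p else a P')" for P'
    have "list_all2 (\<in>) (map b Ps) Ps" unfolding b_def using a p by (auto simp: list_all2_conv_all_nth)
    hence bJ: "foldr (\<otimes>) (map b Ps) \<one> \<in> ?J" using Ps(2) by blast
    have "\<exists>k f. f \<in> Homogs \<and> f \<notin> Q \<and> foldr (\<otimes>) (map b Ps') \<one> = p [^] (k::nat) \<otimes> f" if "set Ps' \<subseteq> set Ps" for Ps'
      using that
    proof (induction Ps')
      case Nil
      show ?case using Homogs_props(2) gprimeD(3)[OF Q(1)] by (intro exI[of _ 0] exI[of _ \<one>]) auto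
    next
      case (Cons P' Ps')
      then obtain k f where f: "f \<in> Homogs" "f \<notin> Q" "foldr (\<otimes>) (map b Ps') \<one> = p [^] (k::nat) \<otimes> f" by auto
      have fc: "f \<in> carrier R" using f Homogs_props(1) by auto
      show ?case
      proof (cases "P' = Q")
        case True
        have "foldr (\<otimes>) (map b (P' # Ps')) \<one> = p \<otimes> (p [^] k \<otimes> f)" using f(3) True unfolding b_def by simp
        also have "\<dots> = p [^] Suc k \<otimes> f" using pc fc by (simp add: m_ac)
        finally show ?thesis using f by blast
      next
        case False
        have aa: "a P' \<in> Homogs" "a P' \<notin> Q" "a P' \<in> carrier R" using a[of P'] Cons.prems False Homogs_props(1) by auto
        have "foldr (\<otimes>) (map b (P' # Ps')) \<one> = a P' \<otimes> (p [^] k \<otimes> f)" using f(3) False unfolding b_def by simp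
        also have "\<dots> = p [^] k \<otimes> (a P' \<otimes> f)" using pc fc aa by (simp add: m_ac)
        finally show ?thesis using gprimeD(4)[OF Q(1) aa(1) f(1)] aa f Homogs_props(3)[OF aa(1) f(1)] by blast
      qed
    qed
    from this[OF order_refl] obtain k f where f: "f \<in> Homogs" "f \<notin> Q" "p [^] (k::nat) \<otimes> f \<in> ?J" using bJ by auto
    have fc: "f \<in> carrier R" using f Homogs_props(1) by auto
    have pk: "p [^] k \<in> alg (set ys) \<and> p [^] k \<notin> P"
    proof (induction k)
      case 0
      show ?case using alg.const[OF K_sub(2)] gprimeD(3)[OF P] by auto
    next
      case (Suc k)
      thus ?case using alg_mult[OF Y(1), of "p [^] k" p] primeideal.I_prime[OF gprime_primeideal[OF P], of "p [^] k" p] p pc by auto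
    qed
    have ph: "pos_homs (ys @ [x])" using ys(2) x(1) unfolding pos_homs_def by auto
    have "gdim (adjoin_list P (ys @ [x])) = 0" using ys(3) unfolding adjoin_list_def by simp
    then obtain W where W: "weighted_list W" "\<And>j. G j \<subseteq> weighted_span (set (ys @ [x])) W j <+> (P \<inter> G j)"
      using finite_over_parameters[OF hP ph] by blast
    let ?S = "alg (insert x (set ys))"
    define F where "F = map fst W"
    have F: "set F \<subseteq> carrier R" using W(1) G_carr unfolding F_def weighted_list_def by auto
    have sS: "subring ?S R" using alg_subring[OF Yx] .
    have pI: "primeideal P R" using gprime_primeideal[OF P] .
    have ctx1: "alg (set ys) \<subseteq> ?S" by (rule alg_mono) auto
    have ctx2: "x \<in> ?S" using alg_self[OF Yx] by auto
    note ctx = pI sS ctx1 ctx2 x(2) alg_insert_split[OF Yx] alg_mult[OF Y(1)] triv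
    have SWc: "\<exists>Ks. set Ks \<subseteq> ?S \<and> length Ks = length V \<and> v = combine Ks (map fst V)"
      if "weighted_list V" "v \<in> weighted_span (set (ys @ [x])) V j" for V v j
      using that
    proof (induction V arbitrary: v)
      case Nil
      thus ?case unfolding weighted_span_def by auto
    next
      case (Cons b V)
      obtain w c where b: "b = (w, c)" by (cases b)
      have w: "w \<in> G c" "weighted_list V" using Cons.prems b unfolding weighted_list_def by auto
      obtain s t where st: "s \<in> weighted_term (set (ys @ [x])) w c j" "t \<in> weighted_span (set (ys @ [x])) V j" "v = s \<oplus> t"
        using Cons.prems(2) unfolding b weighted_span_Cons set_add_mem by blast
      obtain Ks where K: "set Ks \<subseteq> ?S" "length Ks = length V" "t = combine Ks (map fst V)"
        using Cons.IH[OF w(2) st(2)] by blast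
      have "\<exists>k\<in>?S. s = k \<otimes> w"
      proof (cases "c \<le> j")
        case True
        then obtain k where "k \<in> alg (set (ys @ [x]))" "s = w \<otimes> k" using st(1) unfolding weighted_term_def mul_def by auto
        moreover have "set (ys @ [x]) = insert x (set ys)" by auto
        ultimately show ?thesis using m_comm[OF G_carr[OF w(1)]] alg_carrier[OF Yx] by auto
      next
        case False
        hence "s = \<zero> \<otimes> w" using st(1) G_carr[OF w(1)] unfolding weighted_term_def by simp
        thus ?thesis using subringE(2)[OF sS] by blast
      qed
      then obtain k where k: "k \<in> ?S" "s = k \<otimes> w" by blast
      show ?case using K k st(3) unfolding b by (intro exI[of _ "k # Ks"]) auto
    qed
    have Gspan: "g \<in> span_mod ?S P F" if g: "g \<in> G j" for g j
    proof -
      have "g \<in> weighted_span (set (ys @ [x])) W j <+> (P \<inter> G j)" using W(2)[of j] g by blast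
      then obtain v q where v: "v \<in> weighted_span (set (ys @ [x])) W j" "q \<in> P" "g = v \<oplus> q" unfolding set_add_mem by blast
      obtain Ks where "set Ks \<subseteq> ?S" "length Ks = length W" "v = combine Ks F" using SWc[OF W(1) v(1)] unfolding F_def by blast
      thus ?thesis unfolding span_mod_def F_def using v by (intro CollectI exI[of _ Ks] exI[of _ q]) auto
    qed
    have Aspan: "g \<in> span_mod ?S P F" if g: "g \<in> carrier R" for g
    proof -
      obtain N where N: "g = (\<Oplus>j\<in>{..<N::nat}. pr j g)" using pr_sum[OF g] by blast
      have "finite T \<Longrightarrow> (\<Oplus>j\<in>T. pr j g) \<in> span_mod ?S P F" for T
      proof (induction T rule: finite_induct)
        case empty
        show ?case using Gspan[OF G_zero] by simp
      next
        case (insert j T)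
        thus ?case using span_mod_add[OF ctx F Gspan[OF pr_in[OF g]]] pr_carr[OF g] by (subst finsum_insert) auto
      qed
      thus ?thesis using N by (metis finite_lessThan)
    qed
    have "\<exists>n::nat. f [^] n \<in> ?J"
    proof (rule nilpotent_mod_x[OF ctx noetherian F Aspan])
      show "p [^] k \<in> alg (set ys)" "p [^] k \<notin> P" using pk by auto
      show "\<one> \<in> alg (set ys)" using alg.const[OF K_sub(2)] .
      show "f \<in> carrier R" "p [^] k \<otimes> f \<in> ?J" using fc f by auto
    qed
    then obtain n :: nat where n: "f [^] n \<in> Q" using Q(2) by blast
    have "f [^] n \<in> Homogs \<and> f [^] n \<notin> Q" for n :: nat
    proof (induction n)
      case 0
      show ?case using Homogs_props(2) gprimeD(3)[OF Q(1)] by simp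
    next
      case (Suc n)
      thus ?case using gprimeD(4)[OF Q(1), of "f [^] n" f] Homogs_props(3)[of "f [^] n" f] f by auto
    qed
    thus False using n by blast
  qed
  have "gdim ?J \<le> gdim Q" by (rule gdim_le_of_alg[OF hJ gprimeD(1)[OF Q(1)] ys(2,3)]) (use QP PJ in auto)
  moreover have "gdim Q \<le> gdim ?J" using gdim_mono[OF hJ gprimeD(1)[OF Q(1)] Q(2)] .
  ultimately show ?thesis using gJ by simp
qed

end

section \<open>Hyperplane sections and the choice of the forms\<close>

context std_graded
begin

text \<open>Bezout's theorem for a hyperplane. All components of \<open>P + (x)\<close> have the dimension of \<open>P + (x)\<close>, so all of them count in
  \<open>sum_hpcoeff_le\<close>, and the degree of \<open>P + (x)\<close> is that of \<open>P\<close>.\<close>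

lemma hyperplane_cut:
  assumes P: "gprime P" and x: "x \<in> G 1"
  shows "\<exists>\<Q>. finite \<Q> \<and> (\<forall>Q\<in>\<Q>. gprime Q \<and> P \<subseteq> Q \<and> x \<in> Q \<and> gdim Q \<le> (if x \<in> P then gdim P else gdim P - 1)) \<and>
    (\<Sum>Q\<in>\<Q>. gdeg Q) \<le> gdeg P \<and> (\<forall>Q'. gprime Q' \<longrightarrow> P \<subseteq> Q' \<longrightarrow> x \<in> Q' \<longrightarrow> (\<exists>Q\<in>\<Q>. Q \<subseteq> Q'))"
proof (cases "x \<in> P")
  case True
  thus ?thesis using P by (intro exI[of _ "{P}"]) auto
next
  case False
  let ?J = "adjoin P x"
  note iP = gprimeD(2)[OF P] and hJ = homogeneous_adjoin[OF gprimeD(1)[OF P] x]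
  have xc: "x \<in> carrier R" using x G_carr by auto
  obtain Ps where Ps: "\<forall>P\<in>set Ps. gprime P \<and> ?J \<subseteq> P" "\<forall>as. list_all2 (\<in>) as Ps \<longrightarrow> foldr (\<otimes>) as \<one> \<in> ?J"
    using gprime_decomposition[OF hJ] by auto
  have contains: "\<exists>P'\<in>set Ps. P' \<subseteq> Q'" if "gprime Q'" "?J \<subseteq> Q'" for Q'
    using gprime_over_decomposition[OF _ Ps(2) that] Ps(1) by blast
  define \<Q> where "\<Q> = {Q \<in> set Ps. \<forall>Q'\<in>set Ps. Q' \<subseteq> Q \<longrightarrow> Q = Q'}"
  have fin: "finite \<Q>" unfolding \<Q>_def by simp
  have Qp: "gprime Q" "?J \<subseteq> Q" if "Q \<in> \<Q>" for Q using that Ps(1) unfolding \<Q>_def by auto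
  have gQ: "gdim Q = gdim P - 1" if Q: "Q \<in> \<Q>" for Q
  proof (rule principal_ideal_theorem[OF P x False Qp[OF Q]])
    fix Q' assume Q': "gprime Q'" "?J \<subseteq> Q'" "Q' \<subseteq> Q"
    obtain P' where "P' \<in> set Ps" "P' \<subseteq> Q'" using contains[OF Q'(1,2)] by blast
    thus "Q' = Q" using Q Q'(3) unfolding \<Q>_def by blast
  qed
  have sub: "P \<subseteq> Q" "x \<in> Q" if "Q \<in> \<Q>" for Q
    using Qp(2)[OF that] adjoin_incl[OF iP xc] adjoin_mem[OF iP xc] by auto
  have cover: "\<exists>Q\<in>\<Q>. Q \<subseteq> Q'" if Q': "gprime Q'" "P \<subseteq> Q'" "x \<in> Q'" for Q'
  proof -
    have "?J \<subseteq> Q'" using adjoin_least[OF gprimeD(2)[OF Q'(1)] Q'(2,3)] .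
    then obtain P' where P': "P' \<in> set Ps" "P' \<subseteq> Q'" using contains[OF Q'(1)] by blast
    obtain M where "M \<in> set Ps" "M \<subseteq> P'" "\<forall>b\<in>set Ps. b \<subseteq> M \<longrightarrow> M = b"
      using finite_has_minimal2[OF finite_set P'(1)] by blast
    thus ?thesis using P'(2) unfolding \<Q>_def by blast
  qed
  have "(\<Sum>Q\<in>\<Q>. gdeg Q) \<le> gdeg P"
  proof (cases "gdim P \<ge> 2")
    case True
    then obtain D where D: "gdim P = Suc (Suc D)" by (metis add_2_eq_Suc le_Suc_ex)
    have gJ: "gdim ?J = Suc D" using gprime_adjoin(2)[OF P x False] D by simp
    have "(\<Sum>Q\<in>\<Q>. gdeg Q) = fact D * (\<Sum>Q\<in>\<Q>. hpcoeff Q D)"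
      unfolding gdeg_def sum_distrib_left using gQ D by (intro sum.cong) auto
    also have "\<dots> \<le> fact D * hpcoeff ?J D"
      using gJ D gQ Qp by (intro mult_left_mono sum_hpcoeff_le[OF fin _ hJ]) auto
    also have "\<dots> = gdeg ?J" unfolding gdeg_def gJ by simp
    finally show ?thesis using gprime_adjoin_gdeg[OF P x False True] by simp
  next
    case F: False
    hence "gdeg Q = 0" if "Q \<in> \<Q>" for Q using gQ[OF that] hpcoeff_zero[of Q 0] unfolding gdeg_def by simp
    thus ?thesis using gdeg_nonneg[OF gprimeD(1)[OF P]] by simp
  qed
  thus ?thesis using fin Qp sub gQ cover False by (intro exI[of _ \<Q>]) auto
qed

lemma gdim_adjoin_list_ge: "homogeneous I \<Longrightarrow> set ys \<subseteq> G 1 \<Longrightarrow> gdim I \<le> gdim (adjoin_list I ys) + length ys"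
proof (induction ys)
  case (Cons y ys)
  have ph: "pos_homs ys" using Cons.prems(2) unfolding pos_homs_def by auto
  have "gdim (adjoin_list I ys) \<le> Suc (gdim (adjoin (adjoin_list I ys) y))" using gdim_adjoin_ge[OF adjoin_list_homogeneous[OF Cons.prems(1) ph]] Cons.prems(2) by simp
  thus ?case using Cons unfolding adjoin_list_def by simp
qed (simp add: adjoin_list_def)

text \<open>If \<open>m + 1 - gdim P\<close> of the forms lay in \<open>P\<close>, they could be completed by fewer than \<open>gdim P\<close> others to \<open>m\<close> forms, which generate
  the irrelevant ideal. Modulo \<open>P\<close> these fewer than \<open>gdim P\<close> forms would then cut the dimension down to zero.\<close>

lemma forms_in_prime:
  assumes P: "gprime P" and I: "finite I" and xs: "\<And>i. i \<in> I \<Longrightarrow> xs i \<in> G 1" and m: "m \<le> card I"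
    and gp: "\<And>T J. T \<subseteq> I \<Longrightarrow> card T = m \<Longrightarrow> ideal J R \<Longrightarrow> xs ` T \<subseteq> J \<Longrightarrow> G 1 \<subseteq> J"
    and s: "0 < gdim P"
  shows "card {i \<in> I. xs i \<in> P} + gdim P \<le> m"
proof (rule ccontr)
  let ?B = "{i \<in> I. xs i \<in> P}"
  assume c: "\<not> ?thesis"
  have le: "m + 1 - gdim P \<le> card ?B" using c by linarith
  obtain A where A: "A \<subseteq> ?B" "card A = m + 1 - gdim P"
    using obtain_subset_with_card_n[OF le] by blast
  have AI: "A \<subseteq> I" "card A \<le> m" using A s by auto
  then obtain T where T: "A \<subseteq> T" "T \<subseteq> I" "card T = m"
    using exists_subset_between[OF AI(2) m AI(1) I] by blast
  have fT: "finite T" using finite_subset[OF T(2) I] .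
  have cC: "card (T - A) < gdim P" using T A(2) s fT card_Diff_subset[of A T] finite_subset[OF T(1) fT] by simp
  obtain es where es: "set es = T - A" "length es = card (T - A)"
    using fT by (metis distinct_card finite_Diff finite_distinct_list)
  let ?ys = "map xs es"
  have y1: "set ?ys \<subseteq> G 1" using es(1) xs T(2) by auto
  have yc: "set ?ys \<subseteq> carrier R" using y1 G_sub by blast
  have ph: "pos_homs ?ys" using y1 unfolding pos_homs_def by auto
  note ac = adjoin_list_contains[OF gprimeD(2)[OF P] yc]
  have "xs ` T \<subseteq> adjoin_list P ?ys"
  proof
    fix z assume "z \<in> xs ` T"
    then obtain i where i: "i \<in> T" "z = xs i" by auto
    show "z \<in> adjoin_list P ?ys" using ac A(1) es(1) i by (cases "i \<in> A") auto
  qed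
  hence "G 1 \<subseteq> adjoin_list P ?ys" using gp[OF T(2,3)] ac by blast
  hence "\<forall>j\<ge>1. G j \<subseteq> adjoin_list P ?ys" using irrelevant ac by blast
  hence "gdim (adjoin_list P ?ys) = 0" using gdim_zero_iff[OF adjoin_list_homogeneous[OF gprimeD(1)[OF P] ph]] by blast
  thus False using gdim_adjoin_list_ge[OF gprimeD(1)[OF P] y1] cC es(2) by simp
qed

lemma sum_UN_le:
  fixes f :: "'c \<Rightarrow> rat"
  assumes "finite A" "\<And>a. a \<in> A \<Longrightarrow> finite (B a)" "\<And>a b. a \<in> A \<Longrightarrow> b \<in> B a \<Longrightarrow> f b \<ge> 0"
  shows "sum f (\<Union>(B ` A)) \<le> (\<Sum>a\<in>A. sum f (B a))"
  using assms
proof (induction A rule: finite_induct)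
  case (insert a A)
  have fin: "finite (B a)" "finite (\<Union>(B ` A))" using insert by auto
  have "sum f (B a \<union> \<Union>(B ` A)) + sum f (B a \<inter> \<Union>(B ` A)) = sum f (B a) + sum f (\<Union>(B ` A))"
    by (rule sum.union_inter[OF fin])
  moreover have "sum f (B a \<inter> \<Union>(B ` A)) \<ge> 0" using insert.prems by (intro sum_nonneg) auto
  moreover have "sum f (\<Union>(B ` A)) \<le> (\<Sum>a\<in>A. sum f (B a))" using insert by auto
  ultimately show ?case using insert(1,2) by simp
qed simp

theorem selection:
  assumes I: "finite I" "card I = dd * (m - n) + n" and nm: "n \<le> m" and xs: "\<And>i. i \<in> I \<Longrightarrow> xs i \<in> G 1" and m: "m \<le> card I"
    and gp: "\<And>T J. T \<subseteq> I \<Longrightarrow> card T = m \<Longrightarrow> ideal J R \<Longrightarrow> xs ` T \<subseteq> J \<Longrightarrow> G 1 \<subseteq> J"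
    and Ms: "finite Ms" "\<And>P. P \<in> Ms \<Longrightarrow> gprime P \<and> gdim P \<le> n" "(\<Sum>P\<in>Ms. gdeg P) \<le> of_nat dd"
      "\<And>Q. gprime Q \<Longrightarrow> \<exists>P\<in>Ms. P \<subseteq> Q"
  shows "\<exists>S\<subseteq>I. card S = n \<and> (\<forall>Q. gprime Q \<longrightarrow> xs ` S \<subseteq> Q \<longrightarrow> gdim Q = 0)"
proof -
  have "j \<le> n \<Longrightarrow> \<exists>S\<subseteq>I. card S = j \<and> (\<exists>\<P>. finite \<P> \<and> (\<forall>P\<in>\<P>. gprime P \<and> xs ` S \<subseteq> P \<and> gdim P \<le> n - j) \<and>
    (\<Sum>P\<in>\<P>. gdeg P) \<le> of_nat dd \<and> (\<forall>Q. gprime Q \<longrightarrow> xs ` S \<subseteq> Q \<longrightarrow> (\<exists>P\<in>\<P>. P \<subseteq> Q)))" for j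
  proof (induction j)
    case 0
    show ?case using Ms by (intro exI[of _ "{}"]) (auto intro!: exI[of _ Ms])
  next
    case (Suc j)
    from Suc.IH[OF Suc_leD[OF Suc.prems]] obtain S \<P> where S: "S \<subseteq> I" "card S = j" and fin: "finite \<P>"
      and *: "\<forall>P\<in>\<P>. gprime P \<and> xs ` S \<subseteq> P \<and> gdim P \<le> n - j"
      and sum: "(\<Sum>P\<in>\<P>. gdeg P) \<le> of_nat dd" and **: "\<forall>Q. gprime Q \<longrightarrow> xs ` S \<subseteq> Q \<longrightarrow> (\<exists>P\<in>\<P>. P \<subseteq> Q)"
      by blast
    have \<P>: "\<And>P. P \<in> \<P> \<Longrightarrow> gprime P \<and> xs ` S \<subseteq> P \<and> gdim P \<le> n - j" using * by blast
    have cov: "\<And>Q. gprime Q \<Longrightarrow> xs ` S \<subseteq> Q \<Longrightarrow> \<exists>P\<in>\<P>. P \<subseteq> Q" using ** by blast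
    have fS: "finite S" using finite_subset[OF S(1) I(1)] .
    \<comment> \<open>only components of the maximal dimension \<open>n - j\<close> restrict the choice of the next form\<close>
    define \<T> where "\<T> = {P \<in> \<P>. gdim P = n - j}"
    have f\<T>: "finite \<T>" unfolding \<T>_def using fin by simp
    have "of_nat (card \<T>) = (\<Sum>P\<in>\<T>. 1::rat)" by simp
    also have "\<dots> \<le> (\<Sum>P\<in>\<T>. gdeg P)"
    proof (rule sum_mono)
      fix P assume P: "P \<in> \<T>"
      hence "gdim P = Suc (n - j - 1)" unfolding \<T>_def using Suc.prems by simp
      thus "1 \<le> gdeg P" using gdeg_ge_1 P \<P> unfolding \<T>_def by blast
    qed
    also have "\<dots> \<le> (\<Sum>P\<in>\<P>. gdeg P)"
      unfolding \<T>_def using fin \<P> gdeg_nonneg gprimeD(1) by (intro sum_mono2) auto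
    finally have "(of_nat (card \<T>) :: rat) \<le> of_nat dd" using sum by simp
    hence c\<T>: "card \<T> \<le> dd" by simp
    define B where "B P = {i \<in> I - S. xs i \<in> P}" for P
    have cB: "card (B P) \<le> m - n" if P: "P \<in> \<T>" for P
    proof -
      have gP: "gprime P" "xs ` S \<subseteq> P" "gdim P = n - j" using P \<P> unfolding \<T>_def by auto
      have fB: "finite (B P)" unfolding B_def using I by simp
      have "card {i \<in> I. xs i \<in> P} + gdim P \<le> m"
        using forms_in_prime[OF gP(1) I(1) xs m gp] gP(3) Suc.prems by simp
      moreover have "{i \<in> I. xs i \<in> P} = B P \<union> S" unfolding B_def using gP(2) S(1) by auto
      moreover have "card (B P \<union> S) = card (B P) + card S"
        by (rule card_Un_disjoint[OF fB fS]) (auto simp: B_def)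
      ultimately show ?thesis using S(2) gP(3) Suc.prems by simp
    qed
    have "card (\<Union>(B ` \<T>)) \<le> (\<Sum>P\<in>\<T>. card (B P))" using f\<T> by (rule card_UN_le)
    also have "\<dots> \<le> (\<Sum>P\<in>\<T>. m - n)" using cB by (intro sum_mono)
    also have "\<dots> \<le> dd * (m - n)" using c\<T> by simp
    \<comment> \<open>this is where the number \<open>dd * (m - n) + n\<close> of forms is needed\<close>
    also have "\<dots> < card (I - S)" using I(2) S Suc.prems card_Diff_subset[OF fS S(1)] by simp
    finally have lt: "card (\<Union>(B ` \<T>)) < card (I - S)" .
    have "finite (B P)" for P unfolding B_def using I(1) by simp
    hence "finite (\<Union>(B ` \<T>))" using f\<T> by blast
    hence "\<not> I - S \<subseteq> \<Union>(B ` \<T>)" using card_mono[of "\<Union>(B ` \<T>)" "I - S"] lt by linarith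
    then obtain i where i: "i \<in> I" "i \<notin> S" "\<And>P. P \<in> \<T> \<Longrightarrow> xs i \<notin> P" unfolding B_def by blast
    define cut where "cut P \<Q> \<longleftrightarrow> finite \<Q> \<and> (\<forall>Q\<in>\<Q>. gprime Q \<and> P \<subseteq> Q \<and> xs i \<in> Q \<and> gdim Q \<le> (if xs i \<in> P then gdim P else gdim P - 1)) \<and>
      (\<Sum>Q\<in>\<Q>. gdeg Q) \<le> gdeg P \<and> (\<forall>Q'. gprime Q' \<longrightarrow> P \<subseteq> Q' \<longrightarrow> xs i \<in> Q' \<longrightarrow> (\<exists>Q\<in>\<Q>. Q \<subseteq> Q'))" for P \<Q>
    have "\<forall>P\<in>\<P>. \<exists>\<Q>. cut P \<Q>"
      unfolding cut_def by (intro ballI hyperplane_cut[OF conjunct1[OF \<P>] xs[OF i(1)]])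
    from bchoice[OF this] obtain \<C> where cut: "\<forall>P\<in>\<P>. cut P (\<C> P)" ..
    have \<C>: "finite (\<C> P)" "\<And>Q. Q \<in> \<C> P \<Longrightarrow> gprime Q \<and> P \<subseteq> Q \<and> xs i \<in> Q \<and> gdim Q \<le> (if xs i \<in> P then gdim P else gdim P - 1)"
      "(\<Sum>Q\<in>\<C> P. gdeg Q) \<le> gdeg P" "\<And>Q'. gprime Q' \<Longrightarrow> P \<subseteq> Q' \<Longrightarrow> xs i \<in> Q' \<Longrightarrow> \<exists>Q\<in>\<C> P. Q \<subseteq> Q'"
      if "P \<in> \<P>" for P
      using bspec[OF cut that] unfolding cut_def by (elim conjE; simp)+
    let ?S = "insert i S" and ?P = "\<Union>(\<C> ` \<P>)"
    have "(\<Sum>Q\<in>?P. gdeg Q) \<le> (\<Sum>P\<in>\<P>. \<Sum>Q\<in>\<C> P. gdeg Q)"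
      using fin \<C>(1,2) gdeg_nonneg gprimeD(1) by (intro sum_UN_le) auto
    also have "\<dots> \<le> (\<Sum>P\<in>\<P>. gdeg P)" using \<C>(3) by (rule sum_mono)
    finally have sum': "(\<Sum>Q\<in>?P. gdeg Q) \<le> of_nat dd" using sum by simp
    have prime': "gprime Q \<and> xs ` ?S \<subseteq> Q \<and> gdim Q \<le> n - Suc j" if Q: "Q \<in> ?P" for Q
    proof -
      obtain P where P: "P \<in> \<P>" "Q \<in> \<C> P" using Q by auto
      note c = \<C>(2)[OF P] and p = \<P>[OF P(1)]
      have "gdim Q \<le> n - Suc j"
      proof (cases "P \<in> \<T>")
        case True
        thus ?thesis using c i(3)[OF True] p by auto
      next
        case False
        hence "gdim P < n - j" using p P(1) unfolding \<T>_def by auto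
        thus ?thesis using c by (auto split: if_splits)
      qed
      thus ?thesis using c p by auto
    qed
    have cov': "\<exists>P\<in>?P. P \<subseteq> Q" if Q: "gprime Q" "xs ` ?S \<subseteq> Q" for Q
    proof -
      obtain P where P: "P \<in> \<P>" "P \<subseteq> Q" using cov[OF Q(1)] Q(2) by auto
      thus ?thesis using \<C>(4)[OF P(1) Q(1) P(2)] Q(2) by auto
    qed
    show ?case
    proof (rule exI[of _ ?S], intro conjI, goal_cases)
      case 3
      show ?case
      proof (rule exI[of _ ?P], intro conjI ballI allI impI, goal_cases)
        case 1
        show ?case using fin \<C>(1) by (rule finite_UN_I)
      qed (use sum' prime' cov' in simp_all)
    qed (use i S fS in auto)
  qed
  from this[OF order_refl] obtain S \<P> where S: "S \<subseteq> I" "card S = n"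
    and *: "\<forall>P\<in>\<P>. gprime P \<and> xs ` S \<subseteq> P \<and> gdim P \<le> n - n" and **: "\<forall>Q. gprime Q \<longrightarrow> xs ` S \<subseteq> Q \<longrightarrow> (\<exists>P\<in>\<P>. P \<subseteq> Q)"
    by blast
  have \<P>: "\<And>P. P \<in> \<P> \<Longrightarrow> gprime P \<and> gdim P \<le> 0" using * by simp
  have cov: "\<And>Q. gprime Q \<Longrightarrow> xs ` S \<subseteq> Q \<Longrightarrow> \<exists>P\<in>\<P>. P \<subseteq> Q" using ** by blast
  have "gdim Q = 0" if Q: "gprime Q" "xs ` S \<subseteq> Q" for Q
  proof -
    obtain P where "P \<in> \<P>" "P \<subseteq> Q" using cov[OF Q] by blast
    thus ?thesis using \<P> gdim_mono[of P Q] gprimeD(1) Q(1) by fastforce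
  qed
  thus ?thesis using S by blast
qed

end

section \<open>Krull dimension and degree\<close>

context cring
begin

lemma quot_mem_iff:
  assumes "ideal P R" "ideal Q R" "P \<subseteq> Q" "a \<in> carrier R"
  shows "P +> a \<in> (+>) P ` Q \<longleftrightarrow> a \<in> Q"
proof
  assume "P +> a \<in> (+>) P ` Q"
  then obtain q where q: "q \<in> Q" "P +> a = P +> q" by auto
  have qc: "q \<in> carrier R" using q idealD(1)[OF assms(2)] by auto
  have "a \<ominus> q \<in> Q" using quotient_eq_iff_same_a_r_cos[OF assms(1,4) qc] q(2) assms(3) by auto
  hence "(a \<ominus> q) \<oplus> q \<in> Q" using idealD(3)[OF assms(2)] q by auto
  moreover have "(a \<ominus> q) \<oplus> q = a" using assms(4) qc by algebra
  ultimately show "a \<in> Q" by simp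
qed auto

lemma quot_carrier: "carrier (R Quot P) = (+>) P ` carrier R"
  by (auto simp: FactRing_def A_RCOSETS_def')

lemma quot_mult: "ideal P R \<Longrightarrow> a \<in> carrier R \<Longrightarrow> b \<in> carrier R \<Longrightarrow> (P +> a) \<otimes>\<^bsub>R Quot P\<^esub> (P +> b) = P +> (a \<otimes> b)"
  using ideal.rcoset_mult_add by (simp add: FactRing_def)

lemma primeideal_quot:
  assumes P: "ideal P R" and Q: "primeideal Q R" "P \<subseteq> Q"
  shows "primeideal ((+>) P ` Q) (R Quot P)"
proof -
  have iQ: "ideal Q R" using primeideal.axioms(1)[OF Q(1)] .
  note mem = quot_mem_iff[OF P iQ Q(2)]
  show ?thesis
  proof (rule primeidealI)
    show "ideal ((+>) P ` Q) (R Quot P)" using ring_ideal_imp_quot_ideal[OF P iQ] .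
    show "cring (R Quot P)" using ideal.quotient_is_cring[OF P is_cring] .
    show "carrier (R Quot P) \<noteq> (+>) P ` Q"
    proof
      assume "carrier (R Quot P) = (+>) P ` Q"
      hence "P +> \<one> \<in> (+>) P ` Q" unfolding quot_carrier by auto
      hence "\<one> \<in> Q" using mem[OF one_closed] by simp
      thus False using ideal.one_imp_carrier[OF iQ] primeideal.I_notcarr[OF Q(1)] by auto
    qed
    fix A B assume "A \<in> carrier (R Quot P)" "B \<in> carrier (R Quot P)" and AB: "A \<otimes>\<^bsub>R Quot P\<^esub> B \<in> (+>) P ` Q"
    then obtain a b where a: "a \<in> carrier R" "A = P +> a" and b: "b \<in> carrier R" "B = P +> b"
      unfolding quot_carrier by blast
    have "P +> (a \<otimes> b) \<in> (+>) P ` Q" using AB quot_mult[OF P a(1) b(1)] a b by simp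
    hence "a \<in> Q \<or> b \<in> Q" using mem a b primeideal.I_prime[OF Q(1) a(1) b(1)] by simp
    thus "A \<in> (+>) P ` Q \<or> B \<in> (+>) P ` Q" using a b by auto
  qed
qed

lemma prime_chain_quot:
  assumes P: "ideal P R" and C: "prime_chain R n C" "P \<subseteq> C 0"
  shows "prime_chain (R Quot P) n (\<lambda>i. (+>) P ` C i)"
  unfolding prime_chain_def
proof (intro conjI allI impI)
  have p: "\<And>i. i \<le> n \<Longrightarrow> primeideal (C i) R" and l: "\<And>i. i < n \<Longrightarrow> C i \<subset> C (Suc i)"
    using C(1) unfolding prime_chain_def by auto
  have sub: "i \<le> n \<Longrightarrow> P \<subseteq> C i" for i
  proof (induction i)
    case (Suc i)
    thus ?case using l[of i] by auto
  qed (use C in auto)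
  show "primeideal ((+>) P ` C i) (R Quot P)" if "i \<le> n" for i using primeideal_quot[OF P p sub] that by auto
  show "(+>) P ` C i \<subset> (+>) P ` C (Suc i)" if i: "i < n" for i
  proof -
    obtain a where a: "a \<in> C (Suc i)" "a \<notin> C i" using l[OF i] by auto
    have i1: "ideal (C i) R" "ideal (C (Suc i)) R" using primeideal.axioms(1)[OF p[of i]] primeideal.axioms(1)[OF p[of "Suc i"]] i by auto
    have ac: "a \<in> carrier R" using a idealD(1)[OF i1(2)] by auto
    have "P +> a \<notin> (+>) P ` C i" using quot_mem_iff[OF P i1(1) sub ac] i a by auto
    thus ?thesis using a l[OF i] by blast
  qed
qed

lemma prime_chain_vimage:
  assumes P: "ideal P R" and C: "prime_chain (R Quot P) n C"
  shows "prime_chain R n (\<lambda>i. {a \<in> carrier R. P +> a \<in> C i})"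
  unfolding prime_chain_def
proof (intro conjI allI impI)
  have p: "\<And>i. i \<le> n \<Longrightarrow> primeideal (C i) (R Quot P)" and l: "\<And>i. i < n \<Longrightarrow> C i \<subset> C (Suc i)"
    using C(1) unfolding prime_chain_def by auto
  have homogeneous: "ring_hom_ring R (R Quot P) ((+>) P)" using ideal.rcos_ring_hom_ring[OF P] .
  show "primeideal {a \<in> carrier R. P +> a \<in> C i} R" if i: "i \<le> n" for i
  proof (rule primeidealI)
    have iC: "ideal (C i) (R Quot P)" using primeideal.axioms(1)[OF p[OF i]] .
    show "ideal {a \<in> carrier R. P +> a \<in> C i} R" using ring_hom_ring.ideal_vimage[OF homogeneous iC] .
    show "cring R" by (rule is_cring)
    have "carrier (R Quot P) \<noteq> C i" "C i \<subseteq> carrier (R Quot P)"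
      using primeideal.I_notcarr[OF p[OF i]] additive_subgroup.a_subset[OF ideal.axioms(1)[OF iC]] by auto
    thus "carrier R \<noteq> {a \<in> carrier R. P +> a \<in> C i}" unfolding quot_carrier by auto
    fix a b assume ab: "a \<in> carrier R" "b \<in> carrier R" "a \<otimes> b \<in> {a \<in> carrier R. P +> a \<in> C i}"
    have "(P +> a) \<otimes>\<^bsub>R Quot P\<^esub> (P +> b) \<in> C i" using ab quot_mult[OF P ab(1,2)] by simp
    hence "P +> a \<in> C i \<or> P +> b \<in> C i"
      by (rule primeideal.I_prime[OF p[OF i], rotated 2]) (use ab in \<open>auto simp: quot_carrier\<close>)
    thus "a \<in> {a \<in> carrier R. P +> a \<in> C i} \<or> b \<in> {a \<in> carrier R. P +> a \<in> C i}" using ab by auto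
  qed
  show "{a \<in> carrier R. P +> a \<in> C i} \<subset> {a \<in> carrier R. P +> a \<in> C (Suc i)}" if i: "i < n" for i
  proof -
    have "ideal (C (Suc i)) (R Quot P)" using primeideal.axioms(1)[OF p[of "Suc i"]] i by auto
    from additive_subgroup.a_subset[OF ideal.axioms(1)[OF this]]
    have "C (Suc i) \<subseteq> (+>) P ` carrier R" unfolding quot_carrier .
    thus ?thesis using l[OF i] by blast
  qed
qed

lemma primeideal_contains_factor:
  assumes Ps: "\<And>P. P \<in> set Ps \<Longrightarrow> P \<subseteq> carrier R" "\<forall>as. list_all2 (\<in>) as Ps \<longrightarrow> foldr (\<otimes>) as \<one> \<in> I"
    and Q: "primeideal Q R" "I \<subseteq> Q"
  shows "\<exists>P\<in>set Ps. P \<subseteq> Q"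
proof (rule ccontr)
  assume c: "\<not> ?thesis"
  hence "\<exists>a. a \<in> P \<and> a \<notin> Q" if "P \<in> set Ps" for P using that by blast
  then obtain a where a: "\<And>P. P \<in> set Ps \<Longrightarrow> a P \<in> P \<and> a P \<notin> Q" by metis
  have "list_all2 (\<in>) (map a Ps) Ps" using a by (auto simp: list_all2_conv_all_nth)
  hence "foldr (\<otimes>) (map a Ps) \<one> \<in> Q" using Ps(2) Q(2) by blast
  moreover have "foldr (\<otimes>) (map a Ps') \<one> \<in> carrier R \<and> foldr (\<otimes>) (map a Ps') \<one> \<notin> Q" if "set Ps' \<subseteq> set Ps" for Ps'
    using that
  proof (induction Ps')
    case Nil
    have "\<one> \<notin> Q"
      using ideal.one_imp_carrier[OF primeideal.axioms(1)[OF Q(1)]] primeideal.I_notcarr[OF Q(1)] by auto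
    thus ?case by simp
  next
    case (Cons P Ps')
    have A: "a P \<in> carrier R" "a P \<notin> Q" using a[of P] Ps(1)[of P] Cons.prems by auto
    have B: "foldr (\<otimes>) (map a Ps') \<one> \<in> carrier R" "foldr (\<otimes>) (map a Ps') \<one> \<notin> Q" using Cons by auto
    show ?case using primeideal.I_prime[OF Q(1) A(1) B(1)] A B by auto
  qed
  ultimately show False by blast
qed

end

lemma krull_dim_ge: "prime_chain R n C \<Longrightarrow> enat n \<le> krull_dim R"
  unfolding krull_dim_def by (rule SUP_upper) auto

lemma krull_dim_le: "(\<And>n C. prime_chain R n C \<Longrightarrow> n \<le> k) \<Longrightarrow> krull_dim R \<le> enat k"
  unfolding krull_dim_def by (rule SUP_least) auto

context std_graded
begin

lemma prime_attaining_gdim':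
  assumes J: "homogeneous J" and one: "\<one> \<notin> J" shows "\<exists>Q. gprime Q \<and> J \<subseteq> Q \<and> gdim Q = gdim J"
proof (cases "gdim J")
  case 0
  obtain Ps where Ps: "\<forall>P\<in>set Ps. gprime P \<and> J \<subseteq> P" "\<forall>as. list_all2 (\<in>) as Ps \<longrightarrow> foldr (\<otimes>) as \<one> \<in> J"
    using gprime_decomposition[OF J] by auto
  have "Ps \<noteq> []"
  proof
    assume "Ps = []"
    thus False using Ps(2) one by auto
  qed
  then obtain Q where "gprime Q" "J \<subseteq> Q" using Ps(1) by (cases Ps) auto
  thus ?thesis using gdim_mono[OF J gprimeD(1)] 0 by auto
next
  case (Suc s)
  thus ?thesis using prime_attaining_gdim[OF J Suc] by auto
qed

text \<open>A hyperplane that does not contain the variety of \<open>P\<close> lowers the dimension by one, and the dimension of the section is attained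
  at a prime, from which the chain is continued.\<close>

lemma gprime_chain: "gprime P \<Longrightarrow> gdim P = n \<Longrightarrow> \<exists>C. prime_chain R n C \<and> C 0 = P"
proof (induction n arbitrary: P)
  case 0
  thus ?case using gprime_primeideal by (intro exI[of _ "\<lambda>_. P"]) (auto simp: prime_chain_def)
next
  case (Suc n)
  have "\<not> G 1 \<subseteq> P"
  proof
    assume "G 1 \<subseteq> P"
    hence "gdim P = 0" using gdim_zero_iff[OF gprimeD(1)[OF Suc.prems(1)]] irrelevant[OF gprimeD(2)[OF Suc.prems(1)]] by blast
    thus False using Suc.prems by simp
  qed
  then obtain x where x: "x \<in> G 1" "x \<notin> P" by auto
  note iP = gprimeD(2)[OF Suc.prems(1)] and hA = homogeneous_adjoin[OF gprimeD(1)[OF Suc.prems(1)] x(1)]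
  have xc: "x \<in> carrier R" using x G_carr by auto
  have g: "gdim (adjoin P x) = n" using gprime_adjoin(2)[OF Suc.prems(1) x] Suc.prems(2) by simp
  obtain Q where Q: "gprime Q" "adjoin P x \<subseteq> Q" "gdim Q = n"
    using prime_attaining_gdim'[OF hA one_notin_adjoin[OF Suc.prems(1) x(1)]] g by auto
  obtain C where C: "prime_chain R n C" "C 0 = Q" using Suc.IH[OF Q(1,3)] by auto
  have PQ: "P \<subset> Q" using Q(2) adjoin_incl[OF iP xc] adjoin_mem[OF iP xc] x by auto
  have "prime_chain R (Suc n) (case_nat P C)"
    using C PQ gprime_primeideal[OF Suc.prems(1)] unfolding prime_chain_def by (auto split: nat.splits)
  thus ?case by (intro exI[of _ "case_nat P C"]) auto
qed

lemma G_dim: "d (G j) \<le> (j + 1) ^ length Xs"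
proof -
  have "pos_homs Xs" using X_deg unfolding pos_homs_def by auto
  hence "d (alg (set Xs) \<inter> G j) \<le> (j + 1) ^ length Xs" by (rule algG_dim) simp
  moreover have "alg (set Xs) \<inter> G j = G j" using G_carrier_alg G_sub by blast
  ultimately show ?thesis by simp
qed

lemma Fil_subsp: "subsp (Fil N)"
proof (rule subspI)
  show "Fil N \<subseteq> carrier R" using Fil_carr by auto
  show "\<zero> \<in> Fil N" unfolding Fil_def using pr_zero by auto
  show "a \<oplus> b \<in> Fil N" if "a \<in> Fil N" "b \<in> Fil N" for a b using Fil_add[OF that] .
  show "k \<otimes> a \<in> Fil N" if "k \<in> G 0" "a \<in> Fil N" for k a
    using Fil_mult(1)[of k 0 a N] that G_Fil[of 0] by auto
qed

lemma Fil_dim: "fd (Fil N) \<and> d (Fil N) \<le> (N + 1) * (N + 1) ^ length Xs"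
proof (induction N)
  case 0
  have "Fil 0 = G 0"
  proof
    show "G 0 \<subseteq> Fil 0" by (rule G_Fil)
    show "Fil 0 \<subseteq> G 0"
    proof
      fix a assume a: "a \<in> Fil 0"
      hence "a = pr 0 a" using Fil_sum[OF a] pr_carr[OF Fil_carr[OF a]] by simp
      thus "a \<in> G 0" using pr_in[OF Fil_carr[OF a], of 0] by simp
    qed
  qed
  thus ?case using G_fd[of 0] G_dim[of 0] by simp
next
  case (Suc N)
  have sub: "Fil (Suc N) \<subseteq> Fil N <+> G (Suc N)"
  proof
    fix a assume a: "a \<in> Fil (Suc N)"
    have ac: "a \<in> carrier R" using Fil_carr a by auto
    let ?t = "pr (Suc N) a"
    have tc: "?t \<in> carrier R" using pr_carr ac by auto
    have "pr j (a \<ominus> ?t) = \<zero>" if "j > N" for j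
    proof (cases "j = Suc N")
      case True
      thus ?thesis using pr_same[OF pr_in[OF ac, of j]] pr_add[of a "\<ominus> ?t"] pr_minus[OF tc] ac tc
        by (simp add: a_minus_def r_neg)
    next
      case False
      thus ?thesis using that a pr_other[OF pr_in[OF ac, of "Suc N"], of j] pr_add[of a "\<ominus> ?t"] pr_minus[OF tc] ac tc
        unfolding Fil_def by (simp add: a_minus_def)
    qed
    hence "a \<ominus> ?t \<in> Fil N" unfolding Fil_def using ac tc by simp
    moreover have "a = (a \<ominus> ?t) \<oplus> ?t" using ac tc by algebra
    ultimately show "a \<in> Fil N <+> G (Suc N)" unfolding set_add_mem using pr_in[OF ac] by blast
  qed
  have f: "fd (Fil N <+> G (Suc N))" using sum_fd Suc G_fd by auto
  have "d (Fil (Suc N)) \<le> d (Fil N <+> G (Suc N))" using d_mono[OF f Fil_subsp sub] .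
  also have "\<dots> \<le> d (Fil N) + d (G (Suc N))" using d_sum[of "Fil N" "G (Suc N)"] Suc G_fd by simp
  also have "\<dots> \<le> (N + 1) * (N + 1) ^ length Xs + (Suc N + 1) ^ length Xs" using Suc G_dim[of "Suc N"] by simp
  also have "\<dots> \<le> (N + 1) * (Suc N + 1) ^ length Xs + (Suc N + 1) ^ length Xs"
    by (intro add_right_mono mult_left_mono power_mono) auto
  also have "\<dots> = (Suc N + 1) * (Suc N + 1) ^ length Xs" by simp
  finally show ?case using fd_mono[OF f Fil_subsp sub] by simp
qed

text \<open>If \<open>V\<close> meets \<open>Q\<close> trivially, then \<open>V \<oplus> f V \<oplus> \<dots> \<oplus> f\<^sup>t\<^sup>-\<^sup>1 V\<close> meets \<open>Q'\<close> trivially: the constant term of an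
  element of \<open>Q'\<close> lies in \<open>Q\<close>, hence vanishes, and then \<open>f\<close> can be cancelled modulo \<open>Q'\<close>.\<close>

lemma independent_powers:
  assumes Q: "primeideal Q' R" "ideal Q R" "Q' \<subseteq> Q" and f: "f \<in> Q" "f \<notin> Q'" "f \<in> Fil s"
    and V: "fd V" "V \<subseteq> Fil M" "V \<inter> Q = {\<zero>}"
  shows "\<exists>W. fd W \<and> W \<subseteq> Fil (M + s * t) \<and> d W = t * d V \<and> W \<inter> Q' = {\<zero>}"
proof (induction t)
  case 0
  have "\<zero> \<in> Fil M" using subspD(2)[OF Fil_subsp] .
  thus ?case using zero_space idealD(2)[OF primeideal.axioms(1)[OF Q(1)]] by (intro exI[of _ "{\<zero>}"]) auto
next
  case (Suc t)
  then obtain W where W: "fd W" "W \<subseteq> Fil (M + s * t)" "d W = t * d V" "W \<inter> Q' = {\<zero>}" by auto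
  have iQ': "ideal Q' R" using primeideal.axioms(1)[OF Q(1)] .
  have fc: "f \<in> carrier R" using f Fil_carr by auto
  have sW: "subsp W" "subsp V" using fd_subsp W V by auto
  have fm: "fd (mul f W)" using mul_fd[OF fc W(1)] .
  have mQ: "mul f W \<subseteq> Q" unfolding mul_def using idealD(7)[OF Q(2) f(1)] subspD(1)[OF sW(1)] by auto
  have ker: "w = \<zero>" if "w \<in> W" "f \<otimes> w \<in> Q'" for w
  proof -
    have "w \<in> carrier R" using that(1) subspD(1)[OF sW(1)] by auto
    hence "w \<in> Q'" using primeideal.I_prime[OF Q(1) fc _ that(2)] f(2) by auto
    thus ?thesis using that(1) W(4) by auto
  qed
  have "{w \<in> W. f \<otimes> w = \<zero>} = {\<zero>}"
  proof
    have "w = \<zero>" if "w \<in> W" "f \<otimes> w = \<zero>" for w using ker[OF that(1)] idealD(2)[OF iQ'] that(2) by simp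
    thus "{w \<in> W. f \<otimes> w = \<zero>} \<subseteq> {\<zero>}" by blast
    show "{\<zero>} \<subseteq> {w \<in> W. f \<otimes> w = \<zero>}" using subspD(2)[OF sW(1)] fc by simp
  qed
  hence dm: "d (mul f W) = d W" using mul_rank(2)[OF fc W(1)] zero_space by simp
  have "V \<inter> mul f W = {\<zero>}"
    using mQ V(3) subspD(2)[OF sW(2)] subspD(2)[OF mul_subsp[OF fc sW(1)]] by blast
  hence ds: "d (V <+> mul f W) = Suc t * d V" using d_sum[OF V(1) fm] zero_space dm W(3) by simp
  have "mul f W \<subseteq> Fil (M + s * Suc t)"
  proof
    fix y assume "y \<in> mul f W"
    then obtain w where w: "w \<in> W" "y = f \<otimes> w" unfolding mul_def by auto
    have "y \<in> Fil (s + (M + s * t))" using Fil_mult(1)[OF f(3)] w W(2) by auto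
    moreover have "s + (M + s * t) = M + s * Suc t" by simp
    ultimately show "y \<in> Fil (M + s * Suc t)" by metis
  qed
  moreover have "V \<subseteq> Fil (M + s * Suc t)" using V(2) Fil_mono[of M "M + s * Suc t"] by auto
  ultimately have sub: "V <+> mul f W \<subseteq> Fil (M + s * Suc t)" by (intro set_add_least[OF Fil_subsp])
  have "(V <+> mul f W) \<inter> Q' = {\<zero>}"
  proof
    show "{\<zero>} \<subseteq> (V <+> mul f W) \<inter> Q'" using subspD(2)[OF fd_subsp[OF sum_fd[OF V(1) fm]]] idealD(2)[OF iQ'] by auto
    show "(V <+> mul f W) \<inter> Q' \<subseteq> {\<zero>}"
    proof
      fix z assume "z \<in> (V <+> mul f W) \<inter> Q'"
      then have z: "z \<in> V <+> mul f W" "z \<in> Q'" by auto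
      then obtain v w where vw: "v \<in> V" "w \<in> W" "z = v \<oplus> f \<otimes> w" unfolding set_add_mem mul_def by blast
      have c: "v \<in> carrier R" "f \<otimes> w \<in> carrier R" using vw subspD(1)[OF sW(1)] subspD(1)[OF sW(2)] fc by auto
      have "f \<otimes> w \<in> Q" using mQ vw(2) unfolding mul_def by auto
      hence "v \<in> Q" using ideal_cancel_r[OF Q(2) _ _ c(1)] z(2) Q(3) vw(3) by auto
      hence v0: "v = \<zero>" using vw(1) V(3) by auto
      hence "w = \<zero>" using ker[OF vw(2)] z(2) vw(3) c by simp
      thus "z \<in> {\<zero>}" using vw(3) v0 fc by simp
    qed
  qed
  thus ?case using sum_fd[OF V(1) fm] sub ds by blast
qed

text \<open>A chain of \<open>n + 1\<close> primes produces \<open>T\<^sup>n\<close> independent elements whose degrees are bounded by a multiple of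
  \<open>T\<close>, but the number of monomials of these degrees is bounded by a polynomial of degree \<open>length Xs + 1\<close> in \<open>T\<close>. The bound is crude;
  it ensures that the Krull dimensions of the quotients are finite.\<close>

lemma prime_chain_bound:
  assumes C: "prime_chain R n C" shows "n \<le> Suc (length Xs)"
proof (rule ccontr)
  assume c: "\<not> ?thesis"
  have p: "\<And>i. i \<le> n \<Longrightarrow> primeideal (C i) R" and l: "\<And>i. i < n \<Longrightarrow> C i \<subset> C (Suc i)"
    using C(1) unfolding prime_chain_def by auto
  have id: "\<And>i. i \<le> n \<Longrightarrow> ideal (C i) R" using p primeideal.axioms(1) by blast
  have "\<exists>f s. f \<in> C (Suc i) \<and> f \<notin> C i \<and> f \<in> Fil s" if i: "i < n" for i
  proof -
    obtain f where f: "f \<in> C (Suc i)" "f \<notin> C i" using l[OF i] by auto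
    thus ?thesis using Fil_ex[of f] idealD(1)[OF id[of "Suc i"]] i by auto
  qed
  then obtain f s where f: "\<And>i. i < n \<Longrightarrow> f i \<in> C (Suc i) \<and> f i \<notin> C i \<and> f i \<in> Fil (s i)" by metis
  define S where "S = (\<Sum>i<n. s i)"
  have fS: "f i \<in> Fil S" if "i < n" for i
  proof -
    have "s i \<le> S" unfolding S_def using that by (intro member_le_sum) auto
    thus ?thesis using f[OF that] Fil_mono by blast
  qed
  have main: "k \<le> n \<Longrightarrow> \<exists>V. fd V \<and> V \<subseteq> Fil (k * S * T) \<and> d V = T ^ k \<and> V \<inter> C (n - k) = {\<zero>}" for k T
  proof (induction k)
    case 0
    have "a = \<zero>" if "a \<in> G 0" "a \<in> C n" for a
    proof (rule ccontr)
      assume "a \<noteq> \<zero>"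
      hence "\<one> \<in> C n" using field_unit[OF id[of n]] that by auto
      thus False using ideal.one_imp_carrier[OF id[of n]] primeideal.I_notcarr[OF p[of n]] by auto
    qed
    hence "G 0 \<inter> C n = {\<zero>}" using G_zero[of 0] idealD(2)[OF id[OF order_refl]] by blast
    thus ?case using G_fd[of 0] d_eq[OF dimension_one[OF subfield]] G_Fil[of 0] by (intro exI[of _ "G 0"]) auto
  next
    case (Suc k)
    then obtain V where V: "fd V" "V \<subseteq> Fil (k * S * T)" "d V = T ^ k" "V \<inter> C (n - k) = {\<zero>}" by auto
    have i: "n - Suc k < n" "Suc (n - Suc k) = n - k" using Suc.prems by auto
    have fi: "f (n - Suc k) \<in> C (n - k)" "f (n - Suc k) \<notin> C (n - Suc k)" "C (n - Suc k) \<subseteq> C (n - k)"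
      using f[OF i(1)] l[OF i(1)] i(2) by auto
    have "\<exists>W. fd W \<and> W \<subseteq> Fil (k * S * T + S * T) \<and> d W = T * d V \<and> W \<inter> C (n - Suc k) = {\<zero>}"
      by (rule independent_powers[OF p id fi(3,1,2) fS[OF i(1)] V(1,2,4)]) (use i in auto)
    moreover have "k * S * T + S * T = Suc k * S * T" by (simp add: algebra_simps)
    ultimately show ?case using V(3) by (metis power_Suc)
  qed
  let ?L = "length Xs"
  define B where "B = (n * S + 1) ^ Suc ?L"
  define T where "T = Suc B"
  obtain V where V: "fd V" "V \<subseteq> Fil (n * S * T)" "d V = T ^ n" using main[of n T] by auto
  have "T ^ Suc (Suc ?L) \<le> T ^ n" using c unfolding T_def by (intro power_increasing) auto
  also have "\<dots> \<le> d (Fil (n * S * T))" using d_mono[OF _ fd_subsp[OF V(1)] V(2)] Fil_dim V(3) by auto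
  also have "\<dots> \<le> (n * S * T + 1) ^ Suc ?L" using Fil_dim[of "n * S * T"] by simp
  also have "\<dots> \<le> ((n * S + 1) * T) ^ Suc ?L"
    unfolding T_def by (intro power_mono) (auto simp: algebra_simps)
  also have "\<dots> = B * T ^ Suc ?L" unfolding B_def power_mult_distrib by simp
  finally have "T * T ^ Suc ?L \<le> B * T ^ Suc ?L" by simp
  hence "T \<le> B" unfolding T_def by simp
  thus False unfolding T_def by simp
qed

lemma krull_dim_quot:
  assumes P: "gprime P"
  shows "\<exists>k. krull_dim (R Quot P) = enat k \<and> gdim P \<le> k"
proof -
  have iP: "ideal P R" using gprimeD P by auto
  obtain C where C: "prime_chain R (gdim P) C" "C 0 = P" using gprime_chain[OF P refl] by auto
  have "enat (gdim P) \<le> krull_dim (R Quot P)" using krull_dim_ge[OF prime_chain_quot[OF iP C(1)]] C(2) by simp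
  moreover have "krull_dim (R Quot P) \<le> enat (Suc (length Xs))"
    by (rule krull_dim_le) (use prime_chain_bound prime_chain_vimage[OF iP] in blast)
  ultimately show ?thesis by (cases "krull_dim (R Quot P)") auto
qed

text \<open>Both sides have the same leading coefficient; the factorial is taken of \<open>gdim P - 1\<close> on the left and of the Krull dimension
  minus one on the right, and \<open>gdim P\<close> is at most the Krull dimension.\<close>

lemma graded_degree_ge:
  assumes P: "gprime P" shows "gdeg P \<le> graded_degree (R Quot P) (\<lambda>j. (+>) P ` G j)"
proof -
  let ?G = "\<lambda>j. (+>) P ` G j"
  have hf: "hilbert_function (R Quot P) ?G j = H P j" for j
    unfolding hilbert_function_def H_def using dim_mod_quot[OF G_fd gprimeD(2,3)[OF P]] .
  have hpP: "hilbert_polynomial (R Quot P) ?G = hp P"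
    unfolding hilbert_polynomial_def hf hp_def hpoly_def ..
  obtain k where k: "krull_dim (R Quot P) = enat k" "gdim P \<le> k" using krull_dim_quot[OF P] by auto
  show ?thesis
  proof (cases "gdim P")
    case 0
    hence "gdeg P = 0" "hp P = 0" unfolding gdeg_def using hpcoeff_zero[of P 0] by (auto simp: gdim_def split: if_splits)
    thus ?thesis unfolding graded_degree_def hpP by simp
  next
    case (Suc D)
    have dg: "Polynomial.degree (hp P) = D" using Suc unfolding gdim_def by (auto split: if_splits)
    have "graded_degree (R Quot P) ?G = fact (k - 1) * hpcoeff P D"
      unfolding graded_degree_def hpP dg hpcoeff_def using k Suc by (auto simp: zero_enat_def)
    moreover have "gdeg P = fact D * hpcoeff P D" unfolding gdeg_def Suc by simp
    moreover have "fact D \<le> (fact (k - 1) :: rat)" using k(2) Suc by (intro fact_mono) auto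
    ultimately show ?thesis using hpcoeff_pos[OF gprimeD(1)[OF P] Suc] by (simp add: mult_right_mono)
  qed
qed

lemma homogeneous_zero: "homogeneous {\<zero>}" unfolding homogeneous_def using zeroideal pr_zero by auto

lemma minimal_primes_props:
  shows "finite (minimal_primes R)" "\<And>Q. gprime Q \<Longrightarrow> \<exists>P\<in>minimal_primes R. P \<subseteq> Q"
proof -
  obtain Ps where Ps: "\<forall>P\<in>set Ps. gprime P \<and> {\<zero>} \<subseteq> P" "\<forall>as. list_all2 (\<in>) as Ps \<longrightarrow> foldr (\<otimes>) as \<one> \<in> {\<zero>}"
    using gprime_decomposition[OF homogeneous_zero] by auto
  have cont: "\<exists>P\<in>set Ps. P \<subseteq> Q" if Q: "primeideal Q R" for Q
  proof (rule primeideal_contains_factor[OF _ Ps(2) Q])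
    show "P \<subseteq> carrier R" if "P \<in> set Ps" for P using Ps(1) that idealD(1) gprimeD(2) by blast
    show "{\<zero>} \<subseteq> Q" using idealD(2)[OF primeideal.axioms(1)[OF Q]] by simp
  qed
  have "minimal_primes R \<subseteq> set Ps"
  proof
    fix P assume P: "P \<in> minimal_primes R"
    then obtain P' where P': "P' \<in> set Ps" "P' \<subseteq> P" using cont unfolding minimal_primes_def by blast
    hence "P' = P" using P gprime_primeideal Ps(1) unfolding minimal_primes_def by blast
    thus "P \<in> set Ps" using P' by simp
  qed
  thus "finite (minimal_primes R)" using finite_subset by blast
  fix Q assume "gprime Q"
  then obtain P where P: "P \<in> set Ps" "P \<subseteq> Q" using cont gprime_primeideal by blast
  obtain M where M: "M \<in> set Ps" "M \<subseteq> P" "\<forall>b\<in>set Ps. b \<subseteq> M \<longrightarrow> M = b"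
    using finite_has_minimal2[OF finite_set P(1)] by blast
  have "M \<in> minimal_primes R"
    unfolding minimal_primes_def
  proof (intro CollectI conjI allI impI)
    show "primeideal M R" using gprime_primeideal Ps(1) M(1) by blast
    fix Q' assume Q': "primeideal Q' R" "Q' \<subseteq> M"
    then obtain P' where P': "P' \<in> set Ps" "P' \<subseteq> Q'" using cont by blast
    thus "Q' = M" using M(3) Q'(2) by blast
  qed
  thus "\<exists>P\<in>minimal_primes R. P \<subseteq> Q" using M(2) P(2) by blast
qed

theorem few_forms_suffice:
  assumes I: "finite I" "card I = dd * (m - n) + n" and nm: "n \<le> m" and xs: "\<And>i. i \<in> I \<Longrightarrow> xs i \<in> G 1" and m: "m \<le> card I"
    and gp: "\<And>T J. T \<subseteq> I \<Longrightarrow> card T = m \<Longrightarrow> ideal J R \<Longrightarrow> xs ` T \<subseteq> J \<Longrightarrow> G 1 \<subseteq> J"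
    and deg: "deg_rad R G \<le> of_nat dd" and dim: "gdim {\<zero>} \<le> n"
  shows "\<exists>S\<subseteq>I. card S = n \<and> (\<exists>N. \<forall>j\<ge>N. G j \<subseteq> Idl (xs ` S))"
proof -
  let ?M = "minimal_primes R"
  have gP: "gprime P" if "P \<in> ?M" for P using minimal_prime_gprime that by auto
  have "(\<Sum>P\<in>?M. gdeg P) \<le> deg_rad R G"
    unfolding deg_rad_def by (intro sum_mono graded_degree_ge gP)
  hence sum: "(\<Sum>P\<in>?M. gdeg P) \<le> of_nat dd" using deg by simp
  have gn: "gprime P \<and> gdim P \<le> n" if "P \<in> ?M" for P
    using gP[OF that] gdim_mono[OF homogeneous_zero gprimeD(1)[OF gP[OF that]]] dim idealD(2)[OF gprimeD(2)[OF gP[OF that]]] by auto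
  have "\<exists>S\<subseteq>I. card S = n \<and> (\<forall>Q. gprime Q \<longrightarrow> xs ` S \<subseteq> Q \<longrightarrow> gdim Q = 0)"
    by (rule selection[OF I nm xs m gp minimal_primes_props(1) gn sum minimal_primes_props(2)])
  then obtain S where S: "S \<subseteq> I" "card S = n" "\<forall>Q. gprime Q \<longrightarrow> xs ` S \<subseteq> Q \<longrightarrow> gdim Q = 0"
    by (elim exE conjE)
  have fS: "finite S" using finite_subset[OF S(1) I(1)] .
  obtain es where es: "set es = S" using finite_list[OF fS] by auto
  let ?ys = "map xs es"
  have y1: "set ?ys \<subseteq> G 1" using es xs S(1) by auto
  have yc: "set ?ys \<subseteq> carrier R" using y1 G_sub by blast
  have ph: "pos_homs ?ys" using y1 unfolding pos_homs_def by auto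
  note ac = adjoin_list_contains[OF zeroideal yc]
  have xc: "xs ` S \<subseteq> carrier R" using yc es by auto
  have "{\<zero>} \<subseteq> Idl (xs ` S)" using idealD(2)[OF genideal_ideal[OF xc]] by blast
  hence sub: "adjoin_list {\<zero>} ?ys \<subseteq> Idl (xs ` S)"
    by (rule adjoin_list_least[OF genideal_ideal[OF xc]]) (use genideal_self[OF xc] es in auto)
  have hA: "homogeneous (adjoin_list {\<zero>} ?ys)" using adjoin_list_homogeneous[OF homogeneous_zero ph] .
  have "gdim (adjoin_list {\<zero>} ?ys) \<le> 0"
  proof (rule gdim_le_primes[OF hA])
    fix Q assume "gprime Q" "adjoin_list {\<zero>} ?ys \<subseteq> Q"
    thus "gdim Q \<le> 0" using S(3) ac es by auto
  qed
  then obtain N where "\<forall>j\<ge>N. G j \<subseteq> adjoin_list {\<zero>} ?ys" using gdim_zero_iff[OF hA] by auto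
  hence "\<forall>j\<ge>N. G j \<subseteq> Idl (xs ` S)" using sub by blast
  thus ?thesis using S by blast
qed

end

section \<open>The fiber cone is a standard graded algebra\<close>

lemma cring_surj_image:
  fixes S (structure) and T (structure)
  assumes "cring S" and c: "carrier T = h ` carrier S"
    and add: "\<And>a b. a \<in> carrier S \<Longrightarrow> b \<in> carrier S \<Longrightarrow> h a \<oplus>\<^bsub>T\<^esub> h b = h (a \<oplus>\<^bsub>S\<^esub> b)"
    and mult: "\<And>a b. a \<in> carrier S \<Longrightarrow> b \<in> carrier S \<Longrightarrow> h a \<otimes>\<^bsub>T\<^esub> h b = h (a \<otimes>\<^bsub>S\<^esub> b)"
    and one: "\<one>\<^bsub>T\<^esub> = h \<one>\<^bsub>S\<^esub>" and zero: "\<zero>\<^bsub>T\<^esub> = h \<zero>\<^bsub>S\<^esub>"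
  shows "cring T"
proof -
  interpret S: cring S by fact
  show ?thesis
  proof (rule cringI)
    show "abelian_group T"
    proof (rule abelian_groupI)
      show "\<exists>y\<in>carrier T. y \<oplus>\<^bsub>T\<^esub> x = \<zero>\<^bsub>T\<^esub>" if "x \<in> carrier T" for x
      proof -
        obtain a where a: "a \<in> carrier S" "x = h a" using \<open>x \<in> carrier T\<close> c by auto
        have "h (\<ominus>\<^bsub>S\<^esub> a) \<oplus>\<^bsub>T\<^esub> x = \<zero>\<^bsub>T\<^esub>" using a add zero by (simp add: S.l_neg)
        thus ?thesis using a c by auto
      qed
    qed (auto simp: c add zero S.a_ac)
    show "comm_monoid T"
      by (rule comm_monoidI) (auto simp: c mult one S.m_ac)
  qed (auto simp: c add mult S.l_distr)
qed

context cring
begin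

lemma finsum_ideal: "ideal I R \<Longrightarrow> finite S \<Longrightarrow> (\<And>i. i \<in> S \<Longrightarrow> h i \<in> I) \<Longrightarrow> (\<Oplus>i\<in>S. h i) \<in> I"
proof -
  assume I: "ideal I R" and "finite S" "\<And>i. i \<in> S \<Longrightarrow> h i \<in> I"
  from this(2,3) show ?thesis
  proof (induction S rule: finite_induct)
    case (insert i S)
    hence "h i \<in> I" "h i \<in> carrier R" "h \<in> S \<rightarrow> carrier R" using idealD(1)[OF I] by blast+
    thus ?case using insert idealD(3)[OF I] by (subst finsum_insert) auto
  qed (use idealD(2)[OF I] in auto)
qed

lemma Idl_list_eq_combine:
  assumes "set us \<subseteq> carrier R"
  shows "Idl (set us) = {a. \<exists>rs. length rs = length us \<and> set rs \<subseteq> carrier R \<and> a = combine rs us}" (is "_ = ?M")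
proof
  have "set us \<subseteq> ?M \<and> ideal ?M R"
    using assms
  proof (induction us)
    case Nil
    have "{a. \<exists>rs. length rs = length [] \<and> set rs \<subseteq> carrier R \<and> a = combine rs []} = {\<zero>}" by auto
    thus ?case using zeroideal by simp
  next
    case (Cons u us)
    let ?N = "{a. \<exists>rs. length rs = length us \<and> set rs \<subseteq> carrier R \<and> a = combine rs us}"
    have N: "set us \<subseteq> ?N" "ideal ?N R" and u: "u \<in> carrier R" using Cons by auto
    have "{a. \<exists>rs. length rs = length (u # us) \<and> set rs \<subseteq> carrier R \<and> a = combine rs (u # us)} = adjoin ?N u" (is "?L = _")
    proof (intro equalityI subsetI)
      fix a assume "a \<in> ?L"
      then obtain rs where rs: "length rs = length (u # us)" "set rs \<subseteq> carrier R" "a = combine rs (u # us)" by blast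
      then obtain r rs' where r: "rs = r # rs'" by (cases rs) auto
      have "combine rs' us \<in> ?N" using rs r by auto
      moreover have "a = combine rs' us \<oplus> r \<otimes> u" using rs r u Cons.prems by (simp add: a_comm)
      ultimately show "a \<in> adjoin ?N u" unfolding adjoin_iff using rs r by auto
    next
      fix a assume "a \<in> adjoin ?N u"
      then obtain rs r where r: "length rs = length us" "set rs \<subseteq> carrier R" "r \<in> carrier R" "a = combine rs us \<oplus> r \<otimes> u"
        unfolding adjoin_iff by blast
      hence "a = combine (r # rs) (u # us)" using u Cons.prems by (simp add: a_comm)
      thus "a \<in> ?L" using r by (intro CollectI exI[of _ "r # rs"]) auto
    qed
    thus ?case using adjoin_ideal[OF N(2) u] adjoin_mem[OF N(2) u] adjoin_incl[OF N(2) u] N(1) by auto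
  qed
  thus "Idl (set us) \<subseteq> ?M" using genideal_minimal by blast
  show "?M \<subseteq> Idl (set us)"
  proof
    fix a assume "a \<in> ?M"
    then obtain rs where rs: "set rs \<subseteq> carrier R" "a = combine rs us" by blast
    have iI: "ideal (Idl (set us)) R" using genideal_ideal[OF assms] .
    have "combine rs vs \<in> Idl (set us)" if "set rs \<subseteq> carrier R" "set vs \<subseteq> set us" for rs vs
      using that
    proof (induction rs vs rule: combine.induct)
      case (1 k Ks v Vs)
      thus ?case using idealD(3,6)[OF iI] genideal_self[OF assms] by auto
    qed (use idealD(2)[OF iI] in auto)
    thus "a \<in> Idl (set us)" using rs by auto
  qed
qed

lemma ideal_prod_list:
  assumes I: "ideal I R" and us: "set us \<subseteq> carrier R" and x: "x \<in> I \<cdot> (Idl (set us))"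
  shows "\<exists>rs. length rs = length us \<and> set rs \<subseteq> I \<and> x = combine rs us"
  using x
proof (induction rule: ideal_prod.induct)
  case (prod i j)
  then obtain rs where rs: "length rs = length us" "set rs \<subseteq> carrier R" "j = combine rs us"
    unfolding Idl_list_eq_combine[OF us] by blast
  have ic: "i \<in> carrier R" using prod idealD(1)[OF I] by auto
  have "i \<otimes> j = combine (map ((\<otimes>) i) rs) us" using combine_r_distr[OF rs(2) us ic] rs(3) by simp
  moreover have "set (map ((\<otimes>) i) rs) \<subseteq> I" using idealD(7)[OF I prod(1)] rs(2) by auto
  ultimately show ?case using rs(1) by (intro exI[of _ "map ((\<otimes>) i) rs"]) auto
next
  case (sum s t)
  then obtain rs ts where rs: "length rs = length us" "set rs \<subseteq> I" "s = combine rs us"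
    and ts: "length ts = length us" "set ts \<subseteq> I" "t = combine ts us" by blast
  have c: "set rs \<subseteq> carrier R" "set ts \<subseteq> carrier R" using rs ts idealD(1)[OF I] by auto
  have "s \<oplus> t = combine (map2 (\<oplus>) rs ts) us" using combine_add[OF rs(1) ts(1) c us] rs(3) ts(3) by simp
  moreover have "set (map2 (\<oplus>) rs ts) \<subseteq> I"
  proof
    fix z assume "z \<in> set (map2 (\<oplus>) rs ts)"
    then obtain a b where "(a, b) \<in> set (zip rs ts)" "z = a \<oplus> b" by auto
    thus "z \<in> I" using set_zip_leftD set_zip_rightD idealD(3)[OF I] rs(2) ts(2) by (metis subsetD)
  qed
  ultimately show ?case using rs(1) ts(1) by (intro exI[of _ "map2 (\<oplus>) rs ts"]) auto
qed

end

locale fiber_cone_setup = cring R for R (structure) +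
  fixes \<mm> \<aa> :: "'a set" and us :: "'a list"
  assumes max: "maximalideal \<mm> R" and us: "set us \<subseteq> carrier R" and \<aa>: "\<aa> = Idl (set us)"
begin

abbreviation Pw :: "nat \<Rightarrow> 'a set" where "Pw j \<equiv> ideal_pow R \<aa> j"
abbreviation J :: "nat \<Rightarrow> 'a set" where "J j \<equiv> fiber_cone_modulus R \<mm> \<aa> j"
abbreviation F :: "(nat \<Rightarrow> 'a set) ring" where "F \<equiv> fiber_cone R \<mm> \<aa>"
abbreviation C :: "nat \<Rightarrow> (nat \<Rightarrow> 'a set) set" where "C j \<equiv> fiber_cone_component R \<mm> \<aa> j"

lemma m_ideal: "ideal \<mm> R" using maximalideal.axioms(1)[OF max] .

lemma a_ideal: "ideal \<aa> R" unfolding \<aa> using genideal_ideal[OF us] .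

lemma ideals_simps: "carrier (ideals_set R) = {I. ideal I R}" "monoid.mult (ideals_set R) = ideal_prod R"
  "\<one>\<^bsub>ideals_set R\<^esub> = carrier R"
  by (simp_all add: ideals_set_def)

lemma Pw_0: "Pw 0 = carrier R" and Pw_Suc: "Pw (Suc j) = Pw j \<cdot> \<aa>"
  using monoid.nat_pow_0[OF comm_monoid.axioms(1)[OF ideals_set_is_comm_monoid]]
    monoid.nat_pow_Suc[OF comm_monoid.axioms(1)[OF ideals_set_is_comm_monoid]] by (simp_all add: ideals_simps)

lemma Pw_ideal: "ideal (Pw j) R"
  using monoid.nat_pow_closed[OF comm_monoid.axioms(1)[OF ideals_set_is_comm_monoid], of \<aa> j] a_ideal by (simp add: ideals_simps)

lemma Pw_carr: "a \<in> Pw j \<Longrightarrow> a \<in> carrier R" using idealD(1)[OF Pw_ideal] by blast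

lemma Pw_1: "Pw (Suc 0) = \<aa>"
  unfolding Pw_Suc Pw_0 using ideal_prod_commute[OF oneideal a_ideal] ideal_prod_one[OF a_ideal] by simp

lemma Pw_add: "Pw i \<cdot> Pw j = Pw (i + j)"
  using monoid.nat_pow_mult[OF comm_monoid.axioms(1)[OF ideals_set_is_comm_monoid], of \<aa> i j] a_ideal by (simp add: ideals_simps)

lemma Pw_mult: "a \<in> Pw i \<Longrightarrow> b \<in> Pw j \<Longrightarrow> a \<otimes> b \<in> Pw (i + j)"
  using ideal_prod.prod[of a "Pw i" b "Pw j" R] Pw_add by simp

lemma J_ideal: "ideal (J j) R"
  unfolding fiber_cone_modulus_def using ideal_prod_is_ideal[OF m_ideal Pw_ideal] .

lemma J_sub: "J j \<subseteq> Pw j"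
  unfolding fiber_cone_modulus_def using ideal_prod_inter[OF m_ideal Pw_ideal] by auto

lemma J_mem: "a \<in> \<mm> \<Longrightarrow> b \<in> Pw j \<Longrightarrow> a \<otimes> b \<in> J j"
  unfolding fiber_cone_modulus_def by (rule ideal_prod.prod)

lemma J_0: "J 0 = \<mm>"
  unfolding fiber_cone_modulus_def Pw_0 using ideal_prod_one[OF m_ideal] .

lemma J_mult: assumes "a \<in> J i" "b \<in> Pw j" shows "a \<otimes> b \<in> J (i + j)"
  using assms(1) unfolding fiber_cone_modulus_def[of _ _ _ i]
proof (induction rule: ideal_prod.induct)
  case (prod x y)
  have "(x \<otimes> y) \<otimes> b = x \<otimes> (y \<otimes> b)"
    using prod idealD(1)[OF m_ideal] Pw_carr assms(2) by (intro m_assoc) auto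
  thus ?case using J_mem[OF prod(1) Pw_mult[OF prod(2) assms(2)]] by simp
next
  case (sum s t)
  have "s \<in> carrier R" "t \<in> carrier R" using sum ideal_prod_in_carrier[OF m_ideal Pw_ideal] by auto
  hence "(s \<oplus> t) \<otimes> b = s \<otimes> b \<oplus> t \<otimes> b" using Pw_carr[OF assms(2)] by (simp add: l_distr)
  thus ?case using idealD(3)[OF J_ideal] sum by simp
qed

lemma cos_eq: "a \<in> carrier R \<Longrightarrow> b \<in> carrier R \<Longrightarrow> J j +> a = J j +> b \<longleftrightarrow> a \<ominus> b \<in> J j"
  using quotient_eq_iff_same_a_r_cos[OF J_ideal] by auto

lemma cos_zero: "a \<in> carrier R \<Longrightarrow> J j +> a = J j \<longleftrightarrow> a \<in> J j"
  using ideal.rcos_const_imp_mem[OF J_ideal] a_rcos_zero[OF J_ideal] by blast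

lemma cos_add: "a \<in> carrier R \<Longrightarrow> b \<in> carrier R \<Longrightarrow> (J j +> a) <+> (J j +> b) = J j +> (a \<oplus> b)"
  using ideal.a_rcos_sum[OF J_ideal] .

lemma cos_mult:
  assumes a: "a \<in> Pw i" and b: "b \<in> Pw k"
  shows "rcoset_mult R (J (i + k)) (J i +> a) (J k +> b) = J (i + k) +> (a \<otimes> b)"
proof -
  have c: "a \<in> carrier R" "b \<in> carrier R" using a b Pw_carr by auto
  have eq: "J (i + k) +> (x \<otimes> y) = J (i + k) +> (a \<otimes> b)" if xy: "x \<in> J i +> a" "y \<in> J k +> b" for x y
  proof -
    obtain s t where st: "s \<in> J i" "x = s \<oplus> a" "t \<in> J k" "y = t \<oplus> b"
      using xy unfolding a_r_coset_def' by blast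
    have cc: "s \<in> carrier R" "t \<in> carrier R" using st idealD(1)[OF J_ideal] by auto
    have "x \<otimes> y \<ominus> a \<otimes> b = s \<otimes> (t \<oplus> b) \<oplus> t \<otimes> a" using st(2,4) c cc by (simp only:) algebra
    also have "\<dots> \<in> J (i + k)"
    proof (rule idealD(3)[OF J_ideal])
      have "t \<oplus> b \<in> Pw k" using idealD(3)[OF Pw_ideal] J_sub st(3) b by blast
      thus "s \<otimes> (t \<oplus> b) \<in> J (i + k)" using J_mult[OF st(1)] by auto
      show "t \<otimes> a \<in> J (i + k)" using J_mult[OF st(3) a] by (simp add: add.commute)
    qed
    finally show ?thesis using cos_eq[of "x \<otimes> y" "a \<otimes> b" "i + k"] st c cc by auto
  qed
  have ne: "a \<in> J i +> a" "b \<in> J k +> b"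
    using c idealD(2)[OF J_ideal] unfolding a_r_coset_def' by (force intro: bexI[of _ \<zero>])+
  have "rcoset_mult R (J (i + k)) (J i +> a) (J k +> b) = (\<Union>x\<in>J i +> a. \<Union>y\<in>J k +> b. J (i + k) +> (a \<otimes> b))"
    unfolding rcoset_mult_def using eq by (intro SUP_cong refl) auto
  thus ?thesis using ne by auto
qed

lemma F_carrier: "f \<in> carrier F \<longleftrightarrow> (\<forall>j. f j \<in> (\<lambda>x. J j +> x) ` Pw j) \<and> finite {j. f j \<noteq> J j}"
  by (simp add: fiber_cone_def Let_def)

lemma F_mult: "f \<otimes>\<^bsub>F\<^esub> g = (\<lambda>j. \<Oplus>\<^bsub>R Quot J j\<^esub>i\<in>{..j}. rcoset_mult R (J j) (f i) (g (j - i)))"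
  and F_add: "f \<oplus>\<^bsub>F\<^esub> g = (\<lambda>j. f j <+> g j)"
  and F_one: "\<one>\<^bsub>F\<^esub> = (\<lambda>j. if j = 0 then J 0 +> \<one> else J j)"
  and F_zero: "\<zero>\<^bsub>F\<^esub> = (\<lambda>j. J j)"
  by (simp_all add: fiber_cone_def Let_def)

text \<open>The Rees algebra maps onto the fiber cone; this transports the ring axioms.\<close>

definition rees :: "(nat \<Rightarrow> 'a) set" where "rees = {p \<in> carrier (UP R). \<forall>j. p j \<in> Pw j}"

definition img :: "(nat \<Rightarrow> 'a) \<Rightarrow> nat \<Rightarrow> 'a set" where "img p = (\<lambda>j. J j +> p j)"

lemma UP_simps: "carrier (UP R) = up R"
  "p \<in> up R \<Longrightarrow> q \<in> up R \<Longrightarrow> p \<otimes>\<^bsub>UP R\<^esub> q = (\<lambda>n. \<Oplus>i\<in>{..n}. p i \<otimes> q (n - i))"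
  "p \<in> up R \<Longrightarrow> q \<in> up R \<Longrightarrow> p \<oplus>\<^bsub>UP R\<^esub> q = (\<lambda>i. p i \<oplus> q i)"
  "\<one>\<^bsub>UP R\<^esub> = (\<lambda>i. if i = 0 then \<one> else \<zero>)" "\<zero>\<^bsub>UP R\<^esub> = (\<lambda>i. \<zero>)"
  by (simp_all add: UP_def)

lemma up_iff: "p \<in> up R \<longleftrightarrow> (\<forall>j. p j \<in> carrier R) \<and> (\<exists>n. \<forall>j>n. p j = \<zero>)"
  unfolding up_def bound_def by auto

lemma UP_cring': "cring (UP R)" by (rule UP_cring.UP_cring) (simp add: UP_cring_def is_cring)

lemma rees_subcring: "subcring rees (UP R)"
proof -
  interpret U: cring "UP R" by (rule UP_cring')
  have c: "p \<in> up R" if "p \<in> rees" for p using that unfolding rees_def UP_simps(1) by auto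
  have neg: "\<ominus>\<^bsub>UP R\<^esub> p = (\<lambda>i. \<ominus> p i)" if p: "p \<in> up R" for p
  proof -
    have n: "(\<lambda>i. \<ominus> p i) \<in> up R" using p unfolding up_iff by auto
    have "(\<lambda>i. \<ominus> p i) \<oplus>\<^bsub>UP R\<^esub> p = \<zero>\<^bsub>UP R\<^esub>"
      unfolding UP_simps(3)[OF n p] UP_simps(5) using p unfolding up_iff by (auto simp: l_neg)
    thus ?thesis using U.minus_equality[of "\<lambda>i. \<ominus> p i" p] n p UP_simps(1) by simp
  qed
  show ?thesis
  proof (rule U.subcringI'[OF U.subringI])
    show "rees \<subseteq> carrier (UP R)" unfolding rees_def by auto
    have "\<one> \<in> Pw 0" by (subst Pw_0) simp
    hence "(if j = 0 then \<one> else \<zero>) \<in> Pw j" for j :: nat using idealD(2)[OF Pw_ideal] by metis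
    thus "\<one>\<^bsub>UP R\<^esub> \<in> rees"
      using U.one_closed unfolding rees_def UP_simps(4) by blast
    show "\<ominus>\<^bsub>UP R\<^esub> p \<in> rees" if "p \<in> rees" for p
      using that U.a_inv_closed[of p] idealD(4)[OF Pw_ideal] neg[OF c[OF that]] unfolding rees_def by auto
    show "p \<otimes>\<^bsub>UP R\<^esub> q \<in> rees" if pq: "p \<in> rees" "q \<in> rees" for p q
    proof -
      have "(\<Oplus>i\<in>{..n}. p i \<otimes> q (n - i)) \<in> Pw n" for n
      proof (rule finsum_ideal[OF Pw_ideal])
        fix i assume "i \<in> {..n}"
        thus "p i \<otimes> q (n - i) \<in> Pw n" using Pw_mult[of "p i" i "q (n - i)" "n - i"] pq unfolding rees_def by auto
      qed simp
      thus ?thesis using pq U.m_closed[of p q] UP_simps(2)[OF c c] unfolding rees_def by auto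
    qed
    show "p \<oplus>\<^bsub>UP R\<^esub> q \<in> rees" if pq: "p \<in> rees" "q \<in> rees" for p q
      using pq U.a_closed[of p q] UP_simps(3)[OF c c] idealD(3)[OF Pw_ideal] unfolding rees_def by auto
  qed
qed

lemma img_carrier: "carrier F = img ` rees"
proof
  show "img ` rees \<subseteq> carrier F"
  proof
    fix f assume "f \<in> img ` rees"
    then obtain p where p: "p \<in> rees" "f = img p" by auto
    obtain n where n: "\<forall>j>n. p j = \<zero>" using p unfolding rees_def UP_simps(1) up_iff by blast
    have "{j. f j \<noteq> J j} \<subseteq> {..n}"
    proof
      fix j assume "j \<in> {j. f j \<noteq> J j}"
      hence "p j \<noteq> \<zero>" using cos_zero[of \<zero> j] idealD(2)[OF J_ideal] unfolding p(2) img_def by auto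
      thus "j \<in> {..n}" using n by (metis atMost_iff not_le_imp_less)
    qed
    hence "finite {j. f j \<noteq> J j}" using finite_subset by blast
    thus "f \<in> carrier F" unfolding F_carrier using p unfolding rees_def img_def by auto
  qed
  show "carrier F \<subseteq> img ` rees"
  proof
    fix f assume f: "f \<in> carrier F"
    have "\<forall>j. \<exists>a. a \<in> Pw j \<and> f j = J j +> a \<and> (f j = J j \<longrightarrow> a = \<zero>)"
    proof
      fix j
      show "\<exists>a. a \<in> Pw j \<and> f j = J j +> a \<and> (f j = J j \<longrightarrow> a = \<zero>)"
      proof (cases "f j = J j")
        case True
        thus ?thesis using cos_zero[of \<zero> j] idealD(2)[OF J_ideal] idealD(2)[OF Pw_ideal] by (intro exI[of _ \<zero>]) auto
      next
        case False
        thus ?thesis using f unfolding F_carrier by blast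
      qed
    qed
    from choice[OF this] obtain p where p: "\<forall>j. p j \<in> Pw j \<and> f j = J j +> p j \<and> (f j = J j \<longrightarrow> p j = \<zero>)" by blast
    have "finite {j. f j \<noteq> J j}" using f unfolding F_carrier by auto
    then obtain n where n: "\<forall>j\<in>{j. f j \<noteq> J j}. j \<le> n" using finite_nat_set_iff_bounded_le by blast
    have "p j = \<zero>" if "j > n" for j
    proof -
      have "f j = J j" using n that by auto
      thus ?thesis using spec[OF p, of j] by blast
    qed
    moreover have "p j \<in> carrier R" for j using spec[OF p, of j] Pw_carr[of "p j" j] by blast
    moreover have "\<forall>j. p j \<in> Pw j" using p by blast
    ultimately have "p \<in> rees" unfolding rees_def UP_simps(1) up_iff by blast
    moreover have "f = img p" unfolding img_def using p by auto
    ultimately show "f \<in> img ` rees" by auto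
  qed
qed

lemma rees_mem: "p \<in> rees \<Longrightarrow> p \<in> up R" "p \<in> rees \<Longrightarrow> p j \<in> Pw j" "p \<in> rees \<Longrightarrow> p j \<in> carrier R"
  using Pw_carr[of "p j" j] unfolding rees_def UP_simps(1) by blast+

lemma img_add:
  assumes p: "p \<in> rees" and q: "q \<in> rees" shows "img p \<oplus>\<^bsub>F\<^esub> img q = img (p \<oplus>\<^bsub>UP R\<^esub> q)"
  unfolding F_add img_def using cos_add rees_mem(3)[OF p] rees_mem(3)[OF q] UP_simps(3)[OF rees_mem(1)[OF p] rees_mem(1)[OF q]] by simp

lemma img_mult:
  assumes p: "p \<in> rees" and q: "q \<in> rees" shows "img p \<otimes>\<^bsub>F\<^esub> img q = img (p \<otimes>\<^bsub>UP R\<^esub> q)"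
proof -
  note c = rees_mem(3)
  have "(\<Oplus>\<^bsub>R Quot J j\<^esub>i\<in>{..j}. rcoset_mult R (J j) (img p i) (img q (j - i))) = J j +> (\<Oplus>i\<in>{..j}. p i \<otimes> q (j - i))" for j
  proof -
    interpret h: ring_hom_cring R "R Quot J j" "(+>) (J j)" using ideal.rcos_ring_hom_cring[OF J_ideal is_cring] .
    have "(\<Oplus>\<^bsub>R Quot J j\<^esub>i\<in>{..j}. rcoset_mult R (J j) (img p i) (img q (j - i))) = (\<Oplus>\<^bsub>R Quot J j\<^esub>i\<in>{..j}. J j +> (p i \<otimes> q (j - i)))"
    proof (rule h.S.finsum_cong')
      fix i assume "i \<in> {..j}"
      thus "rcoset_mult R (J j) (img p i) (img q (j - i)) = J j +> (p i \<otimes> q (j - i))"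
        using cos_mult[OF rees_mem(2)[OF p, of i] rees_mem(2)[OF q, of "j - i"]] unfolding img_def by simp
    qed (use c[OF p] c[OF q] in auto)
    also have "\<dots> = J j +> (\<Oplus>i\<in>{..j}. p i \<otimes> q (j - i))"
      using h.hom_finsum[of "\<lambda>i. p i \<otimes> q (j - i)" "{..j}"] c[OF p] c[OF q] by (simp add: comp_def)
    finally show ?thesis .
  qed
  thus ?thesis
    unfolding F_mult using UP_simps(2)[OF rees_mem(1)[OF p] rees_mem(1)[OF q]] by (simp add: img_def)
qed

lemma F_cring: "cring F"
proof (rule cring_surj_image[of "UP R \<lparr> carrier := rees \<rparr>" F img])
  show "cring (UP R \<lparr> carrier := rees \<rparr>)"
    using ring.subcring_iff[OF cring.axioms(1)[OF UP_cring']] rees_subcring subcringE(1)[OF rees_subcring] by blast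
  show "carrier F = img ` carrier (UP R \<lparr> carrier := rees \<rparr>)" using img_carrier by simp
  fix p q assume "p \<in> carrier (UP R \<lparr> carrier := rees \<rparr>)" "q \<in> carrier (UP R \<lparr> carrier := rees \<rparr>)"
  thus "img p \<oplus>\<^bsub>F\<^esub> img q = img (p \<oplus>\<^bsub>UP R \<lparr> carrier := rees \<rparr>\<^esub> q)"
    "img p \<otimes>\<^bsub>F\<^esub> img q = img (p \<otimes>\<^bsub>UP R \<lparr> carrier := rees \<rparr>\<^esub> q)"
    using img_add img_mult by auto
next
  have z: "J j +> \<zero> = J j" for j using cos_zero[of \<zero> j] idealD(2)[OF J_ideal] by simp
  show "\<one>\<^bsub>F\<^esub> = img \<one>\<^bsub>UP R \<lparr> carrier := rees \<rparr>\<^esub>"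
    unfolding F_one by (rule ext) (simp add: img_def UP_simps(4) z)
  show "\<zero>\<^bsub>F\<^esub> = img \<zero>\<^bsub>UP R \<lparr> carrier := rees \<rparr>\<^esub>"
    unfolding F_zero by (rule ext) (simp add: img_def UP_simps(5) z)
qed

text \<open>The element of the fiber cone that is the class of \<open>a\<close> in degree \<open>j\<close>.\<close>

definition cls :: "nat \<Rightarrow> 'a \<Rightarrow> nat \<Rightarrow> 'a set" where "cls j a = (\<lambda>i. if i = j then J j +> a else J i)"

lemma cos_z: "J j +> \<zero> = J j" using cos_zero[of \<zero> j] idealD(2)[OF J_ideal] by simp

lemma mono_rees: "a \<in> Pw j \<Longrightarrow> (\<lambda>i. if i = j then a else \<zero>) \<in> rees"
proof -
  assume a: "a \<in> Pw j"
  have "(if i = j then a else \<zero>) \<in> Pw i" for i using a idealD(2)[OF Pw_ideal[of i]] by (cases "i = j") auto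
  moreover have "(if i = j then a else \<zero>) \<in> carrier R" for i using Pw_carr[OF a] by simp
  moreover have "\<forall>i>j. (if i = j then a else \<zero>) = \<zero>" by simp
  ultimately show ?thesis unfolding rees_def UP_simps(1) up_iff by blast
qed

lemma cls_img: "cls j a = img (\<lambda>i. if i = j then a else \<zero>)"
  unfolding cls_def img_def using cos_z by (intro ext) simp

lemma cls_carrier: "a \<in> Pw j \<Longrightarrow> cls j a \<in> carrier F"
  unfolding img_carrier cls_img using mono_rees by blast

lemma C_eq: "C j = cls j ` Pw j"
proof
  show "cls j ` Pw j \<subseteq> C j"
  proof
    fix f assume "f \<in> cls j ` Pw j"
    then obtain a where "a \<in> Pw j" "f = cls j a" by blast
    thus "f \<in> C j" unfolding fiber_cone_component_def using cls_carrier by (auto simp: cls_def)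
  qed
  show "C j \<subseteq> cls j ` Pw j"
  proof
    fix f assume "f \<in> C j"
    hence f: "f \<in> carrier F" "\<And>i. i \<noteq> j \<Longrightarrow> f i = J i" unfolding fiber_cone_component_def by auto
    then obtain a where a: "a \<in> Pw j" "f j = J j +> a" unfolding F_carrier by blast
    have "f = cls j a" unfolding cls_def using a(2) f(2) by (intro ext) simp
    thus "f \<in> cls j ` Pw j" using a(1) by blast
  qed
qed

lemma cls_add: assumes "a \<in> Pw j" "b \<in> Pw j" shows "cls j a \<oplus>\<^bsub>F\<^esub> cls j b = cls j (a \<oplus> b)"
proof
  fix i
  have c: "a \<in> carrier R" "b \<in> carrier R" using assms Pw_carr by auto
  have "J i <+> J i = J i" using cos_add[of \<zero> \<zero> i] cos_z by simp
  thus "(cls j a \<oplus>\<^bsub>F\<^esub> cls j b) i = cls j (a \<oplus> b) i" unfolding F_add cls_def using cos_add[OF c] by simp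
qed

lemma cls_mult: assumes "a \<in> Pw j" "b \<in> Pw k" shows "cls j a \<otimes>\<^bsub>F\<^esub> cls k b = cls (j + k) (a \<otimes> b)"
proof -
  have c: "a \<in> carrier R" "b \<in> carrier R" using assms Pw_carr by auto
  let ?p = "\<lambda>i. if i = j then a else \<zero>" and ?q = "\<lambda>i. if i = k then b else \<zero>"
  have "?p \<otimes>\<^bsub>UP R\<^esub> ?q = (\<lambda>n. \<Oplus>i\<in>{..n}. ?p i \<otimes> ?q (n - i))"
    using UP_simps(2)[OF rees_mem(1)[OF mono_rees[OF assms(1)]] rees_mem(1)[OF mono_rees[OF assms(2)]]] .
  also have "\<dots> = (\<lambda>n. if n = j + k then a \<otimes> b else \<zero>)"
  proof
    fix n
    show "(\<Oplus>i\<in>{..n}. ?p i \<otimes> ?q (n - i)) = (if n = j + k then a \<otimes> b else \<zero>)"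
    proof (cases "n = j + k")
      case True
      have "(\<Oplus>i\<in>{..n}. ?p i \<otimes> ?q (n - i)) = (\<Oplus>i\<in>{..n}. if j = i then a \<otimes> b else \<zero>)"
        using True c by (intro finsum_cong') auto
      also have "\<dots> = a \<otimes> b" using True c by (intro finsum_singleton[where f = "\<lambda>_. a \<otimes> b"]) auto
      finally show ?thesis using True by simp
    next
      case False
      have "(\<Oplus>i\<in>{..n}. ?p i \<otimes> ?q (n - i)) = (\<Oplus>i\<in>{..n}. \<zero>)"
        using False c by (intro finsum_cong') auto
      thus ?thesis using False by simp
    qed
  qed
  finally show ?thesis unfolding cls_img using img_mult[OF mono_rees[OF assms(1)] mono_rees[OF assms(2)]] by simp
qed

lemma cls_zero: "\<zero>\<^bsub>F\<^esub> = cls j \<zero>" unfolding F_zero cls_def using cos_z by (intro ext) simp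

lemma cls_zero_iff: "a \<in> Pw j \<Longrightarrow> cls j a = \<zero>\<^bsub>F\<^esub> \<longleftrightarrow> a \<in> J j"
proof -
  assume a: "a \<in> Pw j"
  have "cls j a = \<zero>\<^bsub>F\<^esub> \<longleftrightarrow> J j +> a = J j" unfolding F_zero cls_def by (auto simp: fun_eq_iff)
  thus ?thesis using cos_zero[OF Pw_carr[OF a]] by simp
qed

lemma cls_one: "\<one>\<^bsub>F\<^esub> = cls 0 \<one>" unfolding F_one cls_def by (rule ext) simp

definition component :: "nat \<Rightarrow> (nat \<Rightarrow> 'a set) \<Rightarrow> nat \<Rightarrow> 'a set" where "component j f = (\<lambda>i. if i = j then f i else J i)"

definition gens :: "(nat \<Rightarrow> 'a set) list" where "gens = map (cls (Suc 0)) us"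

lemma us_Pw: "set us \<subseteq> Pw (Suc 0)" unfolding Pw_1 unfolding \<aa> by (rule genideal_self[OF us])

lemma Pw0_mem: "a \<in> carrier R \<Longrightarrow> a \<in> Pw 0" by (subst Pw_0)

lemma component_in: assumes "f \<in> carrier F" shows "component j f \<in> C j" "\<exists>a\<in>Pw j. component j f = cls j a \<and> f j = J j +> a"
proof -
  obtain a where a: "a \<in> Pw j" "f j = J j +> a" using assms unfolding F_carrier by blast
  have "component j f = cls j a" unfolding component_def cls_def using a(2) by (intro ext) simp
  thus "component j f \<in> C j" "\<exists>a\<in>Pw j. component j f = cls j a \<and> f j = J j +> a" using a unfolding C_eq by blast+
qed

lemma C_subring: "subring (C 0) F"
proof -
  interpret F: cring F by (rule F_cring)
  show ?thesis
  proof (rule F.subringI)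
    show "C 0 \<subseteq> carrier F" unfolding C_eq using cls_carrier by blast
    show "\<one>\<^bsub>F\<^esub> \<in> C 0" unfolding C_eq cls_one using Pw0_mem[OF one_closed] by blast
    fix x assume "x \<in> C 0"
    then obtain a where a: "a \<in> Pw 0" "x = cls 0 a" unfolding C_eq by blast
    have n: "\<ominus> a \<in> Pw 0" using idealD(4)[OF Pw_ideal a(1)] .
    have "cls 0 (\<ominus> a) \<oplus>\<^bsub>F\<^esub> cls 0 a = \<zero>\<^bsub>F\<^esub>"
      unfolding cls_add[OF n a(1)] l_neg[OF Pw_carr[OF a(1)]] cls_zero[of 0] ..
    hence "\<ominus>\<^bsub>F\<^esub> x = cls 0 (\<ominus> a)" using F.minus_equality[of "cls 0 (\<ominus> a)" x] cls_carrier n a by auto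
    thus "\<ominus>\<^bsub>F\<^esub> x \<in> C 0" unfolding C_eq using n by blast
    fix y assume "y \<in> C 0"
    then obtain b where b: "b \<in> Pw 0" "y = cls 0 b" unfolding C_eq by blast
    show "x \<otimes>\<^bsub>F\<^esub> y \<in> C 0"
      unfolding C_eq using cls_mult[OF a(1) b(1)] Pw_mult[OF a(1) b(1)] a(2) b(2) unfolding add_0 by blast
    show "x \<oplus>\<^bsub>F\<^esub> y \<in> C 0"
      unfolding C_eq using cls_add[OF a(1) b(1)] idealD(3)[OF Pw_ideal a(1) b(1)] a(2) b(2) by blast
  qed
qed

lemma C_subfield: "subfield (C 0) F"
proof -
  interpret F: cring F by (rule F_cring)
  have sc: "subcring (C 0) F" by (rule F.subcringI'[OF C_subring])
  interpret K: cring "F \<lparr> carrier := C 0 \<rparr>" using F.subcring_iff[of "C 0"] sc subcringE(1)[OF sc] by blast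
  have m1: "\<one> \<notin> \<mm>" using ideal.one_imp_carrier[OF m_ideal] maximalideal.I_notcarr[OF max] by auto
  show ?thesis
  proof (rule F.subfieldI[OF sc])
    show "Units (F \<lparr> carrier := C 0 \<rparr>) = C 0 - {\<zero>\<^bsub>F\<^esub>}"
    proof
      have "\<zero>\<^bsub>F\<^esub> \<notin> Units (F \<lparr> carrier := C 0 \<rparr>)"
      proof
        assume "\<zero>\<^bsub>F\<^esub> \<in> Units (F \<lparr> carrier := C 0 \<rparr>)"
        then obtain y where "y \<in> C 0" "y \<otimes>\<^bsub>F\<^esub> \<zero>\<^bsub>F\<^esub> = \<one>\<^bsub>F\<^esub>" unfolding Units_def by auto
        hence "\<one>\<^bsub>F\<^esub> = \<zero>\<^bsub>F\<^esub>" using subcringE(1)[OF sc] by auto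
        thus False using cls_zero_iff[OF Pw0_mem[OF one_closed]] cls_one m1 J_0 by simp
      qed
      thus "Units (F \<lparr> carrier := C 0 \<rparr>) \<subseteq> C 0 - {\<zero>\<^bsub>F\<^esub>}" unfolding Units_def by auto
      show "C 0 - {\<zero>\<^bsub>F\<^esub>} \<subseteq> Units (F \<lparr> carrier := C 0 \<rparr>)"
      proof
        fix x assume x: "x \<in> C 0 - {\<zero>\<^bsub>F\<^esub>}"
        then obtain a where a: "a \<in> Pw 0" "x = cls 0 a" unfolding C_eq by blast
        have ac: "a \<in> carrier R" using Pw_carr[OF a(1)] .
        have am: "a \<notin> \<mm>" using x cls_zero_iff[OF a(1)] a(2) J_0 by auto
        have "adjoin \<mm> a = carrier R"
          using maximalideal.I_maximal[OF max adjoin_ideal[OF m_ideal ac] adjoin_incl[OF m_ideal ac]] adjoin_mem[OF m_ideal ac] am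
            idealD(1)[OF adjoin_ideal[OF m_ideal ac]] by auto
        hence "\<one> \<in> adjoin \<mm> a" by simp
        then obtain s r where r: "s \<in> \<mm>" "r \<in> carrier R" "\<one> = s \<oplus> r \<otimes> a" unfolding adjoin_iff by blast
        have sc': "s \<in> carrier R" using r idealD(1)[OF m_ideal] by auto
        have rP: "r \<in> Pw 0" using Pw0_mem[OF r(2)] .
        have "r \<otimes> a \<ominus> \<one> = \<ominus> s" unfolding r(3) using sc' ac r(2) by algebra
        hence "J 0 +> (r \<otimes> a) = J 0 +> \<one>"
          using cos_eq[of "r \<otimes> a" \<one> 0] J_0 idealD(4)[OF m_ideal r(1)] ac r(2) by simp
        hence "cls 0 r \<otimes>\<^bsub>F\<^esub> x = \<one>\<^bsub>F\<^esub>"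
          unfolding a(2) cls_mult[OF rP a(1)] cls_one unfolding cls_def by (intro ext) simp
        moreover have "cls 0 r \<in> C 0" unfolding C_eq using rP by blast
        moreover from this have "x \<otimes>\<^bsub>F\<^esub> cls 0 r = cls 0 r \<otimes>\<^bsub>F\<^esub> x"
          using x subcringE(1)[OF sc] by (intro F.m_comm) auto
        ultimately show "x \<in> Units (F \<lparr> carrier := C 0 \<rparr>)"
          unfolding Units_def using x by (auto intro!: bexI[of _ "cls 0 r"])
      qed
    qed
  qed
qed

lemma fiber_cone_std_graded: "std_graded F C component gens"
proof -
  interpret F: cring F by (rule F_cring)
  show ?thesis
  proof (intro std_graded.intro comm_algebra.intro comm_algebra_axioms.intro std_graded_axioms.intro F_cring C_subfield)
    show "C j \<subseteq> carrier F" for j unfolding C_eq using cls_carrier by blast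
    show "component j f \<in> C j" if "f \<in> carrier F" for f j using component_in[OF that] by blast
    show "component j (f \<oplus>\<^bsub>F\<^esub> g) = component j f \<oplus>\<^bsub>F\<^esub> component j g" for f g j
    proof
      fix i
      have "J i <+> J i = J i" using cos_add[of \<zero> \<zero> i] cos_z by simp
      thus "component j (f \<oplus>\<^bsub>F\<^esub> g) i = (component j f \<oplus>\<^bsub>F\<^esub> component j g) i" unfolding F_add component_def by simp
    qed
    show "component j f = f" if "f \<in> C j" for f j using that unfolding component_def fiber_cone_component_def by (auto simp: fun_eq_iff)
    show "component j f = \<zero>\<^bsub>F\<^esub>" if "f \<in> C i" "i \<noteq> j" for f i j
      using that unfolding component_def fiber_cone_component_def F_zero by (auto simp: fun_eq_iff)
    show "\<exists>N. f = (\<Oplus>\<^bsub>F\<^esub>j\<in>{..<N}. component j f)" if f: "f \<in> carrier F" for f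
    proof -
      have cp: "(\<lambda>j. component j f) \<in> {..<N} \<rightarrow> carrier F" for N
      proof
        fix j
        obtain a where "a \<in> Pw j" "component j f = cls j a" using component_in(2)[OF f] by blast
        thus "component j f \<in> carrier F" using cls_carrier by simp
      qed
      have e: "(\<Oplus>\<^bsub>F\<^esub>j\<in>{..<N}. component j f) = (\<lambda>i. if i < N then f i else J i)" for N
      proof (induction N)
        case 0
        show ?case by (simp add: F_zero)
      next
        case (Suc N)
        have "(\<Oplus>\<^bsub>F\<^esub>j\<in>{..<Suc N}. component j f) = component N f \<oplus>\<^bsub>F\<^esub> (\<Oplus>\<^bsub>F\<^esub>j\<in>{..<N}. component j f)"
          unfolding lessThan_Suc using cp[of "Suc N"] by (subst F.finsum_insert) auto
        also have "\<dots> = (\<lambda>i. if i < Suc N then f i else J i)"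
          unfolding Suc
        proof
          fix i
          obtain a where a: "a \<in> Pw i" "f i = J i +> a" using component_in(2)[OF f] by blast
          have ac: "a \<in> carrier R" using a Pw_carr by auto
          have "J i <+> J i = J i" "f i <+> J i = f i" "J i <+> f i = f i"
            using cos_add[of \<zero> \<zero> i] cos_add[of \<zero> a i] cos_add[of a \<zero> i] cos_z[of i] a(2) ac by simp_all
          thus "(component N f \<oplus>\<^bsub>F\<^esub> (\<lambda>i. if i < N then f i else J i)) i = (if i < Suc N then f i else J i)"
            unfolding F_add component_def by auto
        qed
        finally show ?case .
      qed
      have "finite {j. f j \<noteq> J j}" using f unfolding F_carrier by auto
      then obtain n where "\<forall>j\<in>{j. f j \<noteq> J j}. j \<le> n" using finite_nat_set_iff_bounded_le by blast
      hence "f = (\<lambda>i. if i < Suc n then f i else J i)" by (intro ext) auto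
      thus ?thesis using e[of "Suc n"] by metis
    qed
    show "f \<otimes>\<^bsub>F\<^esub> g \<in> C (i + j)" if fg: "f \<in> C i" "g \<in> C j" for f g i j
    proof -
      obtain a b where "a \<in> Pw i" "f = cls i a" "b \<in> Pw j" "g = cls j b" using fg unfolding C_eq by blast
      thus ?thesis unfolding C_eq using cls_mult Pw_mult by blast
    qed
    show "set gens \<subseteq> C 1" unfolding gens_def C_eq using us_Pw by auto
    show "\<exists>gs. set gs \<subseteq> C j \<and> f = ring.combine F gs gens" if f: "f \<in> C (Suc j)" for f j
    proof -
      obtain a where a: "a \<in> Pw (Suc j)" "f = cls (Suc j) a" using f unfolding C_eq by blast
      have "a \<in> Pw j \<cdot> \<aa>" using a(1) unfolding Pw_Suc .
      from ideal_prod_list[OF Pw_ideal us, folded \<aa>, OF this]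
      obtain rs where rs: "length rs = length us" "set rs \<subseteq> Pw j" "a = combine rs us" by blast
      have "combine qs vs \<in> Pw (Suc j) \<and> cls (Suc j) (combine qs vs) = F.combine (map (cls j) qs) (map (cls (Suc 0)) vs)"
        if "length qs = length vs" "set qs \<subseteq> Pw j" "set vs \<subseteq> set us" for qs vs
        using that
      proof (induction qs vs rule: list_induct2)
        case Nil
        show ?case using idealD(2)[OF Pw_ideal[of "Suc j"]] cls_zero[of "Suc j", symmetric]
          unfolding combine.simps list.map F.combine.simps by blast
      next
        case (Cons q qs v vs)
        have q: "q \<in> Pw j" and v: "v \<in> Pw (Suc 0)" using Cons.prems us_Pw by auto
        have ih: "combine qs vs \<in> Pw (Suc j)" "cls (Suc j) (combine qs vs) = F.combine (map (cls j) qs) (map (cls (Suc 0)) vs)"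
          using Cons by auto
        have qv: "q \<otimes> v \<in> Pw (Suc j)" using Pw_mult[OF q v] unfolding add_Suc_right add_0_right .
        have "cls (Suc j) (q \<otimes> v) = cls j q \<otimes>\<^bsub>F\<^esub> cls (Suc 0) v"
          using cls_mult[OF q v] unfolding add_Suc_right add_0_right ..
        hence "cls (Suc j) (combine (q # qs) (v # vs)) = F.combine (map (cls j) (q # qs)) (map (cls (Suc 0)) (v # vs))"
          using cls_add[OF qv ih(1)] ih(2) unfolding combine.simps list.map F.combine.simps by simp
        moreover have "combine (q # qs) (v # vs) \<in> Pw (Suc j)" unfolding combine.simps using idealD(3)[OF Pw_ideal qv ih(1)] .
        ultimately show ?case by blast
      qed
      from this[OF rs(1,2) order_refl] have "f = F.combine (map (cls j) rs) gens" unfolding a(2) rs(3) gens_def by blast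
      moreover have "set (map (cls j) rs) \<subseteq> C j" unfolding C_eq using rs(2) by auto
      ultimately show ?thesis by blast
    qed
  qed
qed

end

section \<open>Lengths of chains of ideals\<close>

context cring
begin

text \<open>Strict chains of \<open>p + 1\<close> ideals that start with \<open>I\<close> and stay inside \<open>J\<close>; the length of the module \<open>J/I\<close> is the largest such
  \<open>p\<close>.\<close>

inductive ideal_chain :: "'a set \<Rightarrow> 'a set \<Rightarrow> nat \<Rightarrow> bool" where
  nil: "ideal I R \<Longrightarrow> I \<subseteq> J \<Longrightarrow> ideal_chain I J 0"
| step: "ideal I R \<Longrightarrow> I \<subset> L \<Longrightarrow> ideal_chain L J p \<Longrightarrow> ideal_chain I J (Suc p)"

definition length_le :: "'a set \<Rightarrow> 'a set \<Rightarrow> nat \<Rightarrow> bool" where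
  "length_le I J c \<longleftrightarrow> (\<forall>p. ideal_chain I J p \<longrightarrow> p \<le> c)"

lemma ideal_chain_props: "ideal_chain I J p \<Longrightarrow> ideal I R \<and> I \<subseteq> J"
  by (induction rule: ideal_chain.induct) auto

lemma ideal_chain_down: "ideal_chain L J p \<Longrightarrow> ideal I R \<Longrightarrow> I \<subseteq> L \<Longrightarrow> ideal_chain I J p"
proof (induction rule: ideal_chain.induct)
  case (nil L J)
  thus ?case by (intro ideal_chain.nil) auto
next
  case (step L L' J p)
  thus ?case by (intro ideal_chain.step[of I L']) auto
qed

lemma ideal_chain_up: "ideal_chain I J p \<Longrightarrow> J \<subseteq> J' \<Longrightarrow> ideal_chain I J' p"
  by (induction rule: ideal_chain.induct) (auto intro: ideal_chain.intros)

lemma ideal_chain_append: "ideal_chain I K p \<Longrightarrow> ideal_chain K J q \<Longrightarrow> ideal_chain I J (p + q)"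
proof (induction rule: ideal_chain.induct)
  case (nil I K)
  thus ?case using ideal_chain_down[OF nil(3) nil(1,2)] by simp
next
  case (step I L K p)
  thus ?case using ideal_chain.step[OF step(1,2)] by simp
qed

lemma length_le_mono: "length_le I J c \<Longrightarrow> ideal I R \<Longrightarrow> I \<subseteq> I' \<Longrightarrow> J' \<subseteq> J \<Longrightarrow> c \<le> c' \<Longrightarrow> length_le I' J' c'"
  unfolding length_le_def using ideal_chain_down ideal_chain_up by (meson le_trans)

lemma set_add_iff: "x \<in> A <+>\<^bsub>R\<^esub> B \<longleftrightarrow> (\<exists>a\<in>A. \<exists>b\<in>B. x = a \<oplus> b)"
  unfolding set_add_def' by auto

lemma set_add_incl: assumes "ideal A R" "ideal B R" shows "A \<subseteq> A <+>\<^bsub>R\<^esub> B" "B \<subseteq> A <+>\<^bsub>R\<^esub> B"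
proof -
  have "a = a \<oplus> \<zero>" if "a \<in> A" for a using that idealD(1)[OF assms(1)] by auto
  thus "A \<subseteq> A <+>\<^bsub>R\<^esub> B" using idealD(2)[OF assms(2)] unfolding set_add_iff subset_iff by blast
  have "b = \<zero> \<oplus> b" if "b \<in> B" for b using that idealD(1)[OF assms(2)] by auto
  thus "B \<subseteq> A <+>\<^bsub>R\<^esub> B" using idealD(2)[OF assms(1)] unfolding set_add_iff subset_iff by blast
qed

lemma set_add_min: "ideal C R \<Longrightarrow> A \<subseteq> C \<Longrightarrow> B \<subseteq> C \<Longrightarrow> A <+>\<^bsub>R\<^esub> B \<subseteq> C"
  using idealD(3)[of C] by (auto simp: set_add_iff subset_iff)

text \<open>Length is subadditive by the modular law: a strict inclusion stays strict after intersecting with \<open>K\<close> or after adding \<open>K\<close>.\<close>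

lemma ideal_chain_split:
  assumes "ideal K R"
  shows "ideal_chain L J p \<Longrightarrow> ideal J R \<Longrightarrow> \<exists>a b. p \<le> a + b \<and> ideal_chain (L \<inter> K) K a \<and> ideal_chain (L <+>\<^bsub>R\<^esub> K) (J <+>\<^bsub>R\<^esub> K) b"
proof (induction rule: ideal_chain.induct)
  case (nil L J)
  have "L <+>\<^bsub>R\<^esub> K \<subseteq> J <+>\<^bsub>R\<^esub> K"
    using set_add_incl[OF nil(3) assms] nil(2) by (intro set_add_min add_ideals nil(3) assms) auto
  hence "ideal_chain (L \<inter> K) K 0" "ideal_chain (L <+>\<^bsub>R\<^esub> K) (J <+>\<^bsub>R\<^esub> K) 0"
    using nil assms by (auto intro!: ideal_chain.nil i_intersect add_ideals)
  thus ?case by (intro exI[of _ 0]) auto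
next
  case (step L L' J p)
  then obtain a b where ab: "p \<le> a + b" "ideal_chain (L' \<inter> K) K a" "ideal_chain (L' <+>\<^bsub>R\<^esub> K) (J <+>\<^bsub>R\<^esub> K) b" by blast
  have iL': "ideal L' R" using ideal_chain_props[OF step(3)] by simp
  have iLK: "ideal (L \<inter> K) R" "ideal (L <+>\<^bsub>R\<^esub> K) R" using step(1) assms by (auto intro: i_intersect add_ideals)
  have sub: "L <+>\<^bsub>R\<^esub> K \<subseteq> L' <+>\<^bsub>R\<^esub> K"
    using set_add_incl[OF iL' assms] step(2) by (intro set_add_min add_ideals iL' assms) auto
  show ?case
  proof (cases "L \<inter> K = L' \<inter> K")
    case False
    hence "ideal_chain (L \<inter> K) K (Suc a)" using step(2) by (intro ideal_chain.step[OF iLK(1) _ ab(2)]) auto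
    moreover have "ideal_chain (L <+>\<^bsub>R\<^esub> K) (J <+>\<^bsub>R\<^esub> K) b" using ideal_chain_down[OF ab(3) iLK(2) sub] .
    ultimately show ?thesis using ab(1) by (intro exI[of _ "Suc a"] exI[of _ b]) auto
  next
    case True
    obtain x where x: "x \<in> L'" "x \<notin> L" using step(2) by auto
    have "x \<notin> L <+>\<^bsub>R\<^esub> K"
    proof
      assume "x \<in> L <+>\<^bsub>R\<^esub> K"
      then obtain l k where lk: "l \<in> L" "k \<in> K" "x = l \<oplus> k" unfolding set_add_iff by blast
      have c: "l \<in> carrier R" "k \<in> carrier R" using lk idealD(1)[OF step(1)] idealD(1)[OF assms] by auto
      have "k \<in> L'" using ideal_cancel_r[OF iL', of k l] x(1) lk c step(2) by (auto simp: a_comm)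
      hence "k \<in> L" using True lk(2) by auto
      thus False using idealD(3)[OF step(1) lk(1)] lk(3) x(2) by auto
    qed
    moreover have "x \<in> L' <+>\<^bsub>R\<^esub> K" using set_add_incl[OF iL' assms] x(1) by auto
    ultimately have "L <+>\<^bsub>R\<^esub> K \<subset> L' <+>\<^bsub>R\<^esub> K" using sub by blast
    hence "ideal_chain (L <+>\<^bsub>R\<^esub> K) (J <+>\<^bsub>R\<^esub> K) (Suc b)" using ideal_chain.step[OF iLK(2) _ ab(3)] by blast
    thus ?thesis using ab(1,2) True by (intro exI[of _ a] exI[of _ "Suc b"]) auto
  qed
qed

lemma length_le_trans:
  assumes "length_le I K a" "length_le K J b" "ideal I R" "ideal K R" "ideal J R" "I \<subseteq> K" "K \<subseteq> J"
  shows "length_le I J (a + b)"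
  unfolding length_le_def
proof (intro allI impI)
  fix p assume "ideal_chain I J p"
  from ideal_chain_split[OF assms(4) this assms(5)] obtain a' b' where ab: "p \<le> a' + b'" "ideal_chain (I \<inter> K) K a'" "ideal_chain (I <+>\<^bsub>R\<^esub> K) (J <+>\<^bsub>R\<^esub> K) b'"
    by blast
  have "I <+>\<^bsub>R\<^esub> K = K" "J <+>\<^bsub>R\<^esub> K = J"
    using set_add_min[OF assms(4) assms(6) order_refl] set_add_incl[OF assms(3,4)]
      set_add_min[OF assms(5) order_refl assms(7)] set_add_incl[OF assms(5,4)] by auto
  moreover have "I \<inter> K = I" using assms(6) by auto
  ultimately show "p \<le> a + b" using ab assms(1,2) unfolding length_le_def by (metis add_le_mono le_trans)
qed

lemma ideal_chain_colon:
  assumes I: "ideal I R" and y: "y \<in> carrier R"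
  shows "ideal_chain L J p \<Longrightarrow> J \<subseteq> adjoin I y \<Longrightarrow> I \<subseteq> L \<Longrightarrow> ideal_chain (colon L y) (carrier R) p"
proof (induction rule: ideal_chain.induct)
  case (nil L J)
  thus ?case using colon_ideal y by (intro ideal_chain.nil) (auto simp: colon_def)
next
  case (step L L' J p)
  have iL': "ideal L' R" "L' \<subseteq> J" using ideal_chain_props[OF step(3)] by auto
  obtain x where x: "x \<in> L'" "x \<notin> L" using step(2) by auto
  have "x \<in> adjoin I y" using x iL'(2) step.prems by auto
  then obtain i r where ir: "i \<in> I" "r \<in> carrier R" "x = i \<oplus> r \<otimes> y" unfolding adjoin_iff by blast
  have c: "i \<in> carrier R" using ir idealD(1)[OF I] by auto
  have "r \<otimes> y \<in> L'" using ideal_cancel_r[OF iL'(1), of "r \<otimes> y" i] x(1) ir step c y by (auto simp: a_comm)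
  hence "r \<in> colon L' y" unfolding colon_def using ir(2) y by (simp add: m_comm)
  moreover have "r \<notin> colon L y"
  proof
    assume "r \<in> colon L y"
    hence "r \<otimes> y \<in> L" unfolding colon_def using ir(2) y by (simp add: m_comm)
    hence "x \<in> L" using idealD(3)[OF step(1)] ir step.prems by auto
    thus False using x by simp
  qed
  ultimately have "colon L y \<subset> colon L' y" using step(2) unfolding colon_def by blast
  thus ?case using step by (intro ideal_chain.step[OF colon_ideal[OF step(1) y]]) auto
qed

text \<open>The module \<open>(I + (y))/I\<close> is isomorphic to \<open>R/(I : y)\<close>.\<close>

lemma length_le_adjoin:
  assumes I: "ideal I R" and y: "y \<in> carrier R" and c: "ideal c R" "c \<subseteq> colon I y" "length_le c (carrier R) k"
  shows "length_le I (adjoin I y) k"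
  unfolding length_le_def
proof (intro allI impI)
  fix p assume "ideal_chain I (adjoin I y) p"
  hence "ideal_chain (colon I y) (carrier R) p" using ideal_chain_colon[OF I y] by auto
  thus "p \<le> k" using c ideal_chain_down[of "colon I y" "carrier R" p c] unfolding length_le_def by blast
qed

lemma adjoin_commute: assumes "ideal I R" "a \<in> carrier R" "b \<in> carrier R" shows "adjoin (adjoin I a) b = adjoin (adjoin I b) a"
proof -
  have "adjoin (adjoin I a) b \<subseteq> adjoin (adjoin I b) a" if ab: "a \<in> carrier R" "b \<in> carrier R" for a b
  proof -
    have i: "ideal (adjoin I b) R" "ideal (adjoin (adjoin I b) a) R" using adjoin_ideal assms(1) ab by auto
    show ?thesis
      using adjoin_incl[OF i(1) ab(1)] adjoin_mem[OF i(1) ab(1)] adjoin_incl[OF assms(1) ab(2)] adjoin_mem[OF assms(1) ab(2)]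
      by (intro adjoin_least[OF i(2)] ) blast+
  qed
  thus ?thesis using assms(2,3) by blast
qed

lemma adjoin_list_adjoin: "ideal I R \<Longrightarrow> b \<in> carrier R \<Longrightarrow> set zs \<subseteq> carrier R \<Longrightarrow> adjoin_list (adjoin I b) zs = adjoin (adjoin_list I zs) b"
proof (induction zs)
  case (Cons z zs)
  have "adjoin_list (adjoin I b) (z # zs) = adjoin (adjoin (adjoin_list I zs) b) z" using Cons unfolding adjoin_list_def by simp
  also have "\<dots> = adjoin (adjoin (adjoin_list I zs) z) b" using adjoin_commute adjoin_list_contains[of I zs] Cons.prems by auto
  finally show ?case unfolding adjoin_list_def by simp
qed (simp add: adjoin_list_def)

text \<open>The quotients of successive powers of \<open>y\<close> modulo \<open>I\<close> are quotients of \<open>R/(I + (y))\<close>.\<close>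

lemma length_le_power:
  assumes I: "ideal I R" and y: "y \<in> carrier R" and c: "length_le (adjoin I y) (carrier R) c"
  shows "length_le (adjoin I (y [^] (a::nat))) (carrier R) (a * c)"
proof (induction a)
  case 0
  have "carrier R \<subseteq> adjoin I \<one>" using adjoin_mem[OF I one_closed] ideal.one_imp_carrier[OF adjoin_ideal[OF I one_closed]] by auto
  hence "adjoin I (y [^] (0::nat)) = carrier R" using idealD(1)[OF adjoin_ideal[OF I one_closed]] by auto
  moreover have "length_le (carrier R) (carrier R) 0"
    unfolding length_le_def
  proof (intro allI impI)
    fix p assume "ideal_chain (carrier R) (carrier R) p"
    thus "p \<le> 0"
    proof cases
      case (step L p')
      thus ?thesis using ideal_chain_props[OF step(4)] idealD(1) by blast
    qed simp
  qed
  ultimately show ?case by simp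
next
  case (Suc a)
  let ?K = "adjoin I (y [^] Suc a)" and ?L = "adjoin I (y [^] a)"
  have ya: "y [^] a \<in> carrier R" "y [^] Suc a \<in> carrier R" using y by auto
  have iK: "ideal ?K R" and iL: "ideal ?L R" using adjoin_ideal I ya by auto
  have KL: "?K \<subseteq> ?L"
    using adjoin_incl[OF I ya(1)] idealD(7)[OF iL adjoin_mem[OF I ya(1)] y] by (intro adjoin_least[OF iL]) auto
  have "?L \<subseteq> adjoin ?K (y [^] a)"
    using adjoin_incl[OF I ya(2)] adjoin_incl[OF iK ya(1)] adjoin_mem[OF iK ya(1)] by (intro adjoin_least[OF adjoin_ideal[OF iK ya(1)]]) auto
  moreover have "adjoin I y \<subseteq> colon ?K (y [^] a)"
  proof (rule adjoin_least[OF colon_ideal[OF iK ya(1)]])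
    show "I \<subseteq> colon ?K (y [^] a)" using adjoin_incl[OF I ya(2)] colon_incl[OF iK ya(1)] by auto
    show "y \<in> colon ?K (y [^] a)" unfolding colon_def using y adjoin_mem[OF I ya(2)] by simp
  qed
  ultimately have "length_le ?K ?L c"
    using length_le_mono[OF length_le_adjoin[OF iK ya(1) adjoin_ideal[OF I y] _ c] iK order_refl _ order_refl] by blast
  hence "length_le ?K (carrier R) (c + a * c)"
    using length_le_trans[OF _ Suc iK iL oneideal KL] idealD(1)[OF iL] by blast
  thus ?case by simp
qed

lemma length_le_powers:
  "ideal I R \<Longrightarrow> set zs \<subseteq> carrier R \<Longrightarrow> length_le (adjoin_list I zs) (carrier R) c \<Longrightarrow>
    length_le (adjoin_list I (map (\<lambda>z. z [^] (N::nat)) zs)) (carrier R) (N ^ length zs * c)"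
proof (induction zs arbitrary: I c)
  case (Cons z zs)
  let ?p = "\<lambda>z. z [^] N"
  have z: "z \<in> carrier R" "set zs \<subseteq> carrier R" "z [^] N \<in> carrier R" using Cons.prems by auto
  have zp: "set (map ?p zs) \<subseteq> carrier R" using z(2) by auto
  have "length_le (adjoin (adjoin_list I zs) z) (carrier R) c" using Cons.prems(3) unfolding adjoin_list_def by simp
  hence "length_le (adjoin (adjoin_list I zs) (z [^] N)) (carrier R) (N * c)"
    using length_le_power z(1) adjoin_list_contains[OF Cons.prems(1) z(2)] by blast
  hence "length_le (adjoin_list (adjoin I (z [^] N)) zs) (carrier R) (N * c)" using adjoin_list_adjoin[OF Cons.prems(1) z(3,2)] by simp
  hence "length_le (adjoin_list (adjoin I (z [^] N)) (map ?p zs)) (carrier R) (N ^ length zs * (N * c))"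
    using Cons.IH[OF adjoin_ideal[OF Cons.prems(1) z(3)] z(2)] by blast
  moreover have "adjoin_list (adjoin I (z [^] N)) (map ?p zs) = adjoin_list I (map ?p (z # zs))"
    using adjoin_list_adjoin[OF Cons.prems(1) z(3) zp] unfolding adjoin_list_def by simp
  ultimately show ?case by (simp add: mult.assoc mult.left_commute)
qed (simp add: adjoin_list_def)

lemma pow_ideal: assumes "ideal I R" shows "ideal (ideal_pow R I k) R"
  using monoid.nat_pow_closed[OF comm_monoid.axioms(1)[OF ideals_set_is_comm_monoid], of I k] assms
  by (simp add: ideals_set_def)

lemma pow_Suc: "ideal_pow R I (Suc k) = ideal_pow R I k \<cdot> I" and pow_0: "ideal_pow R I 0 = carrier R"
  using monoid.nat_pow_Suc[OF comm_monoid.axioms(1)[OF ideals_set_is_comm_monoid]]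
    monoid.nat_pow_0[OF comm_monoid.axioms(1)[OF ideals_set_is_comm_monoid]] by (simp_all add: ideals_set_def)

lemma prod_least:
  assumes "ideal B R" "\<And>a b. a \<in> I \<Longrightarrow> b \<in> J \<Longrightarrow> a \<otimes> b \<in> B" shows "I \<cdot> J \<subseteq> B"
proof
  fix x assume "x \<in> I \<cdot> J"
  thus "x \<in> B" by (induction rule: ideal_prod.induct) (use assms idealD(3)[OF assms(1)] in auto)
qed

lemma pow_subset:
  assumes M: "ideal M R"
  shows "ideal B R \<Longrightarrow> (\<And>as. length as = k \<Longrightarrow> set as \<subseteq> M \<Longrightarrow> foldr (\<otimes>) as \<one> \<in> B) \<Longrightarrow> ideal_pow R M k \<subseteq> B"
proof (induction k arbitrary: B)
  case 0
  have "\<one> \<in> B" using 0(2)[of "[]"] by simp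
  thus ?case unfolding pow_0 using ideal.one_imp_carrier[OF 0(1)] by simp
next
  case (Suc k)
  show ?case
    unfolding pow_Suc
  proof (rule prod_least[OF Suc.prems(1)])
    fix a b assume a: "a \<in> ideal_pow R M k" and b: "b \<in> M"
    have bc: "b \<in> carrier R" using b idealD(1)[OF M] by auto
    have ac: "a \<in> carrier R" using a idealD(1)[OF pow_ideal[OF M]] by blast
    have fc: "foldr (\<otimes>) as \<one> \<in> carrier R" if "set as \<subseteq> M" for as
      using that idealD(1)[OF M] by (induction as) auto
    have "ideal_pow R M k \<subseteq> colon B b"
    proof (rule Suc.IH[OF colon_ideal[OF Suc.prems(1) bc]])
      fix as :: "'a list" assume as: "length as = k" "set as \<subseteq> M"
      have "foldr (\<otimes>) (b # as) \<one> \<in> B" using as b by (intro Suc.prems(2)) auto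
      thus "foldr (\<otimes>) as \<one> \<in> colon B b" unfolding colon_def using fc[OF as(2)] by simp
    qed
    hence "b \<otimes> a \<in> B" using a unfolding colon_def by blast
    thus "a \<otimes> b \<in> B" using m_comm[OF ac bc] by simp
  qed
qed

end

section \<open>Systems of parameters of a Noetherian local ring\<close>

context noetherian_local_ring
begin

lemma mm: "ideal \<mm> R" using maximalideal.axioms(1)[OF maximal] .

lemma proper_in_max: "ideal I R \<Longrightarrow> I \<noteq> carrier R \<Longrightarrow> I \<subseteq> \<mm>"
proof (induction I rule: noetherian_induct)
  case (step I)
  show ?case
  proof (cases "\<exists>J. ideal J R \<and> I \<subset> J \<and> J \<noteq> carrier R")
    case True
    thus ?thesis using step.IH by blast
  next
    case False
    have "maximalideal I R"
      using False step idealD(1) by (intro maximalidealI) auto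
    thus ?thesis using unique_maximal by blast
  qed
qed

lemma prime_in_max: "primeideal P R \<Longrightarrow> P \<subseteq> \<mm>"
  using proper_in_max primeideal.axioms(1) primeideal.I_notcarr by blast

lemma max_prime: "primeideal \<mm> R" using maximalideal_prime[OF maximal] .

lemma all_prime_decomposition:
  assumes "ideal I R"
  shows "\<exists>Ps. (\<forall>P\<in>set Ps. primeideal P R \<and> I \<subseteq> P) \<and> (\<forall>as. list_all2 (\<in>) as Ps \<longrightarrow> foldr (\<otimes>) as \<one> \<in> I)"
proof -
  have "\<exists>Ps. (\<forall>P\<in>set Ps. P \<in> {I. ideal I R} \<and> I \<subseteq> P \<and> \<one> \<notin> P \<and> (\<forall>a\<in>carrier R. \<forall>b\<in>carrier R. a \<otimes> b \<in> P \<longrightarrow> a \<in> P \<or> b \<in> P)) \<and>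
    (\<forall>as. list_all2 (\<in>) as Ps \<longrightarrow> foldr (\<otimes>) as \<one> \<in> I)"
    by (rule prime_decomposition[OF noetherian_ring_axioms]) (use adjoin_ideal assms in auto)
  then obtain Ps where Ps: "\<forall>P\<in>set Ps. P \<in> {I. ideal I R} \<and> I \<subseteq> P \<and> \<one> \<notin> P \<and> (\<forall>a\<in>carrier R. \<forall>b\<in>carrier R. a \<otimes> b \<in> P \<longrightarrow> a \<in> P \<or> b \<in> P)"
    "\<forall>as. list_all2 (\<in>) as Ps \<longrightarrow> foldr (\<otimes>) as \<one> \<in> I" by (elim exE conjE)
  have "primeideal P R \<and> I \<subseteq> P" if "P \<in> set Ps" for P
  proof -
    note b = bspec[OF Ps(1) that]
    have "carrier R \<noteq> P" using b one_closed by blast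
    thus ?thesis using b by (intro conjI primeidealI is_cring) auto
  qed
  thus ?thesis using Ps(2) by blast
qed

text \<open>A sum of elements each of which avoids exactly one of the minimal primes over \<open>I\<close> other than \<open>\<mm>\<close> avoids them all, and adjoining it
  to \<open>I\<close> shortens all chains of primes over \<open>I\<close>.\<close>

lemma parameters_of_ideal:
  assumes "ideal I R" "\<And>k C. prime_chain R k C \<Longrightarrow> I \<subseteq> C 0 \<Longrightarrow> k \<le> i"
  shows "\<exists>zs. length zs \<le> i \<and> set zs \<subseteq> \<mm> \<and> (\<forall>P. primeideal P R \<longrightarrow> adjoin_list I zs \<subseteq> P \<longrightarrow> P = \<mm>)"
  using assms
proof (induction i arbitrary: I)
  case 0
  have "P = \<mm>" if P: "primeideal P R" "I \<subseteq> P" for P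
  proof (rule ccontr)
    assume "P \<noteq> \<mm>"
    hence "prime_chain R 1 (\<lambda>i. if i = 0 then P else \<mm>)"
      unfolding prime_chain_def using P(1) max_prime prime_in_max[OF P(1)] by auto
    thus False using "0.prems"(2)[of 1 "\<lambda>i. if i = 0 then P else \<mm>"] P(2) by simp
  qed
  thus ?case by (intro exI[of _ "[]"]) (auto simp: adjoin_list_def)
next
  case (Suc i)
  obtain Ps where Ps: "\<forall>P\<in>set Ps. primeideal P R \<and> I \<subseteq> P" "\<forall>as. list_all2 (\<in>) as Ps \<longrightarrow> foldr (\<otimes>) as \<one> \<in> I"
    using all_prime_decomposition[OF Suc.prems(1)] by auto
  define \<Q> where "\<Q> = {Q \<in> set Ps. (\<forall>Q'\<in>set Ps. Q' \<subseteq> Q \<longrightarrow> Q = Q') \<and> Q \<noteq> \<mm>}"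
  have fin: "finite \<Q>" unfolding \<Q>_def by simp
  have pQ: "primeideal Q R" "ideal Q R" "Q \<subset> \<mm>" if "Q \<in> \<Q>" for Q
  proof -
    have q: "Q \<in> set Ps" "Q \<noteq> \<mm>" using that unfolding \<Q>_def by auto
    show "primeideal Q R" using bspec[OF Ps(1) q(1)] by simp
    thus "ideal Q R" "Q \<subset> \<mm>" using primeideal.axioms(1) prime_in_max[of Q] q(2) by auto
  qed
  have "\<exists>f\<in>carrier R. f \<notin> Q \<and> (\<forall>Q'\<in>insert \<mm> (\<Q> - {Q}). f \<in> Q')" if Q: "Q \<in> \<Q>" for Q
  proof (rule separating_element)
    show "\<one> \<notin> Q" using ideal.one_imp_carrier[OF pQ(2)[OF Q]] primeideal.I_notcarr[OF pQ(1)[OF Q]] by auto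
    show "a \<in> Q \<or> b \<in> Q" if "a \<in> carrier R" "b \<in> carrier R" "a \<otimes> b \<in> Q" for a b
      using primeideal.I_prime[OF pQ(1)[OF Q] that] .
    show "ideal Q' R" if "Q' \<in> insert \<mm> (\<Q> - {Q})" for Q' using that mm pQ(2) by auto
    fix Q' assume Q': "Q' \<in> insert \<mm> (\<Q> - {Q})"
    have "\<not> Q' \<subseteq> Q"
    proof (cases "Q' = \<mm>")
      case True
      thus ?thesis using pQ(3)[OF Q] by blast
    next
      case False
      hence Q2: "Q' \<in> \<Q>" "Q' \<noteq> Q" using Q' by auto
      show ?thesis
      proof
        assume "Q' \<subseteq> Q"
        thus False using Q Q2 unfolding \<Q>_def by blast
      qed
    qed
    moreover have "Q' \<subseteq> carrier R" using Q' idealD(1)[OF mm] idealD(1)[OF pQ(2)] by blast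
    ultimately show "\<exists>a\<in>carrier R. a \<in> Q' \<and> a \<notin> Q" by blast
  qed (use fin in auto)
  then obtain f where f: "\<And>Q. Q \<in> \<Q> \<Longrightarrow> f Q \<in> carrier R \<and> f Q \<notin> Q \<and> (\<forall>Q'\<in>insert \<mm> (\<Q> - {Q}). f Q \<in> Q')" by metis
  define x where "x = (\<Oplus>Q\<in>\<Q>. f Q)"
  have xm: "x \<in> \<mm>" unfolding x_def using f by (intro finsum_ideal[OF mm fin]) blast
  have xc: "x \<in> carrier R" using xm idealD(1)[OF mm] by auto
  have xn: "x \<notin> Q" if "Q \<in> \<Q>" for Q
    unfolding x_def by (rule avoid_by_sum[OF fin _ _ _ _ that]) (use f pQ(2) in auto)
  have "k \<le> i" if C: "prime_chain R k C" "adjoin I x \<subseteq> C 0" for k C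
  proof -
    have p0: "primeideal (C 0) R" using C(1) unfolding prime_chain_def by auto
    have sub: "I \<subseteq> C 0" "x \<in> C 0" using C(2) adjoin_incl[OF Suc.prems(1) xc] adjoin_mem[OF Suc.prems(1) xc] by auto
    have "\<exists>P\<in>set Ps. P \<subseteq> C 0"
      by (rule primeideal_contains_factor[OF _ Ps(2) p0 sub(1)]) (use Ps(1) idealD(1) primeideal.axioms(1) in blast)
    then obtain P where P: "P \<in> set Ps" "P \<subseteq> C 0" by blast
    obtain M where M: "M \<in> set Ps" "M \<subseteq> P" "\<forall>b\<in>set Ps. b \<subseteq> M \<longrightarrow> M = b"
      using finite_has_minimal2[OF finite_set P(1)] by blast
    have pM: "primeideal M R" "I \<subseteq> M" using Ps(1) M(1) by auto
    show ?thesis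
    proof (cases "M = \<mm>")
      case True
      hence "C 0 = \<mm>" using M(2) P(2) prime_in_max[OF p0] by auto
      have "k = 0"
      proof (rule ccontr)
        assume "k \<noteq> 0"
        hence "C 0 \<subset> C (Suc 0)" "primeideal (C (Suc 0)) R" using C(1) unfolding prime_chain_def by auto
        thus False using \<open>C 0 = \<mm>\<close> prime_in_max by blast
      qed
      thus ?thesis by simp
    next
      case False
      hence "M \<in> \<Q>" using M unfolding \<Q>_def by auto
      hence "M \<subset> C 0" using xn sub(2) M(2) P(2) by blast
      hence "prime_chain R (Suc k) (case_nat M C)"
        using C(1) pM(1) unfolding prime_chain_def by (auto split: nat.splits)
      thus ?thesis using Suc.prems(2)[of "Suc k" "case_nat M C"] pM(2) by simp
    qed
  qed
  then obtain zs where zs: "length zs \<le> i" "set zs \<subseteq> \<mm>" "\<forall>P. primeideal P R \<longrightarrow> adjoin_list (adjoin I x) zs \<subseteq> P \<longrightarrow> P = \<mm>"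
    using Suc.IH[OF adjoin_ideal[OF Suc.prems(1) xc]] by blast
  have "adjoin_list I (zs @ [x]) = adjoin_list (adjoin I x) zs" unfolding adjoin_list_def by simp
  thus ?case using zs xm by (intro exI[of _ "zs @ [x]"]) auto
qed

lemma length_le_max_powers: "\<exists>c. length_le (ideal_pow R \<mm> k) (carrier R) c"
proof (induction k)
  case 0
  have "length_le (carrier R) (carrier R) 0"
    unfolding length_le_def
  proof (intro allI impI)
    fix p assume "ideal_chain (carrier R) (carrier R) p"
    thus "p \<le> 0"
    proof cases
      case (step L p')
      thus ?thesis using ideal_chain_props[OF step(4)] idealD(1) by blast
    qed simp
  qed
  thus ?case unfolding pow_0 by blast
next
  case (Suc k)
  then obtain c where c: "length_le (ideal_pow R \<mm> k) (carrier R) c" by blast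
  let ?I = "ideal_pow R \<mm> (Suc k)" and ?J = "ideal_pow R \<mm> k"
  have iI: "ideal ?I R" and iJ: "ideal ?J R" using pow_ideal[OF mm] by blast+
  have IJ: "?I \<subseteq> ?J" unfolding pow_Suc using ideal_prod_inter[OF iJ mm] by blast
  obtain S where S: "S \<subseteq> carrier R" "finite S" "?J = Idl S" using finetely_gen[OF iJ] by blast
  obtain gs where gs: "set gs = S" using finite_list[OF S(2)] by blast
  have max1: "length_le \<mm> (carrier R) 1"
    unfolding length_le_def
  proof (intro allI impI)
    fix p assume "ideal_chain \<mm> (carrier R) p"
    thus "p \<le> 1"
    proof cases
      case (step L p')
      have L: "ideal L R" "L \<subseteq> carrier R" using ideal_chain_props[OF step(4)] by auto
      have "L = carrier R" using maximalideal.I_maximal[OF maximal L(1) _ L(2)] step(3) by blast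
      have "p' = 0" using step(4)
      proof cases
        case (step L' p'')
        thus ?thesis using ideal_chain_props[OF step(4)] idealD(1) \<open>L = carrier R\<close> by blast
      qed
      thus ?thesis using step(1) by simp
    qed simp
  qed
  have "length_le ?I (adjoin_list ?I hs) (length hs)" if "set hs \<subseteq> S" for hs
    using that
  proof (induction hs)
    case Nil
    show ?case
      unfolding length_le_def
    proof (intro allI impI)
      fix p assume "ideal_chain ?I (adjoin_list ?I []) p"
      thus "p \<le> length []"
      proof cases
        case (step L p')
        thus ?thesis using ideal_chain_props[OF step(4)] unfolding adjoin_list_def by auto
      qed simp
    qed
  next
    case (Cons h hs)
    have hc: "h \<in> carrier R" "set hs \<subseteq> carrier R" "h \<in> ?J" using Cons.prems S genideal_self[OF S(1)] by auto
    note ac = adjoin_list_contains[OF iI hc(2)]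
    have "\<mm> \<subseteq> colon (adjoin_list ?I hs) h"
    proof
      fix a assume a: "a \<in> \<mm>"
      have "h \<otimes> a \<in> ?I" unfolding pow_Suc using ideal_prod.prod[OF hc(3) a] .
      thus "a \<in> colon (adjoin_list ?I hs) h" unfolding colon_def using ac a idealD(1)[OF mm] by blast
    qed
    hence "length_le (adjoin_list ?I hs) (adjoin (adjoin_list ?I hs) h) 1" using length_le_adjoin[OF _ hc(1) mm _ max1] ac by blast
    hence "length_le ?I (adjoin (adjoin_list ?I hs) h) (length hs + 1)"
      using length_le_trans[OF _ _ iI _ _ _ adjoin_incl[OF _ hc(1)]] Cons ac adjoin_ideal[OF _ hc(1)] by (metis insert_subset list.simps(15))
    thus ?case unfolding adjoin_list_def by simp
  qed
  from this[of gs] have "length_le ?I (adjoin_list ?I gs) (length gs)" using gs by blast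
  moreover have "?J \<subseteq> adjoin_list ?I gs" unfolding S(3) using adjoin_list_contains[OF iI, of gs] gs S(1) by (intro genideal_minimal) auto
  ultimately have "length_le ?I ?J (length gs)" using length_le_mono[OF _ iI order_refl _ order_refl] by blast
  hence "length_le ?I (carrier R) (length gs + c)"
    using length_le_trans[OF _ c iI iJ oneideal IJ idealD(1)[OF iJ]] by blast
  thus ?case by blast
qed

theorem parameters_exist_local:
  assumes "krull_dim R = enat n"
  shows "\<exists>zs c. length zs \<le> n \<and> set zs \<subseteq> \<mm> \<and> length_le (adjoin_list {\<zero>} zs) (carrier R) c"
proof -
  have "k \<le> n" if "prime_chain R k C" for k C using krull_dim_ge[OF that] assms by simp
  then obtain zs where zs: "length zs \<le> n" "set zs \<subseteq> \<mm>" "\<forall>P. primeideal P R \<longrightarrow> adjoin_list {\<zero>} zs \<subseteq> P \<longrightarrow> P = \<mm>"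
    using parameters_of_ideal[OF zeroideal, of n] by blast
  have zc: "set zs \<subseteq> carrier R" using zs(2) idealD(1)[OF mm] by auto
  have iX: "ideal (adjoin_list {\<zero>} zs) R" using adjoin_list_contains[OF zeroideal zc] by blast
  obtain Ps where Ps: "\<forall>P\<in>set Ps. primeideal P R \<and> adjoin_list {\<zero>} zs \<subseteq> P" "\<forall>as. list_all2 (\<in>) as Ps \<longrightarrow> foldr (\<otimes>) as \<one> \<in> adjoin_list {\<zero>} zs"
    using all_prime_decomposition[OF iX] by auto
  have "ideal_pow R \<mm> (length Ps) \<subseteq> adjoin_list {\<zero>} zs"
  proof (rule pow_subset[OF mm iX])
    fix as :: "'a list" assume as: "length as = length Ps" "set as \<subseteq> \<mm>"
    have "list_all2 (\<in>) as Ps"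
      unfolding list_all2_conv_all_nth
    proof (intro conjI allI impI as(1))
      fix i assume i: "i < length as"
      have "Ps ! i \<in> set Ps" "as ! i \<in> set as" using i as(1) by auto
      thus "as ! i \<in> Ps ! i" using zs(3) Ps(1) as(2) by blast
    qed
    thus "foldr (\<otimes>) as \<one> \<in> adjoin_list {\<zero>} zs" using Ps(2) by blast
  qed
  moreover obtain c where "length_le (ideal_pow R \<mm> (length Ps)) (carrier R) c" using length_le_max_powers by blast
  ultimately have "length_le (adjoin_list {\<zero>} zs) (carrier R) c"
    using length_le_mono[OF _ pow_ideal[OF mm] _ order_refl order_refl] by blast
  thus ?thesis using zs by blast
qed

end

section \<open>The dimension of the fiber cone\<close>

context cring
begin

lemma ideal_intro:
  assumes "I \<subseteq> carrier R" "\<zero> \<in> I" "\<And>a b. a \<in> I \<Longrightarrow> b \<in> I \<Longrightarrow> a \<oplus> b \<in> I"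
    "\<And>r a. r \<in> carrier R \<Longrightarrow> a \<in> I \<Longrightarrow> r \<otimes> a \<in> I"
  shows "ideal I R"
proof (rule idealI[OF ring_axioms])
  have "\<ominus> a \<in> I" if "a \<in> I" for a
    using assms(4)[OF _ that, of "\<ominus> \<one>"] that assms(1) by (auto simp: l_minus subset_iff)
  thus "subgroup I (add_monoid R)" using assms(1-3) by (intro add.subgroupI) (auto simp: a_inv_def)
  fix a r assume *: "a \<in> I" "r \<in> carrier R"
  show "r \<otimes> a \<in> I" using assms(4)[OF *(2,1)] .
  thus "a \<otimes> r \<in> I" using m_comm[of r a] * assms(1) by auto
qed

end

locale local_fiber_cone = noetherian_local_ring R \<mm> + fiber_cone_setup R \<mm> \<aa> us
  for R (structure) and \<mm> \<aa> us +
  assumes rad: "radical R \<aa> = \<mm>"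
begin

sublocale A: std_graded F C component gens by (rule fiber_cone_std_graded)

lemma a_sub_m: "\<aa> \<subseteq> \<mm>"
proof
  fix a assume a: "a \<in> \<aa>"
  hence "a \<in> carrier R" using idealD(1)[OF a_ideal] by auto
  moreover from this have "a [^] (1::nat) \<in> \<aa>" using a by simp
  ultimately show "a \<in> \<mm>" unfolding rad[symmetric] radical_def by blast
qed

lemma Pw_Suc_J: "Pw (Suc j) \<subseteq> J j"
  unfolding Pw_Suc
proof (rule prod_least[OF J_ideal])
  fix a b assume a: "a \<in> Pw j" and b: "b \<in> \<aa>"
  have "b \<otimes> a \<in> J j" using J_mem a b a_sub_m by blast
  moreover have "b \<otimes> a = a \<otimes> b" using m_comm Pw_carr[OF a] idealD(1)[OF a_ideal] b by blast
  ultimately show "a \<otimes> b \<in> J j" by simp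
qed

text \<open>The ideal of \<open>R\<close> between \<open>\<mm>\<aa>\<^sup>j\<close> and \<open>\<aa>\<^sup>j\<close> that corresponds to a subspace of the \<open>j\<close>-th component.\<close>

definition lift :: "nat \<Rightarrow> (nat \<Rightarrow> 'a set) set \<Rightarrow> 'a set" where "lift j V = {a \<in> Pw j. cls j a \<in> V}"

lemma lift_ideal: assumes "A.subsp V" shows "ideal (lift j V) R"
proof (rule ideal_intro)
  show "lift j V \<subseteq> carrier R" unfolding lift_def using Pw_carr by blast
  show "\<zero> \<in> lift j V"
    unfolding lift_def using A.subspD(2)[OF assms] idealD(2)[OF Pw_ideal[of j]] cls_zero[of j] by simp
  fix a b assume "a \<in> lift j V" "b \<in> lift j V"
  hence ab: "a \<in> Pw j" "b \<in> Pw j" "cls j a \<in> V" "cls j b \<in> V" unfolding lift_def by auto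
  show "a \<oplus> b \<in> lift j V"
    unfolding lift_def using A.subspD(3)[OF assms ab(3,4)] idealD(3)[OF Pw_ideal ab(1,2)] cls_add[OF ab(1,2)] by simp
next
  fix r a assume r: "r \<in> carrier R" and "a \<in> lift j V"
  hence a: "a \<in> Pw j" "cls j a \<in> V" unfolding lift_def by auto
  have "cls 0 r \<in> C 0" unfolding C_eq using Pw0_mem[OF r] by blast
  hence "cls 0 r \<otimes>\<^bsub>F\<^esub> cls j a \<in> V" using A.subspD(4)[OF assms _ a(2)] by blast
  hence "cls j (r \<otimes> a) \<in> V" using cls_mult[OF Pw0_mem[OF r] a(1)] by simp
  thus "r \<otimes> a \<in> lift j V" unfolding lift_def using idealD(6)[OF Pw_ideal a(1) r] by simp
qed

text \<open>A complete flag of subspaces of the \<open>j\<close>-th component lifts to a chain of ideals between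
  \<open>\<mm>\<aa>\<^sup>j\<close> and \<open>\<aa>\<^sup>j\<close>.\<close>

lemma ideal_chain_lift: "A.dimension k (C 0) E \<Longrightarrow> E \<subseteq> C j \<Longrightarrow> ideal_chain (J j) (lift j E) k"
proof (induction k "C 0" E rule: A.dimension.induct)
  case zero_dim
  have "J j \<subseteq> lift j {\<zero>\<^bsub>F\<^esub>}" unfolding lift_def using cls_zero_iff J_sub by blast
  thus ?case by (rule ideal_chain.nil[OF J_ideal])
next
  case (Suc_dim v E k)
  have sE: "A.subsp E" using A.fd_subsp A.finite_dimensionI[OF Suc_dim(3)] .
  have sE': "A.subsp (A.line_extension (C 0) v E)"
    using A.fd_subsp A.finite_dimensionI[OF A.dimension.Suc_dim[OF Suc_dim(1-3)]] .
  have EE': "E \<subseteq> A.line_extension (C 0) v E"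
  proof
    fix e assume e: "e \<in> E"
    hence "e = \<zero>\<^bsub>F\<^esub> \<otimes>\<^bsub>F\<^esub> v \<oplus>\<^bsub>F\<^esub> e" using Suc_dim(1) A.subspD(1)[OF sE] by auto
    thus "e \<in> A.line_extension (C 0) v E" unfolding A.line_extension_mem_iff using A.K_sub(3) e by blast
  qed
  have "v = \<one>\<^bsub>F\<^esub> \<otimes>\<^bsub>F\<^esub> v \<oplus>\<^bsub>F\<^esub> \<zero>\<^bsub>F\<^esub>" using Suc_dim(1) by simp
  hence v: "v \<in> A.line_extension (C 0) v E"
    unfolding A.line_extension_mem_iff using A.K_sub(2) A.subspD(2)[OF sE] by blast
  then obtain a where a: "a \<in> Pw j" "v = cls j a" using Suc_dim.prems unfolding C_eq by blast
  have "a \<in> lift j (A.line_extension (C 0) v E)" "a \<notin> lift j E" unfolding lift_def using a v Suc_dim(2) by auto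
  moreover have "lift j E \<subseteq> lift j (A.line_extension (C 0) v E)" unfolding lift_def using EE' by blast
  ultimately have "lift j E \<subset> lift j (A.line_extension (C 0) v E)" by blast
  hence "ideal_chain (lift j E) (lift j (A.line_extension (C 0) v E)) (Suc 0)"
    by (rule ideal_chain.step[OF lift_ideal[OF sE] _ ideal_chain.nil[OF lift_ideal[OF sE'] order_refl]])
  moreover have "ideal_chain (J j) (lift j E) k" using Suc_dim(4) Suc_dim.prems EE' by blast
  ultimately show ?case using ideal_chain_append[of "J j" "lift j E" k _ "Suc 0"] by simp
qed

lemma ideal_chain_Pw: "ideal_chain (Pw N) (carrier R) (\<Sum>j<N. A.d (C j))"
proof (induction N)
  case 0
  show ?case using ideal_chain.nil[OF Pw_ideal[of 0]] idealD(1)[OF Pw_ideal[of 0]] unfolding lessThan_0 sum.empty by blast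
next
  case (Suc N)
  have "ideal_chain (J N) (lift N (C N)) (A.d (C N))" using ideal_chain_lift[OF A.fd_dim[OF A.G_fd] order_refl] .
  moreover have "lift N (C N) \<subseteq> Pw N" unfolding lift_def by blast
  ultimately have "ideal_chain (J N) (Pw N) (A.d (C N))" using ideal_chain_up by blast
  hence "ideal_chain (Pw (Suc N)) (Pw N) (A.d (C N))" using ideal_chain_down[OF _ Pw_ideal Pw_Suc_J] by blast
  hence "ideal_chain (Pw (Suc N)) (carrier R) (A.d (C N) + (\<Sum>j<N. A.d (C j)))" using ideal_chain_append[OF _ Suc] by blast
  thus ?case unfolding sum.lessThan_Suc by (simp only: add.commute)
qed

lemma power_in_Pw: "z \<in> \<aa> \<Longrightarrow> z [^] (k::nat) \<in> Pw k"
proof (induction k)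
  case 0
  show ?case using Pw0_mem[OF one_closed] unfolding nat_pow_0 .
next
  case (Suc k)
  have "z [^] k \<otimes> z \<in> Pw k \<cdot> \<aa>" using ideal_prod.prod[OF Suc.IH[OF Suc.prems] Suc.prems] .
  thus ?case unfolding Pw_Suc nat_pow_Suc .
qed

lemma common_power:
  assumes "finite Z" "Z \<subseteq> \<mm>" shows "\<exists>t::nat. \<forall>z\<in>Z. z [^] t \<in> \<aa>"
  using assms
proof (induction Z rule: finite_induct)
  case (insert z Z)
  then obtain t :: nat where t: "\<forall>z\<in>Z. z [^] t \<in> \<aa>" by auto
  have "z \<in> radical R \<aa>" using insert.prems rad by blast
  then obtain s :: nat where s: "z [^] s \<in> \<aa>" "z \<in> carrier R" unfolding radical_def by blast
  have "y [^] (t + s) \<in> \<aa>" if "y \<in> insert z Z" for y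
  proof -
    have yc: "y \<in> carrier R" using that insert.prems idealD(1)[OF mm] by blast
    have "y [^] (t + s) = y [^] t \<otimes> y [^] s" using nat_pow_mult[OF yc] by simp
    thus ?thesis using that s t idealD(6,7)[OF a_ideal] yc by (cases "y = z") auto
  qed
  thus ?case by blast
qed simp

text \<open>The partial sums of the Hilbert function are lengths of \<open>R/\<aa>\<^sup>N\<close>, which are bounded by the
  lengths of \<open>R/(z\<^sub>1\<^sup>N, \<dots>, z\<^sub>n\<^sup>N)\<close> for parameters \<open>z\<^sub>i \<in> \<aa>\<close>, and these grow at most like \<open>N\<^sup>n\<close>.\<close>

theorem gdim_le_krull_dim:
  assumes n: "krull_dim R = enat n" shows "A.gdim {\<zero>\<^bsub>F\<^esub>} \<le> n"
proof (rule ccontr)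
  assume c: "\<not> ?thesis"
  obtain zs c where zs: "length zs \<le> n" "set zs \<subseteq> \<mm>" "length_le (adjoin_list {\<zero>} zs) (carrier R) c"
    using parameters_exist_local[OF n] by blast
  obtain t :: nat where t: "\<forall>z\<in>set zs. z [^] t \<in> \<aa>" using common_power[OF finite_set zs(2)] by blast
  define ys where "ys = map (\<lambda>z. z [^] t) zs"
  have zc: "set zs \<subseteq> carrier R" using zs(2) idealD(1)[OF mm] by blast
  have ya: "set ys \<subseteq> \<aa>" unfolding ys_def using t by auto
  have yc: "set ys \<subseteq> carrier R" using ya idealD(1)[OF a_ideal] by blast
  define B where "B = t ^ length zs * c"
  have lB: "length_le (adjoin_list {\<zero>} ys) (carrier R) B" unfolding B_def ys_def using length_le_powers[OF zeroideal zc zs(3)] .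
  have ub: "(\<Sum>j<N. A.d (C j)) \<le> B * N ^ n" for N :: nat
  proof (cases "N = 0")
    case False
    have l: "length_le (adjoin_list {\<zero>} (map (\<lambda>z. z [^] N) ys)) (carrier R) (N ^ length ys * B)"
      using length_le_powers[OF zeroideal yc lB] .
    have s: "set (map (\<lambda>z. z [^] N) ys) \<subseteq> Pw N" using ya power_in_Pw by auto
    have "adjoin_list {\<zero>} (map (\<lambda>z. z [^] N) ys) \<subseteq> Pw N"
      by (rule adjoin_list_least[OF Pw_ideal _ s]) (use idealD(2)[OF Pw_ideal] in blast)
    moreover have "ideal (adjoin_list {\<zero>} (map (\<lambda>z. z [^] N) ys)) R"
      using adjoin_list_contains[OF zeroideal, of "map (\<lambda>z. z [^] N) ys"] yc by auto
    ultimately have "length_le (Pw N) (carrier R) (N ^ length ys * B)"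
      using length_le_mono[OF l _ _ order_refl order_refl] by blast
    hence "(\<Sum>j<N. A.d (C j)) \<le> N ^ length ys * B" unfolding length_le_def using ideal_chain_Pw by blast
    also have "\<dots> \<le> N ^ n * B"
      using False zs(1) unfolding ys_def by (intro mult_right_mono power_increasing) auto
    finally show ?thesis by (simp only: mult.commute)
  qed simp
  obtain D where D: "A.gdim {\<zero>\<^bsub>F\<^esub>} = Suc D" "n \<le> D" using c by (cases "A.gdim {\<zero>\<^bsub>F\<^esub>}") auto
  have "(\<Sum>j<T. A.H {\<zero>\<^bsub>F\<^esub>} j) \<le> B * T ^ D" for T :: nat
  proof (cases "T = 0")
    case False
    have "(\<Sum>j<T. A.H {\<zero>\<^bsub>F\<^esub>} j) \<le> (\<Sum>j<T. A.d (C j))" unfolding A.H_def using A.dim_mod_le by (intro sum_mono)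
    also have "\<dots> \<le> B * T ^ n" by (rule ub)
    also have "\<dots> \<le> B * T ^ D" using False D(2) by (intro mult_left_mono power_increasing) auto
    finally show ?thesis .
  qed simp
  thus False by (rule A.cumulative_growth[OF A.homogeneous_zero D(1)])
qed

end

section \<open>From the fiber cone to reductions\<close>

context noetherian_local_ring
begin

lemma unit_outside: assumes "x \<in> carrier R" "x \<notin> \<mm>" shows "\<exists>r\<in>carrier R. r \<otimes> x = \<one>"
proof -
  have "PIdl x = carrier R"
    using proper_in_max[OF cgenideal_ideal[OF assms(1)]] cgenideal_self[OF assms(1)] assms(2) by blast
  hence "\<one> \<in> PIdl x" by simp
  thus ?thesis unfolding cgenideal_def by force
qed

lemma one_notin_max: "\<one> \<notin> \<mm>"
  using ideal.one_imp_carrier[OF mm] maximalideal.I_notcarr[OF maximal] by auto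

text \<open>If \<open>M\<close> is generated by \<open>L\<close> and one more element \<open>h\<close>, then \<open>h \<in> L + \<mm> h\<close>, and \<open>1 - s\<close> is a unit for
  \<open>s \<in> \<mm>\<close>. Removing the generators of \<open>M\<close> one after the other in this way proves Nakayama's lemma.\<close>

lemma nakayama_step:
  assumes M: "ideal M R" and N: "ideal N R" and L: "ideal L R" and sub: "M \<subseteq> N <+>\<^bsub>R\<^esub> (\<mm> \<cdot> M)" "N \<subseteq> L"
    and h: "h \<in> M" "M \<subseteq> adjoin L h"
  shows "h \<in> L"
proof -
  have hc: "h \<in> carrier R" using h idealD(1)[OF M] by blast
  let ?Q = "\<mm> \<cdot> (Idl (set [h]))"
  have iH: "ideal (Idl (set [h])) R" using genideal_ideal[of "set [h]"] hc by simp
  have hH: "h \<in> Idl (set [h])" using genideal_self[of "set [h]"] hc by simp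
  have iQ: "ideal ?Q R" using ideal_prod_is_ideal[OF mm iH] .
  have iLQ: "ideal (L <+>\<^bsub>R\<^esub> ?Q) R" using add_ideals[OF L iQ] .
  have "\<mm> \<cdot> M \<subseteq> L <+>\<^bsub>R\<^esub> ?Q"
  proof (rule prod_least[OF iLQ])
    fix a b assume a: "a \<in> \<mm>" and "b \<in> M"
    hence "b \<in> adjoin L h" using h(2) by blast
    then obtain i r where ir: "i \<in> L" "r \<in> carrier R" "b = i \<oplus> r \<otimes> h" unfolding adjoin_iff by blast
    have ac: "a \<in> carrier R" using a idealD(1)[OF mm] by blast
    have "a \<otimes> b = a \<otimes> i \<oplus> a \<otimes> (r \<otimes> h)" using ir ac hc idealD(1)[OF L] by (simp add: r_distr subset_iff)
    moreover have "a \<otimes> i \<in> L" using idealD(6)[OF L ir(1) ac] .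
    moreover have "a \<otimes> (r \<otimes> h) \<in> ?Q" using ideal_prod.prod[OF a idealD(6)[OF iH hH ir(2)]] .
    ultimately show "a \<otimes> b \<in> L <+>\<^bsub>R\<^esub> ?Q" unfolding set_add_iff by blast
  qed
  moreover have "N \<subseteq> L <+>\<^bsub>R\<^esub> ?Q" using set_add_incl(1)[OF L iQ] sub(2) by blast
  ultimately have "h \<in> L <+>\<^bsub>R\<^esub> ?Q" using set_add_min[OF iLQ, of N "\<mm> \<cdot> M"] sub(1) h(1) by blast
  then obtain x y where xy: "x \<in> L" "y \<in> ?Q" "h = x \<oplus> y" unfolding set_add_iff by blast
  obtain rs where rs: "length rs = length [h]" "set rs \<subseteq> \<mm>" "y = combine rs [h]"
    using ideal_prod_list[OF mm _ xy(2)] hc by auto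
  then obtain s where s: "rs = [s]" "s \<in> \<mm>" by (cases rs) auto
  have sc: "s \<in> carrier R" using s(2) idealD(1)[OF mm] by blast
  have xc: "x \<in> carrier R" using xy(1) idealD(1)[OF L] by blast
  have y: "y = s \<otimes> h" using rs(3) s(1) sc hc by simp
  have "\<one> \<ominus> s \<notin> \<mm>"
  proof
    assume "\<one> \<ominus> s \<in> \<mm>"
    hence "(\<one> \<ominus> s) \<oplus> s \<in> \<mm>" using idealD(3)[OF mm] s(2) by blast
    moreover have "(\<one> \<ominus> s) \<oplus> s = \<one>" using sc by algebra
    ultimately show False using one_notin_max by simp
  qed
  then obtain r where r: "r \<in> carrier R" "r \<otimes> (\<one> \<ominus> s) = \<one>" using unit_outside[of "\<one> \<ominus> s"] sc by auto
  have "(x \<oplus> s \<otimes> h) \<ominus> s \<otimes> h = x" using sc hc xc by algebra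
  hence "h \<ominus> s \<otimes> h = x" by (metis xy(3) y)
  moreover have "r \<otimes> (h \<ominus> s \<otimes> h) = (r \<otimes> (\<one> \<ominus> s)) \<otimes> h" using r(1) sc hc by algebra
  ultimately have "r \<otimes> x = (r \<otimes> (\<one> \<ominus> s)) \<otimes> h" by simp
  hence "r \<otimes> x = h" using r(2) hc by simp
  thus "h \<in> L" using idealD(6)[OF L xy(1) r(1)] by simp
qed

lemma nakayama:
  assumes M: "ideal M R" and N: "ideal N R" and sub: "M \<subseteq> N <+>\<^bsub>R\<^esub> (\<mm> \<cdot> M)"
  shows "M \<subseteq> N"
proof -
  obtain A where A: "A \<subseteq> carrier R" "finite A" "M = Idl A" using finetely_gen[OF M] by blast
  obtain gs where gs: "set gs = A" using finite_list[OF A(2)] by blast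
  have gM: "set gs \<subseteq> M" using gs A(3) genideal_self[OF A(1)] by simp
  have gc: "set gs \<subseteq> carrier R" using gs A(1) by simp
  have "M \<subseteq> adjoin_list N gs \<Longrightarrow> set gs \<subseteq> M \<Longrightarrow> M \<subseteq> N" for gs
  proof (induction gs)
    case (Cons h hs)
    have hc: "set hs \<subseteq> carrier R" "h \<in> M" using Cons.prems(2) idealD(1)[OF M] by auto
    note c = adjoin_list_contains[OF N hc(1)]
    have "M \<subseteq> adjoin (adjoin_list N hs) h" using Cons.prems(1) unfolding adjoin_list_def by simp
    moreover from this have "h \<in> adjoin_list N hs" using nakayama_step[OF M N _ sub _ hc(2)] c by blast
    ultimately have "M \<subseteq> adjoin_list N hs" using adjoin_least[of "adjoin_list N hs" "adjoin_list N hs" h] c by blast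
    thus ?case using Cons by simp
  qed (simp add: adjoin_list_def)
  moreover have "M \<subseteq> adjoin_list N gs" unfolding A(3) using adjoin_list_contains[OF N gc] gs by (intro genideal_minimal) auto
  ultimately show ?thesis using gM by blast
qed

text \<open>Gaussian elimination over the residue field, for fewer equations than unknowns. It is carried out in \<open>R\<close>, where the
  elements outside \<open>\<mm>\<close> are units.\<close>

lemma nontrivial_relation:
  assumes "finite Q"
  shows "finite I \<Longrightarrow> card Q < card I \<Longrightarrow> (\<And>i j. i \<in> I \<Longrightarrow> j \<in> Q \<Longrightarrow> a i j \<in> carrier R) \<Longrightarrow>
    \<exists>c \<in> I \<rightarrow> carrier R. (\<exists>i\<in>I. c i \<notin> \<mm>) \<and> (\<forall>j\<in>Q. (\<Oplus>i\<in>I. c i \<otimes> a i j) \<in> \<mm>)"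
  using assms
proof (induction Q arbitrary: I a rule: finite_induct)
  case empty
  then obtain i where "i \<in> I" by fastforce
  thus ?case using one_notin_max by (intro bexI[of _ "\<lambda>_. \<one>"]) auto
next
  case (insert j Q)
  have fin: "finite I" by fact
  show ?case
  proof (cases "\<forall>i\<in>I. a i j \<in> \<mm>")
    case True
    obtain c where c: "c \<in> I \<rightarrow> carrier R" "\<exists>i\<in>I. c i \<notin> \<mm>" "\<forall>j\<in>Q. (\<Oplus>i\<in>I. c i \<otimes> a i j) \<in> \<mm>"
      using insert.IH[OF fin, of a] insert.prems insert.hyps by auto
    have cij: "c i \<otimes> a i j \<in> \<mm>" if "i \<in> I" for i using True that c(1) idealD(6)[OF mm] by blast
    have "(\<Oplus>i\<in>I. c i \<otimes> a i j) \<in> \<mm>" using cij by (rule finsum_ideal[OF mm fin])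
    thus ?thesis using c by (intro bexI[of _ c]) auto
  next
    case False
    then obtain p where p: "p \<in> I" "a p j \<notin> \<mm>" by blast
    have pc: "a p j \<in> carrier R" using insert.prems(3)[OF p(1)] by simp
    obtain r where r: "r \<in> carrier R" "r \<otimes> a p j = \<one>" using unit_outside[OF pc p(2)] by blast
    define b where "b i k = a i k \<ominus> (a i j \<otimes> r) \<otimes> a p k" for i k
    let ?I = "I - {p}"
    have ac: "a i k \<in> carrier R" if "i \<in> I" "k \<in> insert j Q" for i k using insert.prems(3) that by blast
    have bc: "b i k \<in> carrier R" if "i \<in> ?I" "k \<in> Q" for i k unfolding b_def using ac that p(1) r(1) by auto
    have "card Q < card ?I" using insert.prems(2) insert.hyps p(1) fin by simp
    hence "\<exists>c \<in> ?I \<rightarrow> carrier R. (\<exists>i\<in>?I. c i \<notin> \<mm>) \<and> (\<forall>j\<in>Q. (\<Oplus>i\<in>?I. c i \<otimes> b i j) \<in> \<mm>)"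
      by (intro insert.IH) (use fin bc in auto)
    then obtain c where c: "c \<in> ?I \<rightarrow> carrier R" "\<exists>i\<in>?I. c i \<notin> \<mm>"
      "\<forall>k\<in>Q. (\<Oplus>i\<in>?I. c i \<otimes> b i k) \<in> \<mm>" by blast
    define e where "e = (\<Oplus>i\<in>?I. c i \<otimes> (a i j \<otimes> r))"
    have ec': "(\<lambda>i. c i \<otimes> (a i j \<otimes> r)) \<in> ?I \<rightarrow> carrier R" using c(1) ac r(1) by auto
    have ec: "e \<in> carrier R" unfolding e_def using ec' by (rule finsum_closed)
    define c' where "c' = c (p := \<ominus> e)"
    have c': "c' \<in> I \<rightarrow> carrier R" unfolding c'_def using c(1) ec by auto
    have eq: "(\<Oplus>i\<in>I. c' i \<otimes> a i k) = (\<Oplus>i\<in>?I. c i \<otimes> b i k)" if k: "k \<in> insert j Q" for k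
    proof -
      have f: "(\<lambda>i. c i \<otimes> a i k) \<in> ?I \<rightarrow> carrier R" using c(1) ac k by auto
      have pk: "a p k \<in> carrier R" using ac p(1) k by auto
      have ck: "c i \<in> carrier R" "a i k \<in> carrier R" "a i j \<in> carrier R" if "i \<in> I" "i \<noteq> p" for i
        using c(1) ac k that by auto
      have g: "(\<lambda>i. c i \<otimes> b i k) \<in> ?I \<rightarrow> carrier R" "(\<lambda>i. c i \<otimes> (a i j \<otimes> r) \<otimes> a p k) \<in> ?I \<rightarrow> carrier R"
        unfolding b_def using ck pk r(1) by (auto intro!: Pi_I m_closed minus_closed)
      have "(\<Oplus>i\<in>?I. c i \<otimes> a i k) = (\<Oplus>i\<in>?I. c i \<otimes> b i k \<oplus> c i \<otimes> (a i j \<otimes> r) \<otimes> a p k)"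
      proof (rule finsum_cong'[OF refl])
        show "(\<lambda>i. c i \<otimes> b i k \<oplus> c i \<otimes> (a i j \<otimes> r) \<otimes> a p k) \<in> ?I \<rightarrow> carrier R" using g by blast
        fix i assume i: "i \<in> ?I"
        have "c i \<in> carrier R" "a i k \<in> carrier R" "a i j \<in> carrier R" using c(1) ac k i by auto
        thus "c i \<otimes> a i k = c i \<otimes> b i k \<oplus> c i \<otimes> (a i j \<otimes> r) \<otimes> a p k"
          unfolding b_def using pk r(1) by algebra
      qed
      also have "\<dots> = (\<Oplus>i\<in>?I. c i \<otimes> b i k) \<oplus> e \<otimes> a p k"
        unfolding e_def using finsum_addf[OF g] finsum_ldistr[OF _ pk ec'] fin by simp
      finally have 1: "(\<Oplus>i\<in>?I. c i \<otimes> a i k) = (\<Oplus>i\<in>?I. c i \<otimes> b i k) \<oplus> e \<otimes> a p k" .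
      have "(\<Oplus>i\<in>I. c' i \<otimes> a i k) = (\<Oplus>i\<in>insert p ?I. c' i \<otimes> a i k)" using p(1) by (simp add: insert_absorb)
      also have "\<dots> = c' p \<otimes> a p k \<oplus> (\<Oplus>i\<in>?I. c' i \<otimes> a i k)"
        using fin c' ac k p(1) by (intro finsum_insert) auto
      also have "(\<Oplus>i\<in>?I. c' i \<otimes> a i k) = (\<Oplus>i\<in>?I. c i \<otimes> a i k)"
        using f by (intro finsum_cong'[OF refl]) (auto simp: c'_def)
      also have "c' p \<otimes> a p k \<oplus> (\<Oplus>i\<in>?I. c i \<otimes> a i k) = (\<Oplus>i\<in>?I. c i \<otimes> b i k)"
      proof -
        have "\<ominus> e \<otimes> a p k \<oplus> (y \<oplus> e \<otimes> a p k) = y" if "y \<in> carrier R" for y using that ec pk by algebra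
        thus ?thesis unfolding 1 c'_def fun_upd_same using finsum_closed[OF g(1)] by blast
      qed
      finally show ?thesis .
    qed
    have "(\<Oplus>i\<in>?I. c i \<otimes> b i j) = (\<Oplus>i\<in>?I. \<zero>)"
    proof (rule finsum_cong'[OF refl])
      fix i assume i: "i \<in> ?I"
      have aij: "a i j \<in> carrier R" "c i \<in> carrier R" using ac i c(1) by auto
      have "(a i j \<otimes> r) \<otimes> a p j = a i j" using aij pc r m_assoc[of "a i j" r "a p j"] by simp
      hence "b i j = \<zero>" unfolding b_def using aij by (simp add: a_minus_def r_neg)
      thus "c i \<otimes> b i j = \<zero>" using aij by simp
    qed simp
    hence "(\<Oplus>i\<in>I. c' i \<otimes> a i j) \<in> \<mm>" using eq idealD(2)[OF mm] by simp
    moreover have "(\<Oplus>i\<in>I. c' i \<otimes> a i k) \<in> \<mm>" if "k \<in> Q" for k using eq[of k] c(3) that by simp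
    moreover have "\<exists>i\<in>I. c' i \<notin> \<mm>" using c(2) unfolding c'_def by auto
    ultimately show ?thesis using c' by (intro bexI[of _ c']) auto
  qed
qed

lemma primary_if_radical_max:
  assumes b: "ideal \<bb> R" and r: "radical R \<bb> = \<mm>" shows "primary_to R \<mm> \<bb>"
proof -
  have "\<bb> \<noteq> carrier R"
  proof
    assume "\<bb> = carrier R"
    hence "\<one> \<in> radical R \<bb>" unfolding radical_def by simp
    thus False using r one_notin_max by simp
  qed
  moreover have "x \<in> \<bb> \<or> y \<in> radical R \<bb>" if xy: "x \<in> carrier R" "y \<in> carrier R" "x \<otimes> y \<in> \<bb>" for x y
  proof (cases "y \<in> \<mm>")
    case False
    then obtain s where s: "s \<in> carrier R" "s \<otimes> y = \<one>" using unit_outside[OF xy(2)] by blast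
    have "s \<otimes> (x \<otimes> y) = x \<otimes> (s \<otimes> y)" using xy s(1) by algebra
    hence "x \<in> \<bb>" using idealD(6)[OF b xy(3) s(1)] s(2) xy(1) by simp
    thus ?thesis ..
  qed (use r in simp)
  ultimately show ?thesis unfolding primary_to_def primary_ideal_def using b r by blast
qed

end

context local_fiber_cone
begin

text \<open>The component of degree \<open>j + 1\<close> of a combination of elements of degree one only involves the components of degree \<open>j\<close> of the coefficients.\<close>

lemma combine_component:
  assumes "length rs = length is" "set rs \<subseteq> carrier F" "set is \<subseteq> S" and v: "\<And>i. i \<in> S \<Longrightarrow> v i \<in> \<aa>"
  shows "\<exists>b\<in>(Idl (v ` S)) \<cdot> Pw j. component (Suc j) (A.combine rs (map (\<lambda>i. cls 1 (v i)) is)) = cls (Suc j) b"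
  using assms(1-3)
proof (induction rs "is" rule: list_induct2)
  case Nil
  have vS: "v ` S \<subseteq> carrier R" using v idealD(1)[OF a_ideal] by blast
  have "\<zero> \<in> (Idl (v ` S)) \<cdot> Pw j" using idealD(2)[OF ideal_prod_is_ideal[OF genideal_ideal[OF vS] Pw_ideal]] .
  moreover have "component (Suc j) \<zero>\<^bsub>F\<^esub> = cls (Suc j) \<zero>" using A.pr_zero cls_zero by simp
  ultimately show ?case unfolding list.map A.combine.simps by blast
next
  case (Cons r rs i "is")
  have vS: "v ` S \<subseteq> carrier R" using v idealD(1)[OF a_ideal] by blast
  have iV: "ideal (Idl (v ` S)) R" using genideal_ideal[OF vS] .
  have iB: "ideal ((Idl (v ` S)) \<cdot> Pw j) R" using ideal_prod_is_ideal[OF iV Pw_ideal] .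
  have "Idl (v ` S) \<subseteq> \<aa>" using v by (intro genideal_minimal[OF a_ideal]) blast
  hence sub: "(Idl (v ` S)) \<cdot> Pw j \<subseteq> Pw (Suc j)"
    using Pw_mult[of _ "Suc 0" _ j] unfolding Pw_1 add_Suc add_0 by (intro prod_least[OF Pw_ideal]) blast
  have i: "i \<in> S" "r \<in> carrier F" using Cons.prems by auto
  have vP: "v i \<in> Pw 1" using v[OF i(1)] Pw_1 by simp
  have vC: "cls 1 (v i) \<in> C 1" unfolding C_eq using vP by blast
  obtain b where b: "b \<in> (Idl (v ` S)) \<cdot> Pw j" "component (Suc j) (A.combine rs (map (\<lambda>i. cls 1 (v i)) is)) = cls (Suc j) b"
    using Cons by auto
  obtain a where a: "a \<in> Pw j" "component j r = cls j a" using component_in(2)[OF i(2)] by blast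
  have "component (Suc j) (r \<otimes>\<^bsub>F\<^esub> cls 1 (v i)) = component j r \<otimes>\<^bsub>F\<^esub> cls 1 (v i)" using A.pr_mult_homogeneous[OF i(2) vC, of "Suc j"] by simp
  also have "\<dots> = cls (Suc j) (v i \<otimes> a)"
    using cls_mult[OF a(1) vP] a(2) m_comm[OF Pw_carr[OF a(1)] Pw_carr[OF vP]] by simp
  finally have 1: "component (Suc j) (r \<otimes>\<^bsub>F\<^esub> cls 1 (v i)) = cls (Suc j) (v i \<otimes> a)" .
  have va: "v i \<otimes> a \<in> (Idl (v ` S)) \<cdot> Pw j" using ideal_prod.prod[of "v i" "Idl (v ` S)" a "Pw j" R] genideal_self[OF vS] i(1) a(1) by blast
  have cc: "A.combine rs (map (\<lambda>i. cls 1 (v i)) is) \<in> carrier F"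
  proof (rule A.combine_in_carrier)
    show "set (map (\<lambda>i. cls 1 (v i)) is) \<subseteq> carrier F" using Cons.prems(2) v cls_carrier[of _ 1] Pw_1 by auto
  qed (use Cons.prems in auto)
  have "component (Suc j) (A.combine (r # rs) (map (\<lambda>i. cls 1 (v i)) (i # is))) = cls (Suc j) (v i \<otimes> a) \<oplus>\<^bsub>F\<^esub> cls (Suc j) b"
    unfolding list.map A.combine.simps using A.pr_add[OF _ cc] i(2) cls_carrier[OF vP] 1 b(2) by simp
  also have "\<dots> = cls (Suc j) (v i \<otimes> a \<oplus> b)" using cls_add sub va b(1) by blast
  finally show ?case using idealD(3)[OF iB va b(1)] by blast
qed

lemma reduction_of_generated:
  assumes S: "finite S" and v: "\<And>i. i \<in> S \<Longrightarrow> v i \<in> \<aa>"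
    and gen: "C (Suc k) \<subseteq> genideal F ((\<lambda>i. cls 1 (v i)) ` S)"
  shows "Pw (Suc k) = (Idl (v ` S)) \<cdot> Pw k"
proof
  have vS: "v ` S \<subseteq> carrier R" using v idealD(1)[OF a_ideal] by blast
  have iV: "ideal (Idl (v ` S)) R" using genideal_ideal[OF vS] .
  have iB: "ideal ((Idl (v ` S)) \<cdot> Pw k) R" using ideal_prod_is_ideal[OF iV Pw_ideal] .
  have "Idl (v ` S) \<subseteq> \<aa>" using v by (intro genideal_minimal[OF a_ideal]) blast
  thus sub: "(Idl (v ` S)) \<cdot> Pw k \<subseteq> Pw (Suc k)"
    using Pw_mult[of _ "Suc 0" _ k] unfolding Pw_1 add_Suc add_0 by (intro prod_least[OF Pw_ideal]) blast
  obtain "is" where "is": "set is = S" using finite_list[OF S] by blast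
  have xc: "set (map (\<lambda>i. cls 1 (v i)) is) \<subseteq> carrier F" using "is" v cls_carrier[of _ 1] Pw_1 by auto
  have "Pw (Suc k) \<subseteq> ((Idl (v ` S)) \<cdot> Pw k) <+>\<^bsub>R\<^esub> (\<mm> \<cdot> Pw (Suc k))"
  proof
    fix a assume a: "a \<in> Pw (Suc k)"
    have aC: "cls (Suc k) a \<in> C (Suc k)" unfolding C_eq using a by blast
    hence "cls (Suc k) a \<in> genideal F (set (map (\<lambda>i. cls 1 (v i)) is))" using gen "is" by auto
    then obtain rs where rs: "length rs = length is" "set rs \<subseteq> carrier F"
      "cls (Suc k) a = A.combine rs (map (\<lambda>i. cls 1 (v i)) is)"
      unfolding A.Idl_list_eq_combine[OF xc] length_map by blast
    have "\<exists>b\<in>(Idl (v ` S)) \<cdot> Pw k. component (Suc k) (cls (Suc k) a) = cls (Suc k) b"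
      unfolding rs(3) by (rule combine_component[OF rs(1,2)]) (use "is" v in auto)
    then obtain b where b: "b \<in> (Idl (v ` S)) \<cdot> Pw k" "component (Suc k) (cls (Suc k) a) = cls (Suc k) b" by blast
    have bP: "b \<in> Pw (Suc k)" using b(1) sub by blast
    have "cls (Suc k) a = cls (Suc k) b" using A.pr_same[OF aC] b(2) by simp
    hence "cls (Suc k) a (Suc k) = cls (Suc k) b (Suc k)" by simp
    hence "J (Suc k) +> a = J (Suc k) +> b" unfolding cls_def by simp
    hence "a \<ominus> b \<in> J (Suc k)" using cos_eq[OF Pw_carr[OF a] Pw_carr[OF bP]] by blast
    hence 1: "a \<ominus> b \<in> \<mm> \<cdot> Pw (Suc k)" unfolding fiber_cone_modulus_def .
    have "a = b \<oplus> (a \<ominus> b)" using Pw_carr[OF a] Pw_carr[OF bP] by algebra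
    thus "a \<in> ((Idl (v ` S)) \<cdot> Pw k) <+>\<^bsub>R\<^esub> (\<mm> \<cdot> Pw (Suc k))" unfolding set_add_iff using b(1) 1 by blast
  qed
  thus "Pw (Suc k) \<subseteq> (Idl (v ` S)) \<cdot> Pw k" using nakayama[OF Pw_ideal iB] by blast
qed

theorem reduction_from_general_elements:
  assumes n: "krull_dim R = enat n" and nm: "n \<le> m" and I: "finite I" "card I = d * (m - n) + n" "m \<le> card I"
    and v: "\<And>i. i \<in> I \<Longrightarrow> v i \<in> \<aa>"
    and gp: "\<And>T L. T \<subseteq> I \<Longrightarrow> card T = m \<Longrightarrow> ideal L R \<Longrightarrow> v ` T \<subseteq> L \<Longrightarrow> \<mm> \<cdot> \<aa> \<subseteq> L \<Longrightarrow> \<aa> \<subseteq> L"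
    and deg: "deg_rad F C \<le> of_nat d"
  shows "\<exists>S\<subseteq>I. card S = n \<and> (\<exists>k>0. Pw (Suc k) = (Idl (v ` S)) \<cdot> Pw k)"
proof -
  let ?xs = "\<lambda>i. cls 1 (v i)"
  have vP: "v i \<in> Pw 1" if "i \<in> I" for i using v[OF that] Pw_1 by simp
  have xs: "?xs i \<in> C 1" if "i \<in> I" for i unfolding C_eq using vP[OF that] by blast
  have gen: "C 1 \<subseteq> L" if T: "T \<subseteq> I" "card T = m" "ideal L F" "?xs ` T \<subseteq> L" for T L
  proof -
    have iL: "ideal (lift 1 L) R" using lift_ideal[OF A.ideal_subsp[OF T(3)]] .
    have "v ` T \<subseteq> lift 1 L" unfolding lift_def using T(1,4) vP by blast
    moreover have "\<mm> \<cdot> \<aa> \<subseteq> lift 1 L"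
    proof
      fix a assume "a \<in> \<mm> \<cdot> \<aa>"
      hence "a \<in> J 1" unfolding fiber_cone_modulus_def using Pw_1 by simp
      moreover from this have "a \<in> Pw 1" using J_sub by blast
      ultimately show "a \<in> lift 1 L" unfolding lift_def using cls_zero_iff[of a 1] A.idealD(2)[OF T(3)] by simp
    qed
    ultimately have "\<aa> \<subseteq> lift 1 L" using gp[OF T(1,2) iL] by blast
    thus ?thesis unfolding C_eq lift_def using Pw_1 by auto
  qed
  have "\<exists>S\<subseteq>I. card S = n \<and> (\<exists>N. \<forall>j\<ge>N. C j \<subseteq> genideal F (?xs ` S))"
  proof (rule A.few_forms_suffice[OF I(1,2) nm _ I(3) _ deg gdim_le_krull_dim[OF n]])
    show "?xs i \<in> C 1" if "i \<in> I" for i by (rule xs[OF that])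
    show "C 1 \<subseteq> L" if "T \<subseteq> I" "card T = m" "ideal L F" "?xs ` T \<subseteq> L" for T L by (rule gen[OF that])
  qed
  then obtain S N where S: "S \<subseteq> I" "card S = n" "\<forall>j\<ge>N. C j \<subseteq> genideal F (?xs ` S)" by (elim exE conjE)
  have "Pw (Suc (Suc N)) = (Idl (v ` S)) \<cdot> Pw (Suc N)"
  proof (rule reduction_of_generated)
    show "finite S" using S(1) I(1) finite_subset by blast
    show "v i \<in> \<aa>" if "i \<in> S" for i using that S(1) v by blast
    show "C (Suc (Suc N)) \<subseteq> genideal F (?xs ` S)" using S(3) by simp
  qed
  hence "\<exists>k>0. Pw (Suc k) = (Idl (v ` S)) \<cdot> Pw k" by (intro exI[of _ "Suc N"]) simp
  thus ?thesis using S(1,2) by (intro exI[of _ S] conjI)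
qed

lemma radical_of_reduction:
  assumes "ideal \<bb> R" "\<bb> \<subseteq> \<aa>" "Pw (Suc k) = \<bb> \<cdot> Pw k" shows "radical R \<bb> = \<mm>"
proof
  show "radical R \<bb> \<subseteq> \<mm>" unfolding rad[symmetric] radical_def using assms(2) by blast
  show "\<mm> \<subseteq> radical R \<bb>"
  proof
    fix x assume "x \<in> \<mm>"
    then obtain t :: nat where x: "x \<in> carrier R" "x [^] t \<in> \<aa>" unfolding rad[symmetric] radical_def by blast
    have "(x [^] t) [^] Suc k \<in> \<bb>"
      using power_in_Pw[OF x(2), of "Suc k"] assms(3) ideal_prod_inter[OF assms(1) Pw_ideal, of k] by blast
    hence "x [^] (t * Suc k) \<in> \<bb>" by (simp only: nat_pow_pow[OF x(1)])
    thus "x \<in> radical R \<bb>" unfolding radical_def using x(1) by blast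
  qed
qed

end

section \<open>Independent linear forms\<close>

lemma increasing_enumeration:
  assumes "finite T" shows "\<exists>\<iota>. strict_mono_on {1..card T} \<iota> \<and> \<iota> ` {1..card T} = (T :: nat set)"
proof -
  let ?l = "sorted_list_of_set T"
  have l: "length ?l = card T" "set ?l = T" "sorted_wrt (<) ?l" using assms by auto
  let ?i = "\<lambda>k. ?l ! (k - 1)"
  have "strict_mono_on {1..card T} ?i"
  proof (rule strict_mono_onI)
    fix r s assume "r \<in> {1..card T}" "s \<in> {1..card T}" "r < s"
    thus "?l ! (r - 1) < ?l ! (s - 1)" using l(1) by (intro sorted_wrt_nth_less[OF l(3)]) auto
  qed
  moreover have "?i ` {1..card T} = set ?l"
  proof (intro equalityI subsetI)
    fix x assume "x \<in> ?i ` {1..card T}"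
    thus "x \<in> set ?l" using l(1) by (auto intro!: nth_mem simp del: set_sorted_list_of_set)
  next
    fix x assume "x \<in> set ?l"
    then obtain k where "k < length ?l" "x = ?l ! k" by (metis in_set_conv_nth)
    thus "x \<in> ?i ` {1..card T}" using l(1) by (intro image_eqI[of _ _ "Suc k"]) auto
  qed
  ultimately show ?thesis using l(2) by auto
qed

context cring
begin

lemma indexed_pset_support: "P \<in> indexed_pset I (carrier R) \<Longrightarrow> P M \<in> carrier R \<and> (P M \<noteq> \<zero> \<longrightarrow> set_mset M \<subseteq> I)"
proof (induction arbitrary: M rule: indexed_pset.induct)
  case (indexed_const k)
  thus ?case by (auto simp: indexed_const_def)
next
  case (indexed_padd P Q)
  thus ?case unfolding indexed_padd_def by (metis a_closed r_zero zero_closed)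
next
  case (indexed_pmult P i)
  have "M = add_mset i (M - {#i#})" if "i \<in># M" using that by simp
  hence "set_mset M \<subseteq> insert i (set_mset (M - {#i#}))" if "i \<in># M" using that by (metis set_mset_add_mset_insert order_refl)
  thus ?case using indexed_pmult.IH[of "M - {#i#}"] indexed_pmult.hyps(2) unfolding indexed_pmult_def by auto
qed

lemma linear_form_value:
  assumes P: "linear_form R m P" and u: "u \<in> {1..m} \<rightarrow> carrier R"
  shows "P M \<in> carrier R" "P M \<noteq> \<zero> \<Longrightarrow> \<exists>j\<in>{1..m}. M = {#j#}" "poly_value R P u = (\<Oplus>j\<in>{1..m}. P {#j#} \<otimes> u j)"
proof -
  have s: "P M \<in> carrier R" "P M \<noteq> \<zero> \<Longrightarrow> set_mset M \<subseteq> {1..m}" "P M \<noteq> \<zero> \<Longrightarrow> size M = 1" for M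
    using P indexed_pset_support unfolding linear_form_def by blast+
  show "P M \<in> carrier R" by (rule s(1))
  have sup: "\<exists>j\<in>{1..m}. M = {#j#}" if "P M \<noteq> \<zero>" for M
  proof -
    obtain j where "M = {#j#}" using s(3)[OF \<open>P M \<noteq> \<zero>\<close>] size_1_singleton_mset by blast
    thus ?thesis using s(2)[OF \<open>P M \<noteq> \<zero>\<close>] by auto
  qed
  thus "P M \<noteq> \<zero> \<Longrightarrow> \<exists>j\<in>{1..m}. M = {#j#}" .
  let ?h = "\<lambda>M. P M \<otimes> (\<Otimes>i\<in>set_mset M. u i [^] count M i)"
  let ?B = "(\<lambda>j. {#j#}) ` {1..m}"
  have h: "?h {#j#} = P {#j#} \<otimes> u j" if "j \<in> {1..m}" for j
  proof -
    have "u j \<in> carrier R" using u that by blast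
    thus ?thesis by simp
  qed
  have hc: "?h \<in> ?B \<rightarrow> carrier R"
  proof
    fix M assume "M \<in> ?B"
    then obtain j where j: "j \<in> {1..m}" "M = {#j#}" by blast
    have "u j \<in> carrier R" using u j(1) by blast
    thus "?h M \<in> carrier R" unfolding j(2) h[OF j(1)] using s(1) by simp
  qed
  have "poly_value R P u = (\<Oplus>M\<in>?B. ?h M)"
    unfolding poly_value_def
  proof (rule add.finprod_mono_neutral_cong_left)
    show "?h M = \<zero>" if MB: "M \<in> ?B - {M. P M \<noteq> \<zero>}" for M
    proof -
      obtain j where j: "j \<in> {1..m}" "M = {#j#}" "P {#j#} = \<zero>" using MB by blast
      have "u j \<in> carrier R" using u j(1) by blast
      thus ?thesis unfolding j(2) h[OF j(1)] j(3) by simp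
    qed
  qed (use sup hc in auto)
  also have "\<dots> = (\<Oplus>j\<in>{1..m}. ?h {#j#})" by (rule finsum_reindex[OF hc]) (auto simp: inj_on_def)
  also have "\<dots> = (\<Oplus>j\<in>{1..m}. P {#j#} \<otimes> u j)"
    using s(1) u by (intro finsum_cong'[OF refl] h) (auto intro!: m_closed)
  finally show "poly_value R P u = (\<Oplus>j\<in>{1..m}. P {#j#} \<otimes> u j)" .
qed

end

context noetherian_local_ring
begin

text \<open>Any \<open>m\<close> of the values generate \<open>\<qq>\<close> modulo \<open>\<mm>\<qq>\<close>: a relation between a unit vector and the
  coefficient vectors of \<open>m\<close> independent forms must involve the unit vector.\<close>

lemma independent_values_generate:
  assumes ind: "independent_linear_forms (R Quot \<mm>) m l (\<lambda>i. poly_reduce R \<mm> (N i))"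
    and lin: "\<forall>i\<in>{1..l}. linear_form R m (N i)" and u: "\<And>j. j \<in> {1..m} \<Longrightarrow> u j \<in> carrier R"
    and T: "T \<subseteq> {1..l}" "card T = m" and L: "ideal L R" and vL: "\<And>i. i \<in> T \<Longrightarrow> poly_value R (N i) u \<in> L"
    and mL: "\<mm> \<cdot> (Idl (u ` {1..m})) \<subseteq> L" and q: "q \<in> {1..m}"
  shows "u q \<in> L"
proof -
  have uc: "u ` {1..m} \<subseteq> carrier R" using u by blast
  have fin: "finite T" using T(1) finite_subset by blast
  have T0: "0 \<notin> T" using T(1) by auto
  have uP: "u \<in> {1..m} \<rightarrow> carrier R" using u by blast
  have lT: "linear_form R m (N i)" if "i \<in> T" for i using lin T(1) that by blast
  have Nc: "N i M \<in> carrier R" if "i \<in> T" for i M by (rule linear_form_value(1)[OF lT[OF that] uP])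
  \<comment> \<open>row \<open>0\<close>, which is not an index of a form, is the unit vector of \<open>q\<close>\<close>
  define a where "a i j = (if i = 0 then (if j = q then \<one> else \<zero>) else N i {#j#})" for i j
  have ac: "a i j \<in> carrier R" if "i \<in> insert 0 T" for i j unfolding a_def using Nc that by auto
  have "card {1..m} < card (insert 0 T)" using T(2) T0 fin by simp
  from nontrivial_relation[OF _ _ this, of a] fin ac
  obtain c where c: "c \<in> insert 0 T \<rightarrow> carrier R" "\<exists>i\<in>insert 0 T. c i \<notin> \<mm>"
    "\<forall>j\<in>{1..m}. (\<Oplus>i\<in>insert 0 T. c i \<otimes> a i j) \<in> \<mm>" by auto
  have cc: "c i \<in> carrier R" if "i \<in> insert 0 T" for i using c(1) that by blast
  have c0: "c 0 \<in> carrier R" using cc by simp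
  let ?s = "\<lambda>j. \<Oplus>i\<in>T. c i \<otimes> N i {#j#}"
  have sf: "(\<lambda>i. c i \<otimes> N i {#j#}) \<in> T \<rightarrow> carrier R" for j using cc Nc by blast
  have sc: "?s j \<in> carrier R" for j using sf by (rule finsum_closed)
  have e: "(\<Oplus>i\<in>insert 0 T. c i \<otimes> a i j) = c 0 \<otimes> a 0 j \<oplus> ?s j" for j
  proof -
    have "(\<Oplus>i\<in>insert 0 T. c i \<otimes> a i j) = c 0 \<otimes> a 0 j \<oplus> (\<Oplus>i\<in>T. c i \<otimes> a i j)"
      using fin T0 cc ac by (intro finsum_insert) auto
    also have "(\<Oplus>i\<in>T. c i \<otimes> a i j) = ?s j"
      using T0 sf by (intro finsum_cong'[OF refl]) (auto simp: a_def)
    finally show ?thesis .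
  qed
  have dim_mod: "c 0 \<otimes> a 0 j \<oplus> ?s j \<in> \<mm>" if "j \<in> {1..m}" for j using c(3) that e by simp
  have c0m: "c 0 \<notin> \<mm>"
  proof
    assume c0m: "c 0 \<in> \<mm>"
    obtain \<iota> where \<iota>: "strict_mono_on {1..m} \<iota>" "\<iota> ` {1..m} = T" using increasing_enumeration[OF fin] T(2) by auto
    hence "increasing_indices m l \<iota>" unfolding increasing_indices_def using T(1) by simp
    hence li: "lin_indep_polys (R Quot \<mm>) {1..m} (\<lambda>j. poly_reduce R \<mm> (N (\<iota> j)))"
      using ind unfolding independent_linear_forms_def by blast
    interpret h: ring_hom_cring R "R Quot \<mm>" "(+>) \<mm>" using ideal.rcos_ring_hom_cring[OF mm is_cring] .
    have inj: "inj_on \<iota> {1..m}" using \<iota>(1) strict_mono_on_imp_inj_on by blast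
    have z: "(\<Oplus>\<^bsub>R Quot \<mm>\<^esub>i\<in>{1..m}. (\<mm> +> c (\<iota> i)) \<otimes>\<^bsub>R Quot \<mm>\<^esub> poly_reduce R \<mm> (N (\<iota> i)) M) = \<zero>\<^bsub>R Quot \<mm>\<^esub>" for M
    proof -
      have f: "(\<lambda>i. c i \<otimes> N i M) \<in> T \<rightarrow> carrier R" using cc Nc by blast
      have f': "(\<lambda>i. c (\<iota> i) \<otimes> N (\<iota> i) M) \<in> {1..m} \<rightarrow> carrier R" using f \<iota>(2) by blast
      have "(\<Oplus>\<^bsub>R Quot \<mm>\<^esub>i\<in>{1..m}. (\<mm> +> c (\<iota> i)) \<otimes>\<^bsub>R Quot \<mm>\<^esub> poly_reduce R \<mm> (N (\<iota> i)) M)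
        = (\<Oplus>\<^bsub>R Quot \<mm>\<^esub>i\<in>{1..m}. \<mm> +> (c (\<iota> i) \<otimes> N (\<iota> i) M))"
      proof (rule h.S.finsum_cong'[OF refl])
        show "(\<lambda>i. \<mm> +> (c (\<iota> i) \<otimes> N (\<iota> i) M)) \<in> {1..m} \<rightarrow> carrier (R Quot \<mm>)" using f' h.hom_closed by blast
        fix i assume "i \<in> {1..m}"
        hence "\<iota> i \<in> T" using \<iota>(2) by blast
        thus "(\<mm> +> c (\<iota> i)) \<otimes>\<^bsub>R Quot \<mm>\<^esub> poly_reduce R \<mm> (N (\<iota> i)) M = \<mm> +> (c (\<iota> i) \<otimes> N (\<iota> i) M)"
          unfolding poly_reduce_def using cc Nc by simp
      qed
      also have "\<dots> = \<mm> +> (\<Oplus>i\<in>{1..m}. c (\<iota> i) \<otimes> N (\<iota> i) M)"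
        using h.hom_finsum[OF f'] by (simp add: comp_def)
      also have "(\<Oplus>i\<in>{1..m}. c (\<iota> i) \<otimes> N (\<iota> i) M) = (\<Oplus>i\<in>T. c i \<otimes> N i M)"
        using finsum_reindex[of "\<lambda>i. c i \<otimes> N i M" \<iota> "{1..m}"] f inj \<iota>(2) by simp
      also have "(\<Oplus>i\<in>T. c i \<otimes> N i M) \<in> \<mm>"
      proof (cases "\<exists>j\<in>{1..m}. M = {#j#}")
        case True
        then obtain j where j: "j \<in> {1..m}" "M = {#j#}" by blast
        have "?s j \<oplus> c 0 \<otimes> a 0 j \<in> \<mm>" using dim_mod[OF j(1)] a_comm[of "c 0 \<otimes> a 0 j" "?s j"] c0 ac sc by simp
        moreover have "c 0 \<otimes> a 0 j \<in> \<mm>" using idealD(7)[OF mm c0m] ac by blast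
        ultimately have "?s j \<in> \<mm>" using ideal_cancel_r[OF mm _ _ sc] by blast
        thus ?thesis using j(2) by simp
      next
        case False
        have "(\<Oplus>i\<in>T. c i \<otimes> N i M) = (\<Oplus>i\<in>T. \<zero>)"
        proof (rule finsum_cong'[OF refl])
          fix i assume i: "i \<in> T"
          have "N i M = \<zero>" using linear_form_value(2)[OF lT[OF i] uP] False by blast
          thus "c i \<otimes> N i M = \<zero>" using cc i by simp
        qed simp
        thus ?thesis using idealD(2)[OF mm] by simp
      qed
      hence "\<mm> +> (\<Oplus>i\<in>T. c i \<otimes> N i M) = \<mm>" using a_rcos_zero[OF mm] by blast
      finally show ?thesis unfolding FactRing_def by simp
    qed
    have "(\<lambda>i. \<mm> +> c (\<iota> i)) \<in> {1..m} \<rightarrow> carrier (R Quot \<mm>)" using cc \<iota>(2) h.hom_closed by blast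
    from bspec[OF li[unfolded lin_indep_polys_def] this]
    have z: "\<forall>i\<in>{1..m}. \<mm> +> c (\<iota> i) = \<zero>\<^bsub>R Quot \<mm>\<^esub>" using z by (elim impE) (rule allI)
    have "c i \<in> \<mm>" if iT: "i \<in> T" for i
    proof -
      obtain k where "k \<in> {1..m}" "i = \<iota> k" using \<iota>(2) iT by blast
      hence "\<mm> +> c i = \<mm>" using z unfolding FactRing_def by simp
      thus ?thesis using ideal.rcos_const_imp_mem[OF mm] cc iT by blast
    qed
    thus False using c(2) c0m by blast
  qed
  let ?Q = "Idl (u ` {1..m})"
  have iQ: "ideal ?Q R" using genideal_ideal[OF uc] .
  have t: "(c 0 \<otimes> a 0 j \<oplus> ?s j) \<otimes> u j \<in> L" if "j \<in> {1..m}" for j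
    using ideal_prod.prod[of "c 0 \<otimes> a 0 j \<oplus> ?s j" \<mm> "u j" ?Q R] dim_mod[OF that] genideal_self[OF uc] that mL by blast
  have tc: "(\<lambda>j. (c 0 \<otimes> a 0 j) \<otimes> u j) \<in> {1..m} \<rightarrow> carrier R" "(\<lambda>j. ?s j \<otimes> u j) \<in> {1..m} \<rightarrow> carrier R"
    using c0 ac u sc by auto
  have "(\<Oplus>j\<in>{1..m}. (c 0 \<otimes> a 0 j \<oplus> ?s j) \<otimes> u j) \<in> L" using t by (intro finsum_ideal[OF L]) auto
  also have "(\<Oplus>j\<in>{1..m}. (c 0 \<otimes> a 0 j \<oplus> ?s j) \<otimes> u j) = (\<Oplus>j\<in>{1..m}. (c 0 \<otimes> a 0 j) \<otimes> u j \<oplus> ?s j \<otimes> u j)"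
    using c0 ac sc u tc by (intro finsum_cong'[OF refl]) (auto simp: l_distr)
  also have "\<dots> = (\<Oplus>j\<in>{1..m}. (c 0 \<otimes> a 0 j) \<otimes> u j) \<oplus> (\<Oplus>j\<in>{1..m}. ?s j \<otimes> u j)" using finsum_addf[OF tc] .
  also have "(\<Oplus>j\<in>{1..m}. (c 0 \<otimes> a 0 j) \<otimes> u j) = (\<Oplus>j\<in>{1..m}. if q = j then c 0 \<otimes> u j else \<zero>)"
    using c0 u by (intro finsum_cong'[OF refl]) (auto simp: a_def)
  also have "\<dots> = c 0 \<otimes> u q" using c0 u q by (intro finsum_singleton[where f = "\<lambda>j. c 0 \<otimes> u j"]) auto
  also have "(\<Oplus>j\<in>{1..m}. ?s j \<otimes> u j) = (\<Oplus>i\<in>T. c i \<otimes> poly_value R (N i) u)"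
  proof -
    have "finite S \<Longrightarrow> S \<subseteq> T \<Longrightarrow> (\<Oplus>j\<in>{1..m}. (\<Oplus>i\<in>S. c i \<otimes> N i {#j#}) \<otimes> u j) = (\<Oplus>i\<in>S. c i \<otimes> poly_value R (N i) u)" for S
    proof (induction S rule: finite_induct)
      case empty
      have "(\<Oplus>j\<in>{1..m}. (\<Oplus>i\<in>{}. c i \<otimes> N i {#j#}) \<otimes> u j) = (\<Oplus>j\<in>{1..m}. \<zero>)"
        using u by (intro finsum_cong'[OF refl]) auto
      thus ?case by simp
    next
      case (insert i S)
      have i: "i \<in> T" "c i \<in> carrier R" and S: "S \<subseteq> T" using insert.prems cc by auto
      have pv: "poly_value R (N i) u = (\<Oplus>j\<in>{1..m}. N i {#j#} \<otimes> u j)" by (rule linear_form_value(3)[OF lT[OF i(1)] uP])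
      have Sc: "(\<Oplus>i\<in>S. c i \<otimes> N i {#j#}) \<in> carrier R" for j using cc Nc S by (intro finsum_closed) blast
      have nu: "(\<lambda>j. N i {#j#} \<otimes> u j) \<in> {1..m} \<rightarrow> carrier R" using Nc i(1) u by blast
      have g: "(\<lambda>j. c i \<otimes> (N i {#j#} \<otimes> u j)) \<in> {1..m} \<rightarrow> carrier R"
        "(\<lambda>j. (\<Oplus>i\<in>S. c i \<otimes> N i {#j#}) \<otimes> u j) \<in> {1..m} \<rightarrow> carrier R"
        using nu i(2) Sc u by blast+
      have vc: "poly_value R (N k) u \<in> carrier R" if "k \<in> T" for k using vL[OF that] idealD(1)[OF L] by blast
      have "(\<Oplus>j\<in>{1..m}. (\<Oplus>i\<in>insert i S. c i \<otimes> N i {#j#}) \<otimes> u j)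
        = (\<Oplus>j\<in>{1..m}. c i \<otimes> (N i {#j#} \<otimes> u j) \<oplus> (\<Oplus>i\<in>S. c i \<otimes> N i {#j#}) \<otimes> u j)"
      proof (rule finsum_cong'[OF refl])
        show "(\<lambda>j. c i \<otimes> (N i {#j#} \<otimes> u j) \<oplus> (\<Oplus>i\<in>S. c i \<otimes> N i {#j#}) \<otimes> u j) \<in> {1..m} \<rightarrow> carrier R" using g by blast
        fix j assume j: "j \<in> {1..m}"
        have "(\<Oplus>i\<in>insert i S. c i \<otimes> N i {#j#}) = c i \<otimes> N i {#j#} \<oplus> (\<Oplus>i\<in>S. c i \<otimes> N i {#j#})"
          using insert.hyps cc Nc insert.prems by (intro finsum_insert) blast+
        thus "(\<Oplus>i\<in>insert i S. c i \<otimes> N i {#j#}) \<otimes> u j = c i \<otimes> (N i {#j#} \<otimes> u j) \<oplus> (\<Oplus>i\<in>S. c i \<otimes> N i {#j#}) \<otimes> u j"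
          using i Nc[OF i(1), of "{#j#}"] u[OF j] Sc[of j] by (simp add: l_distr m_assoc)
      qed
      also have "\<dots> = (\<Oplus>j\<in>{1..m}. c i \<otimes> (N i {#j#} \<otimes> u j)) \<oplus> (\<Oplus>i\<in>S. c i \<otimes> poly_value R (N i) u)"
        using finsum_addf[OF g] insert.IH[OF S] by simp
      also have "(\<Oplus>j\<in>{1..m}. c i \<otimes> (N i {#j#} \<otimes> u j)) = c i \<otimes> poly_value R (N i) u"
        unfolding pv using finsum_rdistr[OF _ i(2) nu] by simp
      also have "c i \<otimes> poly_value R (N i) u \<oplus> (\<Oplus>i\<in>S. c i \<otimes> poly_value R (N i) u) = (\<Oplus>i\<in>insert i S. c i \<otimes> poly_value R (N i) u)"
        using insert.hyps cc vc insert.prems by (intro finsum_insert[symmetric]) blast+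
      finally show ?case .
    qed
    thus ?thesis using fin by blast
  qed
  finally have "c 0 \<otimes> u q \<oplus> (\<Oplus>i\<in>T. c i \<otimes> poly_value R (N i) u) \<in> L" .
  moreover have "(\<Oplus>i\<in>T. c i \<otimes> poly_value R (N i) u) \<in> L" using vL cc idealD(6)[OF L] by (intro finsum_ideal[OF L fin]) blast
  ultimately have 1: "c 0 \<otimes> u q \<in> L" using ideal_cancel_r[OF L] c0 u[OF q] by blast
  obtain r where r: "r \<in> carrier R" "r \<otimes> c 0 = \<one>" using unit_outside[OF c0 c0m] by blast
  have "r \<otimes> (c 0 \<otimes> u q) = (r \<otimes> c 0) \<otimes> u q" using r(1) c0 u[OF q] by (simp add: m_assoc)
  thus ?thesis using idealD(6)[OF L 1 r(1)] r(2) u[OF q] by simp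
qed

end

theorem mainTheorem1:
  fixes R :: "('a, 'b) ring_scheme" and \<mm> \<qq> :: "'a set"
    and m n d l :: nat
    and N :: "nat \<Rightarrow> nat multiset \<Rightarrow> 'a" and u :: "nat \<Rightarrow> 'a"
  assumes "m > 0" and "n > 0" and "d > 0" and "m \<ge> n"
    and "l = d * (m - n) + n"
    and "noetherian_local_ring R \<mm>"
    and "krull_dim R = enat n"
    and "\<forall>i\<in>{1..l}. linear_form R m (N i)"
    and "independent_linear_forms (R Quot \<mm>) m l (\<lambda>i. poly_reduce R \<mm> (N i))"
    and "\<forall>i\<in>{1..m}. u i \<in> carrier R"
    and "\<qq> = Idl\<^bsub>R\<^esub> (u ` {1..m})"
    and "primary_to R \<mm> \<qq>"
    and "deg_rad (fiber_cone R \<mm> \<qq>) (fiber_cone_component R \<mm> \<qq>) \<le> of_nat d"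
  shows "\<exists>\<iota>. increasing_indices n l \<iota> \<and>
           reduction_of R (Idl\<^bsub>R\<^esub> ((\<lambda>j. poly_value R (N (\<iota> j)) u) ` {1..n})) \<qq> \<and>
           system_of_parameters R \<mm> n (\<lambda>j. poly_value R (N (\<iota> j)) u)"
proof -
  note lin = assms(8) and ind = assms(9) and u = assms(10) and \<qq> = assms(11)
  interpret noetherian_local_ring R \<mm> by fact
  have set_us: "set (map u [1..<Suc m]) = u ` {1..m}" by auto
  have uc: "u ` {1..m} \<subseteq> carrier R" using u by blast
  interpret local_fiber_cone R \<mm> \<qq> "map u [1..<Suc m]"
  proof (intro local_fiber_cone.intro local_fiber_cone_axioms.intro fiber_cone_setup.intro fiber_cone_setup_axioms.intro)
    show "noetherian_local_ring R \<mm>" by fact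
    show "cring R" by (rule is_cring)
    show "maximalideal \<mm> R" by (rule maximal)
    show "set (map u [1..<Suc m]) \<subseteq> carrier R" unfolding set_us by (rule uc)
    show "\<qq> = Idl\<^bsub>R\<^esub> (set (map u [1..<Suc m]))" unfolding set_us by (rule \<qq>)
    show "radical R \<qq> = \<mm>" using assms(12) unfolding primary_to_def by blast
  qed
  let ?v = "\<lambda>i. poly_value R (N i) u"
  have u': "u \<in> {1..m} \<rightarrow> carrier R" using u by blast
  have v: "?v i \<in> \<qq>" if i: "i \<in> {1..l}" for i
  proof -
    note lf = linear_form_value[OF bspec[OF lin i] u']
    have "u j \<in> \<qq>" if "j \<in> {1..m}" for j unfolding \<qq> using genideal_self[OF uc] that by blast
    hence "N i {#j#} \<otimes>\<^bsub>R\<^esub> u j \<in> \<qq>" if "j \<in> {1..m}" for j using idealD(6)[OF a_ideal _ lf(1)] that by blast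
    thus ?thesis unfolding lf(3) by (intro finsum_ideal[OF a_ideal]) auto
  qed
  have "\<qq> \<subseteq> L" if T: "T \<subseteq> {1..l}" "card T = m" "ideal L R" "?v ` T \<subseteq> L" "\<mm> \<cdot>\<^bsub>R\<^esub> \<qq> \<subseteq> L" for T L
  proof -
    have "u q \<in> L" if "q \<in> {1..m}" for q
      by (rule independent_values_generate[OF ind lin _ T(1,2,3) _ _ that]) (use u T(4,5) in \<open>auto simp: \<qq>\<close>)
    thus ?thesis unfolding \<qq> by (intro genideal_minimal[OF T(3)]) blast
  qed
  hence "\<exists>S\<subseteq>{1..l}. card S = n \<and> (\<exists>k>0. ideal_pow R \<qq> (Suc k) = (Idl\<^bsub>R\<^esub> (?v ` S)) \<cdot>\<^bsub>R\<^esub> ideal_pow R \<qq> k)"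
  proof (intro reduction_from_general_elements[OF assms(7,4) finite_atLeastAtMost _ _ _ _ assms(13)])
    show "card {1..l} = d * (m - n) + n" using assms(5) by simp
    show "m \<le> card {1..l}" using ind unfolding independent_linear_forms_def by simp
    show "?v i \<in> \<qq>" if "i \<in> {1..l}" for i by (rule v[OF that])
  qed blast
  then obtain S k where S: "S \<subseteq> {1..l}" "card S = n"
    and k: "k > 0" "ideal_pow R \<qq> (Suc k) = (Idl\<^bsub>R\<^esub> (?v ` S)) \<cdot>\<^bsub>R\<^esub> ideal_pow R \<qq> k"
    by (elim exE conjE)
  have vS: "?v ` S \<subseteq> \<qq>" using v S(1) by blast
  have iV: "ideal (Idl\<^bsub>R\<^esub> (?v ` S)) R" using genideal_ideal vS idealD(1)[OF a_ideal] by blast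
  have bq: "Idl\<^bsub>R\<^esub> (?v ` S) \<subseteq> \<qq>" by (rule genideal_minimal[OF a_ideal vS])
  obtain \<iota> where \<iota>: "strict_mono_on {1..n} \<iota>" "\<iota> ` {1..n} = S"
    using increasing_enumeration[OF finite_subset[OF S(1) finite_atLeastAtMost]] unfolding S(2) by blast
  have im: "(\<lambda>j. ?v (\<iota> j)) ` {1..n} = ?v ` S" unfolding \<iota>(2)[symmetric] image_image ..
  have "increasing_indices n l \<iota>" unfolding increasing_indices_def using \<iota> S(1) by blast
  moreover have "reduction_of R (Idl\<^bsub>R\<^esub> (?v ` S)) \<qq>"
    unfolding reduction_of_def Suc_eq_plus1[symmetric] by (intro conjI iV a_ideal bq exI[of _ k] k)
  moreover have "system_of_parameters R \<mm> n (\<lambda>j. ?v (\<iota> j))"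
    unfolding system_of_parameters_def im
  proof (intro conjI ballI)
    show "krull_dim R = enat n" by fact
    show "?v (\<iota> i) \<in> \<mm>" if "i \<in> {1..n}" for i using that \<iota>(2) vS a_sub_m by blast
    show "primary_to R \<mm> (Idl\<^bsub>R\<^esub> (?v ` S))" by (rule primary_if_radical_max[OF iV radical_of_reduction[OF iV bq k(2)]])
  qed
  ultimately show ?thesis by (intro exI[of _ \<iota>]) (simp only: im)
qed

end
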